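(* Let $(M,\mathcal H,\mathbf h)$ be a compact sub-Riemannian manifold with $\mathcal H$ bracket-generating. Let $L$ be a smooth second order operator on $M$ without constant term satisfying $\mathbf q_L=\mathbf h^*$, and assume that $L$ is symmetric with respect to some volume form $\mathrm{vol}$ on $M$. Denote also by $L$ its unique self-adjoint extension to $L^2(M,\mathrm{vol})$. Assume that, for some positive semi-definite $\mathbf v^*\in\Gamma(\operatorname{Sym}^2TM)$, $L$ satisfies the generalized curvature-dimension inequality (CD* ) with parameters $n,\rho_1,\rho_{2,0},\rho_{2,1}$, where $\rho_{2,0}>0$. Let $\lambda$ be any nonzero eigenvalue of $L$. Then $$\frac{n\,\rho_{2,0}}{n+\rho_{2,0}(n-1)}\left(\rho_1-\frac{k_2}{\rho_{2,0}}\right)\le-\lambda,\qquad k_2=\max\{0,-\rho_{2,1}\}$$ (for $n=\infty$ the first fraction is read as $\rho_{2,0}/(1+\rho_{2,0})$).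
   Context: A sub-Riemannian manifold $(M,\mathcal H,\mathbf h)$ is a connected manifold $M$ with a subbundle $\mathcal H\subseteq TM$ and a positive definite metric tensor $\mathbf h$ on $\mathcal H$. $\mathcal H$ is bracket-generating if its sections and their iterated Lie brackets span $TM$. The co-metric $\mathbf h^*$ on $T^*M$ is $\mathbf h^*(p_1,p_2)=p_1(\sharp^{\mathbf h^*}p_2)$, where $\sharp^{\mathbf h^*}:T^*M\to\mathcal H$ is determined by $p(w)=\mathbf h(w,\sharp^{\mathbf h^*}p)$ for $w\in\mathcal H$. For a second order operator $L$ without constant term, $\mathbf q_L$ is the symmetric bilinear tensor on $T^*M$ with $\mathbf q_L(df,dg)=\frac12(L(fg)-fLg-gLf)$. $L$ is symmetric with respect to $\mathrm{vol}$ if $\int_M fLg\,d\mathrm{vol}=\int_M gLf\,d\mathrm{vol}$ for all $f,g\in C_c^\infty(M)$; in the present situation $L$ is essentially self-adjoint on $C_c^\infty(M)$. For symmetric $\mathbf s^*\in\Gamma(\operatorname{Sym}^2TM)$ set $\mathsf\Gamma^{\mathbf s^*}(f,g)=\mathbf s^*(df,dg)$, $\mathsf\Gamma_2^{\mathbf s^*}(f,g)=\frac12\big(L\mathsf\Gamma^{\mathbf s^*}(f,g)-\mathsf\Gamma^{\mathbf s^*}(Lf,g)-\mathsf\Gamma^{\mathbf s^*}(f,Lg)\big)$, $\mathsf\Gamma^{\mathbf s^*}(f)=\mathsf\Gamma^{\mathbf s^*}(f,f)$ and $\mathsf\Gamma_2^{\mathbf s^*}(f)=\mathsf\Gamma_2^{\mathbf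 s^*}(f,f)$. (CD* ) with respect to $\mathbf v^*$ and with parameters $n,\rho_1,\rho_{2,0},\rho_{2,1}$ ($1\le n\le\infty$, $\rho_1,\rho_{2,0},\rho_{2,1}\in\mathbb R$) means: for all $f\in C^\infty(M)$ and all $\ell>0$, $$\mathsf\Gamma_2^{\mathbf h^*}(f)+\ell\,\mathsf\Gamma_2^{\mathbf v^*}(f)\ge\frac1n(Lf)^2+\Big(\rho_1-\frac1\ell\Big)\mathsf\Gamma^{\mathbf h^*}(f)+(\rho_{2,0}+\rho_{2,1}\ell)\,\mathsf\Gamma^{\mathbf v^*}(f),$$ with $\frac1n=0$ when $n=\infty$. *)

theory Defs
  imports "HOL-Analysis.Analysis"
begin

section \<open>Linear algebra in spaces of real-valued functions\<close>

text \<open>Functions on the manifold, tangent vectors and covectors are all elements of some type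
  \<open>'c \<Rightarrow> real\<close>, with pointwise linear operations.  Linearity is always relative to a
  subspace \<open>V\<close>.\<close>

definition lin_on :: "('c \<Rightarrow> real) set \<Rightarrow> (('c \<Rightarrow> real) \<Rightarrow> real) \<Rightarrow> bool" where
  "lin_on V p \<longleftrightarrow>
     (\<forall>u\<in>V. \<forall>v\<in>V. \<forall>a b. p (\<lambda>z. a * u z + b * v z) = a * p u + b * p v)"

definition lin_span :: "('c \<Rightarrow> real) set \<Rightarrow> ('c \<Rightarrow> real) set" where
  "lin_span S = {(\<lambda>z. \<Sum>v\<in>F. c v * v z) | F c. finite F \<and> F \<subseteq> S}"

definition sym_bilin_on ::
  "('c \<Rightarrow> real) set \<Rightarrow> (('c \<Rightarrow> real) \<Rightarrow> ('c \<Rightarrow> real) \<Rightarrow> real) \<Rightarrow> bool" where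
  "sym_bilin_on V B \<longleftrightarrow> (\<forall>u\<in>V. lin_on V (B u)) \<and> (\<forall>u\<in>V. \<forall>v\<in>V. B u v = B v u)"


section \<open>Smooth manifolds\<close>

primrec Ck_on ::
  "nat \<Rightarrow> 'b::real_normed_vector set \<Rightarrow> ('b \<Rightarrow> 'c::real_normed_vector) \<Rightarrow> bool" where
  "Ck_on 0 S f \<longleftrightarrow> continuous_on S f"
| "Ck_on (Suc k) S f \<longleftrightarrow>
     (\<forall>x\<in>S. f differentiable (at x)) \<and> (\<forall>v. Ck_on k S (\<lambda>x. frechet_derivative f (at x) v))"

text \<open>\<open>S\<close> is meant to be open.\<close>
definition smooth_on ::
  "'b::real_normed_vector set \<Rightarrow> ('b \<Rightarrow> 'c::real_normed_vector) \<Rightarrow> bool" where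
  "smooth_on S f \<longleftrightarrow> (\<forall>k. Ck_on k S f)"

text \<open>The manifold is the whole type \<open>'a\<close>, with its topology; its smooth structure is given by
  a (not necessarily maximal) atlas.  Only the values of the second component of a chart on the
  first component (the domain) matter.\<close>
type_synonym ('a, 'b) chart = "'a set \<times> ('a \<Rightarrow> 'b)"
type_synonym ('a, 'b) atlas = "('a, 'b) chart set"
type_synonym 'a tangent = "('a \<Rightarrow> real) \<Rightarrow> real"
type_synonym 'a cotangent = "'a tangent \<Rightarrow> real"

abbreviation chart_image :: "('a, 'b) chart \<Rightarrow> 'b set" where
  "chart_image c \<equiv> snd c ` fst c"

abbreviation chart_inv :: "('a, 'b) chart \<Rightarrow> 'b \<Rightarrow> 'a" where
  "chart_inv c \<equiv> inv_into (fst c) (snd c)"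

definition smooth_atlas ::
  "('a::{t2_space,second_countable_topology}, 'b::euclidean_space) atlas \<Rightarrow> bool" where
  "smooth_atlas A \<longleftrightarrow>
     (\<Union>c\<in>A. fst c) = UNIV \<and>
     (\<forall>c\<in>A. open (fst c) \<and> open (chart_image c) \<and>
        homeomorphism (fst c) (chart_image c) (snd c) (chart_inv c)) \<and>
     (\<forall>c\<in>A. \<forall>d\<in>A. smooth_on (snd c ` (fst c \<inter> fst d)) (snd d \<circ> chart_inv c))"

definition smooth_fun :: "('a, 'b::euclidean_space) atlas \<Rightarrow> ('a \<Rightarrow> real) \<Rightarrow> bool" where
  "smooth_fun A f \<longleftrightarrow> (\<forall>c\<in>A. smooth_on (chart_image c) (f \<circ> chart_inv c))"

text \<open>Tangent vectors are derivations of \<open>C\<^sup>\<infinity>(M)\<close> at a point.  They are extended by \<open>0\<close> to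
  non-smooth functions, so that equal tangent vectors are equal as HOL functions.\<close>
definition tangent_space ::
  "('a, 'b::euclidean_space) atlas \<Rightarrow> 'a \<Rightarrow> 'a tangent set" where
  "tangent_space A x = {v. lin_on (Collect (smooth_fun A)) v \<and>
     (\<forall>f g. smooth_fun A f \<and> smooth_fun A g \<longrightarrow>
        v (\<lambda>y. f y * g y) = f x * v g + g x * v f) \<and>
     (\<forall>f. \<not> smooth_fun A f \<longrightarrow> v f = 0)}"

text \<open>Covectors are likewise extended by \<open>0\<close> outside the tangent space.\<close>
definition cotangent_space ::
  "('a, 'b::euclidean_space) atlas \<Rightarrow> 'a \<Rightarrow> 'a cotangent set" where
  "cotangent_space A x =
     {p. lin_on (tangent_space A x) p \<and> (\<forall>v. v \<notin> tangent_space A x \<longrightarrow> p v = 0)}"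

definition differential ::
  "('a, 'b::euclidean_space) atlas \<Rightarrow> ('a \<Rightarrow> real) \<Rightarrow> 'a \<Rightarrow> 'a cotangent" where
  "differential A f x = (\<lambda>v. if v \<in> tangent_space A x then v f else 0)"

definition coord_vec ::
  "('a, 'b::euclidean_space) atlas \<Rightarrow> ('a, 'b) chart \<Rightarrow> 'a \<Rightarrow> 'b \<Rightarrow> 'a tangent" where
  "coord_vec A c x i = (\<lambda>f. if smooth_fun A f
     then frechet_derivative (f \<circ> chart_inv c) (at (snd c x)) i else 0)"

definition smooth_vector_field ::
  "('a, 'b::euclidean_space) atlas \<Rightarrow> ('a \<Rightarrow> 'a tangent) \<Rightarrow> bool" where
  "smooth_vector_field A X \<longleftrightarrow> (\<forall>x. X x \<in> tangent_space A x) \<and>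
     (\<forall>f. smooth_fun A f \<longrightarrow> smooth_fun A (\<lambda>x. X x f))"

definition lie_bracket ::
  "('a \<Rightarrow> 'a tangent) \<Rightarrow> ('a \<Rightarrow> 'a tangent) \<Rightarrow> 'a \<Rightarrow> 'a tangent" where
  "lie_bracket X Y x = (\<lambda>f. X x (\<lambda>y. Y y f) - Y x (\<lambda>y. X y f))"


section \<open>Sub-Riemannian manifolds\<close>

text \<open>The members of local frames are taken to be globally defined vector fields; by cutting off
  with bump functions this is no restriction.\<close>
definition subbundle ::
  "('a::topological_space, 'b::euclidean_space) atlas \<Rightarrow> ('a \<Rightarrow> 'a tangent set) \<Rightarrow> bool" where
  "subbundle A H \<longleftrightarrow> (\<exists>r::nat. \<forall>x. \<exists>W X. open W \<and> x \<in> W \<and>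
     (\<forall>i<r. smooth_vector_field A (X i)) \<and>
     (\<forall>y\<in>W. H y = lin_span ((\<lambda>i. X i y) ` {..<r}) \<and>
        (\<forall>c. (\<forall>f. (\<Sum>i<r. c i * X i y f) = 0) \<longrightarrow> (\<forall>i<r. c i = 0))))"

definition smooth_section ::
  "('a, 'b::euclidean_space) atlas \<Rightarrow> ('a \<Rightarrow> 'a tangent set) \<Rightarrow> ('a \<Rightarrow> 'a tangent) \<Rightarrow> bool" where
  "smooth_section A H X \<longleftrightarrow> smooth_vector_field A X \<and> (\<forall>x. X x \<in> H x)"

definition metric_tensor_on ::
  "('a, 'b::euclidean_space) atlas \<Rightarrow> ('a \<Rightarrow> 'a tangent set) \<Rightarrow>
   ('a \<Rightarrow> 'a tangent \<Rightarrow> 'a tangent \<Rightarrow> real) \<Rightarrow> bool" where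
  "metric_tensor_on A H h \<longleftrightarrow>
     (\<forall>x. sym_bilin_on (H x) (h x)) \<and>
     (\<forall>x. \<forall>v\<in>H x. v \<noteq> (\<lambda>f. 0) \<longrightarrow> 0 < h x v v) \<and>
     (\<forall>X Y. smooth_section A H X \<and> smooth_section A H Y \<longrightarrow>
        smooth_fun A (\<lambda>x. h x (X x) (Y x)))"

definition sub_riemannian_manifold ::
  "('a::{t2_space,second_countable_topology}, 'b::euclidean_space) atlas \<Rightarrow>
   ('a \<Rightarrow> 'a tangent set) \<Rightarrow> ('a \<Rightarrow> 'a tangent \<Rightarrow> 'a tangent \<Rightarrow> real) \<Rightarrow> bool" where
  "sub_riemannian_manifold A H h \<longleftrightarrow>
     smooth_atlas A \<and> connected (UNIV :: 'a set) \<and> subbundle A H \<and> metric_tensor_on A H h"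

inductive_set iterated_brackets ::
  "('a, 'b::euclidean_space) atlas \<Rightarrow> ('a \<Rightarrow> 'a tangent set) \<Rightarrow> ('a \<Rightarrow> 'a tangent) set"
  for A :: "('a, 'b) atlas" and H :: "'a \<Rightarrow> 'a tangent set" where
  base: "smooth_section A H X \<Longrightarrow> X \<in> iterated_brackets A H"
| bracket: "X \<in> iterated_brackets A H \<Longrightarrow> Y \<in> iterated_brackets A H \<Longrightarrow>
     lie_bracket X Y \<in> iterated_brackets A H"

definition bracket_generating ::
  "('a, 'b::euclidean_space) atlas \<Rightarrow> ('a \<Rightarrow> 'a tangent set) \<Rightarrow> bool" where
  "bracket_generating A H \<longleftrightarrow>
     (\<forall>x. tangent_space A x = lin_span ((\<lambda>X. X x) ` iterated_brackets A H))"

definition sharp ::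
  "('a \<Rightarrow> 'a tangent set) \<Rightarrow> ('a \<Rightarrow> 'a tangent \<Rightarrow> 'a tangent \<Rightarrow> real) \<Rightarrow>
   'a \<Rightarrow> 'a cotangent \<Rightarrow> 'a tangent" where
  "sharp H h x p = (THE v. v \<in> H x \<and> (\<forall>w\<in>H x. p w = h x w v))"

definition cometric ::
  "('a \<Rightarrow> 'a tangent set) \<Rightarrow> ('a \<Rightarrow> 'a tangent \<Rightarrow> 'a tangent \<Rightarrow> real) \<Rightarrow>
   'a \<Rightarrow> 'a cotangent \<Rightarrow> 'a cotangent \<Rightarrow> real" where
  "cometric H h x p q = p (sharp H h x q)"


section \<open>Second order operators and the curvature-dimension inequality\<close>

text \<open>Smooth sections of \<open>Sym\<^sup>2 TM\<close>, as symmetric bilinear forms on the cotangent spaces.\<close>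
definition sym2_section ::
  "('a, 'b::euclidean_space) atlas \<Rightarrow>
   ('a \<Rightarrow> 'a cotangent \<Rightarrow> 'a cotangent \<Rightarrow> real) \<Rightarrow> bool" where
  "sym2_section A s \<longleftrightarrow> (\<forall>x. sym_bilin_on (cotangent_space A x) (s x)) \<and>
     (\<forall>f g. smooth_fun A f \<and> smooth_fun A g \<longrightarrow>
        smooth_fun A (\<lambda>x. s x (differential A f x) (differential A g x)))"

definition pos_semidef ::
  "('a, 'b::euclidean_space) atlas \<Rightarrow>
   ('a \<Rightarrow> 'a cotangent \<Rightarrow> 'a cotangent \<Rightarrow> real) \<Rightarrow> bool" where
  "pos_semidef A s \<longleftrightarrow> (\<forall>x. \<forall>p\<in>cotangent_space A x. 0 \<le> s x p p)"

text \<open>In every chart,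
  \<open>L = \<Sum> a\<^sub>i\<^sub>j \<partial>\<^sub>i \<partial>\<^sub>j + \<Sum> b\<^sub>i \<partial>\<^sub>i\<close> with smooth coefficients.
  Values of \<open>L\<close> on non-smooth functions are unconstrained.\<close>
definition second_order_operator ::
  "('a, 'b::euclidean_space) atlas \<Rightarrow> (('a \<Rightarrow> real) \<Rightarrow> ('a \<Rightarrow> real)) \<Rightarrow> bool" where
  "second_order_operator A L \<longleftrightarrow> (\<forall>c\<in>A. \<exists>(a :: 'b \<Rightarrow> 'b \<Rightarrow> 'b \<Rightarrow> real) (b :: 'b \<Rightarrow> 'b \<Rightarrow> real).
     (\<forall>i\<in>Basis. \<forall>j\<in>Basis. smooth_on (chart_image c) (a i j)) \<and>
     (\<forall>i\<in>Basis. smooth_on (chart_image c) (b i)) \<and>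
     (\<forall>f. smooth_fun A f \<longrightarrow> (\<forall>y\<in>chart_image c.
        L f (chart_inv c y) =
          (\<Sum>i\<in>Basis. \<Sum>j\<in>Basis. a i j y *
             frechet_derivative (\<lambda>z. frechet_derivative (f \<circ> chart_inv c) (at z) j) (at y) i)
          + (\<Sum>i\<in>Basis. b i y * frechet_derivative (f \<circ> chart_inv c) (at y) i))))"

text \<open>\<open>q = q\<^sub>L\<close>.\<close>
definition is_symbol ::
  "('a, 'b::euclidean_space) atlas \<Rightarrow> (('a \<Rightarrow> real) \<Rightarrow> ('a \<Rightarrow> real)) \<Rightarrow>
   ('a \<Rightarrow> 'a cotangent \<Rightarrow> 'a cotangent \<Rightarrow> real) \<Rightarrow> bool" where
  "is_symbol A L q \<longleftrightarrow> sym2_section A q \<and>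
     (\<forall>f g. smooth_fun A f \<and> smooth_fun A g \<longrightarrow> (\<forall>x.
        q x (differential A f x) (differential A g x) =
          (L (\<lambda>y. f y * g y) x - f x * L g x - g x * L f x) / 2))"

definition Gamma ::
  "('a, 'b::euclidean_space) atlas \<Rightarrow>
   ('a \<Rightarrow> 'a cotangent \<Rightarrow> 'a cotangent \<Rightarrow> real) \<Rightarrow>
   ('a \<Rightarrow> real) \<Rightarrow> ('a \<Rightarrow> real) \<Rightarrow> 'a \<Rightarrow> real" where
  "Gamma A s f g = (\<lambda>x. s x (differential A f x) (differential A g x))"

definition Gamma2 ::
  "('a, 'b::euclidean_space) atlas \<Rightarrow> (('a \<Rightarrow> real) \<Rightarrow> ('a \<Rightarrow> real)) \<Rightarrow>
   ('a \<Rightarrow> 'a cotangent \<Rightarrow> 'a cotangent \<Rightarrow> real) \<Rightarrow>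
   ('a \<Rightarrow> real) \<Rightarrow> ('a \<Rightarrow> real) \<Rightarrow> 'a \<Rightarrow> real" where
  "Gamma2 A L s f g =
     (\<lambda>x. (L (Gamma A s f g) x - Gamma A s (L f) g x - Gamma A s f (L g) x) / 2)"

text \<open>\<open>hs\<close> and \<open>vs\<close> are the co-metric \<open>h\<^sup>*\<close> and \<open>v\<^sup>*\<close>.  The dimension parameter \<open>n\<close> ranges
  over \<open>[1, \<infinity>]\<close>; for \<open>n = \<infinity>\<close> the quotient \<open>1 / n\<close> in \<^typ>\<open>ereal\<close> is \<open>0\<close>.\<close>
definition CD_star ::
  "('a, 'b::euclidean_space) atlas \<Rightarrow> (('a \<Rightarrow> real) \<Rightarrow> ('a \<Rightarrow> real)) \<Rightarrow>
   ('a \<Rightarrow> 'a cotangent \<Rightarrow> 'a cotangent \<Rightarrow> real) \<Rightarrow>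
   ('a \<Rightarrow> 'a cotangent \<Rightarrow> 'a cotangent \<Rightarrow> real) \<Rightarrow>
   ereal \<Rightarrow> real \<Rightarrow> real \<Rightarrow> real \<Rightarrow> bool" where
  "CD_star A L hs vs n \<rho>1 \<rho>20 \<rho>21 \<longleftrightarrow> 1 \<le> n \<and>
     (\<forall>f. smooth_fun A f \<longrightarrow> (\<forall>l>0. \<forall>x.
        Gamma2 A L hs f f x + l * Gamma2 A L vs f f x \<ge>
          real_of_ereal (1 / n) * (L f x)\<^sup>2 + (\<rho>1 - 1 / l) * Gamma A hs f f x
          + (\<rho>20 + \<rho>21 * l) * Gamma A vs f f x))"


section \<open>Volume forms\<close>

text \<open>A differential form of top degree takes as arguments families of tangent vectors indexed by
  the orthonormal basis of the model space, i.e. functions on \<open>'b\<close> of which only the values on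
  \<^const>\<open>Basis\<close> are relevant.\<close>
definition volume_form ::
  "('a, 'b::euclidean_space) atlas \<Rightarrow> ('a \<Rightarrow> ('b \<Rightarrow> 'a tangent) \<Rightarrow> real) \<Rightarrow> bool" where
  "volume_form A \<omega> \<longleftrightarrow>
     (\<forall>x E E'. (\<forall>i\<in>Basis. E i = E' i) \<longrightarrow> \<omega> x E = \<omega> x E') \<and>
     (\<forall>x E. (\<forall>i\<in>Basis. E i \<in> tangent_space A x) \<longrightarrow>
        (\<forall>i\<in>Basis. lin_on (tangent_space A x) (\<lambda>v. \<omega> x (E(i := v)))) \<and>
        (\<forall>i\<in>Basis. \<forall>j\<in>Basis. i \<noteq> j \<and> E i = E j \<longrightarrow> \<omega> x E = 0)) \<and>
     (\<forall>x. \<exists>E. (\<forall>i\<in>Basis. E i \<in> tangent_space A x) \<and> \<omega> x E \<noteq> 0) \<and>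
     (\<forall>X. (\<forall>i\<in>Basis. smooth_vector_field A (X i)) \<longrightarrow> smooth_fun A (\<lambda>x. \<omega> x (\<lambda>i. X i x)))"

text \<open>\<open>\<mu>\<close> is the (uniquely determined) Borel measure \<open>B \<mapsto> \<integral>\<^sub>B |\<omega>|\<close>: in every chart it has
  the density \<open>|\<omega>(\<partial>\<^sub>1, \<dots>, \<partial>\<^sub>d)|\<close> with respect to Lebesgue measure.\<close>
definition volume_measure ::
  "('a::topological_space, 'b::euclidean_space) atlas \<Rightarrow>
   ('a \<Rightarrow> ('b \<Rightarrow> 'a tangent) \<Rightarrow> real) \<Rightarrow> 'a measure \<Rightarrow> bool" where
  "volume_measure A \<omega> \<mu> \<longleftrightarrow> sets \<mu> = sets borel \<and>
     (\<forall>c\<in>A. \<forall>B\<in>sets borel. B \<subseteq> fst c \<longrightarrow>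
        emeasure \<mu> B = (\<integral>\<^sup>+y\<in>snd c ` B.
          ennreal \<bar>\<omega> (chart_inv c y) (coord_vec A c (chart_inv c y))\<bar> \<partial>lborel))"

definition smooth_compact_support ::
  "('a::topological_space, 'b::euclidean_space) atlas \<Rightarrow> ('a \<Rightarrow> real) \<Rightarrow> bool" where
  "smooth_compact_support A f \<longleftrightarrow> smooth_fun A f \<and> compact (closure {x. f x \<noteq> 0})"

definition symmetric_wrt ::
  "('a::topological_space, 'b::euclidean_space) atlas \<Rightarrow> 'a measure \<Rightarrow>
   (('a \<Rightarrow> real) \<Rightarrow> ('a \<Rightarrow> real)) \<Rightarrow> bool" where
  "symmetric_wrt A \<mu> L \<longleftrightarrow>
     (\<forall>f g. smooth_compact_support A f \<and> smooth_compact_support A g \<longrightarrow>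
        (\<integral>x. f x * L g x \<partial>\<mu>) = (\<integral>x. g x * L f x \<partial>\<mu>))"


section \<open>Unbounded operators on real \<open>L\<^sup>2\<close>\<close>

text \<open>Elements of \<open>L\<^sup>2\<close> are represented by square-integrable functions, and an unbounded operator
  by the set of all pairs of representatives \<open>(f, g)\<close> of elements of its graph.\<close>
type_synonym 'a l2_graph = "(('a \<Rightarrow> real) \<times> ('a \<Rightarrow> real)) set"

definition l2 :: "'a measure \<Rightarrow> ('a \<Rightarrow> real) set" where
  "l2 \<mu> = {f \<in> borel_measurable \<mu>. integrable \<mu> (\<lambda>x. (f x)\<^sup>2)}"

definition adjoint_graph :: "'a measure \<Rightarrow> 'a l2_graph \<Rightarrow> 'a l2_graph" where
  "adjoint_graph \<mu> G = {(u, w). u \<in> l2 \<mu> \<and> w \<in> l2 \<mu> \<and>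
     (\<forall>(f, g)\<in>G. (\<integral>x. u x * g x \<partial>\<mu>) = (\<integral>x. w x * f x \<partial>\<mu>))}"

definition densely_defined :: "'a measure \<Rightarrow> 'a l2_graph \<Rightarrow> bool" where
  "densely_defined \<mu> G \<longleftrightarrow>
     (\<forall>u\<in>l2 \<mu>. \<forall>e>0. \<exists>(f, g)\<in>G. (\<integral>x. (u x - f x)\<^sup>2 \<partial>\<mu>) < e)"

text \<open>The equality with the adjoint makes \<open>G\<close> linear and closed under almost everywhere equality;
  together with density of the domain it makes \<open>G\<close> single-valued up to null sets.\<close>
definition self_adjoint :: "'a measure \<Rightarrow> 'a l2_graph \<Rightarrow> bool" where
  "self_adjoint \<mu> G \<longleftrightarrow> densely_defined \<mu> G \<and> G = adjoint_graph \<mu> G"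

definition self_adjoint_extension ::
  "('a::topological_space, 'b::euclidean_space) atlas \<Rightarrow> 'a measure \<Rightarrow>
   (('a \<Rightarrow> real) \<Rightarrow> ('a \<Rightarrow> real)) \<Rightarrow> 'a l2_graph \<Rightarrow> bool" where
  "self_adjoint_extension A \<mu> L G \<longleftrightarrow>
     self_adjoint \<mu> G \<and> {(f, L f) | f. smooth_compact_support A f} \<subseteq> G"

definition eigenvalue :: "'a measure \<Rightarrow> 'a l2_graph \<Rightarrow> real \<Rightarrow> bool" where
  "eigenvalue \<mu> G ev \<longleftrightarrow> (\<exists>f. (f, \<lambda>x. ev * f x) \<in> G \<and> \<not> (AE x in \<mu>. f x = 0))"

end

theory Submission
  imports Defs "HOL-Library.Function_Algebras"
begin

text \<open>For a smooth normalized eigenfunction \<open>f\<close>, integrating the curvature-dimension inequality gives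
  \<open>(\<rho>1 - 1 / l) (- \<lambda>) + (\<rho>20 + \<rho>21 l) \<integral> \<Gamma>\<^sup>v(f) \<le> (1 - 1 / n) \<lambda>\<^sup>2 - l \<lambda> \<integral> \<Gamma>\<^sup>v(f)\<close>, and \<open>l\<close> is chosen such that the
  terms with \<open>\<Gamma>\<^sup>v\<close> cancel in the worst case.

  Smoothness of eigenfunctions, which would follow from hypoellipticity, is replaced by smooth approximate
  eigenfunctions \<open>f\<close> for which \<open>y = L f - \<lambda> f\<close> is small both in \<open>L\<^sup>2\<close> and for \<open>\<integral> \<Gamma>\<^sup>v\<close>.  A weak eigenfunction
  is a bounded functional \<open>E\<close> on smooth functions with \<open>E (L u) = \<lambda> E u\<close>; near maximizers of \<open>E\<close> on the unit ball,
  regularized by the resolvent, make \<open>y\<close> small in \<open>L\<^sup>2\<close>.  The curvature-dimension inequality with small \<open>l\<close> bounds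
  \<open>\<integral> \<Gamma>\<^sup>v((\<beta> - L)\<inverse> y)\<close> by a small multiple of \<open>\<integral> \<Gamma>\<^sup>v(y)\<close> plus a multiple of \<open>\<integral> y\<^sup>2\<close>, so that applying a quadratic
  polynomial of the resolvent repeatedly makes \<open>\<integral> \<Gamma>\<^sup>v(y)\<close> small as well.

  All this needs only that \<open>(\<beta> - L) u = g\<close> can be solved by smooth \<open>u\<close> up to an error which is small together with
  its first derivatives.  Writing \<open>L\<close> as a sum of squares of vector fields plus a drift and embedding \<open>M\<close> in a
  vector space to which the coefficients extend, one obtains \<open>u\<close> as a truncated discounted sum over a random walk
  with small steps: its transition operators almost preserve bounds on derivatives of any order, so for
  large \<open>\<beta>\<close> the sums converge with all their derivatives.\<close>

section \<open>Approximate resolvents in an abstract curvature-dimension setting\<close>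

text \<open>For an approximate eigenfunction \<open>f\<close> no bound on \<open>qv f f\<close>, the
  integral of \<Gamma>(f) for v, is available beforehand. Put \<mu> = - \<lambda> and
  \<open>L f = y - \<mu> *\<^sub>R f\<close>. With l = \<rho>20 / (\<mu> + k2 + \<eta>) the total
  coefficient of \<open>qv f f\<close> has the harmless sign, and Young's inequality with weight
  \<eta> trades \<open>qv f y\<close> for a multiple of \<open>qv y y\<close>. Hence y must be small
  for \<open>qv\<close> too, and \<eta> tends to 0 only after y does.

  The operator T = (\<beta> - \<lambda>) / (\<beta> - L) fixes eigenfunctions for \<lambda>, but
  expands components that belong to the spectrum above \<lambda>. The polynomial 2 T - T^2 fixes
  them as well and never expands, so it can be applied without losing what has been gained in L^2.

  A walk with steps of size s takes of the order of 1 / s^2 steps per unit of time. Bounds on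
  derivatives survive this only if one step enlarges them by a factor 1 + O(s^2); a factor 1 + O(s)
  would be fatal. This dictates the symmetric pairs of steps, and sums of squares of derivatives in
  place of suprema.\<close>

locale psd_form =
  fixes V :: "'v::real_vector set" and q :: "'v \<Rightarrow> 'v \<Rightarrow> real"
  assumes sub: "subspace V"
    and add_left: "\<And>u v w. u \<in> V \<Longrightarrow> v \<in> V \<Longrightarrow> w \<in> V \<Longrightarrow> q (u + v) w = q u w + q v w"
    and scale_left: "\<And>a u w. u \<in> V \<Longrightarrow> w \<in> V \<Longrightarrow> q (a *\<^sub>R u) w = a * q u w"
    and sym: "\<And>u w. u \<in> V \<Longrightarrow> w \<in> V \<Longrightarrow> q u w = q w u"
    and nonneg: "\<And>u. u \<in> V \<Longrightarrow> 0 \<le> q u u"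
begin

definition nrm :: "'v \<Rightarrow> real" where "nrm u = sqrt (q u u)"

lemma closed [simp]:
  "u \<in> V \<Longrightarrow> v \<in> V \<Longrightarrow> u + v \<in> V" "u \<in> V \<Longrightarrow> v \<in> V \<Longrightarrow> u - v \<in> V"
  "u \<in> V \<Longrightarrow> a *\<^sub>R u \<in> V" "u \<in> V \<Longrightarrow> - u \<in> V" "0 \<in> V"
  using sub by (auto simp: subspace_add subspace_diff subspace_scale subspace_neg subspace_0)

lemma add_right: "u \<in> V \<Longrightarrow> v \<in> V \<Longrightarrow> w \<in> V \<Longrightarrow> q w (u + v) = q w u + q w v"
  by (metis add_left sym closed(1))

lemma scale_right: "u \<in> V \<Longrightarrow> w \<in> V \<Longrightarrow> q w (a *\<^sub>R u) = a * q w u"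
  by (metis scale_left sym closed(3))

lemma diff_left: "u \<in> V \<Longrightarrow> v \<in> V \<Longrightarrow> w \<in> V \<Longrightarrow> q (u - v) w = q u w - q v w"
  using add_left[of u "(-1) *\<^sub>R v" w] scale_left[of v w "-1"] by simp

lemma diff_right: "u \<in> V \<Longrightarrow> v \<in> V \<Longrightarrow> w \<in> V \<Longrightarrow> q w (u - v) = q w u - q w v"
  by (metis diff_left sym closed(2))

lemmas bilin = add_left add_right scale_left scale_right diff_left diff_right

lemma nrm_nonneg [simp]: "u \<in> V \<Longrightarrow> 0 \<le> nrm u"
  by (simp add: nrm_def nonneg)

lemma nrm_sq: "u \<in> V \<Longrightarrow> (nrm u)\<^sup>2 = q u u"
  by (simp add: nrm_def nonneg)

lemma cauchy_schwarz_sq: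
  assumes "u \<in> V" "w \<in> V" shows "(q u w)\<^sup>2 \<le> q u u * q w w"
proof -
  have *: "0 \<le> q u u + 2 * t * q u w + t\<^sup>2 * q w w" for t
  proof -
    have "0 \<le> q (u + t *\<^sub>R w) (u + t *\<^sub>R w)" using assms by (intro nonneg) auto
    also have "\<dots> = q u u + 2 * t * q u w + t\<^sup>2 * q w w"
      using assms sym[of u w] by (simp add: bilin power2_eq_square algebra_simps)
    finally show ?thesis .
  qed
  show ?thesis
  proof (cases "q w w = 0")
    case True
    have "q u w = 0"
    proof (rule ccontr)
      assume n: "q u w \<noteq> 0"
      \<comment> \<open>When \<open>q w w\<close> = 0 the quadratic is affine in \<open>t\<close>,
        and this \<open>t\<close> gives it the value -1.\<close>
      have "0 \<le> q u u + 2 * (- (q u u + 1) / (2 * q u w)) * q u w"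
        using *[of "- (q u u + 1) / (2 * q u w)"] True by simp
      also have "\<dots> = -1" using n by (simp add: field_simps)
      finally show False by simp
    qed
    then show ?thesis using True by simp
  next
    case False
    then have p: "q w w > 0" using nonneg[OF assms(2)] by simp
    have "0 \<le> q u u + 2 * (- q u w / q w w) * q u w + (- q u w / q w w)\<^sup>2 * q w w"
      using * by blast
    also have "\<dots> = q u u - (q u w)\<^sup>2 / q w w"
      using p by (simp add: power2_eq_square field_simps)
    finally show ?thesis using p by (simp add: field_simps)
  qed
qed

lemma cauchy_schwarz:
  assumes "u \<in> V" "w \<in> V" shows "\<bar>q u w\<bar> \<le> nrm u * nrm w"
proof -
  have "\<bar>q u w\<bar> = sqrt ((q u w)\<^sup>2)" by simp
  also have "\<dots> \<le> sqrt (q u u * q w w)"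
    using cauchy_schwarz_sq[OF assms] by (rule real_sqrt_le_mono)
  finally show ?thesis by (simp add: nrm_def real_sqrt_mult)
qed

lemma nrm_scale: "u \<in> V \<Longrightarrow> nrm (a *\<^sub>R u) = \<bar>a\<bar> * nrm u"
  by (simp add: nrm_def bilin real_sqrt_mult flip: mult.assoc)

lemma nrm_minus: "u \<in> V \<Longrightarrow> nrm (- u) = nrm u"
  using nrm_scale[of u "-1"] by simp

lemma nrm_triangle:
  assumes "u \<in> V" "w \<in> V" shows "nrm (u + w) \<le> nrm u + nrm w"
proof (rule power2_le_imp_le)
  have "(nrm (u + w))\<^sup>2 = (nrm u)\<^sup>2 + 2 * q u w + (nrm w)\<^sup>2"
    using assms sym[of u w] by (simp add: nrm_sq bilin)
  also have "\<dots> \<le> (nrm u + nrm w)\<^sup>2"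
    using cauchy_schwarz[OF assms] by (simp add: power2_sum)
  finally show "(nrm (u + w))\<^sup>2 \<le> (nrm u + nrm w)\<^sup>2" .
qed (use assms in auto)

lemma nrm_triangle_diff: "u \<in> V \<Longrightarrow> w \<in> V \<Longrightarrow> nrm (u - w) \<le> nrm u + nrm w"
  using nrm_triangle[of u "- w"] by (simp add: nrm_minus)

lemma nrm_sq_add_le:
  assumes "u \<in> V" "w \<in> V" shows "(nrm (u + w))\<^sup>2 \<le> 2 * (nrm u)\<^sup>2 + 2 * (nrm w)\<^sup>2"
proof -
  have "(nrm (u + w))\<^sup>2 \<le> (nrm u + nrm w)\<^sup>2"
    using nrm_triangle[OF assms] assms by (intro power_mono) auto
  also have "\<dots> \<le> 2 * (nrm u)\<^sup>2 + 2 * (nrm w)\<^sup>2"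
    using sum_squares_bound[of "nrm u" "nrm w"] by (simp add: power2_sum)
  finally show ?thesis .
qed

end

text \<open>An abstract copy of the situation on smooth functions: \<open>ip\<close> is the L^2
  product, \<open>qv\<close> the integrated carre du champ of v, \<open>c\<close> is 1/n, and
  \<open>E\<close> is the pairing with a square-integrable eigenfunction of which no smoothness is
  known. \<open>CD\<close> is the curvature-dimension inequality after integration by parts. In
  \<open>dense\<close>, the bound \<open>\<beta>0\<close> is common to all right-hand sides and to
  both seminorms, so one \<beta> can be fixed for the whole argument.\<close>

locale cd_space = ip: psd_form V ip + qv: psd_form V qv
  for V :: "'v::real_vector set" and ip qv :: "'v \<Rightarrow> 'v \<Rightarrow> real" +
  fixes L :: "'v \<Rightarrow> 'v" and E :: "'v \<Rightarrow> real" and c \<rho>1 \<rho>20 \<rho>21 ev :: real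
  assumes L_in [simp]: "\<And>u. u \<in> V \<Longrightarrow> L u \<in> V"
    and L_add: "\<And>u w. u \<in> V \<Longrightarrow> w \<in> V \<Longrightarrow> L (u + w) = L u + L w"
    and L_scale: "\<And>a u. u \<in> V \<Longrightarrow> L (a *\<^sub>R u) = a *\<^sub>R L u"
    and L_sym: "\<And>u w. u \<in> V \<Longrightarrow> w \<in> V \<Longrightarrow> ip u (L w) = ip (L u) w"
    and L_neg: "\<And>u. u \<in> V \<Longrightarrow> ip u (L u) \<le> 0"
    and CD: "\<And>u l. u \<in> V \<Longrightarrow> 0 < l \<Longrightarrow>
      (\<rho>1 - 1 / l) * (- ip u (L u)) + (\<rho>20 + \<rho>21 * l) * qv u u
        \<le> (1 - c) * ip (L u) (L u) - l * qv u (L u)"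
    and c: "0 \<le> c" "c \<le> 1" and rho20: "0 < \<rho>20"
    and dense: "\<exists>\<beta>0. \<forall>\<beta>\<ge>\<beta>0. \<forall>g\<in>V. \<forall>e>0. \<exists>u\<in>V.
      ip.nrm (\<beta> *\<^sub>R u - L u - g) \<le> e \<and> qv.nrm (\<beta> *\<^sub>R u - L u - g) \<le> e"
    and E_add: "\<And>u w. u \<in> V \<Longrightarrow> w \<in> V \<Longrightarrow> E (u + w) = E u + E w"
    and E_scale: "\<And>a u. u \<in> V \<Longrightarrow> E (a *\<^sub>R u) = a * E u"
    and E_bounded: "\<exists>K. \<forall>u\<in>V. \<bar>E u\<bar> \<le> K * ip.nrm u"
    and E_nonzero: "\<exists>u\<in>V. E u \<noteq> 0"
    and E_eigen: "\<And>u. u \<in> V \<Longrightarrow> E (L u) = ev * E u"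
    and ev: "ev \<noteq> 0"
begin

lemma L_diff: "u \<in> V \<Longrightarrow> w \<in> V \<Longrightarrow> L (u - w) = L u - L w"
  using L_add[of u "(-1) *\<^sub>R w"] L_scale[of w "-1"] by simp

lemma E_diff: "u \<in> V \<Longrightarrow> w \<in> V \<Longrightarrow> E (u - w) = E u - E w"
  using E_add[of u "(-1) *\<^sub>R w"] E_scale[of w "-1"] by simp

lemma resolvent_norm_expand:
  assumes "w \<in> V"
  shows "(ip.nrm (\<beta> *\<^sub>R w - L w))\<^sup>2 =
    \<beta>\<^sup>2 * (ip.nrm w)\<^sup>2 + 2 * \<beta> * (- ip w (L w)) + (ip.nrm (L w))\<^sup>2"
  using assms ip.sym[of "L w" w]
  by (simp add: ip.nrm_sq ip.bilin) (simp add: power2_eq_square algebra_simps)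

text \<open>As \<open>- ip w (L w)\<close> is nonnegative, every term of the expansion of the
  squared norm can be compared separately. For the third bound the same expansion is used with
  \<open>ev\<close> in place of \<beta>; it expresses that (ev - L) (\<beta> - L)^-1 is a
  contraction.\<close>

lemma resolvent_bounds:
  assumes w: "w \<in> V" and "0 < \<beta>" "\<bar>ev\<bar> \<le> \<beta>"
  shows "\<beta> * ip.nrm w \<le> ip.nrm (\<beta> *\<^sub>R w - L w)"
    and "ip.nrm (L w) \<le> ip.nrm (\<beta> *\<^sub>R w - L w)"
    and "ip.nrm (ev *\<^sub>R w - L w) \<le> ip.nrm (\<beta> *\<^sub>R w - L w)"
proof -
  have n: "0 \<le> - ip w (L w)" using L_neg[OF w] by simp
  have p: "0 \<le> 2 * \<beta> * (- ip w (L w))" using n assms by (intro mult_nonneg_nonneg) auto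
  have sq: "0 \<le> \<beta>\<^sup>2 * (ip.nrm w)\<^sup>2" "0 \<le> (ip.nrm (L w))\<^sup>2" by auto
  show "\<beta> * ip.nrm w \<le> ip.nrm (\<beta> *\<^sub>R w - L w)"
  proof (rule power2_le_imp_le)
    show "(\<beta> * ip.nrm w)\<^sup>2 \<le> (ip.nrm (\<beta> *\<^sub>R w - L w))\<^sup>2"
      using p sq unfolding resolvent_norm_expand[OF w] power_mult_distrib by linarith
  qed (use w in auto)
  show "ip.nrm (L w) \<le> ip.nrm (\<beta> *\<^sub>R w - L w)"
  proof (rule power2_le_imp_le)
    show "(ip.nrm (L w))\<^sup>2 \<le> (ip.nrm (\<beta> *\<^sub>R w - L w))\<^sup>2"
      using p sq unfolding resolvent_norm_expand[OF w] by linarith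
  qed (use w in auto)
  show "ip.nrm (ev *\<^sub>R w - L w) \<le> ip.nrm (\<beta> *\<^sub>R w - L w)"
  proof (rule power2_le_imp_le)
    have "ev\<^sup>2 * (ip.nrm w)\<^sup>2 \<le> \<beta>\<^sup>2 * (ip.nrm w)\<^sup>2"
      using assms by (intro mult_right_mono) (auto simp: abs_le_square_iff[symmetric])
    moreover have "ev * (- ip w (L w)) \<le> \<beta> * (- ip w (L w))"
      using n assms by (intro mult_right_mono) auto
    ultimately show "(ip.nrm (ev *\<^sub>R w - L w))\<^sup>2 \<le> (ip.nrm (\<beta> *\<^sub>R w - L w))\<^sup>2"
      unfolding resolvent_norm_expand[OF w] by linarith
  qed (use w in auto)
qed

text \<open>The term \<open>\<rho>20 * qv w w\<close> of the curvature-dimension inequality survives as \<open>l \<rightarrow> 0\<close>.\<close>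
lemma resolvent_smoothing:
  assumes \<theta>: "0 < \<theta>" and \<beta>: "0 < \<beta>"
  shows "\<exists>K\<ge>0. \<forall>w\<in>V. (qv.nrm w)\<^sup>2 \<le>
    \<theta> * (qv.nrm (\<beta> *\<^sub>R w - L w))\<^sup>2 + K * (ip.nrm (\<beta> *\<^sub>R w - L w))\<^sup>2"
proof -
  \<comment> \<open>The first entry gives 2 l^2 / \<rho>20^2 \<le> \<theta>, the second |\<rho>21| l
    \<le> \<rho>20 / 4. Of \<open>\<rho>20 * qv w w\<close> one quarter is spent on the \<rho>21
    term and one quarter on Young's inequality for \<open>l * qv w x\<close>; one half
    remains.\<close>
  define l where "l = min (\<rho>20 * sqrt (\<theta> / 2)) (\<rho>20 / (4 * (\<bar>\<rho>21\<bar> + 1)))"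
  have l: "0 < l" using \<theta> rho20 by (simp add: l_def)
  have l1: "2 * l\<^sup>2 / \<rho>20\<^sup>2 \<le> \<theta>"
  proof -
    have "l\<^sup>2 \<le> (\<rho>20 * sqrt (\<theta> / 2))\<^sup>2" using l by (intro power_mono) (auto simp: l_def)
    then show ?thesis using rho20 \<theta> by (simp add: power_mult_distrib field_simps)
  qed
  have l2: "\<bar>\<rho>21\<bar> * l \<le> \<rho>20 / 4"
  proof -
    have "\<bar>\<rho>21\<bar> * l \<le> (\<bar>\<rho>21\<bar> + 1) * (\<rho>20 / (4 * (\<bar>\<rho>21\<bar> + 1)))"
      using l by (intro mult_mono) (auto simp: l_def)
    also have "\<dots> = \<rho>20 / 4" by (simp add: field_simps)
    finally show ?thesis .
  qed
  \<comment> \<open>The possibly huge 1 / l multiplies only L^2 quantities, so it may be put into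
    \<open>K\<close>; 2 / \<rho>20 comes from dividing by the remaining half of \<rho>20.\<close>
  define K where "K = 2 / \<rho>20 * (1 + \<bar>\<rho>1 - 1 / l\<bar> / \<beta>)"
  have "0 \<le> K" using rho20 \<beta> by (simp add: K_def)
  moreover have "(qv.nrm w)\<^sup>2 \<le> \<theta> * (qv.nrm (\<beta> *\<^sub>R w - L w))\<^sup>2 + K * (ip.nrm (\<beta> *\<^sub>R w - L w))\<^sup>2"
    if w: "w \<in> V" for w
  proof -
    define x where "x = \<beta> *\<^sub>R w - L w"
    have x: "x \<in> V" using w by (simp add: x_def)
    have Lw: "L w = \<beta> *\<^sub>R w - x" by (simp add: x_def)
    have n: "0 \<le> - ip w (L w)" using L_neg[OF w] by simp
    have e: "(ip.nrm x)\<^sup>2 = \<beta>\<^sup>2 * (ip.nrm w)\<^sup>2 + 2 * \<beta> * (- ip w (L w)) + (ip.nrm (L w))\<^sup>2"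
      unfolding x_def by (rule resolvent_norm_expand[OF w])
    have e1: "(ip.nrm (L w))\<^sup>2 \<le> (ip.nrm x)\<^sup>2" "2 * \<beta> * (- ip w (L w)) \<le> (ip.nrm x)\<^sup>2"
    proof -
      have "0 \<le> 2 * \<beta> * (- ip w (L w))" using n \<beta> by (intro mult_nonneg_nonneg) auto
      moreover have "0 \<le> \<beta>\<^sup>2 * (ip.nrm w)\<^sup>2" "0 \<le> (ip.nrm (L w))\<^sup>2" by auto
      ultimately show "(ip.nrm (L w))\<^sup>2 \<le> (ip.nrm x)\<^sup>2" "2 * \<beta> * (- ip w (L w)) \<le> (ip.nrm x)\<^sup>2"
        unfolding e by linarith+
    qed
    have e2: "- ip w (L w) \<le> (ip.nrm x)\<^sup>2 / \<beta>"
    proof -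
      have "\<beta> * (- ip w (L w)) \<le> 2 * \<beta> * (- ip w (L w))" using n \<beta> by (intro mult_right_mono) auto
      then have "\<beta> * (- ip w (L w)) \<le> (ip.nrm x)\<^sup>2" using e1(2) by linarith
      then show ?thesis using \<beta> by (simp add: field_simps)
    qed
    have "(\<rho>1 - 1 / l) * (- ip w (L w)) + (\<rho>20 + \<rho>21 * l) * qv w w
        \<le> (1 - c) * ip (L w) (L w) - l * qv w (L w)" by (rule CD[OF w l])
    moreover have "qv w (L w) = \<beta> * qv w w - qv w x" unfolding Lw using w x by (simp add: qv.bilin)
    moreover have "(1 - c) * ip (L w) (L w) \<le> (ip.nrm x)\<^sup>2"
    proof -
      have "(1 - c) * ip (L w) (L w) \<le> 1 * ip (L w) (L w)"
        using c ip.nonneg[of "L w"] w by (intro mult_right_mono) auto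
      then show ?thesis using e1(1) w by (simp add: ip.nrm_sq)
    qed
    moreover have "(\<rho>1 - 1 / l) * (- ip w (L w)) \<ge> - (\<bar>\<rho>1 - 1 / l\<bar> * ((ip.nrm x)\<^sup>2 / \<beta>))"
    proof -
      have "\<bar>(\<rho>1 - 1 / l) * (- ip w (L w))\<bar> \<le> \<bar>\<rho>1 - 1 / l\<bar> * ((ip.nrm x)\<^sup>2 / \<beta>)"
        unfolding abs_mult using n e2 by (intro mult_left_mono) auto
      then show ?thesis by linarith
    qed
    moreover have "l * qv w x \<le> \<rho>20 / 4 * qv w w + l\<^sup>2 / \<rho>20 * (qv.nrm x)\<^sup>2"
    proof -
      have "l * qv w x \<le> l * (qv.nrm w * qv.nrm x)"
        using qv.cauchy_schwarz[OF w x] l by (intro mult_left_mono) auto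
      also have "\<dots> \<le> \<rho>20 / 4 * (qv.nrm w)\<^sup>2 + l\<^sup>2 / \<rho>20 * (qv.nrm x)\<^sup>2"
      proof -
        have "0 \<le> (\<rho>20 / 2 * qv.nrm w - l * qv.nrm x)\<^sup>2 / \<rho>20" using rho20 by simp
        also have "\<dots> = \<rho>20 / 4 * (qv.nrm w)\<^sup>2 + l\<^sup>2 / \<rho>20 * (qv.nrm x)\<^sup>2 - l * (qv.nrm w * qv.nrm x)"
          using rho20 by (simp add: power2_eq_square field_simps)
        finally show ?thesis by simp
      qed
      finally show ?thesis using w by (simp add: qv.nrm_sq)
    qed
    moreover have "- (\<rho>20 / 4 * qv w w) \<le> \<rho>21 * l * qv w w"
    proof -
      have "- (\<rho>20 / 4) * qv w w \<le> (\<rho>21 * l) * qv w w"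
      proof (intro mult_right_mono)
        have "(- \<bar>\<rho>21\<bar>) * l \<le> \<rho>21 * l" using l by (intro mult_right_mono) auto
        then show "- (\<rho>20 / 4) \<le> \<rho>21 * l" using l2 by simp
      qed (rule qv.nonneg[OF w])
      then show ?thesis by simp
    qed
    moreover have "0 \<le> l * \<beta> * qv w w" using l \<beta> qv.nonneg[OF w] by simp
    ultimately have "\<rho>20 / 2 * qv w w \<le> (ip.nrm x)\<^sup>2 + \<bar>\<rho>1 - 1 / l\<bar> * ((ip.nrm x)\<^sup>2 / \<beta>)
        + l\<^sup>2 / \<rho>20 * (qv.nrm x)\<^sup>2"
      by (simp add: algebra_simps)
    then have "2 / \<rho>20 * (\<rho>20 / 2 * qv w w) \<le> 2 / \<rho>20 * ((ip.nrm x)\<^sup>2 + \<bar>\<rho>1 - 1 / l\<bar> * ((ip.nrm x)\<^sup>2 / \<beta>)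
        + l\<^sup>2 / \<rho>20 * (qv.nrm x)\<^sup>2)"
      using rho20 by (intro mult_left_mono) auto
    then have "qv w w \<le> 2 * l\<^sup>2 / \<rho>20\<^sup>2 * (qv.nrm x)\<^sup>2 + K * (ip.nrm x)\<^sup>2"
      using rho20 by (simp add: K_def power2_eq_square algebra_simps)
    also have "\<dots> \<le> \<theta> * (qv.nrm x)\<^sup>2 + K * (ip.nrm x)\<^sup>2"
      using l1 by (intro add_right_mono mult_right_mono) auto
    finally show ?thesis using w by (simp add: qv.nrm_sq x_def)
  qed
  ultimately show ?thesis by blast
qed

text \<open>With \<open>T = (\<beta> - ev) (\<beta> - L)\<inverse>\<close>, the vector \<open>z\<close> approximates \<open>(2 T - T\<^sup>2) y\<close>.  Since \<open>T\<close> has its spectrum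
  in \<open>[0, 2]\<close>, \<open>2 T - T\<^sup>2 = 1 - (1 - T)\<^sup>2\<close> is a contraction.\<close>
lemma two_resolvents:
  assumes y: "y \<in> V" and \<beta>: "0 < \<beta>" "\<bar>ev\<bar> < \<beta>"
    and dens: "\<forall>g\<in>V. \<forall>e>0. \<exists>u\<in>V.
      ip.nrm (\<beta> *\<^sub>R u - L u - g) \<le> e \<and> qv.nrm (\<beta> *\<^sub>R u - L u - g) \<le> e"
    and b: "b = \<beta> - ev"
  shows "\<exists>K\<ge>0. \<forall>\<epsilon>. 0 < \<epsilon> \<and> \<epsilon> \<le> 1 \<longrightarrow> (\<exists>w1\<in>V. \<exists>w2\<in>V. \<exists>r1\<in>V. \<exists>r2\<in>V.
     \<beta> *\<^sub>R w1 - L w1 = y + r1 \<and> \<beta> *\<^sub>R w2 - L w2 = w1 + r2 \<and>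
     ip.nrm r1 \<le> \<epsilon> \<and> ip.nrm r2 \<le> \<epsilon> \<and> qv.nrm r1 \<le> \<epsilon> \<and> qv.nrm r2 \<le> \<epsilon> \<and>
     (ip.nrm ((2 * b) *\<^sub>R w1 - (b\<^sup>2) *\<^sub>R w2))\<^sup>2 \<le> (ip.nrm y)\<^sup>2 + K * \<epsilon> \<and>
     (ip.nrm (y - b *\<^sub>R w1))\<^sup>2 \<le> ip.nrm y * ip.nrm (y - ((2 * b) *\<^sub>R w1 - (b\<^sup>2) *\<^sub>R w2)) + K * \<epsilon>)"
proof -
  have b0: "0 < b" using b \<beta> by auto
  define Y where "Y = ip.nrm y"
  have Y0: "0 \<le> Y" using y by (simp add: Y_def)
  \<comment> \<open>\<open>W\<close>, \<open>S\<close> and \<open>T\<close> bound the norms of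
    \<open>w1\<close>, \<open>s1\<close> and \<open>t1\<close> for \<epsilon> \<le> 1; this
    \<open>T\<close> is a number, not the operator of the explanation above. All constants may
    depend on \<open>y\<close>, which is fixed before \<epsilon>.\<close>
  define W where "W = (Y + 1) / \<beta>"
  have W0: "0 \<le> W" using Y0 \<beta> by (simp add: W_def)
  define S where "S = Y + b * W"
  have S0: "0 \<le> S" using Y0 W0 b0 by (simp add: S_def)
  define T where "T = (S + (1 + b)) / \<beta>"
  have T0: "0 \<le> T" using S0 \<beta> b0 by (simp add: T_def)
  define K1 where "K1 = b * W * (1 + b) + b * T"
  define K where "K = 2 * K1 + 4 * S * (1 + b) + 4 * (1 + b)\<^sup>2"
  have K1_0: "0 \<le> K1" using W0 b0 T0 by (simp add: K1_def)
  have K_0: "0 \<le> K" "K1 \<le> K" using K1_0 S0 b0 by (auto simp: K_def)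
  have "\<exists>w1\<in>V. \<exists>w2\<in>V. \<exists>r1\<in>V. \<exists>r2\<in>V.
     \<beta> *\<^sub>R w1 - L w1 = y + r1 \<and> \<beta> *\<^sub>R w2 - L w2 = w1 + r2 \<and>
     ip.nrm r1 \<le> \<epsilon> \<and> ip.nrm r2 \<le> \<epsilon> \<and> qv.nrm r1 \<le> \<epsilon> \<and> qv.nrm r2 \<le> \<epsilon> \<and>
     (ip.nrm ((2 * b) *\<^sub>R w1 - (b\<^sup>2) *\<^sub>R w2))\<^sup>2 \<le> (ip.nrm y)\<^sup>2 + K * \<epsilon> \<and>
     (ip.nrm (y - b *\<^sub>R w1))\<^sup>2 \<le> ip.nrm y * ip.nrm (y - ((2 * b) *\<^sub>R w1 - (b\<^sup>2) *\<^sub>R w2)) + K * \<epsilon>"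
    if \<epsilon>: "0 < \<epsilon>" "\<epsilon> \<le> 1" for \<epsilon>
  proof -
    obtain w1 where w1: "w1 \<in> V" "ip.nrm (\<beta> *\<^sub>R w1 - L w1 - y) \<le> \<epsilon>" "qv.nrm (\<beta> *\<^sub>R w1 - L w1 - y) \<le> \<epsilon>"
      using dens y \<epsilon> by blast
    obtain w2 where w2: "w2 \<in> V" "ip.nrm (\<beta> *\<^sub>R w2 - L w2 - w1) \<le> \<epsilon>" "qv.nrm (\<beta> *\<^sub>R w2 - L w2 - w1) \<le> \<epsilon>"
      using dens w1(1) \<epsilon> by blast
    define r1 where "r1 = \<beta> *\<^sub>R w1 - L w1 - y"
    define r2 where "r2 = \<beta> *\<^sub>R w2 - L w2 - w1"
    have r: "r1 \<in> V" "r2 \<in> V" using w1 w2 y by (auto simp: r1_def r2_def)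
    have R: "\<beta> *\<^sub>R w1 - L w1 = y + r1" "\<beta> *\<^sub>R w2 - L w2 = w1 + r2" by (auto simp: r1_def r2_def)
    \<comment> \<open>Up to errors of order \<epsilon>, \<open>s1\<close> is (1 - T) y,
      \<open>b *\<^sub>R t1\<close> is T (1 - T) y, and \<open>s2\<close> is (1 - T)^2 y, for the
      operator T.\<close>
    define s1 where "s1 = y - b *\<^sub>R w1"
    define t1 where "t1 = w1 - b *\<^sub>R w2"
    define s2 where "s2 = s1 - b *\<^sub>R t1"
    define z where "z = (2 * b) *\<^sub>R w1 - (b\<^sup>2) *\<^sub>R w2"
    define d where "d = r1 - b *\<^sub>R r2"
    have in_V: "s1 \<in> V" "t1 \<in> V" "s2 \<in> V" "z \<in> V" "d \<in> V"
      using y w1(1) w2(1) r by (simp_all add: s1_def t1_def s2_def z_def d_def)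
    have zs: "z = y - s2"
      by (simp add: z_def s2_def s1_def t1_def algebra_simps power2_eq_square scaleR_2 flip: scaleR_scaleR)
    have t1_eq: "\<beta> *\<^sub>R t1 - L t1 = s1 + d"
    proof -
      have "\<beta> *\<^sub>R t1 - L t1 = (\<beta> *\<^sub>R w1 - L w1) - b *\<^sub>R (\<beta> *\<^sub>R w2 - L w2)"
        using w1(1) w2(1) by (simp add: t1_def L_diff L_scale algebra_simps)
      then show ?thesis unfolding R by (simp add: s1_def d_def algebra_simps)
    qed
    have nd: "ip.nrm d \<le> \<epsilon> * (1 + b)"
    proof -
      have "ip.nrm d \<le> ip.nrm r1 + b * ip.nrm r2"
        using ip.nrm_triangle_diff[of r1 "b *\<^sub>R r2"] r b0 by (simp add: d_def ip.nrm_scale)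
      also have "\<dots> \<le> \<epsilon> + b * \<epsilon>" using w1 w2 b0 by (intro add_mono mult_left_mono) (auto simp: r1_def r2_def)
      finally show ?thesis by (simp add: algebra_simps)
    qed
    have nw1: "ip.nrm w1 \<le> W"
    proof -
      have "\<beta> * ip.nrm w1 \<le> ip.nrm (y + r1)" using resolvent_bounds(1)[OF w1(1), of \<beta>] \<beta> R by simp
      also have "\<dots> \<le> Y + 1" using ip.nrm_triangle[of y r1] y r w1 \<epsilon> by (simp add: Y_def r1_def)
      finally show ?thesis using \<beta> by (simp add: W_def field_simps)
    qed
    have ns1: "ip.nrm s1 \<le> S"
    proof -
      have "ip.nrm s1 \<le> Y + b * ip.nrm w1"
        using ip.nrm_triangle_diff[of y "b *\<^sub>R w1"] y w1 b0 by (simp add: s1_def Y_def ip.nrm_scale)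
      also have "\<dots> \<le> S" using nw1 b0 by (simp add: S_def)
      finally show ?thesis .
    qed
    have nsd: "ip.nrm (s1 + d) \<le> ip.nrm s1 + \<epsilon> * (1 + b)"
      using ip.nrm_triangle[of s1 d] in_V nd by simp
    have nt1: "ip.nrm t1 \<le> T"
    proof -
      have "\<beta> * ip.nrm t1 \<le> ip.nrm (s1 + d)" using resolvent_bounds(1)[OF in_V(2), of \<beta>] \<beta> t1_eq by simp
      also have "\<dots> \<le> S + 1 * (1 + b)"
        using nsd ns1 \<epsilon> b0 mult_right_mono[of \<epsilon> 1 "1 + b"] by linarith
      finally show ?thesis using \<beta> by (simp add: T_def field_simps)
    qed
    have ns2: "ip.nrm s2 \<le> ip.nrm s1 + 2 * (\<epsilon> * (1 + b))"
    proof -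
      \<comment> \<open>Because \<beta> - b = ev, passing from \<open>s1\<close> to
        \<open>s2\<close> amounts to (ev - L) (\<beta> - L)^-1, which does not increase
        norms.\<close>
      have "s2 = (ev *\<^sub>R t1 - L t1) - d" using t1_eq by (simp add: s2_def b algebra_simps)
      then have "ip.nrm s2 \<le> ip.nrm (ev *\<^sub>R t1 - L t1) + ip.nrm d"
        using ip.nrm_triangle_diff[of "ev *\<^sub>R t1 - L t1" d] in_V by simp
      also have "\<dots> \<le> ip.nrm (s1 + d) + ip.nrm d"
        using resolvent_bounds(3)[OF in_V(2), of \<beta>] \<beta> t1_eq by simp
      finally show ?thesis using nsd nd by linarith
    qed
    \<comment> \<open>Symmetry of the resolvent in approximate form: moving it to the other factor
      shows that y paired with (1 - T)^2 y is the squared norm of (1 - T) y, up to errors of order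
      \<epsilon>. Both inequalities of the conclusion rest on this.\<close>
    have "ip y t1 = ip (\<beta> *\<^sub>R w1 - L w1) t1 - ip r1 t1"
      unfolding R using y r in_V by (simp add: ip.bilin)
    also have "ip (\<beta> *\<^sub>R w1 - L w1) t1 = ip w1 (\<beta> *\<^sub>R t1 - L t1)"
      using w1(1) in_V by (simp add: ip.bilin L_sym)
    also have "\<dots> = ip w1 s1 + ip w1 d" unfolding t1_eq using w1 in_V by (simp add: ip.bilin)
    finally have yt1: "ip y t1 = ip w1 s1 + ip w1 d - ip r1 t1" .
    have "ip y s2 = ip y s1 - b * ip y t1" using y in_V by (simp add: s2_def ip.bilin)
    also have "\<dots> = (ip y s1 - b * ip w1 s1) - b * ip w1 d + b * ip r1 t1"
      unfolding yt1 by (simp add: algebra_simps)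
    also have "ip y s1 - b * ip w1 s1 = (ip.nrm s1)\<^sup>2"
    proof -
      have "ip s1 s1 = ip y s1 - b * ip w1 s1"
        using y w1(1) in_V(1) by (subst (1) s1_def) (simp add: ip.bilin)
      then show ?thesis using in_V by (simp add: ip.nrm_sq)
    qed
    finally have ys2: "ip y s2 = (ip.nrm s1)\<^sup>2 - b * ip w1 d + b * ip r1 t1" .
    have e1: "b * \<bar>ip w1 d\<bar> \<le> b * (W * (\<epsilon> * (1 + b)))"
    proof -
      have "\<bar>ip w1 d\<bar> \<le> ip.nrm w1 * ip.nrm d" using w1 in_V by (intro ip.cauchy_schwarz) auto
      also have "\<dots> \<le> W * (\<epsilon> * (1 + b))" using nw1 nd in_V W0 by (intro mult_mono) auto
      finally show ?thesis using b0 by simp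
    qed
    have e2: "b * \<bar>ip r1 t1\<bar> \<le> b * (\<epsilon> * T)"
    proof -
      have "\<bar>ip r1 t1\<bar> \<le> ip.nrm r1 * ip.nrm t1" using r in_V by (intro ip.cauchy_schwarz) auto
      also have "\<dots> \<le> \<epsilon> * T" using w1 nt1 in_V r \<epsilon> by (intro mult_mono) (auto simp: r1_def)
      finally show ?thesis using b0 by simp
    qed
    have e3: "- (K1 * \<epsilon>) \<le> - b * ip w1 d + b * ip r1 t1"
    proof -
      have "- (b * \<bar>ip w1 d\<bar>) \<le> - b * ip w1 d" "- (b * \<bar>ip r1 t1\<bar>) \<le> b * ip r1 t1"
        using b0 by (auto simp: abs_if algebra_simps mult_nonneg_nonneg)
      moreover have "K1 * \<epsilon> = b * (W * (\<epsilon> * (1 + b))) + b * (\<epsilon> * T)" by (simp add: K1_def algebra_simps)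
      ultimately show ?thesis using e1 e2 by linarith
    qed
    have ns2sq: "(ip.nrm s2)\<^sup>2 \<le> (ip.nrm s1)\<^sup>2 + (4 * S * (1 + b) + 4 * (1 + b)\<^sup>2) * \<epsilon>"
    proof -
      have "(ip.nrm s2)\<^sup>2 \<le> (ip.nrm s1 + 2 * (\<epsilon> * (1 + b)))\<^sup>2" using ns2 in_V by (intro power_mono) auto
      also have "\<dots> = (ip.nrm s1)\<^sup>2 + 4 * ip.nrm s1 * (1 + b) * \<epsilon> + 4 * (1 + b)\<^sup>2 * \<epsilon> * \<epsilon>"
        by (simp add: power2_eq_square algebra_simps)
      also have "\<dots> \<le> (ip.nrm s1)\<^sup>2 + 4 * S * (1 + b) * \<epsilon> + 4 * (1 + b)\<^sup>2 * \<epsilon> * 1"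
        using ns1 \<epsilon> b0 in_V by (intro add_mono mult_right_mono mult_left_mono) auto
      finally show ?thesis by (simp add: algebra_simps)
    qed
    have "(ip.nrm z)\<^sup>2 = (ip.nrm y)\<^sup>2 - 2 * ip y s2 + (ip.nrm s2)\<^sup>2"
      unfolding zs using y in_V ip.sym[of s2 y] by (simp add: ip.nrm_sq ip.bilin)
    also have "\<dots> \<le> (ip.nrm y)\<^sup>2 + K * \<epsilon>"
    proof -
      have "K * \<epsilon> = 2 * (K1 * \<epsilon>) + (4 * S * (1 + b) + 4 * (1 + b)\<^sup>2) * \<epsilon>"
        by (simp add: K_def algebra_simps)
      moreover have "2 * ip y s2 \<ge> 2 * (ip.nrm s1)\<^sup>2 - 2 * (K1 * \<epsilon>)" using e3 ys2 by linarith
      ultimately show ?thesis using ns2sq zero_le_power2[of "ip.nrm s1"] by linarith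
    qed
    finally have A: "(ip.nrm z)\<^sup>2 \<le> (ip.nrm y)\<^sup>2 + K * \<epsilon>" .
    have "(ip.nrm s1)\<^sup>2 \<le> ip y s2 + K1 * \<epsilon>" using ys2 e3 by linarith
    also have "\<dots> \<le> ip.nrm y * ip.nrm s2 + K * \<epsilon>"
      using ip.cauchy_schwarz[OF y in_V(3)] mult_right_mono[OF K_0(2), of \<epsilon>] \<epsilon> by linarith
    finally have B: "(ip.nrm s1)\<^sup>2 \<le> ip.nrm y * ip.nrm (y - z) + K * \<epsilon>" by (simp add: zs)
    have nr: "ip.nrm r1 \<le> \<epsilon>" "ip.nrm r2 \<le> \<epsilon>" "qv.nrm r1 \<le> \<epsilon>" "qv.nrm r2 \<le> \<epsilon>"
      using w1 w2 by (simp_all add: r1_def r2_def)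
    show ?thesis
      by (intro bexI[OF _ w1(1)] bexI[OF _ w2(1)] bexI[OF _ r(1)] bexI[OF _ r(2)] conjI)
        (fact R nr A[unfolded z_def] B[unfolded z_def s1_def])+
  qed
  with K_0 show ?thesis by blast
qed

text \<open>The witness is \<open>f + w1 - b w2\<close> with the approximate resolvents \<open>w1\<close>, \<open>w2\<close> of \<open>y = (L - ev) f\<close>; it
  turns \<open>y\<close> into an approximation of \<open>(2 T - T\<^sup>2) y\<close> and, as \<open>E\<close> is an eigenfunctional, hardly changes \<open>E f\<close>.\<close>
lemma eigenvalue_defect_halving:
  assumes \<beta>: "0 < \<beta>" "\<bar>ev\<bar> < \<beta>"
    and dens: "\<forall>g\<in>V. \<forall>e>0. \<exists>u\<in>V.
      ip.nrm (\<beta> *\<^sub>R u - L u - g) \<le> e \<and> qv.nrm (\<beta> *\<^sub>R u - L u - g) \<le> e"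
  shows "\<exists>C\<ge>0. \<forall>\<delta>>0. \<forall>f\<in>V. a < E f \<and> ip.nrm (L f - ev *\<^sub>R f) < \<delta> \<longrightarrow>
    (\<exists>f'\<in>V. a < E f' \<and> ip.nrm (L f' - ev *\<^sub>R f') < \<delta> \<and>
      (qv.nrm (L f' - ev *\<^sub>R f'))\<^sup>2 \<le> (qv.nrm (L f - ev *\<^sub>R f))\<^sup>2 / 2 + C * \<delta>\<^sup>2)"
proof -
  define b where "b = \<beta> - ev"
  have b0: "0 < b" using b_def \<beta> by auto
  \<comment> \<open>Squaring the combination of \<open>w1\<close> and \<open>w2\<close> costs 8 b^2
    + 2 b^4, which is at most m / 2. The total coefficient of \<open>(qv.nrm y)\<^sup>2\<close>
    becomes 4 m \<theta>, and 8 m \<theta> \<le> 1 makes it at most 1/2.\<close>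
  define m where "m = 16 * b\<^sup>2 + 8 * b ^ 4"
  have m0: "0 < m" using b0 by (simp add: m_def add_pos_pos)
  define \<theta> where "\<theta> = min 1 (1 / (8 * m))"
  have \<theta>: "0 < \<theta>" "\<theta> \<le> 1" "8 * m * \<theta> \<le> 1"
    using m0 by (auto simp: \<theta>_def min_def field_simps)
  obtain K where K: "0 \<le> K" "\<And>w. w \<in> V \<Longrightarrow> (qv.nrm w)\<^sup>2 \<le>
    \<theta> * (qv.nrm (\<beta> *\<^sub>R w - L w))\<^sup>2 + K * (ip.nrm (\<beta> *\<^sub>R w - L w))\<^sup>2"
    using resolvent_smoothing[OF \<theta>(1) \<beta>(1)] by blast
  obtain Ke where Ke: "\<And>u. u \<in> V \<Longrightarrow> \<bar>E u\<bar> \<le> Ke * ip.nrm u" using E_bounded by blast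
  define C1 where "C1 = \<theta> * 2 + K * (2 * (4 / \<beta>\<^sup>2) + 2) + 2 * (2 * \<theta> + 4 * K)"
  have C1: "0 \<le> C1" using K \<theta> by (simp add: C1_def)
  define C where "C = 2 * m * C1 + 16 + 16 * b\<^sup>2"
  have C: "0 \<le> C" using C1 m0 by (simp add: C_def)
  have "\<exists>f'\<in>V. a < E f' \<and> ip.nrm (L f' - ev *\<^sub>R f') < \<delta> \<and>
      (qv.nrm (L f' - ev *\<^sub>R f'))\<^sup>2 \<le> (qv.nrm (L f - ev *\<^sub>R f))\<^sup>2 / 2 + C * \<delta>\<^sup>2"
    if d: "0 < \<delta>" and f: "f \<in> V" "a < E f" "ip.nrm (L f - ev *\<^sub>R f) < \<delta>" for \<delta> f
  proof -
    define y where "y = L f - ev *\<^sub>R f"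
    have y: "y \<in> V" using f by (simp add: y_def)
    define Y where "Y = ip.nrm y"
    have Y: "0 \<le> Y" "Y < \<delta>" using f y by (auto simp: Y_def y_def)
    obtain J where J: "0 \<le> J" "\<And>\<epsilon>. 0 < \<epsilon> \<Longrightarrow> \<epsilon> \<le> 1 \<Longrightarrow> (\<exists>w1\<in>V. \<exists>w2\<in>V. \<exists>r1\<in>V. \<exists>r2\<in>V.
     \<beta> *\<^sub>R w1 - L w1 = y + r1 \<and> \<beta> *\<^sub>R w2 - L w2 = w1 + r2 \<and>
     ip.nrm r1 \<le> \<epsilon> \<and> ip.nrm r2 \<le> \<epsilon> \<and> qv.nrm r1 \<le> \<epsilon> \<and> qv.nrm r2 \<le> \<epsilon> \<and>
     (ip.nrm ((2 * b) *\<^sub>R w1 - (b\<^sup>2) *\<^sub>R w2))\<^sup>2 \<le> (ip.nrm y)\<^sup>2 + J * \<epsilon>)"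
      using two_resolvents[OF y \<beta> dens b_def] by blast
    \<comment> \<open>The assumptions on \<open>f\<close> are strict, and their slack pays for the
      residuals. The condition \<epsilon> \<le> \<delta> lets the residuals contribute a multiple of
      \<delta>^2 to the bound for \<open>qv\<close>, with a factor independent of
      \<open>f\<close>.\<close>
    have "\<exists>\<epsilon>>0. \<epsilon> \<le> 1 \<and> \<epsilon> \<le> \<delta> \<and> sqrt (Y\<^sup>2 + J * \<epsilon>) + \<epsilon> * (1 + b) < \<delta> \<and> \<bar>Ke\<bar> * \<epsilon> < E f - a"
    proof -
      have "((\<lambda>\<epsilon>. sqrt (Y\<^sup>2 + J * \<epsilon>) + \<epsilon> * (1 + b)) \<longlongrightarrow> sqrt (Y\<^sup>2 + J * 0) + 0 * (1 + b)) (at_right 0)"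
        by (intro tendsto_intros)
      then have "((\<lambda>\<epsilon>. sqrt (Y\<^sup>2 + J * \<epsilon>) + \<epsilon> * (1 + b)) \<longlongrightarrow> Y) (at_right 0)" using Y by simp
      then have "\<forall>\<^sub>F \<epsilon> in at_right 0. sqrt (Y\<^sup>2 + J * \<epsilon>) + \<epsilon> * (1 + b) < \<delta>"
        using Y(2) by (rule order_tendstoD)
      moreover have "((\<lambda>\<epsilon>. \<bar>Ke\<bar> * \<epsilon>) \<longlongrightarrow> \<bar>Ke\<bar> * 0) (at_right 0)" by (intro tendsto_intros)
      then have "\<forall>\<^sub>F \<epsilon> in at_right 0. \<bar>Ke\<bar> * \<epsilon> < E f - a"
        by (rule order_tendstoD) (use f in simp)
      moreover have "\<forall>\<^sub>F \<epsilon> in at_right 0. \<epsilon> \<in> {0<..<min 1 \<delta>}" using d by (intro eventually_at_right_real) auto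
      ultimately have "\<forall>\<^sub>F \<epsilon> in at_right 0. 0 < \<epsilon> \<and> \<epsilon> \<le> 1 \<and> \<epsilon> \<le> \<delta> \<and>
          sqrt (Y\<^sup>2 + J * \<epsilon>) + \<epsilon> * (1 + b) < \<delta> \<and> \<bar>Ke\<bar> * \<epsilon> < E f - a"
        by eventually_elim auto
      then show ?thesis by (rule eventually_happens'[rotated]) simp
    qed
    then obtain \<epsilon> where \<epsilon>: "0 < \<epsilon>" "\<epsilon> \<le> 1" "\<epsilon> \<le> \<delta>" "sqrt (Y\<^sup>2 + J * \<epsilon>) + \<epsilon> * (1 + b) < \<delta>" "\<bar>Ke\<bar> * \<epsilon> < E f - a"
      by blast
    obtain w1 w2 r1 r2 where V: "w1 \<in> V" "w2 \<in> V" "r1 \<in> V" "r2 \<in> V"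
      and R: "\<beta> *\<^sub>R w1 - L w1 = y + r1" "\<beta> *\<^sub>R w2 - L w2 = w1 + r2"
      and r: "ip.nrm r1 \<le> \<epsilon>" "ip.nrm r2 \<le> \<epsilon>" "qv.nrm r1 \<le> \<epsilon>" "qv.nrm r2 \<le> \<epsilon>"
      and z: "(ip.nrm ((2 * b) *\<^sub>R w1 - (b\<^sup>2) *\<^sub>R w2))\<^sup>2 \<le> Y\<^sup>2 + J * \<epsilon>"
      using J(2)[OF \<epsilon>(1,2)] unfolding Y_def by blast
    define f' where "f' = f + w1 - b *\<^sub>R w2"
    define y' where "y' = L f' - ev *\<^sub>R f'"
    have f': "f' \<in> V" using f V by (simp add: f'_def)
    have Lw: "L w1 = \<beta> *\<^sub>R w1 - y - r1" "L w2 = \<beta> *\<^sub>R w2 - w1 - r2"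
      using R by (auto simp: algebra_simps)
    have Lf: "L f = y + ev *\<^sub>R f" by (simp add: y_def)
    have "L f' = L f + L w1 - b *\<^sub>R L w2" using f V by (simp add: f'_def L_add L_diff L_scale)
    then have Lf': "L f' = (y + ev *\<^sub>R f) + (\<beta> *\<^sub>R w1 - y - r1) - b *\<^sub>R (\<beta> *\<^sub>R w2 - w1 - r2)"
      by (simp add: Lf Lw)
    \<comment> \<open>The defect \<open>y\<close> of \<open>f\<close> is cancelled by the one
      contained in \<open>L w1\<close>, and \<open>L w2\<close> supplies a second copy of
      \<open>w1\<close>; only the polynomial in the resolvent and the residuals are left.\<close>
    have y'_eq: "y' = ((2 * b) *\<^sub>R w1 - (b\<^sup>2) *\<^sub>R w2) + (b *\<^sub>R r2 - r1)"
    proof -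
      have \<beta>_eq: "\<beta> = b + ev" by (simp add: b_def)
      show ?thesis unfolding y'_def Lf' unfolding f'_def \<beta>_eq
        by (simp add: algebra_simps power2_eq_square scaleR_2 flip: scaleR_scaleR)
          (simp add: mult.commute)
    qed
    have nd: "ip.nrm (b *\<^sub>R r2 - r1) \<le> \<epsilon> * (1 + b)" "qv.nrm (b *\<^sub>R r2 - r1) \<le> \<epsilon> * (1 + b)"
    proof -
      have "ip.nrm (b *\<^sub>R r2 - r1) \<le> b * ip.nrm r2 + ip.nrm r1"
        using ip.nrm_triangle_diff[of "b *\<^sub>R r2" r1] V b0 by (simp add: ip.nrm_scale)
      also have "\<dots> \<le> b * \<epsilon> + \<epsilon>" using r b0 by (intro add_mono mult_left_mono) auto
      finally show "ip.nrm (b *\<^sub>R r2 - r1) \<le> \<epsilon> * (1 + b)" by (simp add: algebra_simps)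
      have "qv.nrm (b *\<^sub>R r2 - r1) \<le> b * qv.nrm r2 + qv.nrm r1"
        using qv.nrm_triangle_diff[of "b *\<^sub>R r2" r1] V b0 by (simp add: qv.nrm_scale)
      also have "\<dots> \<le> b * \<epsilon> + \<epsilon>" using r b0 by (intro add_mono mult_left_mono) auto
      finally show "qv.nrm (b *\<^sub>R r2 - r1) \<le> \<epsilon> * (1 + b)" by (simp add: algebra_simps)
    qed
    have "ip.nrm y' < \<delta>"
    proof -
      have "ip.nrm y' \<le> ip.nrm ((2 * b) *\<^sub>R w1 - (b\<^sup>2) *\<^sub>R w2) + ip.nrm (b *\<^sub>R r2 - r1)"
        unfolding y'_eq using V by (intro ip.nrm_triangle) auto
      also have "\<dots> \<le> sqrt (Y\<^sup>2 + J * \<epsilon>) + \<epsilon> * (1 + b)"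
        using z nd V by (intro add_mono real_le_rsqrt) auto
      also have "\<dots> < \<delta>" by (rule \<epsilon>)
      finally show ?thesis .
    qed
    moreover have "a < E f'"
    proof -
      have w1_eq: "w1 = \<beta> *\<^sub>R w2 - L w2 - r2" using R(2) by simp
      have "E w1 = \<beta> * E w2 - E (L w2) - E r2"
        using V by (subst w1_eq) (simp add: E_diff E_scale)
      then have "E w1 = b * E w2 - E r2"
        using E_eigen[OF V(2)] by (simp add: b_def algebra_simps)
      then have "E f' = E f - E r2" using f V by (simp add: f'_def E_add E_diff E_scale)
      moreover have "\<bar>E r2\<bar> \<le> \<bar>Ke\<bar> * \<epsilon>"
      proof -
        have "\<bar>E r2\<bar> \<le> Ke * ip.nrm r2" by (rule Ke[OF V(4)])
        also have "\<dots> \<le> \<bar>Ke\<bar> * \<epsilon>" using r V by (intro mult_mono) auto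
        finally show ?thesis .
      qed
      ultimately show ?thesis using \<epsilon>(5) by linarith
    qed
    moreover have "(qv.nrm y')\<^sup>2 \<le> (qv.nrm y)\<^sup>2 / 2 + C * \<delta>\<^sup>2"
    proof -
      have sqs: "(qv.nrm r1)\<^sup>2 \<le> \<delta>\<^sup>2" "(qv.nrm r2)\<^sup>2 \<le> \<delta>\<^sup>2" "(ip.nrm r2)\<^sup>2 \<le> \<delta>\<^sup>2" "(ip.nrm y)\<^sup>2 \<le> \<delta>\<^sup>2" "(ip.nrm r1)\<^sup>2 \<le> \<delta>\<^sup>2"
        using r V Y \<epsilon> y by (auto intro!: power_mono simp: Y_def)
      have x1: "(ip.nrm (y + r1))\<^sup>2 \<le> 4 * \<delta>\<^sup>2" "(qv.nrm (y + r1))\<^sup>2 \<le> 2 * (qv.nrm y)\<^sup>2 + 2 * \<delta>\<^sup>2"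
        using ip.nrm_sq_add_le[OF y V(3)] qv.nrm_sq_add_le[OF y V(3)] sqs by auto
      have w1n: "(ip.nrm w1)\<^sup>2 \<le> 4 / \<beta>\<^sup>2 * \<delta>\<^sup>2"
      proof -
        have "(\<beta> * ip.nrm w1)\<^sup>2 \<le> (ip.nrm (y + r1))\<^sup>2"
          using resolvent_bounds(1)[OF V(1), of \<beta>] \<beta> R V by (intro power_mono) auto
        then have "\<beta>\<^sup>2 * (ip.nrm w1)\<^sup>2 \<le> 4 * \<delta>\<^sup>2" using x1(1) by (simp add: power_mult_distrib)
        then show ?thesis using \<beta> by (simp add: field_simps)
      qed
      have A1: "(qv.nrm w1)\<^sup>2 \<le> 2 * \<theta> * (qv.nrm y)\<^sup>2 + (2 * \<theta> + 4 * K) * \<delta>\<^sup>2"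
      proof -
        have "(qv.nrm w1)\<^sup>2 \<le> \<theta> * (qv.nrm (y + r1))\<^sup>2 + K * (ip.nrm (y + r1))\<^sup>2"
          using K(2)[OF V(1)] R by simp
        also have "\<dots> \<le> \<theta> * (2 * (qv.nrm y)\<^sup>2 + 2 * \<delta>\<^sup>2) + K * (4 * \<delta>\<^sup>2)"
          using x1 \<theta> K by (intro add_mono mult_left_mono) auto
        finally show ?thesis by (simp add: algebra_simps)
      qed
      have A2: "(qv.nrm w2)\<^sup>2 \<le> 2 * (qv.nrm w1)\<^sup>2 + (\<theta> * 2 + K * (2 * (4 / \<beta>\<^sup>2) + 2)) * \<delta>\<^sup>2"
      proof -
        have "(qv.nrm w2)\<^sup>2 \<le> \<theta> * (qv.nrm (w1 + r2))\<^sup>2 + K * (ip.nrm (w1 + r2))\<^sup>2"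
          using K(2)[OF V(2)] R by simp
        also have "\<dots> \<le> \<theta> * (2 * (qv.nrm w1)\<^sup>2 + 2 * \<delta>\<^sup>2) + K * (2 * (4 / \<beta>\<^sup>2 * \<delta>\<^sup>2) + 2 * \<delta>\<^sup>2)"
        proof (intro add_mono mult_left_mono)
          show "(qv.nrm (w1 + r2))\<^sup>2 \<le> 2 * (qv.nrm w1)\<^sup>2 + 2 * \<delta>\<^sup>2"
            using qv.nrm_sq_add_le[OF V(1,4)] sqs by linarith
          show "(ip.nrm (w1 + r2))\<^sup>2 \<le> 2 * (4 / \<beta>\<^sup>2 * \<delta>\<^sup>2) + 2 * \<delta>\<^sup>2"
            using ip.nrm_sq_add_le[OF V(1,4)] sqs w1n by linarith
        qed (use \<theta> K in auto)
        also have "\<theta> * (2 * (qv.nrm w1)\<^sup>2 + 2 * \<delta>\<^sup>2) \<le> 2 * (qv.nrm w1)\<^sup>2 + \<theta> * 2 * \<delta>\<^sup>2"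
          using mult_right_mono[OF \<theta>(2), of "2 * (qv.nrm w1)\<^sup>2"] by (simp add: algebra_simps)
        finally show ?thesis by (simp add: algebra_simps)
      qed
      have A2': "(qv.nrm w2)\<^sup>2 \<le> 4 * \<theta> * (qv.nrm y)\<^sup>2 + C1 * \<delta>\<^sup>2"
        using A1 A2 by (simp add: C1_def algebra_simps)
      have A1': "(qv.nrm w1)\<^sup>2 \<le> 4 * \<theta> * (qv.nrm y)\<^sup>2 + C1 * \<delta>\<^sup>2"
      proof -
        have "2 * \<theta> * (qv.nrm y)\<^sup>2 \<le> 4 * \<theta> * (qv.nrm y)\<^sup>2" using \<theta> by (intro mult_right_mono) auto
        moreover have "(2 * \<theta> + 4 * K) * \<delta>\<^sup>2 \<le> C1 * \<delta>\<^sup>2"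
          using \<theta> K by (intro mult_right_mono) (auto simp: C1_def)
        ultimately show ?thesis using A1 by linarith
      qed
      have "(qv.nrm ((2 * b) *\<^sub>R w1 - (b\<^sup>2) *\<^sub>R w2))\<^sup>2 \<le> 2 * (qv.nrm ((2 * b) *\<^sub>R w1))\<^sup>2 + 2 * (qv.nrm ((b\<^sup>2) *\<^sub>R w2))\<^sup>2"
        using qv.nrm_sq_add_le[of "(2 * b) *\<^sub>R w1" "- ((b\<^sup>2) *\<^sub>R w2)"] V by (simp add: qv.nrm_minus)
      also have "\<dots> = 8 * b\<^sup>2 * (qv.nrm w1)\<^sup>2 + 2 * b ^ 4 * (qv.nrm w2)\<^sup>2"
        using V by (simp add: qv.nrm_scale power_mult_distrib power4_eq_xxxx power2_eq_square)
      also have "\<dots> \<le> 8 * b\<^sup>2 * (4 * \<theta> * (qv.nrm y)\<^sup>2 + C1 * \<delta>\<^sup>2) + 2 * b ^ 4 * (4 * \<theta> * (qv.nrm y)\<^sup>2 + C1 * \<delta>\<^sup>2)"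
        using A1' A2' b0 by (intro add_mono mult_left_mono) auto
      also have "\<dots> = (8 * b\<^sup>2 + 2 * b ^ 4) * (4 * \<theta> * (qv.nrm y)\<^sup>2 + C1 * \<delta>\<^sup>2)"
        by (simp add: algebra_simps)
      also have "\<dots> \<le> m / 2 * (4 * \<theta> * (qv.nrm y)\<^sup>2 + C1 * \<delta>\<^sup>2)"
        using b0 \<theta> C1 by (intro mult_right_mono) (auto simp: m_def)
      finally have B: "(qv.nrm ((2 * b) *\<^sub>R w1 - (b\<^sup>2) *\<^sub>R w2))\<^sup>2 \<le> m / 2 * (4 * \<theta> * (qv.nrm y)\<^sup>2 + C1 * \<delta>\<^sup>2)" .
      have D: "(qv.nrm (b *\<^sub>R r2 - r1))\<^sup>2 \<le> 2 * \<delta>\<^sup>2 + 2 * b\<^sup>2 * \<delta>\<^sup>2"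
      proof -
        have "(qv.nrm (b *\<^sub>R r2 - r1))\<^sup>2 \<le> 2 * (qv.nrm (b *\<^sub>R r2))\<^sup>2 + 2 * (qv.nrm r1)\<^sup>2"
          using qv.nrm_sq_add_le[of "b *\<^sub>R r2" "- r1"] V by (simp add: qv.nrm_minus)
        also have "\<dots> = 2 * b\<^sup>2 * (qv.nrm r2)\<^sup>2 + 2 * (qv.nrm r1)\<^sup>2" using V by (simp add: qv.nrm_scale power_mult_distrib)
        also have "\<dots> \<le> 2 * b\<^sup>2 * \<delta>\<^sup>2 + 2 * \<delta>\<^sup>2" using sqs by (intro add_mono mult_left_mono) auto
        finally show ?thesis by simp
      qed
      have "(qv.nrm y')\<^sup>2 \<le> 2 * (qv.nrm ((2 * b) *\<^sub>R w1 - (b\<^sup>2) *\<^sub>R w2))\<^sup>2 + 2 * (qv.nrm (b *\<^sub>R r2 - r1))\<^sup>2"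
        unfolding y'_eq using V by (intro qv.nrm_sq_add_le) auto
      also have "\<dots> \<le> 2 * (m / 2 * (4 * \<theta> * (qv.nrm y)\<^sup>2 + C1 * \<delta>\<^sup>2)) + 2 * (2 * \<delta>\<^sup>2 + 2 * b\<^sup>2 * \<delta>\<^sup>2)"
        by (intro add_mono mult_left_mono B D) auto
      also have "\<dots> = (8 * m * \<theta>) * ((qv.nrm y)\<^sup>2 / 2) + (m * C1 + 4 + 4 * b\<^sup>2) * \<delta>\<^sup>2" by (simp add: algebra_simps)
      also have "\<dots> \<le> 1 * ((qv.nrm y)\<^sup>2 / 2) + C * \<delta>\<^sup>2"
        using \<theta> C1 m0 by (intro add_mono mult_right_mono) (auto simp: C_def)
      finally show ?thesis by simp
    qed
    ultimately show ?thesis using f' unfolding y'_def y_def by blast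
  qed
  with C show ?thesis by blast
qed

text \<open>Let \<open>M\<close> be the norm of \<open>E\<close> and \<open>g\<close> a near
  maximizer on the unit ball. As \<open>E\<close> is an eigenfunctional, the approximation
  \<open>z\<close> of (2 T - T^2) g has almost the same value of \<open>E\<close> and a norm that is
  hardly larger, so \<open>g + z\<close> has norm almost 2 and the parallelogram law makes
  \<open>g - z\<close> small. By the last inequality of \<open>two_resolvents\<close>, (1 - T) g is
  small as well, and this is, up to sign and a residual, the eigenvalue defect of the approximate
  resolvent \<open>w1\<close> of \<open>g\<close>.\<close>

lemma almost_eigenvector:
  assumes \<beta>: "0 < \<beta>" "\<bar>ev\<bar> < \<beta>"
    and dens: "\<forall>g\<in>V. \<forall>e>0. \<exists>u\<in>V.
      ip.nrm (\<beta> *\<^sub>R u - L u - g) \<le> e \<and> qv.nrm (\<beta> *\<^sub>R u - L u - g) \<le> e"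
  shows "\<exists>a>0. \<forall>\<delta>>0. \<exists>f\<in>V. a < E f \<and> ip.nrm (L f - ev *\<^sub>R f) < \<delta>"
proof -
  define b where "b = \<beta> - ev"
  have b0: "0 < b" using b_def \<beta> by auto
  obtain Ke where Ke: "\<And>u. u \<in> V \<Longrightarrow> \<bar>E u\<bar> \<le> Ke * ip.nrm u" using E_bounded by blast
  obtain u0 where u0: "u0 \<in> V" "E u0 \<noteq> 0" using E_nonzero by blast
  define U where "U = {u \<in> V. ip.nrm u \<le> 1}"
  define M where "M = Sup (E ` U)"
  have "E u \<le> max Ke 0" if "u \<in> U" for u
  proof -
    have "E u \<le> Ke * ip.nrm u" using Ke[of u] that by (auto simp: U_def)
    also have "\<dots> \<le> max Ke 0 * 1" using that by (intro mult_mono) (auto simp: U_def)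
    finally show ?thesis by simp
  qed
  then have bdd: "bdd_above (E ` U)" by (auto simp: bdd_above_def)
  have M_upper: "E u \<le> M" if "u \<in> U" for u
    unfolding M_def using that bdd by (intro cSup_upper) auto
  have n0: "0 < ip.nrm u0"
  proof (rule ccontr)
    assume "\<not> 0 < ip.nrm u0"
    then have "ip.nrm u0 = 0" using u0 ip.nrm_nonneg[of u0] by linarith
    then show False using Ke[OF u0(1)] u0(2) by simp
  qed
  have M0: "0 < M"
  proof -
    define v where "v = (sgn (E u0) / ip.nrm u0) *\<^sub>R u0"
    have "v \<in> U" using u0 n0 by (simp add: U_def v_def ip.nrm_scale abs_sgn_eq)
    moreover have "E v = \<bar>E u0\<bar> / ip.nrm u0" using u0 by (simp add: v_def E_scale abs_sgn mult.commute)
    ultimately show ?thesis using M_upper[of v] n0 u0 by (smt (verit) divide_pos_pos)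
  qed
  have E_le: "E u \<le> M * ip.nrm u" if "u \<in> V" for u
  proof (cases "ip.nrm u = 0")
    case True then show ?thesis using Ke[OF that] by simp
  next
    case False
    then have p: "0 < ip.nrm u" using ip.nrm_nonneg[OF that] by linarith
    have "(1 / ip.nrm u) *\<^sub>R u \<in> U" using that p by (simp add: U_def ip.nrm_scale)
    from M_upper[OF this] show ?thesis using that p by (simp add: E_scale field_simps)
  qed
  show ?thesis
  proof (intro exI[of _ "M / (4 * b)"] conjI allI impI)
    show "0 < M / (4 * b)" using M0 b0 by simp
    fix \<delta> :: real assume \<delta>: "0 < \<delta>"
    \<comment> \<open>\<open>G \<eta>\<close> will bound the squared norm of
      \<open>g - b *\<^sub>R w1\<close>. It tends to 0 with \<eta> because 2 + 2 - 2^2 = 0.\<close>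
    define G where "G = (\<lambda>\<eta>. 1 * sqrt (2 + 2 * (1 + \<eta>) - (2 - 3 * \<eta> / M)\<^sup>2) + \<eta>)"
    have "\<exists>\<eta>>0. \<eta> \<le> 1 \<and> 3 * \<eta> < M \<and> sqrt (G \<eta>) + \<eta> < \<delta>"
    proof -
      have "((\<lambda>\<eta>. sqrt (G \<eta>) + \<eta>) \<longlongrightarrow> sqrt (1 * sqrt (2 + 2 * (1 + 0) - (2 - 3 * 0 / M)\<^sup>2) + 0) + 0) (at_right 0)"
        unfolding G_def using M0 by (intro tendsto_intros) auto
      then have "((\<lambda>\<eta>. sqrt (G \<eta>) + \<eta>) \<longlongrightarrow> 0) (at_right 0)" by simp
      then have "\<forall>\<^sub>F \<eta> in at_right 0. sqrt (G \<eta>) + \<eta> < \<delta>" using \<delta> by (rule order_tendstoD)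
      moreover have "\<forall>\<^sub>F \<eta> in at_right 0. \<eta> \<in> {0<..<min 1 (M / 3)}" using M0 by (intro eventually_at_right_real) auto
      ultimately have "\<forall>\<^sub>F \<eta> in at_right 0. 0 < \<eta> \<and> \<eta> \<le> 1 \<and> 3 * \<eta> < M \<and> sqrt (G \<eta>) + \<eta> < \<delta>"
        by eventually_elim auto
      then show ?thesis by (rule eventually_happens'[rotated]) simp
    qed
    then obtain \<eta> where \<eta>: "0 < \<eta>" "\<eta> \<le> 1" "3 * \<eta> < M" "sqrt (G \<eta>) + \<eta> < \<delta>"
      by blast
    have "\<exists>g\<in>U. M - \<eta> < E g"
    proof -
      have "0 \<in> U" using ip.nrm_scale[of 0 0] by (simp add: U_def)
      then have "E ` U \<noteq> {}" by blast
      then have "\<exists>x\<in>E ` U. M - \<eta> < x" unfolding M_def using bdd \<eta> by (subst less_cSup_iff[symmetric]) auto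
      then show ?thesis by auto
    qed
    then obtain g where g: "g \<in> V" "ip.nrm g \<le> 1" "M - \<eta> < E g" by (auto simp: U_def)
    obtain J where J: "0 \<le> J" "\<And>\<epsilon>. 0 < \<epsilon> \<Longrightarrow> \<epsilon> \<le> 1 \<Longrightarrow> (\<exists>w1\<in>V. \<exists>w2\<in>V. \<exists>r1\<in>V. \<exists>r2\<in>V.
     \<beta> *\<^sub>R w1 - L w1 = g + r1 \<and> \<beta> *\<^sub>R w2 - L w2 = w1 + r2 \<and>
     ip.nrm r1 \<le> \<epsilon> \<and> ip.nrm r2 \<le> \<epsilon> \<and> qv.nrm r1 \<le> \<epsilon> \<and> qv.nrm r2 \<le> \<epsilon> \<and>
     (ip.nrm ((2 * b) *\<^sub>R w1 - (b\<^sup>2) *\<^sub>R w2))\<^sup>2 \<le> (ip.nrm g)\<^sup>2 + J * \<epsilon> \<and>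
     (ip.nrm (g - b *\<^sub>R w1))\<^sup>2 \<le> ip.nrm g * ip.nrm (g - ((2 * b) *\<^sub>R w1 - (b\<^sup>2) *\<^sub>R w2)) + J * \<epsilon>)"
      using two_resolvents[OF g(1) \<beta> dens b_def] by blast
    \<comment> \<open>The summands of the denominator keep \<epsilon>, J \<epsilon> and the errors
      in the values of \<open>E\<close> below \<eta>.\<close>
    define \<epsilon> where "\<epsilon> = \<eta> / (1 + J + 2 * \<bar>Ke\<bar> + b * \<bar>Ke\<bar>)"
    have den: "1 + J + 2 * \<bar>Ke\<bar> + b * \<bar>Ke\<bar> \<ge> 1" using J b0 by simp
    have \<epsilon>: "0 < \<epsilon>" "\<epsilon> \<le> \<eta>" "J * \<epsilon> \<le> \<eta>" "(2 * \<bar>Ke\<bar> + b * \<bar>Ke\<bar>) * \<epsilon> \<le> \<eta>"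
    proof -
      have "(1 + J + 2 * \<bar>Ke\<bar> + b * \<bar>Ke\<bar>) * \<epsilon> = \<eta>" using den by (simp add: \<epsilon>_def)
      moreover show "0 < \<epsilon>" using den \<eta> by (simp add: \<epsilon>_def)
      moreover from this have "0 \<le> J * \<epsilon>" "0 \<le> (2 * \<bar>Ke\<bar> + b * \<bar>Ke\<bar>) * \<epsilon>" using J b0 by auto
      ultimately show "\<epsilon> \<le> \<eta>" "J * \<epsilon> \<le> \<eta>" "(2 * \<bar>Ke\<bar> + b * \<bar>Ke\<bar>) * \<epsilon> \<le> \<eta>"
        by (simp_all add: algebra_simps)
    qed
    obtain w1 w2 r1 r2 where V: "w1 \<in> V" "w2 \<in> V" "r1 \<in> V" "r2 \<in> V"
      and R: "\<beta> *\<^sub>R w1 - L w1 = g + r1" "\<beta> *\<^sub>R w2 - L w2 = w1 + r2"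
      and r: "ip.nrm r1 \<le> \<epsilon>" "ip.nrm r2 \<le> \<epsilon>"
      and z: "(ip.nrm ((2 * b) *\<^sub>R w1 - (b\<^sup>2) *\<^sub>R w2))\<^sup>2 \<le> (ip.nrm g)\<^sup>2 + J * \<epsilon>"
      and s: "(ip.nrm (g - b *\<^sub>R w1))\<^sup>2 \<le> ip.nrm g * ip.nrm (g - ((2 * b) *\<^sub>R w1 - (b\<^sup>2) *\<^sub>R w2)) + J * \<epsilon>"
      using J(2)[OF \<epsilon>(1) order_trans[OF \<epsilon>(2) \<eta>(2)]] by blast
    define z where "z = (2 * b) *\<^sub>R w1 - (b\<^sup>2) *\<^sub>R w2"
    have zV: "z \<in> V" using V by (simp add: z_def)
    have Er: "\<bar>E r1\<bar> \<le> \<bar>Ke\<bar> * \<epsilon>" "\<bar>E r2\<bar> \<le> \<bar>Ke\<bar> * \<epsilon>"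
    proof -
      have "\<bar>E r\<bar> \<le> \<bar>Ke\<bar> * \<epsilon>" if "r \<in> V" "ip.nrm r \<le> \<epsilon>" for r
      proof -
        have "\<bar>E r\<bar> \<le> Ke * ip.nrm r" by (rule Ke[OF that(1)])
        also have "\<dots> \<le> \<bar>Ke\<bar> * \<epsilon>" using that by (intro mult_mono) auto
        finally show ?thesis .
      qed
      then show "\<bar>E r1\<bar> \<le> \<bar>Ke\<bar> * \<epsilon>" "\<bar>E r2\<bar> \<le> \<bar>Ke\<bar> * \<epsilon>" using V r by auto
    qed
    have Ew: "b * E w1 = E g + E r1" "b * E w2 = E w1 + E r2"
    proof -
      have "E (\<beta> *\<^sub>R w - L w) = b * E w" if "w \<in> V" for w
        using that E_eigen[OF that] by (simp add: E_diff E_scale b_def algebra_simps)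
      then show "b * E w1 = E g + E r1" "b * E w2 = E w1 + E r2"
        using V R g by (metis E_add)+
    qed
    have "E z = 2 * (b * E w1) - b * (b * E w2)"
      using V by (simp add: z_def E_diff E_scale power2_eq_square)
    also have "\<dots> = E g + E r1 - b * E r2" unfolding Ew(2) by (simp add: Ew(1) algebra_simps)
    finally have Ez: "E z = E g + E r1 - b * E r2" .
    \<comment> \<open>Each of the two values of \<open>E\<close> inherits one \<eta> from the near
      maximality of \<open>g\<close>; the third one is lost in passing from \<open>g\<close> to
      \<open>z\<close>.\<close>
    have "2 * M - 3 * \<eta> \<le> M * ip.nrm (g + z)"
    proof -
      have "E g - \<eta> \<le> E z"
      proof -
        have "\<bar>b * E r2\<bar> \<le> b * (\<bar>Ke\<bar> * \<epsilon>)" using Er b0 by (simp add: abs_mult)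
        then show ?thesis using Er(1) \<epsilon>(4) \<epsilon>(1) mult_nonneg_nonneg[of "\<bar>Ke\<bar>" \<epsilon>] Ez by (simp add: algebra_simps)
      qed
      then have "2 * M - 3 * \<eta> \<le> E (g + z)" using g zV by (simp add: E_add)
      also have "\<dots> \<le> M * ip.nrm (g + z)" using g zV by (intro E_le) auto
      finally show ?thesis .
    qed
    then have gz: "2 - 3 * \<eta> / M \<le> ip.nrm (g + z)" using M0 by (simp add: field_simps)
    have gz0: "0 \<le> 2 - 3 * \<eta> / M" using \<eta> M0 by (simp add: field_simps)
    have gn: "(ip.nrm g)\<^sup>2 \<le> 1" using g ip.nrm_nonneg[OF g(1)] by (simp add: power_le_one)
    have "(ip.nrm (g - z))\<^sup>2 = 2 * (ip.nrm g)\<^sup>2 + 2 * (ip.nrm z)\<^sup>2 - (ip.nrm (g + z))\<^sup>2"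
      using g zV by (simp add: ip.nrm_sq ip.bilin)
    also have "\<dots> \<le> 2 + 2 * (1 + \<eta>) - (2 - 3 * \<eta> / M)\<^sup>2"
    proof -
      have "(2 - 3 * \<eta> / M)\<^sup>2 \<le> (ip.nrm (g + z))\<^sup>2" using gz gz0 by (intro power_mono) auto
      moreover have "(ip.nrm z)\<^sup>2 \<le> 1 + \<eta>" using z gn \<epsilon>(3) unfolding z_def by linarith
      ultimately have "2 * (ip.nrm g)\<^sup>2 + 2 * (ip.nrm z)\<^sup>2 - (ip.nrm (g + z))\<^sup>2
          \<le> 2 * 1 + 2 * (1 + \<eta>) - (2 - 3 * \<eta> / M)\<^sup>2"
        using gn by (intro diff_mono add_mono mult_left_mono) auto
      then show ?thesis by simp
    qed
    finally have gmz: "ip.nrm (g - z) \<le> sqrt (2 + 2 * (1 + \<eta>) - (2 - 3 * \<eta> / M)\<^sup>2)"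
      by (rule real_le_rsqrt)
    have "(ip.nrm (g - b *\<^sub>R w1))\<^sup>2 \<le> G \<eta>"
    proof -
      have "ip.nrm g * ip.nrm (g - z) \<le> 1 * sqrt (2 + 2 * (1 + \<eta>) - (2 - 3 * \<eta> / M)\<^sup>2)"
        using g gmz zV by (intro mult_mono) auto
      then show ?thesis using s \<epsilon>(3) unfolding z_def G_def by linarith
    qed
    then have s1: "ip.nrm (g - b *\<^sub>R w1) \<le> sqrt (G \<eta>)" by (rule real_le_rsqrt)
    show "\<exists>f\<in>V. M / (4 * b) < E f \<and> ip.nrm (L f - ev *\<^sub>R f) < \<delta>"
    proof (intro bexI[OF _ V(1)] conjI)
      have "\<bar>Ke\<bar> * \<epsilon> \<le> \<eta>"
      proof -
        have "0 \<le> \<bar>Ke\<bar> * \<epsilon>" "0 \<le> b * (\<bar>Ke\<bar> * \<epsilon>)" using \<epsilon> b0 by auto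
        then show ?thesis using \<epsilon>(4) by (simp add: algebra_simps)
      qed
      then have "M / 4 < b * E w1" using Ew(1) g(3) Er(1) \<eta>(3) by linarith
      then show "M / (4 * b) < E w1" using b0 by (simp add: field_simps)
      have "L w1 - ev *\<^sub>R w1 = - (g - b *\<^sub>R w1) - r1"
      proof -
        have "L w1 = \<beta> *\<^sub>R w1 - g - r1" using R(1) by (simp add: algebra_simps)
        then show ?thesis by (simp add: b_def algebra_simps)
      qed
      then have "ip.nrm (L w1 - ev *\<^sub>R w1) \<le> ip.nrm (g - b *\<^sub>R w1) + ip.nrm r1"
        using ip.nrm_triangle_diff[of "- (g - b *\<^sub>R w1)" r1] g V by (simp only: ip.nrm_minus ip.closed)
      also have "\<dots> \<le> sqrt (G \<eta>) + \<eta>" using s1 r \<epsilon> by (intro add_mono) auto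
      finally show "ip.nrm (L w1 - ev *\<^sub>R w1) < \<delta>" using \<eta>(4) by linarith
    qed
  qed
qed

text \<open>In place of an iteration, \<open>eigenvalue_defect_halving\<close> is applied once, to
  an \<open>f\<close> whose defect \<open>N f\<close> is within \<delta>^2 of the infimum
  \<open>k\<close>: the relations k \<le> N f / 2 + C \<delta>^2 and N f < k + \<delta>^2 give the
  constant 2 C + 2. This works because \<open>a\<close> and \<open>C\<close> are fixed before
  \<delta> and \<open>f\<close>.\<close>

lemma almost_eigenvector_small_form:
  "\<exists>a>0. \<exists>C\<ge>0. \<forall>\<delta>>0. \<exists>f\<in>V. a < E f \<and> ip.nrm (L f - ev *\<^sub>R f) < \<delta> \<and>
     (qv.nrm (L f - ev *\<^sub>R f))\<^sup>2 \<le> C * \<delta>\<^sup>2"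
proof -
  obtain \<beta>0 where \<beta>0: "\<And>\<beta>. \<beta>0 \<le> \<beta> \<Longrightarrow> \<forall>g\<in>V. \<forall>e>0. \<exists>u\<in>V.
      ip.nrm (\<beta> *\<^sub>R u - L u - g) \<le> e \<and> qv.nrm (\<beta> *\<^sub>R u - L u - g) \<le> e"
    using dense by blast
  define \<beta> where "\<beta> = max \<beta>0 (\<bar>ev\<bar> + 1)"
  have \<beta>: "0 < \<beta>" "\<bar>ev\<bar> < \<beta>" "\<beta>0 \<le> \<beta>" by (auto simp: \<beta>_def)
  obtain a where a: "0 < a" "\<And>\<delta>. 0 < \<delta> \<Longrightarrow> \<exists>f\<in>V. a < E f \<and> ip.nrm (L f - ev *\<^sub>R f) < \<delta>"
    using almost_eigenvector[OF \<beta>(1,2) \<beta>0[OF \<beta>(3)]] by blast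
  obtain C where C: "0 \<le> C" "\<And>\<delta> f. 0 < \<delta> \<Longrightarrow> f \<in> V \<Longrightarrow> a < E f \<Longrightarrow> ip.nrm (L f - ev *\<^sub>R f) < \<delta> \<Longrightarrow>
    (\<exists>f'\<in>V. a < E f' \<and> ip.nrm (L f' - ev *\<^sub>R f') < \<delta> \<and>
      (qv.nrm (L f' - ev *\<^sub>R f'))\<^sup>2 \<le> (qv.nrm (L f - ev *\<^sub>R f))\<^sup>2 / 2 + C * \<delta>\<^sup>2)"
    using eigenvalue_defect_halving[OF \<beta>(1,2) \<beta>0[OF \<beta>(3)], of a] by blast
  have "\<exists>f\<in>V. a < E f \<and> ip.nrm (L f - ev *\<^sub>R f) < \<delta> \<and>
     (qv.nrm (L f - ev *\<^sub>R f))\<^sup>2 \<le> (2 * C + 2) * \<delta>\<^sup>2" if \<delta>: "0 < \<delta>" for \<delta>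
  proof -
    define F where "F = {f \<in> V. a < E f \<and> ip.nrm (L f - ev *\<^sub>R f) < \<delta>}"
    define N where "N = (\<lambda>f. (qv.nrm (L f - ev *\<^sub>R f))\<^sup>2)"
    define k where "k = Inf (N ` F)"
    have ne: "N ` F \<noteq> {}" using a(2)[OF \<delta>] by (auto simp: F_def)
    have bdd: "bdd_below (N ` F)" by (rule bdd_belowI[of _ 0]) (auto simp: N_def)
    have "\<exists>x\<in>N ` F. x < k + \<delta>\<^sup>2" unfolding k_def using \<delta> ne bdd by (subst cInf_less_iff[symmetric]) auto
    then obtain f where f: "f \<in> F" "N f < k + \<delta>\<^sup>2" by auto
    obtain f' where f': "f' \<in> F" "N f' \<le> N f / 2 + C * \<delta>\<^sup>2"
      using C(2)[OF \<delta>, of f] f(1) by (auto simp: F_def N_def)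
    have "k \<le> N f'" unfolding k_def using f' bdd by (intro cInf_lower) auto
    then have "N f \<le> (2 * C + 2) * \<delta>\<^sup>2" using f' f(2) by (simp add: algebra_simps)
    then show ?thesis using f(1) by (auto simp: F_def N_def)
  qed
  moreover have "0 \<le> 2 * C + 2" using C by simp
  ultimately show ?thesis using a(1) by blast
qed

text \<open>The lower bound \<open>a\<close> on \<open>E f\<close> keeps the norm of
  \<open>f\<close> away from 0, so the approximate eigenfunctions can be normalized. Inserting them
  into \<open>CD\<close> and letting \<delta> tend to 0 gives A \<mu> \<le> (1 - c) \<mu>^2; after
  division by \<mu> > 0, \<eta> tends to 0.\<close>

theorem eigenvalue_bound:
  "\<rho>1 - max 0 (- \<rho>21) / \<rho>20 \<le> (1 - c + 1 / \<rho>20) * (- ev)"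
proof -
  define \<mu> where "\<mu> = - ev"
  obtain a C where a: "0 < a" "0 \<le> C" and ex: "\<And>\<delta>. 0 < \<delta> \<Longrightarrow> \<exists>f\<in>V. a < E f \<and> ip.nrm (L f - ev *\<^sub>R f) < \<delta> \<and>
     (qv.nrm (L f - ev *\<^sub>R f))\<^sup>2 \<le> C * \<delta>\<^sup>2"
    using almost_eigenvector_small_form by blast
  obtain Ke where Ke: "0 < Ke" "\<And>u. u \<in> V \<Longrightarrow> E u \<le> Ke * ip.nrm u"
  proof -
    obtain K where K: "\<And>u. u \<in> V \<Longrightarrow> \<bar>E u\<bar> \<le> K * ip.nrm u" using E_bounded by blast
    have "E u \<le> (\<bar>K\<bar> + 1) * ip.nrm u" if "u \<in> V" for u
      using K[OF that] ip.nrm_nonneg[OF that] mult_right_mono[of K "\<bar>K\<bar> + 1" "ip.nrm u"] by linarith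
    then show ?thesis by (intro that[of "\<bar>K\<bar> + 1"]) auto
  qed
  define \<gamma> where "\<gamma> = a / Ke"
  have \<gamma>: "0 < \<gamma>" using a Ke by (simp add: \<gamma>_def)
  have approx: "\<exists>f\<in>V. ip.nrm f = 1 \<and> ip.nrm (L f - ev *\<^sub>R f) \<le> \<delta> \<and> (qv.nrm (L f - ev *\<^sub>R f))\<^sup>2 \<le> C * \<delta>\<^sup>2"
    if \<delta>: "0 < \<delta>" for \<delta>
  proof -
    obtain f where f: "f \<in> V" "a < E f" "ip.nrm (L f - ev *\<^sub>R f) < \<delta> * \<gamma>"
      "(qv.nrm (L f - ev *\<^sub>R f))\<^sup>2 \<le> C * (\<delta> * \<gamma>)\<^sup>2"
      using ex[of "\<delta> * \<gamma>"] \<delta> \<gamma> by auto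
    define n where "n = ip.nrm f"
    have n: "\<gamma> < n" using f(2) Ke(1) Ke(2)[OF f(1)] by (simp add: \<gamma>_def n_def field_simps)
    then have n0: "0 < n" using \<gamma> by linarith
    have eq: "L ((1 / n) *\<^sub>R f) - ev *\<^sub>R ((1 / n) *\<^sub>R f) = (1 / n) *\<^sub>R (L f - ev *\<^sub>R f)"
      using f by (simp add: L_scale scaleR_diff_right mult.commute)
    show ?thesis
    proof (intro bexI[of _ "(1 / n) *\<^sub>R f"] conjI)
      show "ip.nrm ((1 / n) *\<^sub>R f) = 1" using f n0 by (simp add: ip.nrm_scale n_def)
      have "\<delta> * \<gamma> \<le> \<delta> * n" using \<delta> n by simp
      then show "ip.nrm (L ((1 / n) *\<^sub>R f) - ev *\<^sub>R ((1 / n) *\<^sub>R f)) \<le> \<delta>"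
        unfolding eq using f n0 by (simp add: ip.nrm_scale pos_divide_le_eq)
      have "C * (\<delta> * \<gamma>)\<^sup>2 \<le> C * (\<delta> * n)\<^sup>2"
        using \<delta> n \<gamma> a by (intro mult_left_mono power_mono) auto
      then have "(qv.nrm (L f - ev *\<^sub>R f))\<^sup>2 \<le> C * (\<delta> * n)\<^sup>2" using f(4) by linarith
      then show "(qv.nrm (L ((1 / n) *\<^sub>R f) - ev *\<^sub>R ((1 / n) *\<^sub>R f)))\<^sup>2 \<le> C * \<delta>\<^sup>2"
        unfolding eq using f n0 by (simp add: qv.nrm_scale power_mult_distrib power_divide pos_divide_le_eq mult.assoc)
    qed (use f in auto)
  qed
  have Qh: "\<bar>- ip f (L f) - \<mu>\<bar> \<le> \<delta>" if f: "f \<in> V" "ip.nrm f = 1" "ip.nrm (L f - ev *\<^sub>R f) \<le> \<delta>" for f \<delta>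
  proof -
    have "ip f (L f - ev *\<^sub>R f) = ip f (L f) + \<mu>"
      using f ip.nrm_sq[OF f(1)] by (simp add: ip.bilin \<mu>_def)
    moreover have "\<bar>ip f (L f - ev *\<^sub>R f)\<bar> \<le> 1 * \<delta>"
      using ip.cauchy_schwarz[of f "L f - ev *\<^sub>R f"] f by simp
    ultimately show ?thesis by (simp add: abs_if split: if_splits)
  qed
  \<comment> \<open>The nonnegative number \<open>- ip f (L f)\<close> differs from \<mu> by at most
    \<delta> for a normalized \<open>f\<close> with defect \<delta>.\<close>
  have \<mu>0: "0 < \<mu>"
  proof (rule ccontr)
    assume "\<not> 0 < \<mu>"
    then have "\<mu> < 0" using ev by (simp add: \<mu>_def)
    then have "0 < - \<mu> / 2" by simp
    from approx[OF this] obtain f where f: "f \<in> V" "ip.nrm f = 1" "ip.nrm (L f - ev *\<^sub>R f) \<le> - \<mu> / 2" by blast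
    from Qh[OF f] L_neg[OF f(1)] \<open>\<mu> < 0\<close> show False by linarith
  qed
  define k2 where "k2 = max 0 (- \<rho>21)"
  have k2: "0 \<le> k2" "- \<rho>21 \<le> k2" by (auto simp: k2_def)
  have main: "\<rho>1 - (\<mu> + k2 + \<eta>) / \<rho>20 \<le> (1 - c) * \<mu>" if \<eta>: "0 < \<eta>" for \<eta>
  proof -
    \<comment> \<open>By - \<rho>21 \<le> \<open>k2\<close> this is small enough for the coefficient
      \<rho>20 + \<rho>21 l of \<open>qv f f\<close> to dominate l (\<mu> + \<eta>). There l \<mu>
      stems from \<open>- l * qv f (L f)\<close> and l \<eta> from the error
      \<open>q2\<close>.\<close>
    define l where "l = \<rho>20 / (\<mu> + k2 + \<eta>)"
    have den: "0 < \<mu> + k2 + \<eta>" using \<mu>0 k2 \<eta> by linarith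
    have l: "0 < l" "1 / l = (\<mu> + k2 + \<eta>) / \<rho>20" using den rho20 by (auto simp: l_def)
    have l_eq: "l * (\<mu> + k2 + \<eta>) = \<rho>20" using den by (simp add: l_def)
    define A where "A = \<rho>1 - 1 / l"
    have step: "A * \<mu> \<le> (1 - c) * (\<mu> + \<delta>)\<^sup>2 + \<bar>A\<bar> * \<delta> + l * (C * \<delta>\<^sup>2) / \<eta>" if \<delta>: "0 < \<delta>" for \<delta>
    proof -
      obtain f where f: "f \<in> V" "ip.nrm f = 1" "ip.nrm (L f - ev *\<^sub>R f) \<le> \<delta>"
        "(qv.nrm (L f - ev *\<^sub>R f))\<^sup>2 \<le> C * \<delta>\<^sup>2"
        using approx[OF \<delta>] by blast
      define y where "y = L f - ev *\<^sub>R f"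
      have y: "y \<in> V" using f by (simp add: y_def)
      have Lf: "L f = y - \<mu> *\<^sub>R f" by (simp add: y_def \<mu>_def)
      have "ip.nrm (L f) \<le> \<mu> + \<delta>"
        unfolding Lf using ip.nrm_triangle_diff[of y "\<mu> *\<^sub>R f"] f y \<mu>0 by (simp add: ip.nrm_scale y_def)
      then have nL: "(1 - c) * ip (L f) (L f) \<le> (1 - c) * (\<mu> + \<delta>)\<^sup>2"
        using c f by (intro mult_left_mono) (auto simp flip: ip.nrm_sq intro: power_mono)
      have q1: "qv f (L f) = qv f y - \<mu> * qv f f" unfolding Lf using f y by (simp add: qv.bilin)
      \<comment> \<open>\<open>qv.nrm f\<close> is not known to stay bounded as \<delta> tends to 0,
        so the product of the two seminorms need not be small. The weight \<eta> moves
        \<open>qv f f\<close> into the term that \<open>q4\<close> absorbs.\<close>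
      have q2: "- qv f y \<le> \<eta> * qv f f + C * \<delta>\<^sup>2 / \<eta>"
      proof -
        have "- qv f y \<le> qv.nrm f * qv.nrm y" using qv.cauchy_schwarz[OF f(1) y] by linarith
        also have "\<dots> \<le> \<eta> * (qv.nrm f)\<^sup>2 + (qv.nrm y)\<^sup>2 / \<eta>"
        proof -
          have "0 \<le> (\<eta> * qv.nrm f - qv.nrm y)\<^sup>2 / \<eta>" using \<eta> by simp
          also have "\<dots> = \<eta> * (qv.nrm f)\<^sup>2 + (qv.nrm y)\<^sup>2 / \<eta> - 2 * (qv.nrm f * qv.nrm y)"
            using \<eta> by (simp add: power2_eq_square field_simps)
          finally have "2 * (qv.nrm f * qv.nrm y) \<le> \<eta> * (qv.nrm f)\<^sup>2 + (qv.nrm y)\<^sup>2 / \<eta>" by simp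
          moreover have "0 \<le> qv.nrm f * qv.nrm y" using f y by simp
          ultimately show ?thesis by linarith
        qed
        also have "\<dots> \<le> \<eta> * qv f f + C * \<delta>\<^sup>2 / \<eta>"
          using f(1,4) \<eta> by (simp add: qv.nrm_sq y_def divide_right_mono)
        finally show ?thesis .
      qed
      have q3: "- (l * qv f (L f)) \<le> l * (\<mu> + \<eta>) * qv f f + l * (C * \<delta>\<^sup>2) / \<eta>"
      proof -
        have "- qv f (L f) \<le> (\<mu> + \<eta>) * qv f f + C * \<delta>\<^sup>2 / \<eta>" using q1 q2 by (simp add: algebra_simps)
        from mult_left_mono[OF this, of l] l show ?thesis by (simp add: algebra_simps)
      qed
      have q4: "l * (\<mu> + \<eta>) * qv f f \<le> (\<rho>20 + \<rho>21 * l) * qv f f"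
      proof (intro mult_right_mono)
        have "l * (- \<rho>21) \<le> l * k2" using l k2 by (intro mult_left_mono) auto
        then show "l * (\<mu> + \<eta>) \<le> \<rho>20 + \<rho>21 * l" using l_eq by (simp add: algebra_simps)
      qed (rule qv.nonneg[OF f(1)])
      have q5: "A * \<mu> - \<bar>A\<bar> * \<delta> \<le> A * (- ip f (L f))"
      proof -
        have "\<bar>A * (- ip f (L f) - \<mu>)\<bar> \<le> \<bar>A\<bar> * \<delta>" unfolding abs_mult using Qh[OF f(1-3)] by (intro mult_left_mono) auto
        then show ?thesis by (simp add: algebra_simps)
      qed
      show ?thesis using CD[OF f(1) l(1), folded A_def] nL q3 q4 q5 by linarith
    qed
    have "((\<lambda>\<delta>. (1 - c) * (\<mu> + \<delta>)\<^sup>2 + \<bar>A\<bar> * \<delta> + l * (C * \<delta>\<^sup>2) / \<eta>) \<longlongrightarrow>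
        (1 - c) * (\<mu> + 0)\<^sup>2 + \<bar>A\<bar> * 0 + l * (C * 0\<^sup>2) / \<eta>) (at_right 0)"
      using \<eta> by (intro tendsto_intros) auto
    moreover have "\<forall>\<^sub>F \<delta> in at_right 0. A * \<mu> \<le> (1 - c) * (\<mu> + \<delta>)\<^sup>2 + \<bar>A\<bar> * \<delta> + l * (C * \<delta>\<^sup>2) / \<eta>"
      using step by (auto simp: eventually_at_right_field intro!: exI[of _ 1])
    ultimately have "A * \<mu> \<le> (1 - c) * (\<mu> + 0)\<^sup>2 + \<bar>A\<bar> * 0 + l * (C * 0\<^sup>2) / \<eta>"
      by (rule tendsto_lowerbound) simp
    then have "A * \<mu> \<le> ((1 - c) * \<mu>) * \<mu>" by (simp add: power2_eq_square)
    then have "A \<le> (1 - c) * \<mu>" using \<mu>0 by simp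
    then show ?thesis by (simp add: A_def l)
  qed
  have "\<rho>1 - (\<mu> + k2 + 0) / \<rho>20 \<le> (1 - c) * \<mu>"
  proof (rule tendsto_upperbound)
    show "((\<lambda>\<eta>. \<rho>1 - (\<mu> + k2 + \<eta>) / \<rho>20) \<longlongrightarrow> \<rho>1 - (\<mu> + k2 + 0) / \<rho>20) (at_right 0)"
      using rho20 by (intro tendsto_intros) auto
    show "\<forall>\<^sub>F \<eta> in at_right 0. \<rho>1 - (\<mu> + k2 + \<eta>) / \<rho>20 \<le> (1 - c) * \<mu>"
      using main by (auto simp: eventually_at_right_field intro!: exI[of _ 1])
  qed simp
  then show ?thesis by (simp add: \<mu>_def k2_def add_divide_distrib diff_divide_distrib algebra_simps)
qed

end

section \<open>Functions with bounded derivatives in finitely many directions\<close>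

definition pd :: "'e::real_normed_vector \<Rightarrow> ('e \<Rightarrow> real) \<Rightarrow> 'e \<Rightarrow> real" where
  "pd e U = (\<lambda>z. frechet_derivative U (at z) e)"

text \<open>Differentiability is meant in the sense of Frechet, but bounds are imposed only along
  the directions of \<open>B\<close>. The ambient space will be infinite-dimensional, while all
  displacements lie in the span of a finite \<open>B\<close>.\<close>

primrec bsm :: "'e::real_normed_vector set \<Rightarrow> nat \<Rightarrow> ('e \<Rightarrow> real) \<Rightarrow> bool" where
  "bsm B 0 U \<longleftrightarrow> bounded (range U)"
| "bsm B (Suc k) U \<longleftrightarrow> bounded (range U) \<and> (\<forall>z. U differentiable (at z)) \<and> (\<forall>e\<in>B. bsm B k (pd e U))"

definition csm :: "'e::real_normed_vector set \<Rightarrow> ('e \<Rightarrow> real) \<Rightarrow> bool" where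
  "csm B U \<longleftrightarrow> (\<forall>k. bsm B k U)"

lemma pd_unfold: "U differentiable (at z) \<Longrightarrow> (U has_derivative (\<lambda>e. pd e U z)) (at z)"
  unfolding pd_def using frechet_derivative_works by auto

lemma pd_eqI: "(U has_derivative D) (at z) \<Longrightarrow> pd e U z = D e"
  unfolding pd_def by (simp add: frechet_derivative_at[symmetric])

lemma bsm_Suc_imp: "bsm B (Suc k) U \<Longrightarrow> bsm B k U"
  by (induction k arbitrary: U) auto

lemma csm_differentiable: "csm B U \<Longrightarrow> U differentiable (at z)"
  unfolding csm_def using bsm.simps(2) by blast

lemma csm_bounded: assumes "csm B U" shows "\<exists>K. \<forall>z. \<bar>U z\<bar> \<le> K"
proof -
  have "bsm B 0 U" using assms unfolding csm_def by blast
  then show ?thesis by (auto simp: bounded_iff)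
qed

lemma csm_pd: "csm B U \<Longrightarrow> e \<in> B \<Longrightarrow> csm B (pd e U)"
  unfolding csm_def using bsm.simps(2) by blast

lemma pd_const [simp]: "pd e (\<lambda>z. c) = (\<lambda>z. 0)"
  by (rule ext, rule pd_eqI) simp

lemma bsm_const: "bsm B k (\<lambda>z. c)"
  by (induction k arbitrary: c) auto

lemma csm_const: "csm B (\<lambda>z. c)"
  by (simp add: csm_def bsm_const)

lemma pd_add:
  assumes "\<And>z. U differentiable (at z)" "\<And>z. W differentiable (at z)"
  shows "pd e (\<lambda>z. U z + W z) = (\<lambda>z. pd e U z + pd e W z)"
  by (rule ext, rule pd_eqI) (intro derivative_intros pd_unfold assms)

lemma pd_mult:
  assumes "\<And>z. U differentiable (at z)" "\<And>z. W differentiable (at z)"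
  shows "pd e (\<lambda>z. U z * W z) = (\<lambda>z. U z * pd e W z + pd e U z * W z)"
  by (rule ext, rule pd_eqI) (intro derivative_intros pd_unfold assms)

lemma bounded_range_add: "bounded (range U) \<Longrightarrow> bounded (range W) \<Longrightarrow> bounded (range (\<lambda>z. U z + W z :: real))"
  using bounded_plus_comp[of U UNIV W] by simp

lemma bounded_range_mult:
  assumes "bounded (range U)" "bounded (range W)" shows "bounded (range (\<lambda>z. U z * W z :: real))"
proof -
  obtain K1 K2 where "\<And>z. \<bar>U z\<bar> \<le> K1" "\<And>z. \<bar>W z\<bar> \<le> K2" using assms by (auto simp: bounded_iff)
  then have "\<bar>U z * W z\<bar> \<le> K1 * K2" for z
    unfolding abs_mult by (intro mult_mono) (auto intro: order_trans[OF abs_ge_zero])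
  then show ?thesis by (auto simp: bounded_iff)
qed

lemma bsm_add: "bsm B k U \<Longrightarrow> bsm B k W \<Longrightarrow> bsm B k (\<lambda>z. U z + W z)"
  by (induction k arbitrary: U W) (auto simp: bounded_range_add pd_add)

lemma bsm_mult: "bsm B k U \<Longrightarrow> bsm B k W \<Longrightarrow> bsm B k (\<lambda>z. U z * W z)"
proof (induction k arbitrary: U W)
  case (Suc k)
  have "bsm B k (pd e (\<lambda>z. U z * W z))" if "e \<in> B" for e
    using Suc that bsm_Suc_imp[OF Suc.prems(1)] bsm_Suc_imp[OF Suc.prems(2)]
    by (auto simp: pd_mult intro!: bsm_add Suc.IH)
  then show ?case using Suc.prems by (auto simp: bounded_range_mult)
qed (simp add: bounded_range_mult)

lemma csm_add: "csm B U \<Longrightarrow> csm B W \<Longrightarrow> csm B (\<lambda>z. U z + W z)"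
  by (simp add: csm_def bsm_add)

lemma csm_mult: "csm B U \<Longrightarrow> csm B W \<Longrightarrow> csm B (\<lambda>z. U z * W z)"
  by (simp add: csm_def bsm_mult)

lemma csm_cmult: "csm B U \<Longrightarrow> csm B (\<lambda>z. c * U z)"
  by (intro csm_mult csm_const)

lemma csm_diff: "csm B U \<Longrightarrow> csm B W \<Longrightarrow> csm B (\<lambda>z. U z - W z)"
  using csm_add[OF _ csm_cmult[of B W "-1"], of U] by simp

lemma csm_sum: "(\<And>i. i \<in> I \<Longrightarrow> csm B (U i)) \<Longrightarrow> csm B (\<lambda>z. \<Sum>i\<in>I. U i z)"
proof (induction I rule: infinite_finite_induct)
  case (insert i I) then show ?case by (auto intro!: csm_add)
qed (auto simp: csm_const)

lemma pd_cmult: "(\<And>z. U differentiable (at z)) \<Longrightarrow> pd e (\<lambda>z. c * U z) = (\<lambda>z. c * pd e U z)"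
  by (subst pd_mult) auto

lemma pd_sum:
  assumes "\<And>i z. i \<in> I \<Longrightarrow> U i differentiable (at z)"
  shows "pd e (\<lambda>z. \<Sum>i\<in>I. U i z) = (\<lambda>z. \<Sum>i\<in>I. pd e (U i) z)"
  by (rule ext, rule pd_eqI) (intro derivative_intros pd_unfold assms)

section \<open>Composition with position-dependent shifts along \<open>B\<close>\<close>

lemma shift_has_derivative:
  assumes "finite B" "\<And>e. e \<in> B \<Longrightarrow> \<phi> e differentiable (at z)"
  shows "((\<lambda>z. z + (\<Sum>e\<in>B. \<phi> e z *\<^sub>R e)) has_derivative
     (\<lambda>v. v + (\<Sum>e\<in>B. pd v (\<phi> e) z *\<^sub>R e))) (at z)"
  using assms by (auto intro!: derivative_eq_intros pd_unfold)

lemma pd_linear: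
  assumes "U differentiable (at z)" shows "linear (\<lambda>e. pd e U z)"
  using pd_unfold[OF assms] has_derivative_linear by blast

lemma pd_shift:
  assumes "finite B" "\<And>e z. e \<in> B \<Longrightarrow> \<phi> e differentiable (at z)" "\<And>z. U differentiable (at z)"
  shows "pd v (\<lambda>z. U (z + (\<Sum>e\<in>B. \<phi> e z *\<^sub>R e))) =
    (\<lambda>z. pd v U (z + (\<Sum>e\<in>B. \<phi> e z *\<^sub>R e)) + (\<Sum>e\<in>B. pd v (\<phi> e) z * pd e U (z + (\<Sum>e\<in>B. \<phi> e z *\<^sub>R e))))"
proof
  fix z
  let ?\<Phi> = "\<lambda>z. z + (\<Sum>e\<in>B. \<phi> e z *\<^sub>R e)"
  have "((\<lambda>z. U (?\<Phi> z)) has_derivative (\<lambda>v. pd (v + (\<Sum>e\<in>B. pd v (\<phi> e) z *\<^sub>R e)) U (?\<Phi> z))) (at z)"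
    using has_derivative_compose[OF shift_has_derivative[OF assms(1)] pd_unfold[OF assms(3)]] assms(2) by auto
  from pd_eqI[OF this] have "pd v (\<lambda>z. U (?\<Phi> z)) z = pd (v + (\<Sum>e\<in>B. pd v (\<phi> e) z *\<^sub>R e)) U (?\<Phi> z)" .
  also have "\<dots> = pd v U (?\<Phi> z) + (\<Sum>e\<in>B. pd v (\<phi> e) z * pd e U (?\<Phi> z))"
  proof -
    define D where "D = (\<lambda>e. pd e U (?\<Phi> z))"
    have "linear D" unfolding D_def by (rule pd_linear) (rule assms)
    then have "D (v + (\<Sum>e\<in>B. pd v (\<phi> e) z *\<^sub>R e)) = D v + (\<Sum>e\<in>B. pd v (\<phi> e) z * D e)"
      by (simp add: linear_add linear_sum linear_scale)
    then show ?thesis by (simp add: D_def)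
  qed
  finally show "pd v (\<lambda>z. U (?\<Phi> z)) z = \<dots>" .
qed

lemma shift_differentiable:
  fixes U :: "'e::real_normed_vector \<Rightarrow> real"
  assumes "finite B" "\<And>e z. e \<in> B \<Longrightarrow> \<phi> e differentiable (at z)" "\<And>z. U differentiable (at z)"
  shows "(\<lambda>z. U (z + (\<Sum>e\<in>B. \<phi> e z *\<^sub>R e))) differentiable (at z)"
  by (rule differentiableI)
    (rule has_derivative_compose[OF shift_has_derivative[OF assms(1,2)] pd_unfold[OF assms(3)]])

lemma bsm_sum: "(\<And>i. i \<in> I \<Longrightarrow> bsm B k (U i)) \<Longrightarrow> bsm B k (\<lambda>z. \<Sum>i\<in>I. U i z)"
proof (induction I rule: infinite_finite_induct)
  case (insert i I) then show ?case by (auto intro!: bsm_add)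
qed (auto simp: bsm_const)

text \<open>The displacement lies in the span of \<open>B\<close>, so by \<open>pd_shift\<close> a
  derivative along \<open>B\<close> of the composite involves only derivatives of \<open>U\<close>
  along \<open>B\<close>, and the induction closes.\<close>

lemma bsm_shift:
  assumes "finite B"
  shows "bsm B k U \<Longrightarrow> (\<And>e. e \<in> B \<Longrightarrow> bsm B k (\<phi> e)) \<Longrightarrow> bsm B k (\<lambda>z. U (z + (\<Sum>e\<in>B. \<phi> e z *\<^sub>R e)))"
proof (induction k arbitrary: U)
  case 0
  then show ?case by (auto simp: bounded_iff)
next
  case (Suc k)
  have d: "\<And>e z. e \<in> B \<Longrightarrow> \<phi> e differentiable (at z)" "\<And>z. U differentiable (at z)" using Suc.prems by auto
  have "bsm B k (pd v (\<lambda>z. U (z + (\<Sum>e\<in>B. \<phi> e z *\<^sub>R e))))" if "v \<in> B" for v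
  proof (subst pd_shift[OF assms])
    show "bsm B k (\<lambda>z. pd v U (z + (\<Sum>e\<in>B. \<phi> e z *\<^sub>R e)) +
        (\<Sum>e\<in>B. pd v (\<phi> e) z * pd e U (z + (\<Sum>e\<in>B. \<phi> e z *\<^sub>R e))))"
      using Suc.prems that bsm_Suc_imp[OF Suc.prems(2)]
      by (intro bsm_add bsm_sum bsm_mult Suc.IH) auto
  qed (use d in auto)
  then show ?case using Suc.prems shift_differentiable[OF assms d] by (auto simp: bounded_iff)
qed

lemma csm_shift:
  "finite B \<Longrightarrow> csm B U \<Longrightarrow> (\<And>e. e \<in> B \<Longrightarrow> csm B (\<phi> e)) \<Longrightarrow> csm B (\<lambda>z. U (z + (\<Sum>e\<in>B. \<phi> e z *\<^sub>R e)))"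
  by (simp add: csm_def bsm_shift)

section \<open>Iterated derivatives, indexed by words\<close>

primrec pdw :: "'e::real_normed_vector list \<Rightarrow> ('e \<Rightarrow> real) \<Rightarrow> 'e \<Rightarrow> real" where
  "pdw [] U = U"
| "pdw (e # w) U = pd e (pdw w U)"

lemma csm_pdw: "csm B U \<Longrightarrow> set w \<subseteq> B \<Longrightarrow> csm B (pdw w U)"
  by (induction w) (auto intro: csm_pd)

lemma pdw_append: "pdw (w @ w') U = pdw w (pdw w' U)"
  by (induction w) auto

lemma pdw_cmult: "csm B U \<Longrightarrow> set w \<subseteq> B \<Longrightarrow> pdw w (\<lambda>z. c * U z) = (\<lambda>z. c * pdw w U z)"
  by (induction w) (auto simp: pd_cmult csm_differentiable[OF csm_pdw])

lemma pdw_add: "csm B U \<Longrightarrow> csm B W \<Longrightarrow> set w \<subseteq> B \<Longrightarrow> pdw w (\<lambda>z. U z + W z) = (\<lambda>z. pdw w U z + pdw w W z)"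
  by (induction w) (auto simp: pd_add csm_differentiable[OF csm_pdw])

lemma pdw_diff: "csm B U \<Longrightarrow> csm B W \<Longrightarrow> set w \<subseteq> B \<Longrightarrow> pdw w (\<lambda>z. U z - W z) = (\<lambda>z. pdw w U z - pdw w W z)"
  using pdw_add[of B U "\<lambda>z. (-1) * W z" w] pdw_cmult[of B W w "-1"] csm_cmult[of B W "-1"] by simp

lemma pdw_sum: "(\<And>i. i \<in> I \<Longrightarrow> csm B (U i)) \<Longrightarrow> set w \<subseteq> B \<Longrightarrow>
    pdw w (\<lambda>z. \<Sum>i\<in>I. U i z) = (\<lambda>z. \<Sum>i\<in>I. pdw w (U i) z)"
  by (induction w) (auto intro!: pd_sum intro: csm_differentiable[OF csm_pdw])

definition words :: "'e set \<Rightarrow> nat \<Rightarrow> 'e list set" where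
  "words B k = {w. set w \<subseteq> B \<and> length w \<le> k}"

lemma finite_words: "finite B \<Longrightarrow> finite (words B k)"
  unfolding words_def by (rule finite_lists_length_le)

section \<open>One step of a random walk\<close>

locale walk_step =
  fixes B :: "'e::real_normed_vector set" and \<sigma> b :: "'e \<Rightarrow> 'e \<Rightarrow> real"
  assumes finB: "finite B"
    and sm_\<sigma>: "\<And>e. e \<in> B \<Longrightarrow> csm B (\<sigma> e)" and sm_b: "\<And>e. e \<in> B \<Longrightarrow> csm B (b e)"
begin

text \<open>One Euler step along a straight line, not the flow of a vector field; accordingly
  \<open>gen\<close> contains no derivatives of \<sigma>. The square of \<open>s\<close> plays the
  role of time, which is why the drift \<open>b\<close> enters with the factor s^2.\<close>

definition flow :: "real \<Rightarrow> 'e \<Rightarrow> 'e" where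
  "flow s z = z + (\<Sum>e\<in>B. (s * \<sigma> e z + s\<^sup>2 * b e z) *\<^sub>R e)"

definition gen :: "('e \<Rightarrow> real) \<Rightarrow> 'e \<Rightarrow> real" where
  "gen U z = (\<Sum>e\<in>B. \<Sum>e'\<in>B. \<sigma> e z * \<sigma> e' z * pd e' (pd e U) z) / 2 + (\<Sum>e\<in>B. b e z * pd e U z)"

definition avg :: "real \<Rightarrow> ('e \<Rightarrow> real) \<Rightarrow> 'e \<Rightarrow> real" where
  "avg s U z = (U (flow s z) + U (flow (- s) z)) / 2"

lemma flow_0 [simp]: "flow 0 z = z" by (simp add: flow_def)

lemma sm_coef: "e \<in> B \<Longrightarrow> csm B (\<lambda>z. s * \<sigma> e z + s\<^sup>2 * b e z)"
  by (intro csm_add csm_cmult sm_\<sigma> sm_b)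

lemma csm_flow: "csm B U \<Longrightarrow> csm B (\<lambda>z. U (flow s z))"
  unfolding flow_def by (intro csm_shift finB sm_coef)

lemma csm_avg: "csm B U \<Longrightarrow> csm B (avg s U)"
  using csm_cmult[OF csm_add[OF csm_flow[of U s] csm_flow[of U "- s"]], of "1/2"]
  unfolding avg_def[abs_def] by simp

lemma csm_gen:
  assumes "csm B U" shows "csm B (gen U)"
proof -
  have "csm B (\<lambda>z. (1 / 2) * (\<Sum>e\<in>B. \<Sum>e'\<in>B. \<sigma> e z * \<sigma> e' z * pd e' (pd e U) z) + (\<Sum>e\<in>B. b e z * pd e U z))"
    using assms by (intro csm_add csm_cmult csm_sum csm_mult sm_\<sigma> sm_b csm_pd)
  then show ?thesis unfolding gen_def[abs_def] by simp
qed

lemma pd_flow: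
  assumes "csm B U" "v \<in> B"
  shows "pd v (\<lambda>z. U (flow s z)) = (\<lambda>z. pd v U (flow s z) +
    (\<Sum>e\<in>B. (s * pd v (\<sigma> e) z + s\<^sup>2 * pd v (b e) z) * pd e U (flow s z)))"
proof -
  have "pd v (\<lambda>z. s * \<sigma> e z + s\<^sup>2 * b e z) = (\<lambda>z. s * pd v (\<sigma> e) z + s\<^sup>2 * pd v (b e) z)" if "e \<in> B" for e
    using that by (subst pd_add) (auto simp: pd_cmult csm_differentiable[OF sm_\<sigma>] csm_differentiable[OF sm_b]
       csm_differentiable[OF csm_cmult[OF sm_\<sigma>]] csm_differentiable[OF csm_cmult[OF sm_b]])
  then show ?thesis unfolding flow_def
    by (subst pd_shift) (auto simp: finB csm_differentiable[OF sm_coef] csm_differentiable[OF assms(1)])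
qed

text \<open>A triple \<open>(p, c, w)\<close> stands for the term \<open>s\<^sup>p c (\<partial>\<^sub>w U \<circ> flow s)\<close>.\<close>
definition expr :: "(nat \<times> ('e \<Rightarrow> real) \<times> 'e list) list \<Rightarrow> real \<Rightarrow> ('e \<Rightarrow> real) \<Rightarrow> 'e \<Rightarrow> real" where
  "expr xs s U z = (\<Sum>(p, c, w)\<leftarrow>xs. s ^ p * c z * pdw w U (flow s z))"

definition wf_expr :: "nat \<Rightarrow> nat \<Rightarrow> (nat \<times> ('e \<Rightarrow> real) \<times> 'e list) list \<Rightarrow> bool" where
  "wf_expr m d xs \<longleftrightarrow> (\<forall>(p, c, w)\<in>set xs. m \<le> p \<and> csm B c \<and> w \<in> words B d)"

lemma expr_Nil [simp]: "expr [] s U = (\<lambda>z. 0)" by (simp add: expr_def fun_eq_iff)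

lemma expr_Cons: "expr ((p, c, w) # xs) s U = (\<lambda>z. s ^ p * c z * pdw w U (flow s z) + expr xs s U z)"
  by (simp add: expr_def fun_eq_iff)

lemma expr_append: "expr (xs @ ys) s U z = expr xs s U z + expr ys s U z"
  by (simp add: expr_def)

lemma csm_term: "csm B U \<Longrightarrow> csm B c \<Longrightarrow> w \<in> words B d \<Longrightarrow> csm B (\<lambda>z. s ^ p * c z * pdw w U (flow s z))"
  by (intro csm_mult csm_const csm_flow csm_pdw) (auto simp: words_def)

lemma csm_expr: "csm B U \<Longrightarrow> wf_expr m d xs \<Longrightarrow> csm B (expr xs s U)"
proof (induction xs)
  case (Cons x xs)
  obtain p c w where x: "x = (p, c, w)" by (cases x)
  show ?case using Cons csm_term[of U c w d s p] unfolding x expr_Cons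
    by (intro csm_add) (auto simp: wf_expr_def)
qed (simp add: csm_const)

text \<open>\<open>expr\<close> takes lists, whereas \<open>B\<close> is an unordered set; any
  enumeration of the index set does.\<close>

lemma expr_sum:
  assumes "finite I"
  shows "\<exists>xs. set xs = x ` I \<and> (\<forall>s U z. expr xs s U z = (\<Sum>i\<in>I. expr [x i] s U z))"
  using assms
proof (induction I)
  case (insert i I)
  then obtain xs where "set xs = x ` I" "\<forall>s U z. expr xs s U z = (\<Sum>i\<in>I. expr [x i] s U z)" by blast
  then show ?case using insert by (intro exI[of _ "x i # xs"]) (auto simp: expr_def)
qed auto

text \<open>The derivative falls on the coefficient, on \<open>U\<close>, or on the displacement of
  \<open>flow\<close>. The terms of the last kind, collected in \<open>ys\<close>, gain a power of
  \<open>s\<close>, as \<open>flow\<close> differs from the identity by terms with a factor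
  \<open>s\<close>. Since \<open>ys\<close> is chosen before \<open>U\<close> and \<open>s\<close>,
  bounds derived from it are uniform in both.\<close>

lemma pd_term:
  assumes v: "v \<in> B" and c: "csm B c" and w: "w \<in> words B d"
  shows "\<exists>ys. wf_expr (Suc p) (Suc d) ys \<and> (\<forall>U s. csm B U \<longrightarrow>
    pd v (expr [(p, c, w)] s U) = expr ((p, pd v c, w) # (p, c, v # w) # ys) s U)"
proof -
  obtain xs1 where xs1: "set xs1 = (\<lambda>e. (p + 1, \<lambda>z. c z * pd v (\<sigma> e) z, e # w)) ` B"
    "\<And>s U z. expr xs1 s U z = (\<Sum>e\<in>B. expr [(p + 1, \<lambda>z. c z * pd v (\<sigma> e) z, e # w)] s U z)"
    using expr_sum[OF finB, of "\<lambda>e. (p + 1, \<lambda>z. c z * pd v (\<sigma> e) z, e # w)"] by blast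
  obtain xs2 where xs2: "set xs2 = (\<lambda>e. (p + 2, \<lambda>z. c z * pd v (b e) z, e # w)) ` B"
    "\<And>s U z. expr xs2 s U z = (\<Sum>e\<in>B. expr [(p + 2, \<lambda>z. c z * pd v (b e) z, e # w)] s U z)"
    using expr_sum[OF finB, of "\<lambda>e. (p + 2, \<lambda>z. c z * pd v (b e) z, e # w)"] by blast
  have "wf_expr (Suc p) (Suc d) (xs1 @ xs2)"
    using v c w by (auto simp: wf_expr_def xs1 xs2 words_def intro!: csm_mult csm_pd sm_\<sigma> sm_b)
  moreover have "pd v (expr [(p, c, w)] s U) = expr ((p, pd v c, w) # (p, c, v # w) # xs1 @ xs2) s U"
    if U: "csm B U" for U s
  proof -
    define H where "H = pdw w U"
    have H: "csm B H" using U w by (auto simp: H_def words_def intro: csm_pdw)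
    have "pd v (expr [(p, c, w)] s U) = pd v (\<lambda>z. s ^ p * (c z * H (flow s z)))"
      by (simp add: expr_Cons H_def mult.assoc)
    also have "\<dots> = (\<lambda>z. s ^ p * (c z * pd v (\<lambda>z. H (flow s z)) z + pd v c z * H (flow s z)))"
      using csm_differentiable[OF c] csm_differentiable[OF csm_flow[OF H]]
         csm_differentiable[OF csm_mult[OF c csm_flow[OF H]]]
      by (simp add: pd_cmult pd_mult)
    also have "\<dots> = expr ((p, pd v c, w) # (p, c, v # w) # xs1 @ xs2) s U"
      unfolding pd_flow[OF H v]
      by (simp add: expr_Cons expr_append xs1 xs2 H_def fun_eq_iff sum_distrib_left sum.distrib algebra_simps power2_eq_square)
    finally show ?thesis .
  qed
  ultimately show ?thesis by blast
qed

lemma pd_expr: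
  assumes v: "v \<in> B" and "wf_expr m d xs"
  shows "\<exists>ys. wf_expr m (Suc d) ys \<and> (\<forall>U s. csm B U \<longrightarrow> pd v (expr xs s U) = expr ys s U)"
  using assms(2)
proof (induction xs)
  case Nil then show ?case by (intro exI[of _ "[]"]) (auto simp: wf_expr_def)
next
  case (Cons x xs)
  obtain p c w where x: "x = (p, c, w)" by (cases x)
  have c: "csm B c" "w \<in> words B d" "m \<le> p" "wf_expr m d xs" using Cons.prems by (auto simp: x wf_expr_def)
  obtain ys where ys: "wf_expr (Suc p) (Suc d) ys" "\<And>U s. csm B U \<Longrightarrow>
    pd v (expr [(p, c, w)] s U) = expr ((p, pd v c, w) # (p, c, v # w) # ys) s U"
    using pd_term[OF v c(1,2), of p] by blast
  obtain zs where zs: "wf_expr m (Suc d) zs" "\<And>U s. csm B U \<Longrightarrow> pd v (expr xs s U) = expr zs s U"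
    using Cons.IH[OF c(4)] by blast
  show ?case
  proof (intro exI[of _ "((p, pd v c, w) # (p, c, v # w) # ys) @ zs"] conjI allI impI)
    show "wf_expr m (Suc d) (((p, pd v c, w) # (p, c, v # w) # ys) @ zs)"
    proof -
      have "wf_expr m (Suc d) ys"
        using ys(1) c(3) by (auto simp: wf_expr_def)
      moreover have "csm B (pd v c)" "w \<in> words B (Suc d)" "v # w \<in> words B (Suc d)"
        using c v by (auto simp: words_def intro: csm_pd)
      ultimately show ?thesis using zs(1) c by (auto simp: wf_expr_def)
    qed
    fix U :: "'e \<Rightarrow> real" and s assume U: "csm B U"
    have "pd v (expr (x # xs) s U) = pd v (\<lambda>z. expr [(p, c, w)] s U z + expr xs s U z)"
      by (simp add: x expr_Cons)
    also have "\<dots> = (\<lambda>z. pd v (expr [(p, c, w)] s U) z + pd v (expr xs s U) z)"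
      using csm_differentiable[OF csm_expr[OF U, of m d "[(p, c, w)]" s]] csm_differentiable[OF csm_expr[OF U c(4), of s]] c
      by (intro pd_add) (auto simp: wf_expr_def)
    finally show "pd v (expr (x # xs) s U) = expr (((p, pd v c, w) # (p, c, v # w) # ys) @ zs) s U"
      by (simp add: ys(2)[OF U] zs(2)[OF U] fun_eq_iff expr_append[symmetric] del: append_Cons)
  qed
qed

text \<open>By \<open>pd_term\<close> the only term without a factor \<open>s\<close> is the one in
  which all derivatives fall on \<open>U\<close>; its coefficient is the constant 1, which produces
  no further terms when differentiated.\<close>

lemma pdw_flow:
  assumes "w \<in> words B d"
  shows "\<exists>xs. wf_expr 1 d xs \<and> (\<forall>U s z. csm B U \<longrightarrow>
    pdw w (\<lambda>z. U (flow s z)) z = pdw w U (flow s z) + expr xs s U z)"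
  using assms
proof (induction w arbitrary: d)
  case Nil then show ?case by (intro exI[of _ "[]"]) (auto simp: wf_expr_def)
next
  case (Cons v w)
  obtain d' where d': "d = Suc d'" using Cons.prems by (cases d) (auto simp: words_def)
  have w: "w \<in> words B d'" "v \<in> B" using Cons.prems by (auto simp: words_def d')
  obtain xs where xs: "wf_expr 1 d' xs" "\<And>U s z. csm B U \<Longrightarrow>
    pdw w (\<lambda>z. U (flow s z)) z = pdw w U (flow s z) + expr xs s U z"
    using Cons.IH[OF w(1)] by blast
  obtain ys where ys: "wf_expr 1 (Suc d') ys" "\<And>U s. csm B U \<Longrightarrow> pd v (expr xs s U) = expr ys s U"
    using pd_expr[OF w(2) xs(1)] by blast
  obtain zs where zs: "wf_expr (Suc 0) (Suc d') zs" "\<And>U s. csm B U \<Longrightarrow>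
    pd v (expr [(0, \<lambda>z. 1, w)] s U) = expr ((0, pd v (\<lambda>z. 1), w) # (0, \<lambda>z. 1, v # w) # zs) s U"
    using pd_term[OF w(2) csm_const w(1), of 0 1] by blast
  show ?case
  proof (intro exI[of _ "zs @ ys"] conjI allI impI)
    show "wf_expr 1 d (zs @ ys)" using zs(1) ys(1) by (auto simp: wf_expr_def d')
    fix U :: "'e \<Rightarrow> real" and s z assume U: "csm B U"
    have "pdw w (\<lambda>z. U (flow s z)) = (\<lambda>z. expr [(0, \<lambda>z. 1, w)] s U z + expr xs s U z)"
      by (rule ext) (simp add: xs(2)[OF U] expr_Cons)
    then have "pdw (v # w) (\<lambda>z. U (flow s z)) = pd v (\<lambda>z. expr [(0, \<lambda>z. 1, w)] s U z + expr xs s U z)" by simp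
    also have "\<dots> = (\<lambda>z. pd v (expr [(0, \<lambda>z. 1, w)] s U) z + pd v (expr xs s U) z)"
      using csm_differentiable[OF csm_expr[OF U, of 0 d' "[(0, \<lambda>z. 1, w)]" s]] csm_differentiable[OF csm_expr[OF U xs(1), of s]] w
      by (intro pd_add) (auto simp: wf_expr_def csm_const)
    finally show "pdw (v # w) (\<lambda>z. U (flow s z)) z = pdw (v # w) U (flow s z) + expr (zs @ ys) s U z"
      using zs(2)[OF U, of s] by (simp add: ys(2)[OF U] expr_append expr_Cons)
  qed
qed

section \<open>Uniform bounds and their growth under one averaged step\<close>

definition bnd :: "nat \<Rightarrow> real \<Rightarrow> ('e \<Rightarrow> real) \<Rightarrow> bool" where
  "bnd d K U \<longleftrightarrow> (\<forall>w\<in>words B d. \<forall>z. \<bar>pdw w U z\<bar> \<le> K)"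

lemma bnd_nonneg: "bnd d K U \<Longrightarrow> 0 \<le> K"
  unfolding bnd_def words_def using abs_ge_zero order_trans by (metis (mono_tags) mem_Collect_eq empty_set empty_subsetI list.size(3) zero_le)

lemma bnd_mono: "bnd d K U \<Longrightarrow> d' \<le> d \<Longrightarrow> bnd d' K U"
  by (auto simp: bnd_def words_def)

lemma bnd_pdw: "bnd (d + length w) K U \<Longrightarrow> set w \<subseteq> B \<Longrightarrow> bnd d K (pdw w U)"
  by (fastforce simp: bnd_def words_def pdw_append[symmetric])

lemma expr_bound:
  "wf_expr m d xs \<Longrightarrow> \<exists>C\<ge>0. \<forall>U K s z. bnd d K U \<and> \<bar>s\<bar> \<le> 1 \<longrightarrow> \<bar>expr xs s U z\<bar> \<le> C * \<bar>s\<bar> ^ m * K"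
proof (induction xs)
  case Nil
  then show ?case by (intro exI[of _ 0]) auto
next
  case (Cons x xs)
  obtain p c w where x: "x = (p, c, w)" by (cases x)
  have c: "csm B c" "w \<in> words B d" "m \<le> p" "wf_expr m d xs" using Cons.prems by (auto simp: x wf_expr_def)
  obtain C where C: "0 \<le> C" "\<And>U K s z. bnd d K U \<Longrightarrow> \<bar>s\<bar> \<le> 1 \<Longrightarrow> \<bar>expr xs s U z\<bar> \<le> C * \<bar>s\<bar> ^ m * K"
    using Cons.IH[OF c(4)] by blast
  obtain M where M: "\<And>z. \<bar>c z\<bar> \<le> M" using csm_bounded[OF c(1)] by blast
  have M0: "0 \<le> M" using M[of undefined] by linarith
  have "\<bar>expr (x # xs) s U z\<bar> \<le> (M + C) * \<bar>s\<bar> ^ m * K" if U: "bnd d K U" "\<bar>s\<bar> \<le> 1" for U K s z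
  proof -
    have "\<bar>s ^ p * c z * pdw w U (flow s z)\<bar> = \<bar>s\<bar> ^ p * \<bar>c z\<bar> * \<bar>pdw w U (flow s z)\<bar>"
      by (simp add: abs_mult power_abs)
    also have "\<dots> \<le> \<bar>s\<bar> ^ m * M * K"
      using U c M M0 by (intro mult_mono power_decreasing) (auto simp: bnd_def)
    finally show ?thesis using C(2)[OF U, of z] by (simp add: x expr_Cons algebra_simps abs_if split: if_splits)
  qed
  then show ?case using M0 C(1) by (intro exI[of _ "M + C"]) auto
qed

text \<open>At the first power of \<open>s\<close> the two contributions have opposite signs, so
  only differences between the two end points occur, and these are controlled by \<open>D\<close>;
  higher powers are of order s^2 without any cancellation. \<open>D\<close> is kept as a parameter,
  because \<open>avg_growth\<close> absorbs it into the parallelogram identity whereas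
  \<open>pdw_avg_diff\<close> bounds it by a multiple of \<open>s\<close>.\<close>

lemma expr_pair_bound:
  "wf_expr 1 d xs \<Longrightarrow> \<exists>C\<ge>0. \<forall>U K D s z. bnd d K U \<and> \<bar>s\<bar> \<le> 1 \<and> 0 \<le> D \<and>
    (\<forall>w\<in>words B d. \<bar>pdw w U (flow s z) - pdw w U (flow (- s) z)\<bar> / 2 \<le> D) \<longrightarrow>
    \<bar>expr xs s U z + expr xs (- s) U z\<bar> / 2 \<le> C * (\<bar>s\<bar> * D + s\<^sup>2 * K)"
proof (induction xs)
  case Nil
  then show ?case by (intro exI[of _ 0]) auto
next
  case (Cons x xs)
  obtain p c w where x: "x = (p, c, w)" by (cases x)
  have c: "csm B c" "w \<in> words B d" "1 \<le> p" "wf_expr 1 d xs" using Cons.prems by (auto simp: x wf_expr_def)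
  obtain C where C: "0 \<le> C" "\<And>U K D s z. bnd d K U \<Longrightarrow> \<bar>s\<bar> \<le> 1 \<Longrightarrow> 0 \<le> D \<Longrightarrow>
    \<forall>w\<in>words B d. \<bar>pdw w U (flow s z) - pdw w U (flow (- s) z)\<bar> / 2 \<le> D \<Longrightarrow>
    \<bar>expr xs s U z + expr xs (- s) U z\<bar> / 2 \<le> C * (\<bar>s\<bar> * D + s\<^sup>2 * K)"
    using Cons.IH[OF c(4)] by blast
  obtain M where M: "\<And>z. \<bar>c z\<bar> \<le> M" using csm_bounded[OF c(1)] by blast
  have M0: "0 \<le> M" using M[of undefined] by linarith
  have "\<bar>expr (x # xs) s U z + expr (x # xs) (- s) U z\<bar> / 2 \<le> (M + C) * (\<bar>s\<bar> * D + s\<^sup>2 * K)"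
    if U: "bnd d K U" "\<bar>s\<bar> \<le> 1" "0 \<le> D" "\<forall>w\<in>words B d. \<bar>pdw w U (flow s z) - pdw w U (flow (- s) z)\<bar> / 2 \<le> D"
    for U K D s z
  proof -
    define v where "v = (\<lambda>s. pdw w U (flow s z))"
    have K0: "0 \<le> K" by (rule bnd_nonneg[OF U(1)])
    have v: "\<bar>v s - v (- s)\<bar> / 2 \<le> D" "\<bar>v s\<bar> \<le> K" "\<bar>v (- s)\<bar> \<le> K"
      using U c by (auto simp: v_def bnd_def)
    have "\<bar>s ^ p * v s + (- s) ^ p * v (- s)\<bar> / 2 \<le> \<bar>s\<bar> * D + s\<^sup>2 * K"
    proof (cases "p = 1")
      case True
      have "\<bar>s * v s - s * v (- s)\<bar> / 2 = \<bar>s\<bar> * (\<bar>v s - v (- s)\<bar> / 2)"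
        by (simp add: abs_mult flip: right_diff_distrib)
      also have "\<dots> \<le> \<bar>s\<bar> * D" using v by (intro mult_left_mono) auto
      finally show ?thesis using True K0 by (simp add: add_increasing2)
    next
      case False
      have "\<bar>s ^ p * v s + (- s) ^ p * v (- s)\<bar> \<le> \<bar>s\<bar> ^ p * \<bar>v s\<bar> + \<bar>s\<bar> ^ p * \<bar>v (- s)\<bar>"
        by (rule order_trans[OF abs_triangle_ineq]) (simp add: abs_mult power_abs)
      also have "\<dots> \<le> \<bar>s\<bar>\<^sup>2 * K + \<bar>s\<bar>\<^sup>2 * K"
        using False c v U by (intro add_mono mult_mono power_decreasing) auto
      finally have "\<bar>s ^ p * v s + (- s) ^ p * v (- s)\<bar> / 2 \<le> s\<^sup>2 * K" by (simp add: algebra_simps)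
      moreover have "0 \<le> \<bar>s\<bar> * D" using U(3) by simp
      ultimately show ?thesis by linarith
    qed
    then have "\<bar>c z\<bar> * (\<bar>s ^ p * v s + (- s) ^ p * v (- s)\<bar> / 2) \<le> M * (\<bar>s\<bar> * D + s\<^sup>2 * K)"
      using M M0 by (intro mult_mono) auto
    then have "\<bar>s ^ p * c z * v s + (- s) ^ p * c z * v (- s)\<bar> / 2 \<le> M * (\<bar>s\<bar> * D + s\<^sup>2 * K)"
      by (simp add: abs_mult[symmetric] algebra_simps)
    moreover have "\<bar>expr (x # xs) s U z + expr (x # xs) (- s) U z\<bar>
       \<le> \<bar>s ^ p * c z * v s + (- s) ^ p * c z * v (- s)\<bar> + \<bar>expr xs s U z + expr xs (- s) U z\<bar>"
    proof -
      have "expr (x # xs) s U z + expr (x # xs) (- s) U z =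
        (s ^ p * c z * v s + (- s) ^ p * c z * v (- s)) + (expr xs s U z + expr xs (- s) U z)"
        by (simp add: x expr_Cons v_def)
      then show ?thesis by (simp only: abs_triangle_ineq)
    qed
    ultimately show ?thesis using C(2)[OF U] by (simp add: algebra_simps)
  qed
  then show ?case using M0 C(1) by (intro exI[of _ "M + C"]) auto
qed

lemma pdw_avg:
  assumes "csm B U" "set w \<subseteq> B"
  shows "pdw w (avg s U) z = (pdw w (\<lambda>z. U (flow s z)) z + pdw w (\<lambda>z. U (flow (- s) z)) z) / 2"
proof -
  have "avg s U = (\<lambda>z. 1 / 2 * (U (flow s z) + U (flow (- s) z)))"
    by (simp add: avg_def fun_eq_iff)
  then have "pdw w (avg s U) = (\<lambda>z. 1 / 2 * (pdw w (\<lambda>z. U (flow s z)) z + pdw w (\<lambda>z. U (flow (- s) z)) z))"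
    using assms by (simp only: pdw_cmult[OF csm_add[OF csm_flow csm_flow]] pdw_add[OF csm_flow csm_flow])
  then show ?thesis by simp
qed

text \<open>A Euclidean counterpart of \<open>bnd\<close>: sums of squares obey the parallelogram
  identity on which \<open>avg_growth\<close> relies.\<close>

definition nsq :: "nat \<Rightarrow> ('e \<Rightarrow> real) \<Rightarrow> 'e \<Rightarrow> real" where
  "nsq k U z = (\<Sum>w\<in>words B k. (pdw w U z)\<^sup>2)"

lemma nsq_bnd: 
  assumes "\<And>z. nsq k U z \<le> K" shows "bnd k (sqrt K) U"
  unfolding bnd_def
proof (intro ballI allI)
  fix w z assume w: "w \<in> words B k"
  have "(pdw w U z)\<^sup>2 \<le> nsq k U z" unfolding nsq_def using w by (intro member_le_sum finite_words finB) auto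
  then have "(pdw w U z)\<^sup>2 \<le> K" using assms order_trans by blast
  then show "\<bar>pdw w U z\<bar> \<le> sqrt K" by (rule real_le_rsqrt[OF order_trans[rotated]]) simp
qed

text \<open>The terms of order \<open>s\<close> in the derivatives of the two summands of \<open>avg s U\<close> are opposite up to the
  difference of the two function values, whose square is absorbed by the parallelogram identity.\<close>
lemma avg_growth:
  "\<exists>C\<ge>0. \<forall>U s K. csm B U \<and> \<bar>s\<bar> \<le> 1 \<and> (\<forall>z. nsq k U z \<le> K) \<longrightarrow> (\<forall>z. nsq k (avg s U) z \<le> K * (1 + C * s\<^sup>2))"
proof -
  let ?W = "words B k"
  have finW: "finite ?W" by (rule finite_words[OF finB])
  have "\<forall>w\<in>?W. \<exists>xs. wf_expr 1 k xs \<and> (\<forall>U s z. csm B U \<longrightarrow>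
      pdw w (\<lambda>z. U (flow s z)) z = pdw w U (flow s z) + expr xs s U z)"
    using pdw_flow by blast
  from bchoice[OF this] obtain xs where xs: "\<And>w. w \<in> ?W \<Longrightarrow> wf_expr 1 k (xs w)"
    "\<And>w U s z. w \<in> ?W \<Longrightarrow> csm B U \<Longrightarrow> pdw w (\<lambda>z. U (flow s z)) z = pdw w U (flow s z) + expr (xs w) s U z"
    by blast
  have "\<forall>w\<in>?W. \<exists>C\<ge>0. (\<forall>U K D s z. bnd k K U \<and> \<bar>s\<bar> \<le> 1 \<and> 0 \<le> D \<and>
      (\<forall>w\<in>words B k. \<bar>pdw w U (flow s z) - pdw w U (flow (- s) z)\<bar> / 2 \<le> D) \<longrightarrow>
      \<bar>expr (xs w) s U z + expr (xs w) (- s) U z\<bar> / 2 \<le> C * (\<bar>s\<bar> * D + s\<^sup>2 * K))"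
    using expr_pair_bound xs(1) by blast
  from bchoice[OF this] obtain C where C: "\<And>w. w \<in> ?W \<Longrightarrow> 0 \<le> C w"
    "\<And>w U K D s z. w \<in> ?W \<Longrightarrow> bnd k K U \<Longrightarrow> \<bar>s\<bar> \<le> 1 \<Longrightarrow> 0 \<le> D \<Longrightarrow>
      (\<forall>w\<in>words B k. \<bar>pdw w U (flow s z) - pdw w U (flow (- s) z)\<bar> / 2 \<le> D) \<Longrightarrow>
      \<bar>expr (xs w) s U z + expr (xs w) (- s) U z\<bar> / 2 \<le> C w * (\<bar>s\<bar> * D + s\<^sup>2 * K)"
    by blast
  define c where "c = sum C ?W"
  have c0: "0 \<le> c" using C(1) by (auto simp: c_def intro: sum_nonneg)
  have Cc: "C w \<le> c" if "w \<in> ?W" for w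
    unfolding c_def using that C(1) finW by (intro member_le_sum) auto
  have "nsq k (avg s U) z \<le> K * (1 + (6 * c\<^sup>2 + 2 * c) * s\<^sup>2)"
    if U: "csm B U" and s: "\<bar>s\<bar> \<le> 1" and K: "\<And>z. nsq k U z \<le> K" for U s K z
  proof -
    define p where "p = (\<lambda>w. pdw w U (flow s z))"
    define q where "q = (\<lambda>w. pdw w U (flow (- s) z))"
    define a where "a = (\<lambda>w. (p w + q w) / 2)"
    define d where "d = (\<lambda>w. (p w - q w) / 2)"
    define err where "err = (\<lambda>w. (expr (xs w) s U z + expr (xs w) (- s) U z) / 2)"
    define P where "P = sqrt (\<Sum>w\<in>?W. (a w)\<^sup>2)"
    define D where "D = sqrt (\<Sum>w\<in>?W. (d w)\<^sup>2)"
    have P2: "P\<^sup>2 = (\<Sum>w\<in>?W. (a w)\<^sup>2)" and D2: "D\<^sup>2 = (\<Sum>w\<in>?W. (d w)\<^sup>2)"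
      by (auto simp: P_def D_def sum_nonneg)
    have P0: "0 \<le> P" "0 \<le> D" by (auto simp: P_def D_def sum_nonneg)
    have s2: "s\<^sup>2 \<le> 1" using s by (simp add: abs_square_le_1)
    have PD: "P\<^sup>2 + D\<^sup>2 \<le> K"
    proof -
      have "P\<^sup>2 + D\<^sup>2 = (\<Sum>w\<in>?W. ((p w)\<^sup>2 + (q w)\<^sup>2) / 2)"
        unfolding P2 D2 sum.distrib[symmetric] a_def d_def
        by (intro sum.cong) (auto simp: power2_eq_square field_simps)
      also have "\<dots> = (nsq k U (flow s z) + nsq k U (flow (- s) z)) / 2"
        by (simp add: nsq_def p_def q_def sum.distrib flip: sum_divide_distrib)
      also have "\<dots> \<le> (K + K) / 2" by (intro divide_right_mono add_mono K) auto
      finally show ?thesis by simp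
    qed
    have PK: "P\<^sup>2 \<le> K" "D\<^sup>2 \<le> K"
      using PD zero_le_power2[of P] zero_le_power2[of D] by linarith+
    have K0: "0 \<le> K" using order_trans[OF zero_le_power2 PK(1)] .
    define R where "R = sqrt K"
    have R2: "R\<^sup>2 = K" "0 \<le> R" using K0 by (auto simp: R_def)
    have PR: "P \<le> R" "D \<le> R"
      using PK R2 by (auto intro!: power2_le_imp_le[of _ R])
    define \<eta> where "\<eta> = \<bar>s\<bar> * D + s\<^sup>2 * R"
    have eta0: "0 \<le> \<eta>" using P0 R2 by (simp add: \<eta>_def)
    have dD: "\<bar>d w\<bar> \<le> D" if "w \<in> ?W" for w
    proof -
      have "(d w)\<^sup>2 \<le> (\<Sum>w\<in>?W. (d w)\<^sup>2)" using that finW by (intro member_le_sum) auto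
      then show ?thesis unfolding D_def by (intro real_le_rsqrt) auto
    qed
    have aP: "\<bar>a w\<bar> \<le> P" if "w \<in> ?W" for w
    proof -
      have "(a w)\<^sup>2 \<le> (\<Sum>w\<in>?W. (a w)\<^sup>2)" using that finW by (intro member_le_sum) auto
      then show ?thesis unfolding P_def by (intro real_le_rsqrt) auto
    qed
    have err: "\<bar>err w\<bar> \<le> C w * \<eta>" if "w \<in> ?W" for w
    proof -
      have "\<forall>w\<in>words B k. \<bar>pdw w U (flow s z) - pdw w U (flow (- s) z)\<bar> / 2 \<le> D"
        using dD by (simp add: d_def p_def q_def)
      from C(2)[OF that nsq_bnd[OF K] s P0(2) this] show ?thesis
        by (simp add: err_def \<eta>_def R_def)
    qed
    have eq: "pdw w (avg s U) z = a w + err w" if "w \<in> ?W" for w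
    proof -
      have "set w \<subseteq> B" using that by (auto simp: words_def)
      then show ?thesis
        by (simp add: pdw_avg[OF U] xs(2)[OF that U] a_def p_def q_def err_def field_simps)
    qed
    have "nsq k (avg s U) z = (\<Sum>w\<in>?W. (a w + err w)\<^sup>2)" by (simp add: nsq_def eq)
    also have "\<dots> \<le> (\<Sum>w\<in>?W. (a w)\<^sup>2 + 2 * P * (C w * \<eta>) + c * \<eta>\<^sup>2 * C w)"
    proof (rule sum_mono)
      fix w assume w: "w \<in> ?W"
      have "a w * err w \<le> P * (C w * \<eta>)"
      proof -
        have "\<bar>a w * err w\<bar> \<le> P * (C w * \<eta>)"
          unfolding abs_mult using aP[OF w] err[OF w] P0 by (intro mult_mono) auto
        then show ?thesis by linarith
      qed
      moreover have "(err w)\<^sup>2 \<le> c * \<eta>\<^sup>2 * C w"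
      proof -
        have "\<bar>err w\<bar> * \<bar>err w\<bar> \<le> (C w * \<eta>) * (c * \<eta>)"
          using err[OF w] Cc[OF w] C(1)[OF w] eta0 c0
          by (intro mult_mono) (auto intro: order_trans mult_right_mono)
        then show ?thesis by (simp add: power2_eq_square algebra_simps)
      qed
      ultimately show "(a w + err w)\<^sup>2 \<le> (a w)\<^sup>2 + 2 * P * (C w * \<eta>) + c * \<eta>\<^sup>2 * C w"
        by (simp add: power2_sum)
    qed
    also have "\<dots> = P\<^sup>2 + 2 * P * c * \<eta> + c\<^sup>2 * \<eta>\<^sup>2"
      unfolding P2 sum.distrib c_def
      by (simp add: sum_distrib_left sum_distrib_right power2_eq_square algebra_simps)
    also have "\<dots> \<le> K * (1 + (6 * c\<^sup>2 + 2 * c) * s\<^sup>2)"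
    proof -
      \<comment> \<open>This is the contribution of order \<open>s\<close>. The square is completed
        so that D^2 has coefficient 1 and disappears in P^2 + D^2 \<le> K; what remains carries
        s^2.\<close>
      have i1: "2 * P * c * (\<bar>s\<bar> * D) \<le> D\<^sup>2 + c\<^sup>2 * s\<^sup>2 * K"
      proof -
        have "0 \<le> (D - c * \<bar>s\<bar> * P)\<^sup>2" by simp
        then have "2 * P * c * (\<bar>s\<bar> * D) \<le> D\<^sup>2 + c\<^sup>2 * s\<^sup>2 * P\<^sup>2"
          by (simp add: power2_eq_square algebra_simps)
        also have "\<dots> \<le> D\<^sup>2 + c\<^sup>2 * s\<^sup>2 * K" using PK by (intro add_left_mono mult_left_mono) auto
        finally show ?thesis .
      qed
      have i2: "2 * P * c * (s\<^sup>2 * R) \<le> 2 * c * s\<^sup>2 * K"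
      proof -
        have "P * R \<le> K" using PR R2 P0 mult_right_mono[of P R R] by (simp add: power2_eq_square)
        then have "(2 * c * s\<^sup>2) * (P * R) \<le> (2 * c * s\<^sup>2) * K" using c0 by (intro mult_left_mono) auto
        then show ?thesis by (simp add: algebra_simps)
      qed
      have i3: "\<eta>\<^sup>2 \<le> 4 * s\<^sup>2 * K"
      proof -
        have "\<eta> \<le> \<bar>s\<bar> * R + \<bar>s\<bar> * R"
        proof -
          have "s\<^sup>2 \<le> \<bar>s\<bar>" using mult_left_le[of "\<bar>s\<bar>" "\<bar>s\<bar>"] s by (simp add: power2_eq_square)
          then show ?thesis unfolding \<eta>_def using PR P0 R2 by (intro add_mono mult_mono) auto
        qed
        then have "\<eta>\<^sup>2 \<le> (\<bar>s\<bar> * R + \<bar>s\<bar> * R)\<^sup>2" using eta0 by (intro power_mono)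
        also have "\<dots> = 4 * s\<^sup>2 * K" by (simp add: R2(1)[symmetric] power2_eq_square algebra_simps)
        finally show ?thesis .
      qed
      have "2 * P * c * \<eta> = 2 * P * c * (\<bar>s\<bar> * D) + 2 * P * c * (s\<^sup>2 * R)"
        by (simp add: \<eta>_def algebra_simps)
      moreover have "c\<^sup>2 * \<eta>\<^sup>2 \<le> c\<^sup>2 * (4 * s\<^sup>2 * K)" using i3 by (intro mult_left_mono) auto
      moreover have "0 \<le> c\<^sup>2 * s\<^sup>2 * K" using K0 by simp
      ultimately have "P\<^sup>2 + 2 * P * c * \<eta> + c\<^sup>2 * \<eta>\<^sup>2 \<le> P\<^sup>2 + D\<^sup>2 + c\<^sup>2 * s\<^sup>2 * K + 2 * c * s\<^sup>2 * K + c\<^sup>2 * (4 * s\<^sup>2 * K) + c\<^sup>2 * s\<^sup>2 * K"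
        using i1 i2 by linarith
      also have "\<dots> \<le> K + c\<^sup>2 * s\<^sup>2 * K + 2 * c * s\<^sup>2 * K + c\<^sup>2 * (4 * s\<^sup>2 * K) + c\<^sup>2 * s\<^sup>2 * K"
        using PD by linarith
      also have "\<dots> = K * (1 + (6 * c\<^sup>2 + 2 * c) * s\<^sup>2)" by (simp add: algebra_simps)
      finally show ?thesis .
    qed
    finally show ?thesis .
  qed
  moreover have "0 \<le> 6 * c\<^sup>2 + 2 * c" using c0 by simp
  ultimately show ?thesis by blast
qed

section \<open>Taylor expansion in the step size\<close>

lemma flow_has_derivative:
  assumes H: "csm B H"
  shows "((\<lambda>t. H (flow t z)) has_real_derivative
    (\<Sum>e\<in>B. (\<sigma> e z + 2 * t * b e z) * pd e H (flow t z))) (at t)"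
proof -
  have f: "((\<lambda>t. flow t z) has_derivative (\<lambda>h. \<Sum>e\<in>B. (h * (\<sigma> e z + 2 * t * b e z)) *\<^sub>R e)) (at t)"
    unfolding flow_def by (auto intro!: derivative_eq_intros sum.cong simp: fun_eq_iff algebra_simps)
  define D where "D = (\<lambda>v. pd v H (flow t z))"
  have lin: "linear D" unfolding D_def by (rule pd_linear[OF csm_differentiable[OF H]])
  have "((\<lambda>t. H (flow t z)) has_derivative (\<lambda>h. D (\<Sum>e\<in>B. (h * (\<sigma> e z + 2 * t * b e z)) *\<^sub>R e))) (at t)"
    unfolding D_def by (rule has_derivative_compose[OF f pd_unfold[OF csm_differentiable[OF H]]])
  also have "(\<lambda>h. D (\<Sum>e\<in>B. (h * (\<sigma> e z + 2 * t * b e z)) *\<^sub>R e)) =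
      (*) (\<Sum>e\<in>B. (\<sigma> e z + 2 * t * b e z) * D e)"
    using lin by (auto simp: fun_eq_iff linear_sum linear_scale sum_distrib_left sum_distrib_right mult_ac intro!: sum.cong)
  finally show ?thesis by (simp add: has_field_derivative_def D_def)
qed

lemma sum_B_bound: "(\<And>e. e \<in> B \<Longrightarrow> \<bar>f e\<bar> \<le> X) \<Longrightarrow> \<bar>\<Sum>e\<in>B. f e\<bar> \<le> card B * (X :: real)"
  using sum_norm_bound[of B f X] by (simp add: real_norm_def)

lemma coef_bound: "\<exists>M\<ge>0. \<forall>e\<in>B. \<forall>z. \<bar>\<sigma> e z\<bar> \<le> M \<and> \<bar>b e z\<bar> \<le> M"
proof -
  have "\<forall>e\<in>B. \<exists>M. \<forall>z. \<bar>\<sigma> e z\<bar> \<le> M \<and> \<bar>b e z\<bar> \<le> M"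
  proof
    fix e assume e: "e \<in> B"
    obtain M1 M2 where "\<And>z. \<bar>\<sigma> e z\<bar> \<le> M1" "\<And>z. \<bar>b e z\<bar> \<le> M2"
      using csm_bounded[OF sm_\<sigma>[OF e]] csm_bounded[OF sm_b[OF e]] by blast
    then show "\<exists>M. \<forall>z. \<bar>\<sigma> e z\<bar> \<le> M \<and> \<bar>b e z\<bar> \<le> M"
      by (intro exI[of _ "max M1 M2"]) (auto simp: le_max_iff_disj)
  qed
  from bchoice[OF this] obtain M where M: "\<And>e z. e \<in> B \<Longrightarrow> \<bar>\<sigma> e z\<bar> \<le> M e \<and> \<bar>b e z\<bar> \<le> M e" by blast
  have M0: "0 \<le> M e" if "e \<in> B" for e using M[OF that, of undefined] by linarith
  have "M e \<le> sum M B" if "e \<in> B" for e using that M0 finB by (intro member_le_sum) auto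
  then show ?thesis using M M0 by (intro exI[of _ "sum M B"]) (meson order_trans sum_nonneg)
qed

lemma abs_mult_bound: "\<bar>x\<bar> \<le> X \<Longrightarrow> \<bar>y\<bar> \<le> Y \<Longrightarrow> \<bar>x * y\<bar> \<le> X * (Y :: real)"
  unfolding abs_mult by (intro mult_mono) auto

lemma flow_pair_diff:
  "\<exists>C\<ge>0. \<forall>U K s z. csm B U \<and> bnd 1 K U \<and> \<bar>s\<bar> \<le> 1 \<longrightarrow> \<bar>U (flow s z) - U (flow (- s) z)\<bar> / 2 \<le> C * \<bar>s\<bar> * K"
proof -
  obtain M where M: "0 \<le> M" "\<And>e z. e \<in> B \<Longrightarrow> \<bar>\<sigma> e z\<bar> \<le> M" "\<And>e z. e \<in> B \<Longrightarrow> \<bar>b e z\<bar> \<le> M"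
    using coef_bound by blast
  define C where "C = card B * (3 * M)"
  have C: "0 \<le> C" using M by (simp add: C_def)
  have "\<bar>U (flow s z) - U z\<bar> \<le> C * \<bar>s\<bar> * K" if U: "csm B U" "bnd 1 K U" and s: "\<bar>s\<bar> \<le> 1" for U K s z
  proof -
    define g where "g = (\<lambda>m t. if m = (0::nat) then U (flow t z) else (\<Sum>e\<in>B. (\<sigma> e z + 2 * t * b e z) * pd e U (flow t z)))"
    have "\<exists>t. \<bar>t\<bar> \<le> \<bar>s\<bar> \<and> U (flow s z) = (\<Sum>m<1. g m 0 / fact m * s ^ m) + g 1 t / fact 1 * s ^ 1"
      by (rule Maclaurin_bi_le) (use flow_has_derivative[OF U(1)] in \<open>auto simp: g_def\<close>)
    then obtain t where t: "\<bar>t\<bar> \<le> \<bar>s\<bar>" "U (flow s z) = U z + (\<Sum>e\<in>B. (\<sigma> e z + 2 * t * b e z) * pd e U (flow t z)) * s"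
      by (auto simp: g_def)
    have "\<bar>\<Sum>e\<in>B. (\<sigma> e z + 2 * t * b e z) * pd e U (flow t z)\<bar> \<le> card B * (3 * M * K)"
    proof (rule sum_B_bound, rule abs_mult_bound)
      fix e assume e: "e \<in> B"
      have "\<bar>t * b e z\<bar> \<le> 1 * M" using t s M e by (intro abs_mult_bound) auto
      then show "\<bar>\<sigma> e z + 2 * t * b e z\<bar> \<le> 3 * M" using M(2)[OF e, of z] by (auto simp: abs_if split: if_splits)
      have "[e] \<in> words B 1" using e by (auto simp: words_def)
      then have "\<bar>pdw [e] U (flow t z)\<bar> \<le> K" using U(2) unfolding bnd_def by blast
      then show "\<bar>pd e U (flow t z)\<bar> \<le> K" by simp
    qed
    then have "\<bar>(\<Sum>e\<in>B. (\<sigma> e z + 2 * t * b e z) * pd e U (flow t z)) * s\<bar> \<le> card B * (3 * M * K) * \<bar>s\<bar>"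
      by (intro abs_mult_bound) auto
    then show ?thesis using t(2) by (simp add: C_def algebra_simps)
  qed
  note * = this
  have "\<bar>U (flow s z) - U (flow (- s) z)\<bar> / 2 \<le> C * \<bar>s\<bar> * K" if U: "csm B U" "bnd 1 K U" and s: "\<bar>s\<bar> \<le> 1" for U K s z
  proof -
    define X where "X = C * \<bar>s\<bar> * K"
    have d: "\<bar>U (flow (- s) z) - U z\<bar> \<le> X" "\<bar>U (flow s z) - U z\<bar> \<le> X"
      using *[OF U, of "- s" z] *[OF U s, of z] s by (simp_all add: X_def)
    have "\<bar>(U (flow s z) - U z) - (U (flow (- s) z) - U z)\<bar> \<le> X + X"
      by (rule order_trans[OF abs_triangle_ineq4 add_mono[OF d(2) d(1)]])
    then show ?thesis unfolding X_def[symmetric] by simp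
  qed
  then show ?thesis using C by blast
qed

text \<open>Taylor expansion of \<open>U (flow t z)\<close> in \<open>t\<close>: averaging over
  \<open>s\<close> and \<open>- s\<close> removes the term of first order, and half of the second
  derivative at 0 is \<open>gen U z\<close>, where for the drift the factor 2 from differentiating
  t^2 cancels this half.\<close>

lemma avg_taylor:
  "\<exists>C\<ge>0. \<forall>U K s z. csm B U \<and> bnd 3 K U \<and> \<bar>s\<bar> \<le> 1 \<longrightarrow> \<bar>avg s U z - U z - s\<^sup>2 * gen U z\<bar> \<le> C * \<bar>s\<bar> ^ 3 * K"
proof -
  obtain M where M: "0 \<le> M" "\<And>e z. e \<in> B \<Longrightarrow> \<bar>\<sigma> e z\<bar> \<le> M" "\<And>e z. e \<in> B \<Longrightarrow> \<bar>b e z\<bar> \<le> M"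
    using coef_bound by blast
  define n where "n = real (card B)"
  define C where "C = n * (2 * M * (n * (3 * M)) + n * ((2 * M * (3 * M) + 3 * M * (2 * M)) + 3 * M * (3 * M) * (n * (3 * M))))"
  have n0: "0 \<le> n" by (simp add: n_def)
  have C: "0 \<le> C" using M n0 by (simp add: C_def)
  have T: "\<bar>U (flow s z) - U z - s * (\<Sum>e\<in>B. \<sigma> e z * pd e U z) - s\<^sup>2 * gen U z\<bar> \<le> C * \<bar>s\<bar> ^ 3 * K"
    if U: "csm B U" "bnd 3 K U" and s: "\<bar>s\<bar> \<le> 1" for U K s z
  proof -
    define c where "c = (\<lambda>e t. \<sigma> e z + 2 * t * b e z)"
    define u1 where "u1 = (\<lambda>e t. pd e U (flow t z))"
    define u2 where "u2 = (\<lambda>e' e t. pd e' (pd e U) (flow t z))"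
    define u3 where "u3 = (\<lambda>e'' e' e t. pd e'' (pd e' (pd e U)) (flow t z))"
    \<comment> \<open>The derivatives of orders 0 to 3 as one function of the order, in the form
      that Taylor's theorem expects; beyond order 3 the value is merely repeated.\<close>
    define f where "f = rec_nat (\<lambda>t. U (flow t z)) (\<lambda>m _. rec_nat (\<lambda>t. \<Sum>e\<in>B. c e t * u1 e t)
      (\<lambda>m _. rec_nat (\<lambda>t. \<Sum>e\<in>B. 2 * b e z * u1 e t + c e t * (\<Sum>e'\<in>B. c e' t * u2 e' e t))
      (\<lambda>m _ t. \<Sum>e\<in>B. 2 * b e z * (\<Sum>e'\<in>B. c e' t * u2 e' e t) +
         (2 * b e z * (\<Sum>e'\<in>B. c e' t * u2 e' e t) +
          c e t * (\<Sum>e'\<in>B. 2 * b e' z * u2 e' e t + c e' t * (\<Sum>e''\<in>B. c e'' t * u3 e'' e' e t)))) m) m)"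
    have f: "f 0 = (\<lambda>t. U (flow t z))" "f 1 = (\<lambda>t. \<Sum>e\<in>B. c e t * u1 e t)"
      "f 2 = (\<lambda>t. \<Sum>e\<in>B. 2 * b e z * u1 e t + c e t * (\<Sum>e'\<in>B. c e' t * u2 e' e t))"
      "f 3 = (\<lambda>t. \<Sum>e\<in>B. 2 * b e z * (\<Sum>e'\<in>B. c e' t * u2 e' e t) +
         (2 * b e z * (\<Sum>e'\<in>B. c e' t * u2 e' e t) +
          c e t * (\<Sum>e'\<in>B. 2 * b e' z * u2 e' e t + c e' t * (\<Sum>e''\<in>B. c e'' t * u3 e'' e' e t))))"
      by (simp_all add: f_def numeral_2_eq_2 numeral_3_eq_3)
    have dc: "(c e has_real_derivative 2 * b e z) (at t)" for e t
      unfolding c_def by (auto intro!: derivative_eq_intros)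
    have d1: "(u1 e has_real_derivative (\<Sum>e'\<in>B. c e' t * u2 e' e t)) (at t)" if "e \<in> B" for e t
      unfolding u1_def u2_def c_def by (rule flow_has_derivative[OF csm_pd[OF U(1) that]])
    have d2: "(u2 e' e has_real_derivative (\<Sum>e''\<in>B. c e'' t * u3 e'' e' e t)) (at t)" if "e \<in> B" "e' \<in> B" for e e' t
      unfolding u2_def u3_def c_def by (rule flow_has_derivative[OF csm_pd[OF csm_pd[OF U(1) that(1)] that(2)]])
    have D: "(f m has_real_derivative f (Suc m) t) (at t)" if m3: "m < 3" for m t
    proof -
      consider "m = 0" | "m = 1" | "m = 2" using m3 by linarith
      then show ?thesis
      proof cases
        case 1
        have "((\<lambda>t. U (flow t z)) has_real_derivative (\<Sum>e\<in>B. c e t * u1 e t)) (at t)"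
          unfolding c_def u1_def by (rule flow_has_derivative[OF U(1)])
        then show ?thesis using 1 f by simp
      next
        case 2
        have "((\<lambda>t. \<Sum>e\<in>B. c e t * u1 e t) has_real_derivative
          (\<Sum>e\<in>B. 2 * b e z * u1 e t + c e t * (\<Sum>e'\<in>B. c e' t * u2 e' e t))) (at t)"
          by (rule DERIV_sum) (auto intro!: derivative_eq_intros dc d1)
        then show ?thesis using 2 f by (simp add: numeral_2_eq_2)
      next
        case 3
        have "((\<lambda>t. \<Sum>e\<in>B. 2 * b e z * u1 e t + c e t * (\<Sum>e'\<in>B. c e' t * u2 e' e t)) has_real_derivative
          (\<Sum>e\<in>B. 2 * b e z * (\<Sum>e'\<in>B. c e' t * u2 e' e t) +
         (2 * b e z * (\<Sum>e'\<in>B. c e' t * u2 e' e t) +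
          c e t * (\<Sum>e'\<in>B. 2 * b e' z * u2 e' e t + c e' t * (\<Sum>e''\<in>B. c e'' t * u3 e'' e' e t))))) (at t)"
        proof (rule DERIV_sum)
          fix e assume e: "e \<in> B"
          have "((\<lambda>t. \<Sum>e'\<in>B. c e' t * u2 e' e t) has_real_derivative
             (\<Sum>e'\<in>B. 2 * b e' z * u2 e' e t + c e' t * (\<Sum>e''\<in>B. c e'' t * u3 e'' e' e t))) (at t)"
            using e by (intro DERIV_sum) (auto intro!: derivative_eq_intros dc d2)
          note this' = DERIV_mult'[OF dc[of e t] this]
          show "((\<lambda>t. 2 * b e z * u1 e t + c e t * (\<Sum>e'\<in>B. c e' t * u2 e' e t)) has_real_derivative
            2 * b e z * (\<Sum>e'\<in>B. c e' t * u2 e' e t) +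
         (2 * b e z * (\<Sum>e'\<in>B. c e' t * u2 e' e t) +
          c e t * (\<Sum>e'\<in>B. 2 * b e' z * u2 e' e t + c e' t * (\<Sum>e''\<in>B. c e'' t * u3 e'' e' e t)))) (at t)"
            using DERIV_add[OF DERIV_cmult[OF d1[OF e, of t], of "2 * b e z"] this'] by (simp add: add.commute)
        qed
        then show ?thesis using 3 f by (simp add: eval_nat_numeral)
      qed
    qed
    obtain t where t: "\<bar>t\<bar> \<le> \<bar>s\<bar>" "U (flow s z) = (\<Sum>m<3. f m 0 / fact m * s ^ m) + f 3 t / fact 3 * s ^ 3"
      using Maclaurin_bi_le[of f "\<lambda>t. U (flow t z)" 3 s] f(1) D by blast
    have K0: "0 \<le> K" by (rule bnd_nonneg[OF U(2)])
    have bc: "\<bar>c e t\<bar> \<le> 3 * M" if e: "e \<in> B" for e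
    proof -
      have "\<bar>t * b e z\<bar> \<le> 1 * M" using t s M e by (intro abs_mult_bound) auto
      then show ?thesis using M(2)[OF e, of z] by (auto simp: c_def abs_if split: if_splits)
    qed
    have b2: "\<bar>u2 e' e t\<bar> \<le> K" if "e \<in> B" "e' \<in> B" for e e'
    proof -
      have "[e', e] \<in> words B 3" using that by (auto simp: words_def)
      then have "\<bar>pdw [e', e] U (flow t z)\<bar> \<le> K" using U(2) unfolding bnd_def by blast
      then show ?thesis by (simp add: u2_def)
    qed
    have b3: "\<bar>u3 e'' e' e t\<bar> \<le> K" if "e \<in> B" "e' \<in> B" "e'' \<in> B" for e e' e''
    proof -
      have "[e'', e', e] \<in> words B 3" using that by (auto simp: words_def)
      then have "\<bar>pdw [e'', e', e] U (flow t z)\<bar> \<le> K" using U(2) unfolding bnd_def by blast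
      then show ?thesis by (simp add: u3_def)
    qed
    have bb: "\<bar>2 * b e z\<bar> \<le> 2 * M" if "e \<in> B" for e using M(3)[OF that, of z] by simp
    have s2: "\<bar>\<Sum>e'\<in>B. c e' t * u2 e' e t\<bar> \<le> n * (3 * M * K)" if "e \<in> B" for e
      unfolding n_def using that by (intro sum_B_bound abs_mult_bound bc b2)
    have "\<bar>f 3 t\<bar> \<le> n * (2 * M * (n * (3 * M * K)) + (2 * M * (n * (3 * M * K)) +
        3 * M * (n * (2 * M * K + 3 * M * (n * (3 * M * K))))))"
      unfolding f(4) unfolding n_def
      by (intro sum_B_bound order_trans[OF abs_triangle_ineq] add_mono abs_mult_bound bc bb s2[unfolded n_def] b2 b3)
    also have "\<dots> = C * K" by (simp add: C_def algebra_simps)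
    finally have f3: "\<bar>f 3 t\<bar> \<le> C * K" .
    have "\<bar>f 3 t / fact 3 * s ^ 3\<bar> = \<bar>f 3 t\<bar> * \<bar>s\<bar> ^ 3 / 6"
      by (simp add: abs_mult power_abs fact_numeral)
    also have "\<dots> \<le> \<bar>f 3 t\<bar> * \<bar>s\<bar> ^ 3" by simp
    also have "\<dots> \<le> C * K * \<bar>s\<bar> ^ 3" using f3 by (intro mult_right_mono) auto
    finally have R: "\<bar>f 3 t / fact 3 * s ^ 3\<bar> \<le> C * \<bar>s\<bar> ^ 3 * K" by (simp add: mult_ac)
    have "gen U z = f 2 0 / 2"
      unfolding gen_def f by (simp add: c_def u1_def u2_def sum.distrib sum_distrib_left field_simps)
    moreover have "(\<Sum>e\<in>B. \<sigma> e z * pd e U z) = f 1 0" unfolding f by (simp add: c_def u1_def)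
    moreover have "(\<Sum>m<3. f m 0 / fact m * s ^ m) = U z + f 1 0 * s + f 2 0 / 2 * s\<^sup>2"
      by (simp add: eval_nat_numeral f(1))
    ultimately have "U (flow s z) - U z - s * (\<Sum>e\<in>B. \<sigma> e z * pd e U z) - s\<^sup>2 * gen U z = f 3 t / fact 3 * s ^ 3"
      using t(2) by simp
    then show ?thesis using R by simp
  qed
  have "\<bar>avg s U z - U z - s\<^sup>2 * gen U z\<bar> \<le> C * \<bar>s\<bar> ^ 3 * K"
    if U: "csm B U" "bnd 3 K U" and s: "\<bar>s\<bar> \<le> 1" for U K s z
  proof -
    let ?A = "\<lambda>s. U (flow s z) - U z - s * (\<Sum>e\<in>B. \<sigma> e z * pd e U z) - s\<^sup>2 * gen U z"
    have "avg s U z - U z - s\<^sup>2 * gen U z = (?A s + ?A (- s)) / 2"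
      by (simp add: avg_def field_simps)
    moreover have A: "\<bar>?A s\<bar> \<le> C * \<bar>s\<bar> ^ 3 * K" "\<bar>?A (- s)\<bar> \<le> C * \<bar>s\<bar> ^ 3 * K"
      using T[OF U s, of z] T[OF U, of "- s" z] s by auto
    moreover have "\<bar>?A s + ?A (- s)\<bar> \<le> C * \<bar>s\<bar> ^ 3 * K + C * \<bar>s\<bar> ^ 3 * K"
      by (rule order_trans[OF abs_triangle_ineq add_mono[OF A]])
    ultimately show ?thesis by simp
  qed
  then show ?thesis using C by blast
qed

text \<open>\<open>flow 0\<close> is the identity and 0 ^ 0 = 1, so at s = 0 an \<open>expr\<close>
  with all exponents 0 is a differential operator. In this way the differentiation rules for
  \<open>expr\<close> become available for \<open>gen\<close>.\<close>

lemma gen_expr: "\<exists>xs. wf_expr 0 2 xs \<and> (\<forall>U. csm B U \<longrightarrow> gen U = expr xs 0 U)"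
proof -
  let ?x = "\<lambda>i. (0 :: nat, \<lambda>z. (1 / 2) * (\<sigma> (fst i) z * \<sigma> (snd i) z), [snd i, fst i])"
  obtain xs1 where xs1: "set xs1 = ?x ` (B \<times> B)" "\<And>s U z. expr xs1 s U z = (\<Sum>i\<in>B \<times> B. expr [?x i] s U z)"
    using expr_sum[of "B \<times> B" ?x] finB by blast
  let ?y = "\<lambda>e. (0 :: nat, b e, [e])"
  obtain xs2 where xs2: "set xs2 = ?y ` B" "\<And>s U z. expr xs2 s U z = (\<Sum>i\<in>B. expr [?y i] s U z)"
    using expr_sum[of B ?y] finB by blast
  have "wf_expr 0 2 (xs1 @ xs2)"
    by (auto simp: wf_expr_def xs1 xs2 words_def intro!: csm_cmult csm_mult sm_\<sigma> sm_b simp del: times_divide_eq_left)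
  moreover have "gen U = expr (xs1 @ xs2) 0 U" for U
    by (simp add: fun_eq_iff gen_def expr_append xs1(2) xs2(2) expr_Cons sum.cartesian_product'
        sum_divide_distrib mult_ac)
  ultimately show ?thesis by blast
qed

lemma pdw_expr:
  "set w \<subseteq> B \<Longrightarrow> wf_expr m d xs \<Longrightarrow> \<exists>ys. wf_expr m (length w + d) ys \<and> (\<forall>U s. csm B U \<longrightarrow> pdw w (expr xs s U) = expr ys s U)"
proof (induction w)
  case (Cons v w)
  then obtain ys where ys: "wf_expr m (length w + d) ys" "\<And>U s. csm B U \<Longrightarrow> pdw w (expr xs s U) = expr ys s U" by auto
  obtain zs where zs: "wf_expr m (Suc (length w + d)) zs" "\<And>U s. csm B U \<Longrightarrow> pd v (expr ys s U) = expr zs s U"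
    using pd_expr[OF _ ys(1), of v] Cons.prems by auto
  show ?case using ys zs by (intro exI[of _ zs]) auto
qed auto

lemma pdw_gen_bound:
  assumes "set w \<subseteq> B"
  shows "\<exists>C\<ge>0. \<forall>U K z. csm B U \<and> bnd (length w + 2) K U \<longrightarrow> \<bar>pdw w (gen U) z\<bar> \<le> C * K"
proof -
  obtain xs where xs: "wf_expr 0 2 xs" "\<And>U. csm B U \<Longrightarrow> gen U = expr xs 0 U" using gen_expr by blast
  obtain ys where ys: "wf_expr 0 (length w + 2) ys" "\<And>U s. csm B U \<Longrightarrow> pdw w (expr xs s U) = expr ys s U"
    using pdw_expr[OF assms xs(1)] by blast
  obtain C where "0 \<le> C" "\<And>U K s z. bnd (length w + 2) K U \<Longrightarrow> \<bar>s\<bar> \<le> 1 \<Longrightarrow> \<bar>expr ys s U z\<bar> \<le> C * \<bar>s\<bar> ^ 0 * K"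
    using expr_bound[OF ys(1)] by blast
  from this(1) this(2)[where s = 0] show ?thesis using xs(2) ys(2) by (intro exI[of _ C]) auto
qed

text \<open>Differentiation and averaging commute up to the terms treated in
  \<open>expr_pair_bound\<close>. The differences occurring there are of order \<open>s\<close> by
  \<open>flow_pair_diff\<close>, so these terms are of order s^2. What is left is the effect of
  averaging on H = pdw w U, of order s^2 by \<open>avg_taylor\<close> at the price of three more
  derivatives.\<close>

lemma pdw_avg_diff:
  assumes w: "set w \<subseteq> B"
  shows "\<exists>C\<ge>0. \<forall>U K s z. csm B U \<and> bnd (length w + 3) K U \<and> \<bar>s\<bar> \<le> 1 \<longrightarrow>
    \<bar>pdw w (avg s U) z - pdw w U z\<bar> \<le> C * s\<^sup>2 * K"
proof -
  have wW: "w \<in> words B (length w)" using w by (auto simp: words_def)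
  obtain xs where xs: "wf_expr 1 (length w) xs" "\<And>U s z. csm B U \<Longrightarrow>
      pdw w (\<lambda>z. U (flow s z)) z = pdw w U (flow s z) + expr xs s U z"
    using pdw_flow[OF wW] by blast
  obtain C1 where C1: "0 \<le> C1" "\<And>U K D s z. bnd (length w) K U \<Longrightarrow> \<bar>s\<bar> \<le> 1 \<Longrightarrow> 0 \<le> D \<Longrightarrow>
    (\<forall>w\<in>words B (length w). \<bar>pdw w U (flow s z) - pdw w U (flow (- s) z)\<bar> / 2 \<le> D) \<Longrightarrow>
    \<bar>expr xs s U z + expr xs (- s) U z\<bar> / 2 \<le> C1 * (\<bar>s\<bar> * D + s\<^sup>2 * K)"
    using expr_pair_bound[OF xs(1)] by blast
  obtain C2 where C2: "0 \<le> C2" "\<And>U K s z. csm B U \<Longrightarrow> bnd 1 K U \<Longrightarrow> \<bar>s\<bar> \<le> 1 \<Longrightarrow>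
     \<bar>U (flow s z) - U (flow (- s) z)\<bar> / 2 \<le> C2 * \<bar>s\<bar> * K"
    using flow_pair_diff by blast
  obtain C3 where C3: "0 \<le> C3" "\<And>U K s z. csm B U \<Longrightarrow> bnd 3 K U \<Longrightarrow> \<bar>s\<bar> \<le> 1 \<Longrightarrow>
     \<bar>avg s U z - U z - s\<^sup>2 * gen U z\<bar> \<le> C3 * \<bar>s\<bar> ^ 3 * K"
    using avg_taylor by blast
  obtain C4 where C4: "0 \<le> C4" "\<And>U K z. csm B U \<Longrightarrow> bnd 2 K U \<Longrightarrow> \<bar>gen U z\<bar> \<le> C4 * K"
    using pdw_gen_bound[of "[]"] by (auto simp: numeral_2_eq_2)
  define C where "C = C3 + C4 + C1 * (C2 + 1)"
  have "\<bar>pdw w (avg s U) z - pdw w U z\<bar> \<le> C * s\<^sup>2 * K"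
    if U: "csm B U" "bnd (length w + 3) K U" and s: "\<bar>s\<bar> \<le> 1" for U K s z
  proof -
    define H where "H = pdw w U"
    have H: "csm B H" "bnd 3 K H" unfolding H_def using U w by (auto intro: csm_pdw bnd_pdw simp: add.commute)
    have K0: "0 \<le> K" by (rule bnd_nonneg[OF U(2)])
    have eq: "pdw w (avg s U) z - pdw w U z = (avg s H z - H z - s\<^sup>2 * gen H z) + s\<^sup>2 * gen H z + (expr xs s U z + expr xs (- s) U z) / 2"
    proof -
      have "pdw w (avg s U) z = ((H (flow s z) + expr xs s U z) + (H (flow (- s) z) + expr xs (- s) U z)) / 2"
        unfolding pdw_avg[OF U(1) w] xs(2)[OF U(1)] H_def ..
      then show ?thesis by (simp add: H_def avg_def field_simps)
    qed
    have "\<bar>s\<bar> ^ 3 \<le> \<bar>s\<bar> ^ 2" using s by (intro power_decreasing) auto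
    then have "C3 * \<bar>s\<bar> ^ 3 * K \<le> C3 * \<bar>s\<bar> ^ 2 * K" using C3 K0 by (intro mult_right_mono mult_left_mono) auto
    then have e1: "\<bar>avg s H z - H z - s\<^sup>2 * gen H z\<bar> \<le> C3 * s\<^sup>2 * K"
      using C3(2)[OF H s, of z] by simp
    have "\<bar>gen H z\<bar> \<le> C4 * K" using C4(2)[OF H(1)] bnd_mono[OF H(2), of 2] by simp
    then have e2: "\<bar>s\<^sup>2 * gen H z\<bar> \<le> C4 * s\<^sup>2 * K"
      using mult_left_mono[of "\<bar>gen H z\<bar>" "C4 * K" "s\<^sup>2"] by (simp add: abs_mult mult_ac)
    have "\<forall>v\<in>words B (length w). \<bar>pdw v U (flow s z) - pdw v U (flow (- s) z)\<bar> / 2 \<le> C2 * \<bar>s\<bar> * K"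
    proof
      fix v assume v: "v \<in> words B (length w)"
      then have "bnd (1 + length v) K U" by (intro bnd_mono[OF U(2)]) (auto simp: words_def)
      then have "bnd 1 K (pdw v U)" "csm B (pdw v U)" using v U by (auto simp: words_def intro: bnd_pdw csm_pdw)
      then show "\<bar>pdw v U (flow s z) - pdw v U (flow (- s) z)\<bar> / 2 \<le> C2 * \<bar>s\<bar> * K"
        using C2(2) s by blast
    qed
    then have "\<bar>expr xs s U z + expr xs (- s) U z\<bar> / 2 \<le> C1 * (\<bar>s\<bar> * (C2 * \<bar>s\<bar> * K) + s\<^sup>2 * K)"
      using C1(2)[OF bnd_mono[OF U(2)] s, of "C2 * \<bar>s\<bar> * K" z] C2(1) K0 by simp
    also have "\<dots> = C1 * (C2 + 1) * s\<^sup>2 * K" by (simp add: power2_eq_square algebra_simps abs_mult_self_eq)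
    finally have e3: "\<bar>(expr xs s U z + expr xs (- s) U z) / 2\<bar> \<le> C1 * (C2 + 1) * s\<^sup>2 * K" by simp
    have "\<bar>pdw w (avg s U) z - pdw w U z\<bar> \<le> C3 * s\<^sup>2 * K + C4 * s\<^sup>2 * K + C1 * (C2 + 1) * s\<^sup>2 * K"
      unfolding eq using e1 e2 e3 by linarith
    then show ?thesis by (simp add: C_def algebra_simps)
  qed
  moreover have "0 \<le> C" using C1 C2 C3 C4 by (simp add: C_def)
  ultimately show ?thesis by blast
qed

end

section \<open>Approximate resolvents from random walks\<close>

text \<open>The constants of finitely many indices are replaced by their sum. \<open>x\<close> will
  be the tuple of all remaining variables, so that the lemma serves estimates of various
  shapes.\<close>

lemma uniform_const:
  fixes f :: "'w \<Rightarrow> 'x \<Rightarrow> real"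
  assumes "finite W" and ex: "\<And>w. w \<in> W \<Longrightarrow> \<exists>C\<ge>0. \<forall>x. Q w x \<longrightarrow> f w x \<le> C * g x"
    and g: "\<And>w x. w \<in> W \<Longrightarrow> Q w x \<Longrightarrow> 0 \<le> g x"
  shows "\<exists>C\<ge>0. \<forall>w\<in>W. \<forall>x. Q w x \<longrightarrow> f w x \<le> C * g x"
proof -
  have "\<forall>w\<in>W. \<exists>C. 0 \<le> C \<and> (\<forall>x. Q w x \<longrightarrow> f w x \<le> C * g x)" using ex by blast
  from bchoice[OF this] obtain C where C: "\<And>w. w \<in> W \<Longrightarrow> 0 \<le> C w" "\<And>w x. w \<in> W \<Longrightarrow> Q w x \<Longrightarrow> f w x \<le> C w * g x"
    by blast
  have "f w x \<le> sum C W * g x" if "w \<in> W" "Q w x" for w x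
  proof -
    have "C w \<le> sum C W" using that C(1) assms(1) by (intro member_le_sum) auto
    then have "C w * g x \<le> sum C W * g x" using g[OF that] by (rule mult_right_mono)
    then show ?thesis using C(2)[OF that] by linarith
  qed
  then show ?thesis using C(1) by (intro exI[of _ "sum C W"]) (auto intro: sum_nonneg)
qed

text \<open>Landau's inequality, from a second-order Taylor expansion along \<open>e\<close> with a
  free step \<open>t\<close>. It is meant for a function of order s with second derivatives of order
  1: the choice t = sqrt s makes the first derivatives of order sqrt s.\<close>

lemma interpolation:
  assumes R: "csm B R" "e \<in> B" and a: "\<And>z. \<bar>R z\<bar> \<le> a" and b: "\<And>z. \<bar>pd e (pd e R) z\<bar> \<le> b" and t: "0 < t"
  shows "\<bar>pd e R z\<bar> \<le> 2 * a / t + b * t / 2"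
proof -
  have d: "((\<lambda>h. H (z + h *\<^sub>R e)) has_real_derivative pd e H (z + h *\<^sub>R e)) (at h)" if "csm B H" for H h
  proof -
    have f: "((\<lambda>h. z + h *\<^sub>R e) has_derivative (\<lambda>k. k *\<^sub>R e)) (at h)" by (auto intro!: derivative_eq_intros)
    define D where "D = (\<lambda>v. pd v H (z + h *\<^sub>R e))"
    have lin: "linear D" unfolding D_def by (rule pd_linear[OF csm_differentiable[OF that]])
    have "((\<lambda>h. H (z + h *\<^sub>R e)) has_derivative (\<lambda>k. D (k *\<^sub>R e))) (at h)"
      unfolding D_def by (rule has_derivative_compose[OF f pd_unfold[OF csm_differentiable[OF that]]])
    also have "(\<lambda>k. D (k *\<^sub>R e)) = (*) (D e)" using lin by (auto simp: fun_eq_iff linear_scale)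
    finally show ?thesis by (simp add: has_field_derivative_def D_def)
  qed
  define f where "f = (\<lambda>m h. (if m = (0::nat) then R else if m = 1 then pd e R else pd e (pd e R)) (z + h *\<^sub>R e))"
  have "\<exists>u. \<bar>u\<bar> \<le> \<bar>t\<bar> \<and> R (z + t *\<^sub>R e) = (\<Sum>m<2. f m 0 / fact m * t ^ m) + f 2 u / fact 2 * t ^ 2"
    by (rule Maclaurin_bi_le) (use d[OF R(1)] d[OF csm_pd[OF R]] in \<open>auto simp: f_def less_2_cases_iff\<close>)
  then obtain u where u: "R (z + t *\<^sub>R e) = R z + pd e R z * t + pd e (pd e R) (z + u *\<^sub>R e) / 2 * t\<^sup>2"
    by (auto simp: f_def numeral_2_eq_2)
  have "\<bar>pd e R z\<bar> * t = \<bar>R (z + t *\<^sub>R e) - R z - pd e (pd e R) (z + u *\<^sub>R e) / 2 * t\<^sup>2\<bar>"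
    using u t by (simp add: abs_mult[symmetric] abs_of_pos del: abs_mult) (simp add: abs_mult)
  also have "\<dots> \<le> \<bar>R (z + t *\<^sub>R e)\<bar> + \<bar>R z\<bar> + \<bar>pd e (pd e R) (z + u *\<^sub>R e) / 2 * t\<^sup>2\<bar>"
    by (intro order_trans[OF abs_triangle_ineq4] add_mono) auto
  also have "\<bar>pd e (pd e R) (z + u *\<^sub>R e) / 2 * t\<^sup>2\<bar> = \<bar>pd e (pd e R) (z + u *\<^sub>R e)\<bar> / 2 * t\<^sup>2"
    by (simp add: abs_mult)
  also have "\<dots> \<le> b / 2 * t\<^sup>2" using b by (intro mult_right_mono divide_right_mono) auto
  finally have "\<bar>pd e R z\<bar> * t \<le> a + a + b / 2 * t\<^sup>2" using a[of z] a[of "z + t *\<^sub>R e"] by linarith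
  then have "\<bar>pd e R z\<bar> \<le> (a + a + b / 2 * t\<^sup>2) / t" using t by (simp add: pos_le_divide_eq)
  also have "\<dots> = 2 * a / t + b * t / 2" using t by (simp add: power2_eq_square field_simps)
  finally show ?thesis .
qed

locale walk =
  fixes B :: "'e::real_normed_vector set" and I :: "'i set" and \<sigma> b :: "'i \<Rightarrow> 'e \<Rightarrow> 'e \<Rightarrow> real"
  assumes finI: "finite I" and neI: "I \<noteq> {}"
    and ws: "\<And>i. i \<in> I \<Longrightarrow> walk_step B (\<sigma> i) (b i)"
begin

lemma finB: "finite B"
  using neI ws walk_step.finB by blast

abbreviation bnd where "bnd \<equiv> walk_step.bnd B"
abbreviation nsq where "nsq \<equiv> walk_step.nsq B"
abbreviation avg where "avg i \<equiv> walk_step.avg B (\<sigma> i) (b i)"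
abbreviation gen where "gen i \<equiv> walk_step.gen B (\<sigma> i) (b i)"

definition S :: "real \<Rightarrow> ('e \<Rightarrow> real) \<Rightarrow> 'e \<Rightarrow> real" where
  "S s U z = 1 / card I * (\<Sum>i\<in>I. avg i s U z)"

definition A :: "('e \<Rightarrow> real) \<Rightarrow> 'e \<Rightarrow> real" where
  "A U z = 1 / card I * (\<Sum>i\<in>I. gen i U z)"

lemma cardI: "1 \<le> real (card I)"
  using finI neI by (simp add: Suc_le_eq card_gt_0_iff)

lemma csm_S: "csm B U \<Longrightarrow> csm B (S s U)"
  unfolding S_def[abs_def] by (intro csm_cmult csm_sum walk_step.csm_avg[OF ws])

lemma csm_A: "csm B U \<Longrightarrow> csm B (A U)"
  unfolding A_def[abs_def] by (intro csm_cmult csm_sum walk_step.csm_gen[OF ws])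

lemma pdw_S: "csm B U \<Longrightarrow> set w \<subseteq> B \<Longrightarrow> pdw w (S s U) z = 1 / card I * (\<Sum>i\<in>I. pdw w (avg i s U) z)"
  unfolding S_def[abs_def]
  using walk_step.csm_avg[OF ws, of _ U s]
  by (subst pdw_cmult[of B]) (auto intro: csm_sum simp: pdw_sum[of I B])

lemma pdw_A: "csm B U \<Longrightarrow> set w \<subseteq> B \<Longrightarrow> pdw w (A U) z = 1 / card I * (\<Sum>i\<in>I. pdw w (gen i U) z)"
  unfolding A_def[abs_def]
  using walk_step.csm_gen[OF ws, of _ U]
  by (subst pdw_cmult[of B]) (auto intro: csm_sum simp: pdw_sum[of I B])

lemma mean_bound:
  assumes "\<And>i. i \<in> I \<Longrightarrow> \<bar>x i\<bar> \<le> X"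
  shows "\<bar>1 / card I * (\<Sum>i\<in>I. x i)\<bar> \<le> X"
proof -
  have "\<bar>\<Sum>i\<in>I. x i\<bar> \<le> card I * X" using sum_norm_bound[of I x X] assms by simp
  then show ?thesis using cardI by (simp add: abs_mult field_simps)
qed

lemma mean_eq_const: "1 / card I * (\<Sum>i\<in>I. (c::real)) = c"
  using cardI by simp

text \<open>Squaring is convex, so averaging over \<open>I\<close> preserves the common bound for
  the single steps.\<close>

lemma S_growth:
  "\<exists>C\<ge>0. \<forall>U s K. csm B U \<and> \<bar>s\<bar> \<le> 1 \<and> (\<forall>z. nsq k U z \<le> K) \<longrightarrow> (\<forall>z. nsq k (S s U) z \<le> K * (1 + C * s\<^sup>2))"
proof -
  have "\<exists>C\<ge>0. \<forall>i\<in>I. \<forall>x. (case x of (U, s, K, z) \<Rightarrow> csm B U \<and> \<bar>s\<bar> \<le> 1 \<and> 0 \<le> K \<and> (\<forall>z. nsq k U z \<le> K)) \<longrightarrow>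
     (case x of (U, s, K, z) \<Rightarrow> nsq k (avg i s U) z - K) \<le> C * (case x of (U, s, K, z) \<Rightarrow> K * s\<^sup>2)"
  proof (rule uniform_const[OF finI])
    fix i assume i: "i \<in> I"
    obtain C where "0 \<le> C" "\<And>U s K z. csm B U \<Longrightarrow> \<bar>s\<bar> \<le> 1 \<Longrightarrow> (\<forall>z. nsq k U z \<le> K) \<Longrightarrow> nsq k (avg i s U) z \<le> K * (1 + C * s\<^sup>2)"
      using walk_step.avg_growth[OF ws[OF i], of k] by blast
    then show "\<exists>C\<ge>0. \<forall>x. (case x of (U, s, K, z) \<Rightarrow> csm B U \<and> \<bar>s\<bar> \<le> 1 \<and> 0 \<le> K \<and> (\<forall>z. nsq k U z \<le> K)) \<longrightarrow>
     (case x of (U, s, K, z) \<Rightarrow> nsq k (avg i s U) z - K) \<le> C * (case x of (U, s, K, z) \<Rightarrow> K * s\<^sup>2)"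
      by (intro exI[of _ C]) (auto simp: algebra_simps)
  qed (auto split: prod.splits)
  then obtain C where C: "0 \<le> C" "\<And>i U s K z. i \<in> I \<Longrightarrow> csm B U \<Longrightarrow> \<bar>s\<bar> \<le> 1 \<Longrightarrow> 0 \<le> K \<Longrightarrow> (\<forall>z. nsq k U z \<le> K) \<Longrightarrow>
     nsq k (avg i s U) z - K \<le> C * (K * s\<^sup>2)"
    by (auto simp: split_paired_all)
  obtain i0 where i0: "i0 \<in> I" using neI by blast
  have nsq_def: "nsq k U z = (\<Sum>w\<in>words B k. (pdw w U z)\<^sup>2)" for U z by (rule walk_step.nsq_def[OF ws[OF i0]])
  have "nsq k (S s U) z \<le> K * (1 + C * s\<^sup>2)" if U: "csm B U" "\<bar>s\<bar> \<le> 1" "\<forall>z. nsq k U z \<le> K" for U s K z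
  proof -
    have "0 \<le> nsq k U z" unfolding nsq_def by (intro sum_nonneg) auto
    then have K0: "0 \<le> K" using U(3) order_trans by blast
    have "nsq k (S s U) z = (\<Sum>w\<in>words B k. (1 / card I * (\<Sum>i\<in>I. pdw w (avg i s U) z))\<^sup>2)"
      unfolding nsq_def by (intro sum.cong) (auto simp: pdw_S[OF U(1)] words_def)
    also have "\<dots> \<le> (\<Sum>w\<in>words B k. 1 / card I * (\<Sum>i\<in>I. (pdw w (avg i s U) z)\<^sup>2))"
    proof (rule sum_mono)
      fix w
      have "(\<Sum>i\<in>I. pdw w (avg i s U) z)\<^sup>2 \<le> (\<Sum>i\<in>I. (pdw w (avg i s U) z)\<^sup>2) * card I"
        by (rule sum_squared_le_sum_of_squares)
      then have "(1 / card I)\<^sup>2 * (\<Sum>i\<in>I. pdw w (avg i s U) z)\<^sup>2 \<le> (1 / card I)\<^sup>2 * ((\<Sum>i\<in>I. (pdw w (avg i s U) z)\<^sup>2) * card I)"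
        by (intro mult_left_mono) auto
      also have "\<dots> = 1 / card I * (\<Sum>i\<in>I. (pdw w (avg i s U) z)\<^sup>2)" using cardI by (simp add: power2_eq_square)
      finally show "(1 / card I * (\<Sum>i\<in>I. pdw w (avg i s U) z))\<^sup>2 \<le> 1 / card I * (\<Sum>i\<in>I. (pdw w (avg i s U) z)\<^sup>2)"
        by (simp only: power_mult_distrib)
    qed
    also have "\<dots> = 1 / card I * (\<Sum>i\<in>I. nsq k (avg i s U) z)"
      unfolding nsq_def sum_distrib_left[symmetric] by (subst sum.swap) simp
    also have "\<dots> \<le> 1 / card I * (\<Sum>i\<in>I. K * (1 + C * s\<^sup>2))"
      using C(2)[OF _ U(1,2) K0 U(3)] by (intro mult_left_mono sum_mono) (auto simp: algebra_simps)
    also have "\<dots> = K * (1 + C * s\<^sup>2)" by (rule mean_eq_const)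
    finally show ?thesis .
  qed
  then show ?thesis using C(1) by blast
qed

lemma bnd_nonneg: "bnd d K U \<Longrightarrow> 0 \<le> K"
  using neI ws walk_step.bnd_nonneg by blast

lemma S_taylor:
  "\<exists>C\<ge>0. \<forall>U K s z. csm B U \<and> bnd 3 K U \<and> \<bar>s\<bar> \<le> 1 \<longrightarrow> \<bar>S s U z - U z - s\<^sup>2 * A U z\<bar> \<le> C * (\<bar>s\<bar> ^ 3 * K)"
proof -
  have "\<exists>C\<ge>0. \<forall>i\<in>I. \<forall>x. (case x of (U, K, s, z) \<Rightarrow> csm B U \<and> bnd 3 K U \<and> \<bar>s\<bar> \<le> 1) \<longrightarrow>
     (case x of (U, K, s, z) \<Rightarrow> \<bar>avg i s U z - U z - s\<^sup>2 * gen i U z\<bar>) \<le> C * (case x of (U, K, s, z) \<Rightarrow> \<bar>s\<bar> ^ 3 * K)"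
  proof (rule uniform_const[OF finI])
    fix i assume i: "i \<in> I"
    obtain C where "0 \<le> C" "\<And>U K s z. csm B U \<Longrightarrow> bnd 3 K U \<Longrightarrow> \<bar>s\<bar> \<le> 1 \<Longrightarrow> \<bar>avg i s U z - U z - s\<^sup>2 * gen i U z\<bar> \<le> C * \<bar>s\<bar> ^ 3 * K"
      using walk_step.avg_taylor[OF ws[OF i]] by blast
    then show "\<exists>C\<ge>0. \<forall>x. (case x of (U, K, s, z) \<Rightarrow> csm B U \<and> bnd 3 K U \<and> \<bar>s\<bar> \<le> 1) \<longrightarrow>
     (case x of (U, K, s, z) \<Rightarrow> \<bar>avg i s U z - U z - s\<^sup>2 * gen i U z\<bar>) \<le> C * (case x of (U, K, s, z) \<Rightarrow> \<bar>s\<bar> ^ 3 * K)"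
      by (intro exI[of _ C]) (auto simp: mult.assoc)
  qed (auto split: prod.splits dest: bnd_nonneg)
  then obtain C where C: "0 \<le> C" "\<And>i U K s z. i \<in> I \<Longrightarrow> csm B U \<Longrightarrow> bnd 3 K U \<Longrightarrow> \<bar>s\<bar> \<le> 1 \<Longrightarrow>
     \<bar>avg i s U z - U z - s\<^sup>2 * gen i U z\<bar> \<le> C * (\<bar>s\<bar> ^ 3 * K)"
    by (auto simp: split_paired_all)
  have "\<bar>S s U z - U z - s\<^sup>2 * A U z\<bar> \<le> C * (\<bar>s\<bar> ^ 3 * K)" if U: "csm B U" "bnd 3 K U" "\<bar>s\<bar> \<le> 1" for U K s z
  proof -
    have "S s U z - U z - s\<^sup>2 * A U z = 1 / card I * (\<Sum>i\<in>I. avg i s U z - U z - s\<^sup>2 * gen i U z)"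
      unfolding S_def A_def sum_subtractf right_diff_distrib mean_eq_const
      by (simp add: sum_distrib_left mult_ac)
    then show ?thesis using mean_bound[OF C(2)[OF _ U]] by simp
  qed
  then show ?thesis using C(1) by blast
qed

lemma S_diff:
  assumes w: "set w \<subseteq> B"
  shows "\<exists>C\<ge>0. \<forall>U K s z. csm B U \<and> bnd (length w + 3) K U \<and> \<bar>s\<bar> \<le> 1 \<longrightarrow> \<bar>pdw w (S s U) z - pdw w U z\<bar> \<le> C * (s\<^sup>2 * K)"
proof -
  have "\<exists>C\<ge>0. \<forall>i\<in>I. \<forall>x. (case x of (U, K, s, z) \<Rightarrow> csm B U \<and> bnd (length w + 3) K U \<and> \<bar>s\<bar> \<le> 1) \<longrightarrow>
     (case x of (U, K, s, z) \<Rightarrow> \<bar>pdw w (avg i s U) z - pdw w U z\<bar>) \<le> C * (case x of (U, K, s, z) \<Rightarrow> s\<^sup>2 * K)"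
  proof (rule uniform_const[OF finI])
    fix i assume i: "i \<in> I"
    obtain C where "0 \<le> C" "\<And>U K s z. csm B U \<Longrightarrow> bnd (length w + 3) K U \<Longrightarrow> \<bar>s\<bar> \<le> 1 \<Longrightarrow> \<bar>pdw w (avg i s U) z - pdw w U z\<bar> \<le> C * s\<^sup>2 * K"
      using walk_step.pdw_avg_diff[OF ws[OF i] w] by blast
    then show "\<exists>C\<ge>0. \<forall>x. (case x of (U, K, s, z) \<Rightarrow> csm B U \<and> bnd (length w + 3) K U \<and> \<bar>s\<bar> \<le> 1) \<longrightarrow>
     (case x of (U, K, s, z) \<Rightarrow> \<bar>pdw w (avg i s U) z - pdw w U z\<bar>) \<le> C * (case x of (U, K, s, z) \<Rightarrow> s\<^sup>2 * K)"
      by (intro exI[of _ C]) (auto simp: mult.assoc)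
  qed (auto split: prod.splits dest: bnd_nonneg)
  then obtain C where C: "0 \<le> C" "\<And>i U K s z. i \<in> I \<Longrightarrow> csm B U \<Longrightarrow> bnd (length w + 3) K U \<Longrightarrow> \<bar>s\<bar> \<le> 1 \<Longrightarrow>
     \<bar>pdw w (avg i s U) z - pdw w U z\<bar> \<le> C * (s\<^sup>2 * K)"
    by (auto simp: split_paired_all)
  have "\<bar>pdw w (S s U) z - pdw w U z\<bar> \<le> C * (s\<^sup>2 * K)" if U: "csm B U" "bnd (length w + 3) K U" "\<bar>s\<bar> \<le> 1" for U K s z
  proof -
    have "pdw w (S s U) z - pdw w U z = 1 / card I * (\<Sum>i\<in>I. pdw w (avg i s U) z - pdw w U z)"
      using mean_eq_const[of "pdw w U z"]
      by (simp add: pdw_S[OF U(1) w] sum_subtractf sum_distrib_left algebra_simps)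
    then show ?thesis using mean_bound[OF C(2)[OF _ U]] by simp
  qed
  then show ?thesis using C(1) by blast
qed

lemma A_bound:
  assumes w: "set w \<subseteq> B"
  shows "\<exists>C\<ge>0. \<forall>U K z. csm B U \<and> bnd (length w + 2) K U \<longrightarrow> \<bar>pdw w (A U) z\<bar> \<le> C * K"
proof -
  have "\<exists>C\<ge>0. \<forall>i\<in>I. \<forall>x. (case x of (U, K, z) \<Rightarrow> csm B U \<and> bnd (length w + 2) K U) \<longrightarrow>
     (case x of (U, K, z) \<Rightarrow> \<bar>pdw w (gen i U) z\<bar>) \<le> C * (case x of (U, K, z) \<Rightarrow> K)"
  proof (rule uniform_const[OF finI])
    fix i assume i: "i \<in> I"
    obtain C where "0 \<le> C" "\<And>U K z. csm B U \<Longrightarrow> bnd (length w + 2) K U \<Longrightarrow> \<bar>pdw w (gen i U) z\<bar> \<le> C * K"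
      using walk_step.pdw_gen_bound[OF ws[OF i] w] by blast
    then show "\<exists>C\<ge>0. \<forall>x. (case x of (U, K, z) \<Rightarrow> csm B U \<and> bnd (length w + 2) K U) \<longrightarrow>
     (case x of (U, K, z) \<Rightarrow> \<bar>pdw w (gen i U) z\<bar>) \<le> C * (case x of (U, K, z) \<Rightarrow> K)"
      by (intro exI[of _ C]) auto
  qed (auto split: prod.splits dest: bnd_nonneg)
  then obtain C where C: "0 \<le> C" "\<And>i U K z. i \<in> I \<Longrightarrow> csm B U \<Longrightarrow> bnd (length w + 2) K U \<Longrightarrow>
     \<bar>pdw w (gen i U) z\<bar> \<le> C * K"
    by (auto simp: split_paired_all)
  have "\<bar>pdw w (A U) z\<bar> \<le> C * K" if U: "csm B U" "bnd (length w + 2) K U" for U K z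
    unfolding pdw_A[OF U(1) w] by (rule mean_bound[OF C(2)[OF _ U]])
  then show ?thesis using C(1) by blast
qed

lemma S_lincomb: "S s (\<lambda>z. \<Sum>j\<in>F. c j * V j z) z = (\<Sum>j\<in>F. c j * S s (V j) z)"
proof -
  have "avg i s (\<lambda>z. \<Sum>j\<in>F. c j * V j z) z = (\<Sum>j\<in>F. c j * avg i s (V j) z)" if "i \<in> I" for i
    unfolding walk_step.avg_def[OF ws[OF that]]
    by (simp add: sum_divide_distrib[symmetric] sum.distrib distrib_left)
  then have "S s (\<lambda>z. \<Sum>j\<in>F. c j * V j z) z = 1 / card I * (\<Sum>i\<in>I. \<Sum>j\<in>F. c j * avg i s (V j) z)"
    by (simp add: S_def)
  also have "\<dots> = (\<Sum>j\<in>F. c j * S s (V j) z)"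
    unfolding S_def by (subst sum.swap) (simp add: sum_distrib_left mult_ac)
  finally show ?thesis .
qed

text \<open>With \<tau> = s^2 the discrete equation is (1 + \<beta> \<tau>) U - S U = \<tau> G; its
  Neumann series is the sum of the S^j G discounted by q = 1 / (1 + \<beta> \<tau>). One application
  of \<open>S\<close> enlarges bounds on derivatives by at most 1 + C \<tau>, so for \<beta> > C the
  discount prevails, by a margin proportional to \<tau>, and the truncated series is bounded with
  its derivatives independently of \<open>s\<close> and \<open>J\<close>. Replacing (S - 1) / \<tau>
  by \<open>A\<close> costs the error \<open>R\<close>. Derivatives up to order 5 are controlled
  because the Taylor estimate takes three and the second derivatives of \<open>R\<close> take two
  more.\<close>

theorem resolvent_approx:
  "\<exists>\<beta>0. \<forall>\<beta>\<ge>\<beta>0. \<forall>G. csm B G \<longrightarrow> (\<forall>\<epsilon>>0. \<exists>U. csm B U \<and>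
     (\<forall>z. \<bar>\<beta> * U z - A U z - G z\<bar> \<le> \<epsilon>) \<and>
     (\<forall>e\<in>B. \<forall>z. \<bar>pd e (\<lambda>z. \<beta> * U z - A U z - G z) z\<bar> \<le> \<epsilon>))"
proof -
  obtain C where C: "0 \<le> C" "\<And>U s K z. csm B U \<Longrightarrow> \<bar>s\<bar> \<le> 1 \<Longrightarrow> (\<forall>z. nsq 5 U z \<le> K) \<Longrightarrow> nsq 5 (S s U) z \<le> K * (1 + C * s\<^sup>2)"
    using S_growth[of 5] by blast
  obtain C1 where C1: "0 \<le> C1" "\<And>U K s z. csm B U \<Longrightarrow> bnd 3 K U \<Longrightarrow> \<bar>s\<bar> \<le> 1 \<Longrightarrow> \<bar>S s U z - U z - s\<^sup>2 * A U z\<bar> \<le> C1 * (\<bar>s\<bar> ^ 3 * K)"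
    using S_taylor by blast
  \<comment> \<open>The second derivatives of the error \<open>R\<close> are only bounded, not
    small; \<open>interpolation\<close> turns this and the smallness of \<open>R\<close> into
    smallness of its first derivatives.\<close>
  have "\<exists>C\<ge>0. \<forall>e\<in>B. \<forall>x. (case x of (U, K, s, z) \<Rightarrow> csm B U \<and> bnd 5 K U \<and> 0 < s \<and> s \<le> 1) \<longrightarrow>
     (case x of (U, K, s, z) \<Rightarrow> \<bar>(pdw [e, e] (S s U) z - pdw [e, e] U z) / s\<^sup>2 - pdw [e, e] (A U) z\<bar>) \<le> C * (case x of (U, K, s, z) \<Rightarrow> K)"
  proof (rule uniform_const[OF finB])
    fix e assume e: "e \<in> B"
    obtain C2 where C2: "0 \<le> C2" "\<And>U K s z. csm B U \<Longrightarrow> bnd 5 K U \<Longrightarrow> \<bar>s\<bar> \<le> 1 \<Longrightarrow> \<bar>pdw [e, e] (S s U) z - pdw [e, e] U z\<bar> \<le> C2 * (s\<^sup>2 * K)"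
      using S_diff[of "[e, e]"] e by (auto simp: numeral_eq_Suc)
    obtain C3 where C3: "0 \<le> C3" "\<And>U K z. csm B U \<Longrightarrow> bnd 4 K U \<Longrightarrow> \<bar>pdw [e, e] (A U) z\<bar> \<le> C3 * K"
      using A_bound[of "[e, e]"] e by (auto simp: numeral_eq_Suc)
    have "\<bar>(pdw [e, e] (S s U) z - pdw [e, e] U z) / s\<^sup>2 - pdw [e, e] (A U) z\<bar> \<le> (C2 + C3) * K"
      if U: "csm B U" "bnd 5 K U" "0 < s" "s \<le> 1" for U K s z
    proof -
      have "\<bar>pdw [e, e] (S s U) z - pdw [e, e] U z\<bar> / s\<^sup>2 \<le> C2 * (s\<^sup>2 * K) / s\<^sup>2"
        using U by (intro divide_right_mono C2) auto
      then have "\<bar>(pdw [e, e] (S s U) z - pdw [e, e] U z) / s\<^sup>2\<bar> \<le> C2 * K" using U(3) by simp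
      moreover have "bnd 4 K U" using walk_step.bnd_mono[OF _ U(2)] neI ws by fastforce
      then have "\<bar>pdw [e, e] (A U) z\<bar> \<le> C3 * K" using C3(2) U by blast
      ultimately have "\<bar>(pdw [e, e] (S s U) z - pdw [e, e] U z) / s\<^sup>2\<bar> + \<bar>pdw [e, e] (A U) z\<bar> \<le> (C2 + C3) * K"
        by (simp only: distrib_right add_mono)
      then show ?thesis by (rule order_trans[OF abs_triangle_ineq4])
    qed
    then show "\<exists>C\<ge>0. \<forall>x. (case x of (U, K, s, z) \<Rightarrow> csm B U \<and> bnd 5 K U \<and> 0 < s \<and> s \<le> 1) \<longrightarrow>
     (case x of (U, K, s, z) \<Rightarrow> \<bar>(pdw [e, e] (S s U) z - pdw [e, e] U z) / s\<^sup>2 - pdw [e, e] (A U) z\<bar>) \<le> C * (case x of (U, K, s, z) \<Rightarrow> K)"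
      using C2(1) C3(1) by (intro exI[of _ "C2 + C3"]) auto
  qed (auto split: prod.splits dest: bnd_nonneg)
  then obtain C2 where C2: "0 \<le> C2" "\<And>e U K s z. e \<in> B \<Longrightarrow> csm B U \<Longrightarrow> bnd 5 K U \<Longrightarrow> 0 < s \<Longrightarrow> s \<le> 1 \<Longrightarrow>
     \<bar>(pdw [e, e] (S s U) z - pdw [e, e] U z) / s\<^sup>2 - pdw [e, e] (A U) z\<bar> \<le> C2 * K"
    by (auto simp: split_paired_all)
  show ?thesis
  proof (intro exI[of _ "C + 1"] allI impI)
    fix \<beta> :: real and G :: "'e \<Rightarrow> real" and \<epsilon> :: real
    assume \<beta>: "C + 1 \<le> \<beta>" and G: "csm B G" and \<epsilon>: "0 < \<epsilon>"
    obtain i0 where i0: "i0 \<in> I" using neI by blast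
    note nsq_def = walk_step.nsq_def[OF ws[OF i0]]
    note nsq_bnd = walk_step.nsq_bnd[OF ws[OF i0]]
    note bnd_def = walk_step.bnd_def[OF ws[OF i0]]
    have "\<exists>K0>0. \<forall>z. nsq 5 G z \<le> K0\<^sup>2"
    proof -
      have "csm B (\<lambda>z. \<Sum>w\<in>words B 5. pdw w G z * pdw w G z)"
        using G by (intro csm_sum csm_mult csm_pdw) (auto simp: words_def)
      then obtain K where K: "\<And>z. \<bar>\<Sum>w\<in>words B 5. pdw w G z * pdw w G z\<bar> \<le> K" using csm_bounded by blast
      have "nsq 5 G z \<le> (\<bar>K\<bar> + 1)\<^sup>2" for z
      proof -
        have "nsq 5 G z \<le> \<bar>K\<bar>" using K[of z] by (simp add: nsq_def power2_eq_square)
        also have "\<dots> \<le> (\<bar>K\<bar> + 1)\<^sup>2" by (simp add: power2_eq_square algebra_simps)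
        finally show ?thesis .
      qed
      then show ?thesis by (intro exI[of _ "\<bar>K\<bar> + 1"]) auto
    qed
    then obtain K0 where K0: "0 < K0" "\<And>z. nsq 5 G z \<le> K0\<^sup>2" by blast
    \<comment> \<open>\<open>D * t\<close> will bound \<open>R\<close> and its first derivatives
      when s = t^2: 2 C1 K0 t comes from the size of \<open>R\<close> divided by \<open>t\<close>,
      and C2 K0 covers the second derivatives. The other half of \<epsilon> is reserved for the
      truncation, where \<open>J\<close> is chosen after \<open>s\<close>.\<close>
    define D where "D = (2 * C1 + C2) * K0"
    have D0: "0 \<le> D" using C1 C2 K0 by (simp add: D_def)
    define t where "t = min 1 (\<epsilon> / (2 * (D + 1)))"
    have t: "0 < t" "t \<le> 1" using \<epsilon> D0 by (auto simp: t_def)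
    have Dt: "D * t \<le> \<epsilon> / 2"
    proof -
      have "D * t \<le> (D + 1) * (\<epsilon> / (2 * (D + 1)))" using D0 t by (intro mult_mono) (auto simp: t_def)
      also have "\<dots> = \<epsilon> / 2" using D0 by (simp add: field_simps)
      finally show ?thesis .
    qed
    define s where "s = t\<^sup>2"
    have s: "0 < s" "s \<le> 1" "s \<le> t" using t by (auto simp: s_def power2_eq_square mult_le_one mult_left_le)
    define \<tau> where "\<tau> = s\<^sup>2"
    have \<tau>: "0 < \<tau>" using s by (simp add: \<tau>_def)
    define q where "q = 1 / (1 + \<beta> * \<tau>)"
    have den: "0 < 1 + \<beta> * \<tau>" using \<beta> C \<tau> by (intro add_pos_pos mult_pos_pos) auto
    have q: "0 < q" "(1 + \<beta> * \<tau>) * q = 1" using den by (auto simp: q_def)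
    define \<theta> where "\<theta> = (1 + C * \<tau>) * q"
    have \<theta>: "0 \<le> \<theta>" using C \<tau> q by (simp add: \<theta>_def)
    \<comment> \<open>Since \<beta> \<ge> C + 1, the gap 1 - \<theta> is at least \<tau> q, the
      weight of the first term. The weighted geometric series is therefore at most 1, whatever
      \<open>s\<close> is.\<close>
    have th1: "1 - \<theta> = (\<beta> - C) * (\<tau> * q)" using q(2) by (simp add: \<theta>_def algebra_simps)
    have th2: "\<tau> * q \<le> 1 - \<theta>" unfolding th1 using \<beta> \<tau> q mult_right_mono[of 1 "\<beta> - C" "\<tau> * q"] by simp
    have th3: "\<theta> < 1" using th2 \<tau> q mult_pos_pos[of \<tau> q] by linarith
    obtain J where J: "K0 * \<theta> ^ J \<le> \<epsilon> / 2"
    proof -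
      obtain J where "\<theta> ^ J < \<epsilon> / 2 / K0" using real_arch_pow_inv[of "\<epsilon> / 2 / K0" \<theta>] \<epsilon> K0 th3 by auto
      then have "K0 * \<theta> ^ J \<le> \<epsilon> / 2" using K0 by (simp add: field_simps)
      then show ?thesis by (rule that)
    qed
    define V where "V = (\<lambda>j. (S s ^^ j) G)"
    have V0: "V 0 = G" and V_Suc: "V (Suc j) = S s (V j)" for j by (auto simp: V_def)
    have V: "csm B (V j)" for j by (induction j) (auto simp: V0 V_Suc G csm_S)
    have Vn: "nsq 5 (V j) z \<le> K0\<^sup>2 * (1 + C * \<tau>) ^ j" for j z
    proof (induction j arbitrary: z)
      case 0 then show ?case using K0 by (simp add: V0)
    next
      case (Suc j)
      have "nsq 5 (S s (V j)) z \<le> (K0\<^sup>2 * (1 + C * \<tau>) ^ j) * (1 + C * s\<^sup>2)"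
        using s Suc by (intro C(2) V) auto
      then show ?case by (simp add: V_Suc \<tau>_def algebra_simps)
    qed
    have Vb: "\<bar>pdw w (V j) z\<bar> \<le> K0 * (1 + C * \<tau>) ^ j" if "w \<in> words B 5" for w j z
    proof -
      have "\<bar>pdw w (V j) z\<bar> \<le> sqrt (K0\<^sup>2 * (1 + C * \<tau>) ^ j)"
        using nsq_bnd[OF Vn] that unfolding bnd_def by blast
      also have "\<dots> = K0 * sqrt ((1 + C * \<tau>) ^ j)" using K0 by (simp add: real_sqrt_mult)
      also have "\<dots> \<le> K0 * (1 + C * \<tau>) ^ j"
      proof (intro mult_left_mono)
        have "1 \<le> (1 + C * \<tau>) ^ j" using C \<tau> by (intro one_le_power) auto
        then have "(1 + C * \<tau>) ^ j \<le> ((1 + C * \<tau>) ^ j)\<^sup>2" by (simp add: power2_eq_square)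
        then show "sqrt ((1 + C * \<tau>) ^ j) \<le> (1 + C * \<tau>) ^ j"
          using C \<tau> by (intro real_le_lsqrt) auto
      qed (use K0 in auto)
      finally show ?thesis .
    qed
    define U where "U = (\<lambda>z. \<Sum>j<J. (\<tau> * q ^ Suc j) * V j z)"
    have U: "csm B U" unfolding U_def by (intro csm_sum csm_cmult V)
    have Ub: "bnd 5 K0 U"
      unfolding bnd_def
    proof (intro ballI allI)
      fix w z assume w: "w \<in> words B 5"
      have "pdw w U z = (\<Sum>j<J. (\<tau> * q ^ Suc j) * pdw w (V j) z)"
        unfolding U_def using w V by (subst pdw_sum[of _ B]) (auto intro!: csm_cmult simp: words_def pdw_cmult[of B])
      then have "\<bar>pdw w U z\<bar> \<le> (\<Sum>j<J. \<bar>(\<tau> * q ^ Suc j) * pdw w (V j) z\<bar>)" by (simp add: sum_abs)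
      also have "\<dots> \<le> (\<Sum>j<J. (\<tau> * q ^ Suc j) * (K0 * (1 + C * \<tau>) ^ j))"
        unfolding abs_mult[of "\<tau> * _"] using Vb[OF w] \<tau> q by (intro sum_mono mult_mono) (auto simp: abs_mult)
      also have "\<dots> = K0 * ((\<tau> * q) * (\<Sum>j<J. \<theta> ^ j))"
        by (simp add: \<theta>_def power_mult_distrib sum_distrib_left mult_ac)
      also have "\<dots> \<le> K0 * ((1 - \<theta>) * (\<Sum>j<J. \<theta> ^ j))"
        using th2 \<theta> K0 by (intro mult_left_mono mult_right_mono sum_nonneg) auto
      also have "(1 - \<theta>) * (\<Sum>j<J. \<theta> ^ j) = 1 - \<theta> ^ J" by (rule one_diff_power_eq[symmetric])
      also have "K0 * (1 - \<theta> ^ J) \<le> K0" using K0 \<theta> by simp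
      finally show "\<bar>pdw w U z\<bar> \<le> K0" .
    qed
    \<comment> \<open>The factor 1 + \<beta> \<tau> = 1 / q lowers the power of \<open>q\<close> by
      one and \<open>S\<close> raises the index of \<open>V\<close> by one, so the difference
      telescopes.\<close>
    have SU: "(1 + \<beta> * \<tau>) * U z - S s U z = \<tau> * G z - \<tau> * (q ^ J * V J z)" for z
    proof -
      have "S s U z = (\<Sum>j<J. (\<tau> * q ^ Suc j) * V (Suc j) z)"
        unfolding U_def by (subst S_lincomb) (simp add: V_Suc)
      moreover have "(1 + \<beta> * \<tau>) * U z = (\<Sum>j<J. (\<tau> * q ^ j) * V j z)"
      proof -
        have "(1 + \<beta> * \<tau>) * U z = (\<Sum>j<J. ((1 + \<beta> * \<tau>) * q) * ((\<tau> * q ^ j) * V j z))"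
          unfolding U_def sum_distrib_left by (intro sum.cong) (auto simp: mult_ac)
        then show ?thesis by (simp add: q(2))
      qed
      ultimately have "(1 + \<beta> * \<tau>) * U z - S s U z = (\<Sum>j<J. (\<tau> * q ^ j) * V j z - (\<tau> * q ^ Suc j) * V (Suc j) z)"
        by (simp add: sum_subtractf)
      also have "\<dots> = (\<tau> * q ^ 0) * V 0 z - (\<tau> * q ^ J) * V J z"
        by (rule sum_lessThan_telescope')
      finally show ?thesis by (simp add: V0)
    qed
    define R where "R = (\<lambda>z. (1 / \<tau>) * (S s U z - U z) - A U z)"
    have R: "csm B R" unfolding R_def by (intro csm_diff csm_cmult csm_S csm_A U)
    have eq: "(\<lambda>z. \<beta> * U z - A U z - G z) = (\<lambda>z. R z - q ^ J * V J z)"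
    proof
      fix z
      have "S s U z - U z = \<tau> * (\<beta> * U z) - \<tau> * G z + \<tau> * (q ^ J * V J z)"
        using SU[of z] by (simp add: algebra_simps)
      then have "(1 / \<tau>) * (S s U z - U z) = \<beta> * U z - G z + q ^ J * V J z"
        using \<tau> by (simp add: field_simps)
      then show "\<beta> * U z - A U z - G z = R z - q ^ J * V J z" by (simp add: R_def)
    qed
    have Rb: "\<bar>R z\<bar> \<le> C1 * s * K0" for z
    proof -
      have "bnd 3 K0 U" using walk_step.bnd_mono[OF ws[OF i0] Ub, of 3] by simp
      from C1(2)[OF U this, of s z] s have "\<bar>S s U z - U z - s\<^sup>2 * A U z\<bar> \<le> C1 * (s ^ 3 * K0)" by simp
      then have "\<bar>S s U z - U z - s\<^sup>2 * A U z\<bar> / s\<^sup>2 \<le> C1 * (s ^ 3 * K0) / s\<^sup>2" by (intro divide_right_mono) auto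
      moreover have "C1 * (s ^ 3 * K0) / s\<^sup>2 = C1 * s * K0" using s by (simp add: power3_eq_cube power2_eq_square)
      moreover have "R z = (S s U z - U z - s\<^sup>2 * A U z) / s\<^sup>2" using s by (simp add: R_def \<tau>_def field_simps)
      ultimately show ?thesis by simp
    qed
    have R2: "\<bar>pd e (pd e R) z\<bar> \<le> C2 * K0" if e: "e \<in> B" for e z
    proof -
      have "pdw [e, e] R z = (1 / \<tau>) * (pdw [e, e] (S s U) z - pdw [e, e] U z) - pdw [e, e] (A U) z"
      proof -
        have SU: "csm B (S s U)" "csm B (\<lambda>z. S s U z - U z)" using U by (auto intro: csm_S csm_diff)
        have w: "set [e, e] \<subseteq> B" using e by simp
        show ?thesis
          unfolding R_def pdw_diff[OF csm_cmult[OF SU(2)] csm_A[OF U] w] pdw_cmult[OF SU(2) w] pdw_diff[OF SU(1) U w] ..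
      qed
      then show ?thesis using C2(2)[OF e U Ub s(1,2), of z] by (simp add: \<tau>_def)
    qed
    have R1: "\<bar>pd e R z\<bar> \<le> D * t" if e: "e \<in> B" for e z
    proof -
      have "\<bar>pd e R z\<bar> \<le> 2 * (C1 * s * K0) / t + (C2 * K0) * t / 2"
        by (rule interpolation[OF R e Rb R2[OF e] t(1)])
      also have "2 * (C1 * s * K0) / t = 2 * C1 * K0 * t" using t by (simp add: s_def power2_eq_square)
      also have "2 * C1 * K0 * t + (C2 * K0) * t / 2 \<le> 2 * C1 * K0 * t + C2 * K0 * t" using C2 K0 t by simp
      also have "\<dots> = D * t" by (simp add: D_def algebra_simps)
      finally show ?thesis .
    qed
    have R0: "\<bar>R z\<bar> \<le> D * t" for z
    proof -
      have "C1 * s * K0 \<le> (2 * C1 + C2) * t * K0" using C1 C2 s K0 by (intro mult_mono) auto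
      then show ?thesis using Rb[of z] by (simp add: D_def mult_ac)
    qed
    have VJ: "\<bar>q ^ J * pdw w (V J) z\<bar> \<le> \<epsilon> / 2" if "w \<in> words B 5" for w z
    proof -
      have "\<bar>q ^ J * pdw w (V J) z\<bar> \<le> q ^ J * (K0 * (1 + C * \<tau>) ^ J)"
        unfolding abs_mult using Vb[OF that] q by (intro mult_mono) auto
      also have "\<dots> = K0 * \<theta> ^ J" by (simp add: \<theta>_def power_mult_distrib mult_ac)
      finally show ?thesis using J by linarith
    qed
    have sum2: "\<bar>x - y\<bar> \<le> \<epsilon>" if "\<bar>x\<bar> \<le> D * t" "\<bar>y\<bar> \<le> \<epsilon> / 2" for x y :: real
    proof -
      have "\<bar>x\<bar> + \<bar>y\<bar> \<le> \<epsilon> / 2 + \<epsilon> / 2" by (rule add_mono[OF order_trans[OF that(1) Dt] that(2)])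
      then show ?thesis using abs_triangle_ineq4[of x y] by simp
    qed
    show "\<exists>U. csm B U \<and> (\<forall>z. \<bar>\<beta> * U z - A U z - G z\<bar> \<le> \<epsilon>) \<and>
     (\<forall>e\<in>B. \<forall>z. \<bar>pd e (\<lambda>z. \<beta> * U z - A U z - G z) z\<bar> \<le> \<epsilon>)"
    proof (intro exI[of _ U] conjI ballI allI U)
      fix z
      have "\<beta> * U z - A U z - G z = R z - q ^ J * V J z" using eq by (rule fun_cong)
      then show "\<bar>\<beta> * U z - A U z - G z\<bar> \<le> \<epsilon>"
        using sum2[OF R0[of z] VJ[of "[]" z]] by (simp add: words_def)
    next
      fix e z assume e: "e \<in> B"
      have "pdw [e] (\<lambda>z. R z - q ^ J * V J z) z = pdw [e] R z - q ^ J * pdw [e] (V J) z"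
        using R e V by (simp only: pdw_diff[of B R "\<lambda>z. q ^ J * V J z" "[e]"] pdw_cmult[of B "V J" "[e]"] csm_cmult set_simps insert_subset empty_subsetI simp_thms)
      moreover have "[e] \<in> words B 5" using e by (simp add: words_def)
      ultimately show "\<bar>pd e (\<lambda>z. \<beta> * U z - A U z - G z) z\<bar> \<le> \<epsilon>"
        unfolding eq using sum2[OF R1[OF e, of z] VJ[of "[e]" z]] by simp
    qed
  qed
qed

end

section \<open>Calculus of smooth functions\<close>

lemma Ck_on_cong:
  assumes "open S"
  shows "\<lbrakk>Ck_on k S f; \<And>x. x \<in> S \<Longrightarrow> f x = g x\<rbrakk> \<Longrightarrow> Ck_on k S g"
proof (induction k arbitrary: f g)
  case 0
  then show ?case using continuous_on_cong[of S S f g] by simp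
next
  case (Suc k)
  have d: "f differentiable (at x)" if "x \<in> S" for x using Suc.prems(1) that by simp
  have fd: "frechet_derivative f (at x) = frechet_derivative g (at x)" if "x \<in> S" for x
    by (rule frechet_derivative_transform_within_open[OF d[OF that] assms that Suc.prems(2)])
  have "g differentiable (at x)" if "x \<in> S" for x
  proof -
    have "(f has_derivative frechet_derivative f (at x)) (at x)" using d[OF that] frechet_derivative_works by blast
    then have "(g has_derivative frechet_derivative f (at x)) (at x)"
      by (rule has_derivative_transform_within_open[OF _ assms that Suc.prems(2)])
    then show ?thesis by (rule differentiableI)
  qed
  moreover have "Ck_on k S (\<lambda>x. frechet_derivative g (at x) v)" for v
    by (rule Suc.IH[of "\<lambda>x. frechet_derivative f (at x) v"]) (use Suc.prems(1) fd in auto)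
  ultimately show ?case by simp
qed

lemma Ck_on_subset: "Ck_on k S f \<Longrightarrow> T \<subseteq> S \<Longrightarrow> Ck_on k T f"
  by (induction k arbitrary: f) (auto intro: continuous_on_subset)

lemma Ck_on_continuous: "Ck_on k S f \<Longrightarrow> continuous_on S f"
  by (cases k) (auto intro!: continuous_at_imp_continuous_on differentiable_imp_continuous_within)

lemma Ck_on_SucD: "Ck_on (Suc k) S f \<Longrightarrow> Ck_on k S f"
proof (induction k arbitrary: f)
  case 0
  then show ?case using Ck_on_continuous by fastforce
qed auto

lemma Ck_on_local:
  "(\<And>x. x \<in> S \<Longrightarrow> \<exists>T. open T \<and> x \<in> T \<and> Ck_on k T f) \<Longrightarrow> Ck_on k S f"
proof (induction k arbitrary: f)
  case 0
  have "isCont f x" if x: "x \<in> S" for x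
  proof -
    obtain T where "open T" "x \<in> T" "continuous_on T f" using 0[OF x] by auto
    then show ?thesis using continuous_on_eq_continuous_at by blast
  qed
  then show ?case by (auto intro: continuous_at_imp_continuous_on)
next
  case (Suc k)
  have "f differentiable (at x)" if "x \<in> S" for x using Suc.prems[OF that] by auto
  moreover have "Ck_on k S (\<lambda>x. frechet_derivative f (at x) v)" for v
    by (rule Suc.IH) (use Suc.prems in fastforce)
  ultimately show ?case by simp
qed

lemma Ck_on_const: "Ck_on k S (\<lambda>x. c)"
  by (induction k arbitrary: c) auto

lemma Ck_on_SucI:
  assumes "open S" "\<And>x. x \<in> S \<Longrightarrow> (f has_derivative D x) (at x)" "\<And>v. Ck_on k S (\<lambda>x. D x v)"
  shows "Ck_on (Suc k) S f"
proof -
  have "D x v = frechet_derivative f (at x) v" if "x \<in> S" for x v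
    by (simp add: frechet_derivative_at[OF assms(2)[OF that]])
  then have "Ck_on k S (\<lambda>x. frechet_derivative f (at x) v)" for v
    by (intro Ck_on_cong[OF assms(1) assms(3)])
  then show ?thesis using assms(2) by (auto intro: differentiableI)
qed

lemma Ck_on_has_derivative:
  "Ck_on (Suc k) S f \<Longrightarrow> x \<in> S \<Longrightarrow> (f has_derivative frechet_derivative f (at x)) (at x)"
  using frechet_derivative_works by auto

lemma Ck_on_bounded_linear:
  assumes "open S" "bounded_linear L" shows "Ck_on k S f \<Longrightarrow> Ck_on k S (\<lambda>x. L (f x))"
proof (induction k arbitrary: f)
  case 0
  then show ?case using assms by (auto intro: bounded_linear.continuous_on)
next
  case (Suc k)
  show ?case
  proof (rule Ck_on_SucI[OF assms(1)])
    show "((\<lambda>x. L (f x)) has_derivative (\<lambda>v. L (frechet_derivative f (at x) v))) (at x)" if "x \<in> S" for x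
      by (rule bounded_linear.has_derivative[OF assms(2) Ck_on_has_derivative[OF Suc.prems that]])
    show "Ck_on k S (\<lambda>x. L (frechet_derivative f (at x) v))" for v
      using Suc by simp
  qed
qed

lemma Ck_on_linear: "bounded_linear L \<Longrightarrow> open S \<Longrightarrow> Ck_on k S L"
proof (cases k)
  case (Suc m)
  assume L: "bounded_linear L" and S: "open S"
  show ?thesis unfolding Suc
    by (rule Ck_on_SucI[OF S bounded_linear_imp_has_derivative[OF L]]) (rule Ck_on_const)
qed (auto intro: linear_continuous_on)

lemma Ck_on_add:
  assumes "open S" shows "Ck_on k S f \<Longrightarrow> Ck_on k S g \<Longrightarrow> Ck_on k S (\<lambda>x. f x + g x)"
proof (induction k arbitrary: f g)
  case (Suc k)
  show ?case
    by (rule Ck_on_SucI[OF assms has_derivative_add[OF Ck_on_has_derivative[OF Suc.prems(1)] Ck_on_has_derivative[OF Suc.prems(2)]]])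
      (use Suc in auto)
qed (auto intro: continuous_on_add)

lemma Ck_on_mult:
  fixes f g :: "'b::real_normed_vector \<Rightarrow> real"
  assumes "open S" shows "Ck_on k S f \<Longrightarrow> Ck_on k S g \<Longrightarrow> Ck_on k S (\<lambda>x. f x * g x)"
proof (induction k arbitrary: f g)
  case (Suc k)
  show ?case
    by (rule Ck_on_SucI[OF assms has_derivative_mult[OF Ck_on_has_derivative[OF Suc.prems(1)] Ck_on_has_derivative[OF Suc.prems(2)]]])
      (use Suc Ck_on_SucD[OF Suc.prems(1)] Ck_on_SucD[OF Suc.prems(2)] in \<open>auto intro!: Ck_on_add[OF assms] Suc.IH\<close>)
qed (auto intro: continuous_on_mult)

lemma Ck_on_sum:
  assumes "open S" shows "(\<And>i. i \<in> I \<Longrightarrow> Ck_on k S (f i)) \<Longrightarrow> Ck_on k S (\<lambda>x. \<Sum>i\<in>I. f i x)"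
proof (induction I rule: infinite_finite_induct)
  case (insert i I) then show ?case by (auto intro!: Ck_on_add[OF assms])
qed (auto intro: Ck_on_const)

text \<open>The differential of the composite is expanded over \<open>Basis\<close>, which turns it
  into a sum of products of real functions accessible to the induction hypothesis and the product
  rule.\<close>

lemma Ck_on_compose:
  fixes f :: "'b::euclidean_space \<Rightarrow> real" and g :: "'c::real_normed_vector \<Rightarrow> 'b"
  assumes "open S" "g ` S \<subseteq> T"
  shows "Ck_on k T f \<Longrightarrow> Ck_on k S g \<Longrightarrow> Ck_on k S (\<lambda>x. f (g x))"
proof (induction k arbitrary: f)
  case 0
  then show ?case using assms by (auto intro: continuous_on_compose2)
next
  case (Suc k)
  let ?D = "\<lambda>x v. \<Sum>i\<in>Basis. (frechet_derivative g (at x) v \<bullet> i) * frechet_derivative f (at (g x)) i"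
  show ?case
  proof (rule Ck_on_SucI[OF assms(1), where D = ?D])
    fix x assume x: "x \<in> S"
    have lin: "linear (frechet_derivative f (at (g x)))"
      using Ck_on_has_derivative[OF Suc.prems(1), of "g x"] x assms(2) has_derivative_linear by blast
    have "((\<lambda>x. f (g x)) has_derivative (\<lambda>v. frechet_derivative f (at (g x)) (frechet_derivative g (at x) v))) (at x)"
      using x assms(2) by (intro has_derivative_compose[OF Ck_on_has_derivative[OF Suc.prems(2)] Ck_on_has_derivative[OF Suc.prems(1)]]) auto
    also have "(\<lambda>v. frechet_derivative f (at (g x)) (frechet_derivative g (at x) v)) = ?D x"
    proof
      fix v
      show "frechet_derivative f (at (g x)) (frechet_derivative g (at x) v) = ?D x v"
        by (subst euclidean_representation[of "frechet_derivative g (at x) v", symmetric])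
          (simp add: linear_sum[OF lin] linear_scale[OF lin])
    qed
    finally show "((\<lambda>x. f (g x)) has_derivative ?D x) (at x)" .
  next
    fix v
    show "Ck_on k S (\<lambda>x. ?D x v)"
    proof (rule Ck_on_sum[OF assms(1)], rule Ck_on_mult[OF assms(1)])
      show "Ck_on k S (\<lambda>x. frechet_derivative g (at x) v \<bullet> i)" for i
        by (rule Ck_on_bounded_linear[OF assms(1) bounded_linear_inner_left]) (use Suc.prems(2) in simp)
      show "Ck_on k S (\<lambda>x. frechet_derivative f (at (g x)) i)" for i
        by (rule Suc.IH[OF _ Ck_on_SucD[OF Suc.prems(2)]]) (use Suc.prems(1) in simp)
    qed
  qed
qed

lemma smooth_onD: "smooth_on S f \<Longrightarrow> Ck_on k S f" by (simp add: smooth_on_def)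

lemma smooth_on_cong: "open S \<Longrightarrow> smooth_on S f \<Longrightarrow> (\<And>x. x \<in> S \<Longrightarrow> f x = g x) \<Longrightarrow> smooth_on S g"
  unfolding smooth_on_def using Ck_on_cong by blast

lemma smooth_on_subset: "smooth_on S f \<Longrightarrow> T \<subseteq> S \<Longrightarrow> smooth_on T f"
  unfolding smooth_on_def using Ck_on_subset by blast

lemma smooth_on_local: "(\<And>x. x \<in> S \<Longrightarrow> \<exists>T. open T \<and> x \<in> T \<and> smooth_on T f) \<Longrightarrow> smooth_on S f"
  unfolding smooth_on_def by (intro allI Ck_on_local) blast

lemma smooth_on_const: "smooth_on S (\<lambda>x. c)"
  by (simp add: smooth_on_def Ck_on_const)

lemma smooth_on_linear: "bounded_linear L \<Longrightarrow> open S \<Longrightarrow> smooth_on S L"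
  by (simp add: smooth_on_def Ck_on_linear)

lemma smooth_on_add: "open S \<Longrightarrow> smooth_on S f \<Longrightarrow> smooth_on S g \<Longrightarrow> smooth_on S (\<lambda>x. f x + g x)"
  by (simp add: smooth_on_def Ck_on_add)

lemma smooth_on_mult:
  fixes f g :: "'b::real_normed_vector \<Rightarrow> real"
  shows "open S \<Longrightarrow> smooth_on S f \<Longrightarrow> smooth_on S g \<Longrightarrow> smooth_on S (\<lambda>x. f x * g x)"
  by (simp add: smooth_on_def Ck_on_mult)

lemma smooth_on_sum: "open S \<Longrightarrow> (\<And>i. i \<in> I \<Longrightarrow> smooth_on S (f i)) \<Longrightarrow> smooth_on S (\<lambda>x. \<Sum>i\<in>I. f i x)"
  by (simp add: smooth_on_def Ck_on_sum)

lemma smooth_on_compose: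
  fixes f :: "'b::euclidean_space \<Rightarrow> real" and g :: "'c::real_normed_vector \<Rightarrow> 'b"
  shows "open S \<Longrightarrow> g ` S \<subseteq> T \<Longrightarrow> smooth_on T f \<Longrightarrow> smooth_on S g \<Longrightarrow> smooth_on S (\<lambda>x. f (g x))"
  unfolding smooth_on_def using Ck_on_compose by blast

lemma smooth_on_frechet_derivative: "smooth_on S f \<Longrightarrow> smooth_on S (\<lambda>x. frechet_derivative f (at x) v)"
  unfolding smooth_on_def by (metis Ck_on.simps(2))

lemma smooth_on_differentiable: "smooth_on S f \<Longrightarrow> x \<in> S \<Longrightarrow> f differentiable (at x)"
  unfolding smooth_on_def by (metis Ck_on.simps(2))

lemma smooth_on_has_derivative:
  "smooth_on S f \<Longrightarrow> x \<in> S \<Longrightarrow> (f has_derivative frechet_derivative f (at x)) (at x)"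
  using smooth_on_differentiable frechet_derivative_works by blast

section \<open>Inverses, square roots and cutoff functions\<close>

lemma Ck_on_SucI_real:
  fixes f :: "real \<Rightarrow> real"
  assumes "open S" "\<And>x. x \<in> S \<Longrightarrow> (f has_real_derivative f' x) (at x)" "Ck_on k S f'"
  shows "Ck_on (Suc k) S f"
  by (rule Ck_on_SucI[OF assms(1) assms(2)[unfolded has_field_derivative_def]])
    (auto intro: Ck_on_mult[OF assms(1)] Ck_on_const assms(3))

text \<open>The derivative is a polynomial in the function itself, so C^k smoothness implies its own
  next case; the same works for the inverse square root.\<close>

lemma smooth_on_inverse: "smooth_on {x. x \<noteq> (0::real)} inverse"
  unfolding smooth_on_def
proof
  have op: "open {x. x \<noteq> (0::real)}" by (simp add: open_Collect_neq)
  fix k show "Ck_on k {x. x \<noteq> (0::real)} inverse"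
  proof (induction k)
    case 0 then show ?case by (auto intro!: continuous_intros)
  next
    case (Suc k)
    show ?case
    proof (rule Ck_on_SucI_real[OF op])
      show "(inverse has_real_derivative (- 1) * (inverse x * inverse x)) (at x)" if "x \<in> {x. x \<noteq> (0::real)}" for x
        using that by (auto intro!: derivative_eq_intros)
    qed (intro Ck_on_mult[OF op] Ck_on_const Suc)
  qed
qed

lemma smooth_on_inverse_sqrt: "smooth_on {x. 0 < (x::real)} (\<lambda>x. inverse (sqrt x))"
  unfolding smooth_on_def
proof
  have op: "open {x. 0 < (x::real)}" by (simp add: open_Collect_less)
  fix k show "Ck_on k {x. 0 < (x::real)} (\<lambda>x. inverse (sqrt x))"
  proof (induction k)
    case 0 then show ?case by (auto intro!: continuous_intros)
  next
    case (Suc k)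
    show ?case
    proof (rule Ck_on_SucI_real[OF op])
      show "((\<lambda>x. inverse (sqrt x)) has_real_derivative (- (1/2)) * (inverse (sqrt x) * (inverse (sqrt x) * inverse (sqrt x)))) (at x)" if "x \<in> {x. 0 < (x::real)}" for x
        using that by (auto intro!: derivative_eq_intros simp: field_simps)
    qed (intro Ck_on_mult[OF op] Ck_on_const Suc)
  qed
qed

text \<open>The classical exp(-1/x) continued by 0. The powers of 1/x are included because the
  family is then closed under differentiation up to linear combinations, see
  \<open>flat_has_derivative\<close>.\<close>

definition flat :: "nat \<Rightarrow> real \<Rightarrow> real" where
  "flat n x = (if 0 < x then (1 / x) ^ n * exp (- (1 / x)) else 0)"

text \<open>Exponential decay beats every power of 1/x; this is the derivative of
  \<open>flat n\<close> at 0, the only delicate point.\<close>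

lemma flat_div_tendsto: "((\<lambda>y. flat n y / y) \<longlongrightarrow> 0) (at 0)"
proof -
  have "((\<lambda>y. flat n y / y) \<longlongrightarrow> 0) (at_left 0)"
    by (rule tendsto_eventually) (auto simp: flat_def eventually_at_filter)
  moreover have "((\<lambda>y. flat n y / y) \<longlongrightarrow> 0) (at_right 0)"
  proof (rule Lim_transform_eventually)
    have "((\<lambda>y. (inverse y) ^ Suc n / exp (inverse y)) \<longlongrightarrow> (0::real)) (at_right 0)"
      by (rule filterlim_compose[OF tendsto_power_div_exp_0 filterlim_inverse_at_top_right])
    then show "((\<lambda>y. (inverse y) ^ Suc n / exp (inverse y)) \<longlongrightarrow> (0::real)) (at_right 0)" .
    show "\<forall>\<^sub>F y in at_right 0. (inverse y) ^ Suc n / exp (inverse y) = flat n y / y"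
      unfolding eventually_at_filter
      by (rule always_eventually) (auto simp: flat_def exp_minus field_simps)
  qed
  ultimately show ?thesis by (simp add: filterlim_split_at)
qed

lemma flat_has_derivative:
  "(flat n has_real_derivative - real n * flat (n + 1) x + flat (n + 2) x) (at x)"
proof (cases "x = 0")
  case True
  then show ?thesis using flat_div_tendsto[of n]
    by (simp add: has_field_derivative_iff flat_def)
next
  case False
  show ?thesis
  proof (cases "0 < x")
    case True
    have "((\<lambda>x. (1 / x) ^ n * exp (- (1 / x))) has_real_derivative - real n * flat (n + 1) x + flat (n + 2) x) (at x)"
      using True
      by (auto intro!: derivative_eq_intros simp: flat_def) (cases n; simp add: field_simps power2_eq_square)
    then show ?thesis
      by (rule has_field_derivative_transform_within_open[of _ _ _ "{0<..}"]) (use True in \<open>auto simp: flat_def\<close>)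
  next
    case False
    with \<open>x \<noteq> 0\<close> have x: "x < 0" by simp
    have "((\<lambda>x. 0) has_real_derivative 0) (at x)" by simp
    then have "(flat n has_real_derivative 0) (at x)"
      by (rule has_field_derivative_transform_within_open[of _ _ _ "{..<0}"]) (use x in \<open>auto simp: flat_def\<close>)
    then show ?thesis using x by (simp add: flat_def)
  qed
qed

lemma smooth_on_flat: "smooth_on UNIV (flat n)"
  unfolding smooth_on_def
proof
  fix k show "Ck_on k UNIV (flat n)"
  proof (induction k arbitrary: n)
    case 0
    then show ?case by (auto intro!: continuous_at_imp_continuous_on DERIV_isCont[OF flat_has_derivative])
  next
    case (Suc k)
    show ?case
      by (rule Ck_on_SucI_real[OF open_UNIV flat_has_derivative])
        (intro Ck_on_add Ck_on_mult Ck_on_const Suc open_UNIV)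
  qed
qed

definition smooth_step :: "real \<Rightarrow> real" where
  "smooth_step x = flat 0 x * inverse (flat 0 x + flat 0 (1 - x))"

lemma smooth_step_denominator: "0 < flat 0 x + flat 0 (1 - x)"
  by (auto simp: flat_def add_pos_nonneg)

lemma smooth_on_smooth_step: "smooth_on UNIV smooth_step"
proof -
  have "smooth_on UNIV (\<lambda>x::real. 1 + (- 1) * x)"
    by (intro smooth_on_add smooth_on_mult smooth_on_const open_UNIV smooth_on_linear bounded_linear_ident)
  then have "smooth_on UNIV (\<lambda>x. flat 0 (1 + (- 1) * x))"
    by (intro smooth_on_compose[OF open_UNIV _ smooth_on_flat]) auto
  then have "smooth_on UNIV (\<lambda>x. flat 0 x + flat 0 (1 - x))"
    by (intro smooth_on_add open_UNIV smooth_on_flat) simp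
  then have "smooth_on UNIV (\<lambda>x. inverse (flat 0 x + flat 0 (1 - x)))"
    using smooth_step_denominator by (intro smooth_on_compose[OF open_UNIV _ smooth_on_inverse]) (auto simp: less_le)
  then have "smooth_on UNIV (\<lambda>x. flat 0 x * inverse (flat 0 x + flat 0 (1 - x)))"
    by (intro smooth_on_mult smooth_on_flat open_UNIV)
  then show ?thesis unfolding smooth_step_def[abs_def] .
qed

lemma smooth_step_nonpos: "x \<le> 0 \<Longrightarrow> smooth_step x = 0"
  and smooth_step_ge_1: "1 \<le> x \<Longrightarrow> smooth_step x = 1"
  and smooth_step_range: "0 \<le> smooth_step x" "smooth_step x \<le> 1"
  using smooth_step_denominator[of x] by (auto simp: smooth_step_def flat_def field_simps)

lemma bump_euclidean:
  fixes y0 :: "'b::euclidean_space"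
  assumes "0 < r"
  obtains \<beta> where "smooth_on UNIV \<beta>" "\<And>y. 0 \<le> \<beta> y" "\<And>y. \<beta> y \<le> (1::real)"
    "\<And>y. y \<in> ball y0 r \<Longrightarrow> \<beta> y = 1" "\<And>y. y \<notin> cball y0 (2 * r) \<Longrightarrow> \<beta> y = 0"
proof
  \<comment> \<open>This is \<open>smooth_step\<close> of 2 - (dist y0 y / r)^2, an argument that is
    at least 1 within distance r and nonpositive beyond distance 2 r. It is spelled out in
    coordinates so that the closure rules for smooth functions apply.\<close>
  define \<beta> where "\<beta> = (\<lambda>y. smooth_step (2 + (- 1 / r\<^sup>2) * (\<Sum>i\<in>Basis. (y \<bullet> i + (- (y0 \<bullet> i))) * (y \<bullet> i + (- (y0 \<bullet> i))))))"
  have eq: "\<beta> y = smooth_step (2 - (dist y0 y / r)\<^sup>2)" for y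
  proof -
    have "(\<Sum>i\<in>Basis. (y \<bullet> i + (- (y0 \<bullet> i))) * (y \<bullet> i + (- (y0 \<bullet> i)))) = (dist y0 y)\<^sup>2"
    proof -
      have "(dist y0 y)\<^sup>2 = (y - y0) \<bullet> (y - y0)"
        by (metis dist_commute dist_norm power2_norm_eq_inner)
      also have "\<dots> = (\<Sum>i\<in>Basis. ((y - y0) \<bullet> i) * ((y - y0) \<bullet> i))" by (rule euclidean_inner)
      finally show ?thesis by (simp add: inner_diff_left)
    qed
    then show ?thesis by (simp add: \<beta>_def power_divide)
  qed
  have "smooth_on UNIV (\<lambda>y. 2 + (- 1 / r\<^sup>2) * (\<Sum>i\<in>Basis. (y \<bullet> i + (- (y0 \<bullet> i))) * (y \<bullet> i + (- (y0 \<bullet> i)))))"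
    by (intro smooth_on_add smooth_on_mult smooth_on_sum smooth_on_const open_UNIV smooth_on_linear bounded_linear_inner_left)
  then show "smooth_on UNIV \<beta>"
    unfolding \<beta>_def by (intro smooth_on_compose[OF open_UNIV _ smooth_on_smooth_step]) auto
  show "0 \<le> \<beta> y" "\<beta> y \<le> 1" for y by (auto simp: eq smooth_step_range)
  show "\<beta> y = 1" if "y \<in> ball y0 r" for y
  proof -
    have "dist y0 y / r \<le> 1" using that assms by (simp add: field_simps)
    then have "(dist y0 y / r)\<^sup>2 \<le> 1" using assms by (intro power_le_one) auto
    then show ?thesis by (simp add: eq smooth_step_ge_1)
  qed
  show "\<beta> y = 0" if "y \<notin> cball y0 (2 * r)" for y
  proof -
    have "2 \<le> dist y0 y / r" using that assms by (simp add: field_simps)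
    then have "2\<^sup>2 \<le> (dist y0 y / r)\<^sup>2" by (intro power_mono) auto
    then show ?thesis by (simp add: eq smooth_step_nonpos)
  qed
qed

section \<open>Smooth functions on a compact manifold\<close>

locale compact_manifold =
  fixes A :: "('a::{t2_space,second_countable_topology}, 'b::euclidean_space) atlas"
  assumes atlas: "smooth_atlas A" and compact_UNIV: "compact (UNIV :: 'a set)"
begin

lemma chart_ex: "\<exists>c\<in>A. x \<in> fst c"
  using atlas unfolding smooth_atlas_def by blast

lemma chart_open: "c \<in> A \<Longrightarrow> open (fst c)" "c \<in> A \<Longrightarrow> open (chart_image c)"
  using atlas unfolding smooth_atlas_def by blast+

lemma chart_homeo: "c \<in> A \<Longrightarrow> homeomorphism (fst c) (chart_image c) (snd c) (chart_inv c)"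
  using atlas unfolding smooth_atlas_def by blast

lemma chart_inv_chart: "c \<in> A \<Longrightarrow> x \<in> fst c \<Longrightarrow> chart_inv c (snd c x) = x"
  using chart_homeo by (blast intro: homeomorphism_apply1)

lemma chart_chart_inv: "c \<in> A \<Longrightarrow> y \<in> chart_image c \<Longrightarrow> snd c (chart_inv c y) = y"
  using chart_homeo by (blast intro: homeomorphism_apply2)

lemma chart_inv_in: "y \<in> chart_image c \<Longrightarrow> chart_inv c y \<in> fst c"
  by (rule inv_into_into)

lemma chart_continuous: "c \<in> A \<Longrightarrow> continuous_on (fst c) (snd c)"
  "c \<in> A \<Longrightarrow> continuous_on (chart_image c) (chart_inv c)"
  using chart_homeo by (blast intro: homeomorphism_cont1 homeomorphism_cont2)+

lemma chart_image_eq: "c \<in> A \<Longrightarrow> snd c ` (fst c \<inter> W) = chart_image c \<inter> chart_inv c -` W"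
  using chart_inv_chart chart_chart_inv chart_inv_in by (auto simp: image_iff)

lemma chart_image_open: "c \<in> A \<Longrightarrow> open W \<Longrightarrow> open (snd c ` (fst c \<inter> W))"
  using continuous_open_preimage[OF chart_continuous(2) chart_open(2), of c W] by (simp add: chart_image_eq)

lemma transition_smooth: "c \<in> A \<Longrightarrow> d \<in> A \<Longrightarrow> smooth_on (snd c ` (fst c \<inter> fst d)) (snd d \<circ> chart_inv c)"
  using atlas unfolding smooth_atlas_def by blast

lemma smooth_funD: "smooth_fun A f \<Longrightarrow> c \<in> A \<Longrightarrow> smooth_on (chart_image c) (\<lambda>y. f (chart_inv c y))"
  unfolding smooth_fun_def comp_def by blast

lemma smooth_funI: "(\<And>c. c \<in> A \<Longrightarrow> smooth_on (chart_image c) (\<lambda>y. f (chart_inv c y))) \<Longrightarrow> smooth_fun A f"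
  unfolding smooth_fun_def comp_def by blast

lemma smooth_fun_continuous:
  assumes "smooth_fun A f" shows "continuous_on UNIV f"
proof -
  have "isCont f x" for x
  proof -
    obtain c where c: "c \<in> A" "x \<in> fst c" using chart_ex by blast
    have "continuous_on (chart_image c) (\<lambda>y. f (chart_inv c y))"
      using smooth_funD[OF assms c(1)] smooth_onD Ck_on_continuous by blast
    then have "continuous_on (fst c) (\<lambda>x. f (chart_inv c (snd c x)))"
      by (rule continuous_on_compose2[OF _ chart_continuous(1)[OF c(1)]]) auto
    then have "continuous_on (fst c) f"
      by (rule continuous_on_eq) (simp add: chart_inv_chart[OF c(1)])
    then show ?thesis using c chart_open(1) continuous_on_eq_continuous_at by blast
  qed
  then show ?thesis by (auto intro: continuous_at_imp_continuous_on)
qed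

lemma smooth_fun_bounded:
  assumes "smooth_fun A f" shows "\<exists>K. \<forall>x. \<bar>f x\<bar> \<le> K"
proof -
  have "compact (range f)" by (rule compact_continuous_image[OF smooth_fun_continuous[OF assms] compact_UNIV])
  then have "bounded (range f)" by (rule compact_imp_bounded)
  then show ?thesis by (auto simp: bounded_iff)
qed

lemma smooth_fun_const: "smooth_fun A (\<lambda>x. c)"
  by (intro smooth_funI smooth_on_const)

lemma smooth_fun_add: "smooth_fun A f \<Longrightarrow> smooth_fun A g \<Longrightarrow> smooth_fun A (\<lambda>x. f x + g x)"
  by (rule smooth_funI) (intro smooth_on_add chart_open smooth_funD)

lemma smooth_fun_mult: "smooth_fun A f \<Longrightarrow> smooth_fun A g \<Longrightarrow> smooth_fun A (\<lambda>x. f x * g x)"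
  by (rule smooth_funI) (intro smooth_on_mult chart_open smooth_funD)

lemma smooth_fun_cmult: "smooth_fun A f \<Longrightarrow> smooth_fun A (\<lambda>x. c * f x)"
  by (intro smooth_fun_mult smooth_fun_const)

lemma smooth_fun_diff: "smooth_fun A f \<Longrightarrow> smooth_fun A g \<Longrightarrow> smooth_fun A (\<lambda>x. f x - g x)"
  using smooth_fun_add[of f "\<lambda>x. (- 1) * g x"] smooth_fun_cmult[of g "- 1"] by simp

lemma smooth_fun_sum: "(\<And>i. i \<in> I \<Longrightarrow> smooth_fun A (f i)) \<Longrightarrow> smooth_fun A (\<lambda>x. \<Sum>i\<in>I. f i x)"
  by (rule smooth_funI) (intro smooth_on_sum chart_open smooth_funD)

lemma smooth_fun_compose:
  fixes g :: "real \<Rightarrow> real"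
  assumes "smooth_on T g" "smooth_fun A f" "range f \<subseteq> T"
  shows "smooth_fun A (\<lambda>x. g (f x))"
proof (rule smooth_funI)
  fix c assume c: "c \<in> A"
  show "smooth_on (chart_image c) (\<lambda>y. g (f (chart_inv c y)))"
    by (rule smooth_on_compose[OF chart_open(2)[OF c] _ assms(1) smooth_funD[OF assms(2) c]]) (use assms(3) in auto)
qed

lemma smooth_fun_inverse: "smooth_fun A f \<Longrightarrow> (\<And>x. f x \<noteq> 0) \<Longrightarrow> smooth_fun A (\<lambda>x. inverse (f x))"
  by (rule smooth_fun_compose[OF smooth_on_inverse]) auto

lemma smooth_fun_inverse_sqrt: "smooth_fun A f \<Longrightarrow> (\<And>x. 0 < f x) \<Longrightarrow> smooth_fun A (\<lambda>x. inverse (sqrt (f x)))"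
  by (rule smooth_fun_compose[OF smooth_on_inverse_sqrt]) auto

text \<open>Two open sets suffice: the domain of \<open>c\<close>, where smoothness follows by a
  change of charts, and the complement of the set corresponding to \<open>K\<close>, where the
  function is 0. That complement is open because compact sets of a Hausdorff space are
  closed.\<close>

lemma extend_by_zero:
  assumes c: "c \<in> A" and u: "smooth_on (chart_image c) u" and K: "compact K" "K \<subseteq> chart_image c"
    and zero: "\<And>y. y \<in> chart_image c \<Longrightarrow> y \<notin> K \<Longrightarrow> u y = 0"
  shows "smooth_fun A (\<lambda>x. if x \<in> fst c then u (snd c x) else 0)" (is "smooth_fun A ?f")
proof (rule smooth_funI, rule smooth_on_local)
  fix d y assume d: "d \<in> A" and y: "y \<in> chart_image d"
  define x where "x = chart_inv d y"
  have x: "x \<in> fst d" "y = snd d x" using chart_inv_in[OF y] chart_chart_inv[OF d y] by (auto simp: x_def)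
  show "\<exists>T. open T \<and> y \<in> T \<and> smooth_on T (\<lambda>y. ?f (chart_inv d y))"
  proof (cases "x \<in> fst c")
    case True
    let ?T = "snd d ` (fst d \<inter> fst c)"
    have T: "open ?T" by (rule chart_image_open[OF d chart_open(1)[OF c]])
    have sub: "chart_inv d z \<in> fst c" if "z \<in> ?T" for z using that chart_inv_chart[OF d] by auto
    have "smooth_on ?T (\<lambda>y. u ((snd c \<circ> chart_inv d) y))"
      using sub by (intro smooth_on_compose[OF T _ u] transition_smooth d c) auto
    then have "smooth_on ?T (\<lambda>y. ?f (chart_inv d y))"
      by (rule smooth_on_cong[OF T]) (use sub in auto)
    then show ?thesis using T True x by blast
  next
    case False
    let ?K = "chart_inv c ` K"
    have "compact ?K" using K chart_continuous(2)[OF c] by (meson compact_continuous_image continuous_on_subset)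
    then have cl: "closed ?K" by (rule compact_imp_closed)
    have "?K \<subseteq> fst c"
    proof (rule image_subsetI)
      fix w assume "w \<in> K"
      then show "chart_inv c w \<in> fst c" using K(2) by (intro chart_inv_in) blast
    qed
    then have xK: "x \<notin> ?K" using False by blast
    let ?T = "snd d ` (fst d \<inter> - ?K)"
    have T: "open ?T" by (rule chart_image_open[OF d open_Compl[OF cl]])
    have z: "?f (chart_inv d z) = 0" if zT: "z \<in> ?T" for z
    proof -
      obtain w where w: "z = snd d w" "w \<in> fst d \<inter> - ?K" using zT by (rule imageE)
      then have "chart_inv d z = w" using chart_inv_chart[OF d] by simp
      then have n: "chart_inv d z \<notin> ?K" using w(2) by (simp only: Int_iff Compl_iff simp_thms)
      show ?thesis
      proof (cases "chart_inv d z \<in> fst c")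
        case True
        then have "snd c (chart_inv d z) \<notin> K" using n by (metis chart_inv_chart[OF c] imageI)
        then show ?thesis using True zero by auto
      qed auto
    qed
    have "smooth_on ?T (\<lambda>y. ?f (chart_inv d y))"
      by (rule smooth_on_cong[OF T smooth_on_const[of ?T 0]]) (use z in auto)
    moreover have "y \<in> ?T" using x xK by auto
    ultimately show ?thesis using T by blast
  qed
qed

lemma bump:
  assumes "open W" "x \<in> W"
  obtains \<psi> V K where "smooth_fun A \<psi>" "\<And>y. 0 \<le> \<psi> y" "\<And>y. \<psi> y \<le> (1::real)" "open V" "x \<in> V"
    "\<And>y. y \<in> V \<Longrightarrow> \<psi> y = 1" "closed K" "K \<subseteq> W" "\<And>y. y \<notin> K \<Longrightarrow> \<psi> y = 0"
proof -
  obtain c where c: "c \<in> A" "x \<in> fst c" using chart_ex by blast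
  have "open (snd c ` (fst c \<inter> W))" by (rule chart_image_open[OF c(1) assms(1)])
  moreover have "snd c x \<in> snd c ` (fst c \<inter> W)" using c assms by auto
  ultimately obtain e where e: "0 < e" "cball (snd c x) e \<subseteq> snd c ` (fst c \<inter> W)"
    using open_contains_cball by blast
  define r where "r = e / 2"
  have r: "0 < r" "cball (snd c x) (2 * r) \<subseteq> snd c ` (fst c \<inter> W)" using e by (auto simp: r_def)
  obtain \<beta> where \<beta>: "smooth_on UNIV \<beta>" "\<And>y. 0 \<le> \<beta> y" "\<And>y. \<beta> y \<le> (1::real)"
    "\<And>y. y \<in> ball (snd c x) r \<Longrightarrow> \<beta> y = 1" "\<And>y. y \<notin> cball (snd c x) (2 * r) \<Longrightarrow> \<beta> y = 0"
    using bump_euclidean[OF r(1)] by metis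
  define \<psi> where "\<psi> = (\<lambda>y. if y \<in> fst c then \<beta> (snd c y) else 0)"
  let ?K = "chart_inv c ` cball (snd c x) (2 * r)"
  let ?V = "fst c \<inter> snd c -` ball (snd c x) r"
  have sub: "cball (snd c x) (2 * r) \<subseteq> chart_image c" using r(2) by auto
  have sm: "smooth_fun A \<psi>"
    unfolding \<psi>_def by (rule extend_by_zero[OF c(1) smooth_on_subset[OF \<beta>(1)] compact_cball sub \<beta>(5)]) auto
  have V: "open ?V" using chart_continuous(1)[OF c(1)] chart_open(1)[OF c(1)] open_ball by (rule continuous_open_preimage)
  have "compact ?K" using chart_continuous(2)[OF c(1)] sub by (meson compact_cball compact_continuous_image continuous_on_subset)
  then have K: "closed ?K" by (rule compact_imp_closed)
  have KW: "?K \<subseteq> W" using r(2) chart_inv_chart[OF c(1)] by (force simp: image_subset_iff)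
  have \<psi>0: "\<psi> y = 0" if "y \<notin> ?K" for y
  proof (cases "y \<in> fst c")
    case True
    then have "snd c y \<notin> cball (snd c x) (2 * r)" using that chart_inv_chart[OF c(1) True] by (metis imageI)
    then show ?thesis using \<beta>(5) by (simp add: \<psi>_def)
  qed (simp add: \<psi>_def)
  show ?thesis
    by (rule that[OF sm _ _ V _ _ K KW \<psi>0]) (use \<beta> c r in \<open>auto simp: \<psi>_def\<close>)
qed

lemma finite_bump_cover:
  fixes \<psi> :: "'a \<Rightarrow> 'a \<Rightarrow> real"
  assumes "\<And>x. \<exists>V. open V \<and> x \<in> V \<and> (\<forall>y\<in>V. \<psi> x y = 1)"
  obtains X where "finite X" "X \<noteq> {}" "\<And>y. \<exists>x\<in>X. \<psi> x y = 1"
proof -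
  obtain V where V: "\<And>x. open (V x)" "\<And>x. x \<in> V x" "\<And>x y. y \<in> V x \<Longrightarrow> \<psi> x y = 1" using assms by metis
  have "UNIV \<subseteq> (\<Union>x\<in>UNIV. V x)" using V by auto
  then obtain X where X: "finite X" "UNIV \<subseteq> (\<Union>x\<in>X. V x)"
    using compactE_image[OF compact_UNIV, of UNIV V] V(1) by (metis subset_UNIV)
  have cover: "\<exists>x\<in>X. \<psi> x y = 1" for y
  proof -
    have "y \<in> (\<Union>x\<in>X. V x)" using X(2) by blast
    then show ?thesis using V(3) by blast
  qed
  then have "X \<noteq> {}" by blast
  from that[OF X(1) this cover] show ?thesis .
qed

end

section \<open>Tangent vectors in coordinates\<close>

text \<open>Differentiation under the integral sign. Every derivative produces another factor
  \<open>t\<close>, so the induction has to run over all exponents \<open>m\<close> and all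
  \<open>H\<close> simultaneously.\<close>

lemma param_integral_Ck:
  fixes H :: "'b::euclidean_space \<Rightarrow> real"
  shows "smooth_on (ball y0 r) H \<Longrightarrow>
    Ck_on k (ball y0 r) (\<lambda>y. integral (cbox 0 1) (\<lambda>t. t ^ m * H (y0 + t *\<^sub>R (y - y0))))"
proof (induction k arbitrary: m H)
  case 0
  have mem: "y0 + t *\<^sub>R (y - y0) \<in> ball y0 r" if "y \<in> ball y0 r" "t \<in> cbox 0 1" for y :: 'b and t :: real
  proof -
    have "norm (t *\<^sub>R (y - y0)) \<le> norm (y - y0)" using that by (simp add: mult_left_le_one_le)
    then show ?thesis using that by (simp add: dist_norm norm_minus_commute)
  qed
  have "continuous_on (ball y0 r) H" using 0 smooth_onD Ck_on_continuous by blast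
  then have "continuous_on (ball y0 r \<times> cbox 0 1) (\<lambda>x. H (y0 + snd x *\<^sub>R (fst x - y0)))"
    by (rule continuous_on_compose2) (use mem in \<open>auto intro!: continuous_intros\<close>)
  then have "continuous_on (ball y0 r \<times> cbox 0 1) (\<lambda>(y, t). t ^ m * H (y0 + t *\<^sub>R (y - y0)))"
    by (auto simp: case_prod_beta intro!: continuous_intros)
  then show ?case unfolding Ck_on.simps by (rule integral_continuous_on_param)
next
  case (Suc k)
  have mem: "y0 + t *\<^sub>R (y - y0) \<in> ball y0 r" if "y \<in> ball y0 r" "t \<in> cbox 0 1" for y :: 'b and t :: real
  proof -
    have "norm (t *\<^sub>R (y - y0)) \<le> norm (y - y0)" using that by (simp add: mult_left_le_one_le)
    then show ?thesis using that by (simp add: dist_norm norm_minus_commute)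
  qed
  \<comment> \<open>The Leibniz rule takes the derivative as a continuous map into the bounded
    linear maps; its continuity is then checked on basis vectors.\<close>
  define D where "D = (\<lambda>y t. Blinfun (\<lambda>v. t ^ Suc m * frechet_derivative H (at (y0 + t *\<^sub>R (y - y0))) v))"
  have bl: "bounded_linear (\<lambda>v. t ^ Suc m * frechet_derivative H (at (y0 + t *\<^sub>R (y - y0))) v)"
    if "y \<in> ball y0 r" "t \<in> cbox 0 1" for y t
    using smooth_on_has_derivative[OF Suc.prems mem[OF that]]
    by (intro bounded_linear_const_mult) (rule has_derivative_bounded_linear)
  have D: "blinfun_apply (D y t) v = t ^ Suc m * frechet_derivative H (at (y0 + t *\<^sub>R (y - y0))) v"
    if "y \<in> ball y0 r" "t \<in> cbox 0 1" for y t v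
    unfolding D_def bounded_linear_Blinfun_apply[OF bl[OF that]] ..
  have der: "((\<lambda>y. t ^ m * H (y0 + t *\<^sub>R (y - y0))) has_derivative blinfun_apply (D y t)) (at y within ball y0 r)"
    if yt: "y \<in> ball y0 r" "t \<in> cbox 0 1" for y t
  proof -
    let ?p = "y0 + t *\<^sub>R (y - y0)"
    have lin: "linear (frechet_derivative H (at ?p))"
      using smooth_on_has_derivative[OF Suc.prems mem[OF yt]] has_derivative_linear by blast
    have "((\<lambda>y. y0 + t *\<^sub>R (y - y0)) has_derivative (\<lambda>v. t *\<^sub>R v)) (at y)"
      by (auto intro!: derivative_eq_intros)
    from has_derivative_compose[OF this smooth_on_has_derivative[OF Suc.prems mem[OF yt]]]
    have "((\<lambda>y. H (y0 + t *\<^sub>R (y - y0))) has_derivative (\<lambda>v. frechet_derivative H (at ?p) (t *\<^sub>R v))) (at y)" .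
    from has_derivative_mult_right[OF this, of "t ^ m"]
    have "((\<lambda>y. t ^ m * H (y0 + t *\<^sub>R (y - y0))) has_derivative (\<lambda>v. t ^ m * frechet_derivative H (at ?p) (t *\<^sub>R v))) (at y)" .
    also have "(\<lambda>v. t ^ m * frechet_derivative H (at ?p) (t *\<^sub>R v)) = blinfun_apply (D y t)"
      by (simp add: fun_eq_iff D[OF yt] linear_scale[OF lin])
    finally show ?thesis by (rule has_derivative_at_withinI)
  qed
  have cH: "continuous_on (ball y0 r \<times> cbox 0 1) (\<lambda>x. snd x ^ j * H' (y0 + snd x *\<^sub>R (fst x - y0)))"
    if "continuous_on (ball y0 r) H'" for H' :: "'b \<Rightarrow> real" and j
  proof -
    have "continuous_on (ball y0 r \<times> cbox 0 1) (\<lambda>x. H' (y0 + snd x *\<^sub>R (fst x - y0)))"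
      by (rule continuous_on_compose2[OF that]) (use mem in \<open>auto intro!: continuous_intros\<close>)
    then show ?thesis by (auto intro!: continuous_intros)
  qed
  have contD: "continuous_on (ball y0 r \<times> cbox 0 1) (\<lambda>(y, t). D y t)"
  proof (rule continuous_on_blinfun_componentwise)
    fix i :: 'b assume "i \<in> Basis"
    have "continuous_on (ball y0 r) (\<lambda>y. frechet_derivative H (at y) i)"
      using smooth_on_frechet_derivative[OF Suc.prems] smooth_onD Ck_on_continuous by blast
    from cH[OF this, of "Suc m"]
    show "continuous_on (ball y0 r \<times> cbox 0 1) (\<lambda>x. blinfun_apply (case x of (y, t) \<Rightarrow> D y t) i)"
      by (rule continuous_on_eq) (auto simp: D)
  qed
  have pair: "continuous_on (cbox 0 1) (\<lambda>t::real. (y, t))" for y :: 'b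
    by (rule continuous_on_Pair[OF continuous_on_const continuous_on_id])
  have pair_in: "(\<lambda>t. (y, t)) ` cbox 0 1 \<subseteq> ball y0 r \<times> cbox 0 1" if "y \<in> ball y0 r" for y
    using that by auto
  have cD: "continuous_on (cbox 0 1) (D y)" if "y \<in> ball y0 r" for y
    using continuous_on_compose2[OF contD pair pair_in[OF that]] by simp
  have cont1: "(\<lambda>t. t ^ m * H (y0 + t *\<^sub>R (y - y0))) integrable_on cbox 0 1" if "y \<in> ball y0 r" for y
  proof (rule integrable_continuous)
    have "continuous_on (ball y0 r) H" using Suc.prems smooth_onD Ck_on_continuous by blast
    from continuous_on_compose2[OF cH[OF this, of m] pair pair_in[OF that]]
    show "continuous_on (cbox 0 1) (\<lambda>t. t ^ m * H (y0 + t *\<^sub>R (y - y0)))" by simp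
  qed
  show ?case
  proof (rule Ck_on_SucI[OF open_ball])
    fix y assume y: "y \<in> ball y0 r"
    have "((\<lambda>y. integral (cbox 0 1) (\<lambda>t. t ^ m * H (y0 + t *\<^sub>R (y - y0)))) has_derivative
       blinfun_apply (integral (cbox 0 1) (D y))) (at y within ball y0 r)"
      by (rule leibniz_rule[OF der cont1 contD y convex_ball])
    then have "((\<lambda>y. integral (cbox 0 1) (\<lambda>t. t ^ m * H (y0 + t *\<^sub>R (y - y0)))) has_derivative
       blinfun_apply (integral (cbox 0 1) (D y))) (at y)"
      unfolding at_within_open[OF y open_ball] .
    also have "blinfun_apply (integral (cbox 0 1) (D y)) =
      (\<lambda>v. integral (cbox 0 1) (\<lambda>t. t ^ Suc m * frechet_derivative H (at (y0 + t *\<^sub>R (y - y0))) v))"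
    proof
      fix v
      have "blinfun_apply (integral (cbox 0 1) (D y)) v = integral (cbox 0 1) (\<lambda>t. blinfun_apply (D y t) v)"
        by (rule blinfun_apply_integral[OF integrable_continuous[OF cD[OF y]]])
      also have "\<dots> = integral (cbox 0 1) (\<lambda>t. t ^ Suc m * frechet_derivative H (at (y0 + t *\<^sub>R (y - y0))) v)"
        by (rule integral_cong) (rule D[OF y])
      finally show "blinfun_apply (integral (cbox 0 1) (D y)) v = \<dots>" .
    qed
    finally show "((\<lambda>y. integral (cbox 0 1) (\<lambda>t. t ^ m * H (y0 + t *\<^sub>R (y - y0)))) has_derivative
      (\<lambda>v. integral (cbox 0 1) (\<lambda>t. t ^ Suc m * frechet_derivative H (at (y0 + t *\<^sub>R (y - y0))) v))) (at y)" .
  next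
    show "Ck_on k (ball y0 r) (\<lambda>y. integral (cbox 0 1) (\<lambda>t. t ^ Suc m * frechet_derivative H (at (y0 + t *\<^sub>R (y - y0))) v))" for v
      by (rule Suc.IH[OF smooth_on_frechet_derivative[OF Suc.prems]])
  qed
qed

text \<open>\<open>G i\<close> is the mean of the i-th partial derivative over the segment from
  \<open>y0\<close> to \<open>y\<close>. Its smoothness is the point: derivations can be applied to
  the products of the formula.\<close>

lemma hadamard:
  fixes f :: "'b::euclidean_space \<Rightarrow> real"
  assumes f: "smooth_on (ball y0 r) f" and r: "0 < r"
  obtains G where "\<And>i. smooth_on (ball y0 r) (G i)" "\<And>i. G i y0 = frechet_derivative f (at y0) i"
    "\<And>y. y \<in> ball y0 r \<Longrightarrow> f y = f y0 + (\<Sum>i\<in>Basis. ((y - y0) \<bullet> i) * G i y)"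
proof
  define G where "G = (\<lambda>i y. integral (cbox 0 1) (\<lambda>t. t ^ 0 * frechet_derivative f (at (y0 + t *\<^sub>R (y - y0))) i))"
  show "smooth_on (ball y0 r) (G i)" for i
    unfolding smooth_on_def G_def by (intro allI param_integral_Ck smooth_on_frechet_derivative f)
  show "G i y0 = frechet_derivative f (at y0) i" for i by (simp add: G_def)
  fix y assume y: "y \<in> ball y0 r"
  have mem: "y0 + t *\<^sub>R (y - y0) \<in> ball y0 r" if "t \<in> {0..1}" for t :: real
  proof -
    have "norm (t *\<^sub>R (y - y0)) \<le> norm (y - y0)" using that by (simp add: mult_left_le_one_le)
    then show ?thesis using y by (simp add: dist_norm norm_minus_commute)
  qed
  let ?p = "\<lambda>t. y0 + t *\<^sub>R (y - y0)"
  have der: "((\<lambda>t. f (?p t)) has_vector_derivative (\<Sum>i\<in>Basis. ((y - y0) \<bullet> i) * frechet_derivative f (at (?p t)) i)) (at t within {0..1})"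
    if t: "t \<in> {0..1}" for t
  proof -
    have lin: "linear (frechet_derivative f (at (?p t)))"
      using smooth_on_has_derivative[OF f mem[OF t]] has_derivative_linear by blast
    have "(?p has_derivative (\<lambda>h. h *\<^sub>R (y - y0))) (at t)" by (auto intro!: derivative_eq_intros)
    from has_derivative_compose[OF this smooth_on_has_derivative[OF f mem[OF t]]]
    have d: "((\<lambda>t. f (?p t)) has_derivative (\<lambda>h. frechet_derivative f (at (?p t)) (h *\<^sub>R (y - y0)))) (at t)" .
    have "frechet_derivative f (at (?p t)) (y - y0) = (\<Sum>i\<in>Basis. ((y - y0) \<bullet> i) * frechet_derivative f (at (?p t)) i)"
    proof -
      have "frechet_derivative f (at (?p t)) (\<Sum>i\<in>Basis. ((y - y0) \<bullet> i) *\<^sub>R i) =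
         (\<Sum>i\<in>Basis. ((y - y0) \<bullet> i) * frechet_derivative f (at (?p t)) i)"
        by (simp only: linear_sum[OF lin] linear_scale[OF lin] real_scaleR_def)
      then show ?thesis by (simp only: euclidean_representation)
    qed
    then show ?thesis using d
      by (auto simp: has_vector_derivative_def linear_scale[OF lin] intro: has_derivative_at_withinI)
  qed
  have "((\<lambda>t. \<Sum>i\<in>Basis. ((y - y0) \<bullet> i) * frechet_derivative f (at (?p t)) i) has_integral f (?p 1) - f (?p 0)) {0..1}"
    by (rule fundamental_theorem_of_calculus[OF _ der]) auto
  then have "f y - f y0 = integral {0..1} (\<lambda>t. \<Sum>i\<in>Basis. ((y - y0) \<bullet> i) * frechet_derivative f (at (?p t)) i)"
    by (simp add: integral_unique)
  also have "\<dots> = (\<Sum>i\<in>Basis. integral {0..1} (\<lambda>t. ((y - y0) \<bullet> i) * frechet_derivative f (at (?p t)) i))"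
  proof (rule integral_sum)
    fix i :: 'b assume "i \<in> Basis"
    have "continuous_on (ball y0 r) (\<lambda>y. frechet_derivative f (at y) i)"
      using smooth_on_frechet_derivative[OF f] smooth_onD Ck_on_continuous by blast
    then have "continuous_on {0..1} (\<lambda>t. frechet_derivative f (at (?p t)) i)"
      by (rule continuous_on_compose2) (use mem in \<open>auto intro!: continuous_intros\<close>)
    then show "(\<lambda>t. ((y - y0) \<bullet> i) * frechet_derivative f (at (?p t)) i) integrable_on {0..1}"
      by (intro integrable_continuous_interval continuous_intros)
  qed simp
  also have "\<dots> = (\<Sum>i\<in>Basis. ((y - y0) \<bullet> i) * G i y)"
    by (simp add: G_def)
  finally show "f y = f y0 + (\<Sum>i\<in>Basis. ((y - y0) \<bullet> i) * G i y)" by simp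
qed

section \<open>Derivations at a point, expressed in coordinates\<close>

context compact_manifold
begin

lemma tangent_lincomb:
  "v \<in> tangent_space A x \<Longrightarrow> smooth_fun A f \<Longrightarrow> smooth_fun A g \<Longrightarrow> v (\<lambda>y. a * f y + b * g y) = a * v f + b * v g"
  unfolding tangent_space_def lin_on_def by blast

lemma tangent_add: "v \<in> tangent_space A x \<Longrightarrow> smooth_fun A f \<Longrightarrow> smooth_fun A g \<Longrightarrow> v (\<lambda>y. f y + g y) = v f + v g"
  using tangent_lincomb[of v x f g 1 1] by simp

lemma tangent_mult:
  "v \<in> tangent_space A x \<Longrightarrow> smooth_fun A f \<Longrightarrow> smooth_fun A g \<Longrightarrow> v (\<lambda>y. f y * g y) = f x * v g + g x * v f"
  unfolding tangent_space_def by blast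

lemma tangent_const:
  assumes "v \<in> tangent_space A x" shows "v (\<lambda>y. c) = 0"
proof -
  have "v (\<lambda>y. 1 * 1) = 1 * v (\<lambda>y. 1) + 1 * v (\<lambda>y. 1)"
    by (rule tangent_mult[OF assms smooth_fun_const smooth_fun_const])
  then have "v (\<lambda>y. 1) = 0" by simp
  then show ?thesis using tangent_lincomb[OF assms smooth_fun_const smooth_fun_const, of c 1 0 1] by simp
qed

lemma tangent_sum:
  assumes v: "v \<in> tangent_space A x"
  shows "(\<And>i. i \<in> I \<Longrightarrow> smooth_fun A (f i)) \<Longrightarrow> v (\<lambda>y. \<Sum>i\<in>I. f i y) = (\<Sum>i\<in>I. v (f i))"
proof (induction I rule: infinite_finite_induct)
  case (insert i I)
  then show ?case using tangent_add[OF v, of "f i" "\<lambda>y. \<Sum>i\<in>I. f i y"] by (simp add: smooth_fun_sum)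
qed (simp_all add: tangent_const[OF v])

text \<open>\<open>\<xi> i\<close> is the i-th coordinate, centred at \<open>x\<close> and cut off.
  Hadamard's lemma writes f - f(x) near \<open>x\<close> as a sum of products with the factors
  \<open>\<xi> i\<close>, and the Leibniz rule leaves the partial derivatives of f as coefficients.
  The \<open>\<xi> i\<close> depend neither on the derivation nor on f.\<close>

lemma tangent_coordinates:
  assumes c: "c \<in> A" "x \<in> fst c"
  obtains \<xi> where "\<And>i. smooth_fun A (\<xi> i)"
    "\<And>v f. v \<in> tangent_space A x \<Longrightarrow> smooth_fun A f \<Longrightarrow>
       v f = (\<Sum>i\<in>Basis. frechet_derivative (\<lambda>y. f (chart_inv c y)) (at (snd c x)) i * v (\<xi> i))"
proof -
  define y0 where "y0 = snd c x"
  have y0: "y0 \<in> chart_image c" "chart_inv c y0 = x" using c chart_inv_chart by (auto simp: y0_def)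
  obtain r where r: "0 < r" "cball y0 r \<subseteq> chart_image c"
    using open_contains_cball chart_open(2)[OF c(1)] y0(1) by blast
  have br: "ball y0 r \<subseteq> chart_image c" using r(2) by auto
  have W: "open (chart_inv c ` ball y0 r)" "x \<in> chart_inv c ` ball y0 r"
  proof -
    have "chart_inv c ` ball y0 r = fst c \<inter> snd c -` ball y0 r"
    proof (intro set_eqI iffI)
      fix z assume "z \<in> chart_inv c ` ball y0 r"
      then obtain y where y: "z = chart_inv c y" "y \<in> ball y0 r" by (rule imageE)
      then have "y \<in> chart_image c" using br by blast
      then show "z \<in> fst c \<inter> snd c -` ball y0 r" using y chart_chart_inv[OF c(1)] by (simp add: chart_inv_in)
    next
      fix z assume "z \<in> fst c \<inter> snd c -` ball y0 r"
      then show "z \<in> chart_inv c ` ball y0 r" using chart_inv_chart[OF c(1), of z] by (metis IntE image_eqI vimageE)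
    qed
    then show "open (chart_inv c ` ball y0 r)"
      using continuous_open_preimage[OF chart_continuous(1)[OF c(1)] chart_open(1)[OF c(1)] open_ball] by simp
    show "x \<in> chart_inv c ` ball y0 r" using y0(2) r(1) by (metis centre_in_ball image_eqI)
  qed
  obtain \<psi> V K where \<psi>: "smooth_fun A \<psi>" "open V" "x \<in> V" "\<And>y. y \<in> V \<Longrightarrow> \<psi> y = 1" "closed K"
    "K \<subseteq> chart_inv c ` ball y0 r" "\<And>y. y \<notin> K \<Longrightarrow> \<psi> y = (0::real)"
    using bump[OF W] by metis
  define K' where "K' = snd c ` K"
  have Kc: "K \<subseteq> fst c"
  proof
    fix z assume "z \<in> K"
    then obtain y where "z = chart_inv c y" "y \<in> ball y0 r" using \<psi>(6) by blast
    moreover from this have "y \<in> chart_image c" using br by blast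
    ultimately show "z \<in> fst c" using chart_inv_in[of y c] by simp
  qed
  have K': "compact K'" "K' \<subseteq> ball y0 r"
  proof -
    have "compact K" using compact_Int_closed[OF compact_UNIV \<psi>(5)] by simp
    then show "compact K'" unfolding K'_def
      using chart_continuous(1)[OF c(1)] Kc by (meson compact_continuous_image continuous_on_subset)
    show "K' \<subseteq> ball y0 r"
    proof
      fix y assume "y \<in> K'"
      then obtain z where z: "z \<in> K" "y = snd c z" by (auto simp: K'_def)
      then obtain u where u: "z = chart_inv c u" "u \<in> ball y0 r" using \<psi>(6) by blast
      then have "u \<in> chart_image c" using br by blast
      then have "y = u" using z u chart_chart_inv[OF c(1), of u] by simp
      then show "y \<in> ball y0 r" using u by simp
    qed
  qed
  have \<psi>K: "\<psi> (chart_inv c y) = 0" if "y \<in> chart_image c" "y \<notin> K'" for y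
  proof -
    have "chart_inv c y \<notin> K" using that chart_chart_inv[OF c(1)] unfolding K'_def by (metis imageI)
    then show ?thesis by (rule \<psi>(7))
  qed
  have \<psi>x: "\<psi> x = 1" using \<psi> by blast
  have sm: "smooth_fun A (\<lambda>z. if z \<in> fst c then \<psi> (chart_inv c (snd c z)) * u (snd c z) else 0)"
    if u: "smooth_on (ball y0 r) u" for u :: "'b \<Rightarrow> real"
  proof (rule extend_by_zero[OF c(1), of "\<lambda>y. \<psi> (chart_inv c y) * u y" K'])
    show "smooth_on (chart_image c) (\<lambda>y. \<psi> (chart_inv c y) * u y)"
    proof (rule smooth_on_local)
      fix y assume y: "y \<in> chart_image c"
      show "\<exists>T. open T \<and> y \<in> T \<and> smooth_on T (\<lambda>y. \<psi> (chart_inv c y) * u y)"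
      proof (cases "y \<in> K'")
        case True
        have "smooth_on (ball y0 r) (\<lambda>y. \<psi> (chart_inv c y) * u y)"
          by (intro smooth_on_mult open_ball u smooth_on_subset[OF smooth_funD[OF \<psi>(1) c(1)] br])
        then show ?thesis using True K'(2) open_ball by blast
      next
        case False
        let ?T = "chart_image c \<inter> - K'"
        have T: "open ?T" using K'(1) chart_open(2)[OF c(1)] by (intro open_Int open_Compl compact_imp_closed)
        have "smooth_on ?T (\<lambda>y. \<psi> (chart_inv c y) * u y)"
          by (rule smooth_on_cong[OF T smooth_on_const[of _ 0]]) (use \<psi>K in auto)
        then show ?thesis using T y False by blast
      qed
    qed
  qed (use K' br \<psi>K in auto)
  define ext where "ext = (\<lambda>u z. if z \<in> fst c then \<psi> (chart_inv c (snd c z)) * u (snd c z) else (0::real))"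
  have ext_sm: "smooth_fun A (ext u)" if "smooth_on (ball y0 r) u" for u
    unfolding ext_def by (rule sm[OF that])
  define \<xi> where "\<xi> = (\<lambda>i. ext (\<lambda>y. y \<bullet> i + - (y0 \<bullet> i)))"
  have lin_sm: "smooth_on (ball y0 r) (\<lambda>y. y \<bullet> i + - (y0 \<bullet> i))" for i
    by (intro smooth_on_add smooth_on_const open_ball smooth_on_linear bounded_linear_inner_left)
  have \<xi>: "smooth_fun A (\<xi> i)" for i unfolding \<xi>_def by (rule ext_sm[OF lin_sm])
  have \<xi>x: "\<xi> i x = 0" for i using c by (simp add: \<xi>_def ext_def y0_def)
  have "v f = (\<Sum>i\<in>Basis. frechet_derivative (\<lambda>y. f (chart_inv c y)) (at y0) i * v (\<xi> i))"
    if v: "v \<in> tangent_space A x" and f: "smooth_fun A f" for v f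
  proof -
    obtain G where G: "\<And>i. smooth_on (ball y0 r) (G i)" "\<And>i. G i y0 = frechet_derivative (\<lambda>y. f (chart_inv c y)) (at y0) i"
      "\<And>y. y \<in> ball y0 r \<Longrightarrow> f (chart_inv c y) = f (chart_inv c y0) + (\<Sum>i\<in>Basis. ((y - y0) \<bullet> i) * G i y)"
      by (rule hadamard[OF smooth_on_subset[OF smooth_funD[OF f c(1)] br] r(1)], rule that)
    define g where "g = (\<lambda>i. ext (G i))"
    have g: "smooth_fun A (g i)" for i unfolding g_def by (rule ext_sm[OF G(1)])
    have gx: "g i x = G i y0" for i using c \<psi>x chart_inv_chart by (simp add: g_def ext_def y0_def)
    \<comment> \<open>Both \<open>\<xi> i\<close> and \<open>g i\<close> carry a factor \<psi>,
      hence the square. As \<kappa> and f - f(x) both vanish at \<open>x\<close>, every derivation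
      at \<open>x\<close> annihilates their product.\<close>
    define \<kappa> where "\<kappa> = (\<lambda>z. 1 - \<psi> z * \<psi> z)"
    have \<kappa>: "smooth_fun A \<kappa>" unfolding \<kappa>_def by (intro smooth_fun_diff smooth_fun_const smooth_fun_mult \<psi>)
    have f0: "smooth_fun A (\<lambda>z. f z - f x)" by (intro smooth_fun_diff smooth_fun_const f)
    have eq: "(\<lambda>z. f z - f x) = (\<lambda>z. (\<Sum>i\<in>Basis. \<xi> i z * g i z) + \<kappa> z * (f z - f x))"
    proof
      fix z
      show "f z - f x = (\<Sum>i\<in>Basis. \<xi> i z * g i z) + \<kappa> z * (f z - f x)"
      proof (cases "z \<in> K")
        case True
        then have z: "z \<in> fst c" "snd c z \<in> ball y0 r" "chart_inv c (snd c z) = z"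
          using Kc K'(2) chart_inv_chart[OF c(1)] by (auto simp: K'_def)
        have "f z - f x = (\<Sum>i\<in>Basis. ((snd c z - y0) \<bullet> i) * G i (snd c z))"
          using G(3)[OF z(2)] z(3) y0(2) by simp
        then have "\<psi> z * \<psi> z * (f z - f x) = (\<Sum>i\<in>Basis. \<xi> i z * g i z)"
          using z by (simp add: \<xi>_def g_def ext_def sum_distrib_left inner_diff_left mult_ac)
        then show ?thesis by (simp add: \<kappa>_def algebra_simps)
      next
        case False
        then have "\<psi> z = 0" by (rule \<psi>(7))
        moreover have "\<xi> i z = 0" for i
          using \<open>\<psi> z = 0\<close> chart_inv_chart[OF c(1), of z] by (simp add: \<xi>_def ext_def)
        ultimately show ?thesis by (simp add: \<kappa>_def)
      qed
    qed
    have "v f = v (\<lambda>z. f z - f x)"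
      using tangent_add[OF v f smooth_fun_const[of "- f x"]] tangent_const[OF v] by simp
    also have "\<dots> = v (\<lambda>z. \<Sum>i\<in>Basis. \<xi> i z * g i z) + v (\<lambda>z. \<kappa> z * (f z - f x))"
      by (subst eq, rule tangent_add[OF v]) (intro smooth_fun_sum smooth_fun_mult \<xi> g \<kappa> f0)+
    also have "v (\<lambda>z. \<kappa> z * (f z - f x)) = 0"
      using tangent_mult[OF v \<kappa> f0] \<psi>x by (simp add: \<kappa>_def)
    also have "v (\<lambda>z. \<Sum>i\<in>Basis. \<xi> i z * g i z) = (\<Sum>i\<in>Basis. v (\<lambda>z. \<xi> i z * g i z))"
      by (rule tangent_sum[OF v]) (intro smooth_fun_mult \<xi> g)
    also have "\<dots> = (\<Sum>i\<in>Basis. frechet_derivative (\<lambda>y. f (chart_inv c y)) (at y0) i * v (\<xi> i))"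
      by (simp add: tangent_mult[OF v \<xi> g] \<xi>x gx G(2))
    finally show ?thesis by simp
  qed
  then show ?thesis using \<xi> by (intro that[of \<xi>]) (auto simp: y0_def)
qed

end

section \<open>Chain rules\<close>

lemma line_derivative:
  assumes "csm B U"
  shows "((\<lambda>s. U (p + s *\<^sub>R e)) has_real_derivative pd e U (p + s *\<^sub>R e)) (at s)"
proof -
  define D where "D = (\<lambda>v. pd v U (p + s *\<^sub>R e))"
  have lin: "linear D" unfolding D_def by (rule pd_linear[OF csm_differentiable[OF assms]])
  have "((\<lambda>s. p + s *\<^sub>R e) has_derivative (\<lambda>k. k *\<^sub>R e)) (at s)" by (auto intro!: derivative_eq_intros)
  from has_derivative_compose[OF this pd_unfold[OF csm_differentiable[OF assms]]]
  have "((\<lambda>s. U (p + s *\<^sub>R e)) has_derivative (\<lambda>k. D (k *\<^sub>R e))) (at s)" unfolding D_def .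
  also have "(\<lambda>k. D (k *\<^sub>R e)) = (*) (D e)" using lin by (auto simp: fun_eq_iff linear_scale)
  finally show ?thesis by (simp add: has_field_derivative_def D_def)
qed

lemma second_difference:
  assumes U: "csm B U" and e: "e \<in> B" and h: "0 < h"
  shows "\<exists>\<xi> \<eta>. 0 < \<xi> \<and> \<xi> < h \<and> 0 < \<eta> \<and> \<eta> < h \<and>
    U (z + h *\<^sub>R e + h *\<^sub>R e') - U (z + h *\<^sub>R e) - U (z + h *\<^sub>R e') + U z =
      h * h * pd e' (pd e U) (z + \<xi> *\<^sub>R e + \<eta> *\<^sub>R e')"
proof -
  let ?\<phi> = "\<lambda>s. U ((z + h *\<^sub>R e') + s *\<^sub>R e) - U (z + s *\<^sub>R e)"
  have "\<exists>\<xi>. 0 < \<xi> \<and> \<xi> < h \<and> ?\<phi> h - ?\<phi> 0 = (h - 0) * (pd e U ((z + h *\<^sub>R e') + \<xi> *\<^sub>R e) - pd e U (z + \<xi> *\<^sub>R e))"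
    using h by (intro MVT2) (auto intro!: DERIV_diff line_derivative[OF U])
  then obtain \<xi> where \<xi>: "0 < \<xi>" "\<xi> < h" "?\<phi> h - ?\<phi> 0 = h * (pd e U ((z + \<xi> *\<^sub>R e) + h *\<^sub>R e') - pd e U (z + \<xi> *\<^sub>R e))"
    by (auto simp: algebra_simps)
  have "\<exists>\<eta>. 0 < \<eta> \<and> \<eta> < h \<and> pd e U ((z + \<xi> *\<^sub>R e) + h *\<^sub>R e') - pd e U ((z + \<xi> *\<^sub>R e) + 0 *\<^sub>R e') =
      (h - 0) * pd e' (pd e U) ((z + \<xi> *\<^sub>R e) + \<eta> *\<^sub>R e')"
    using h by (intro MVT2) (auto intro!: line_derivative[OF csm_pd[OF U e]])
  then obtain \<eta> where "0 < \<eta>" "\<eta> < h" "pd e U ((z + \<xi> *\<^sub>R e) + h *\<^sub>R e') - pd e U (z + \<xi> *\<^sub>R e) =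
      h * pd e' (pd e U) ((z + \<xi> *\<^sub>R e) + \<eta> *\<^sub>R e')" by auto
  then show ?thesis using \<xi> by (intro exI[of _ \<xi>] exI[of _ \<eta>]) (simp add: algebra_simps)
qed

text \<open>The second difference is symmetric in \<open>e\<close> and \<open>e'\<close>. Divided by
  h^2 it is a value of either mixed derivative at a point near \<open>z\<close>, and both mixed
  derivatives are continuous at \<open>z\<close>.\<close>

lemma pd_commute:
  assumes U: "csm B U" and e: "e \<in> B" "e' \<in> B"
  shows "pd e' (pd e U) z = pd e (pd e' U) z"
proof (rule ccontr)
  let ?f = "pd e' (pd e U)" and ?g = "pd e (pd e' U)"
  assume ne: "?f z \<noteq> ?g z"
  define \<epsilon> where "\<epsilon> = \<bar>?f z - ?g z\<bar> / 3"
  have \<epsilon>: "0 < \<epsilon>" using ne by (simp add: \<epsilon>_def)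
  have cont: "isCont ?f z" "isCont ?g z"
    using csm_differentiable[OF csm_pd[OF csm_pd[OF U e(1)] e(2)]] csm_differentiable[OF csm_pd[OF csm_pd[OF U e(2)] e(1)]]
      differentiable_imp_continuous_within by blast+
  obtain d1 where d1: "0 < d1" "\<And>y. dist y z < d1 \<Longrightarrow> dist (?f y) (?f z) < \<epsilon>"
    using cont(1) \<epsilon> unfolding continuous_at_eps_delta by blast
  obtain d2 where d2: "0 < d2" "\<And>y. dist y z < d2 \<Longrightarrow> dist (?g y) (?g z) < \<epsilon>"
    using cont(2) \<epsilon> unfolding continuous_at_eps_delta by blast
  define h where "h = min d1 d2 / (2 * (norm e + norm e' + 1))"
  have h: "0 < h" using d1 d2 by (auto simp: h_def intro!: divide_pos_pos add_nonneg_pos)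
  have near: "dist (z + s *\<^sub>R e + t *\<^sub>R e') z < min d1 d2" if "0 < s" "s < h" "0 < t" "t < h" for s t
  proof -
    have "dist (z + s *\<^sub>R e + t *\<^sub>R e') z = norm (s *\<^sub>R e + t *\<^sub>R e')" by (simp add: dist_norm)
    also have "\<dots> \<le> s * norm e + t * norm e'" using that norm_triangle_ineq[of "s *\<^sub>R e" "t *\<^sub>R e'"] by simp
    also have "\<dots> \<le> h * norm e + h * norm e'" using that by (intro add_mono mult_right_mono) auto
    also have "\<dots> < h * (2 * (norm e + norm e' + 1))"
    proof -
      have "norm e + norm e' < 2 * (norm e + norm e' + 1)" 
        using norm_ge_zero[of e] norm_ge_zero[of e'] unfolding distrib_left by linarith
      from mult_strict_left_mono[OF this h] show ?thesis by (simp add: algebra_simps)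
    qed
    also have "\<dots> = min d1 d2"
    proof -
      have "0 < norm e + norm e' + 1" by (intro add_nonneg_pos) auto
      then show ?thesis by (simp add: h_def)
    qed
    finally show ?thesis .
  qed
  let ?\<Delta> = "U (z + h *\<^sub>R e + h *\<^sub>R e') - U (z + h *\<^sub>R e) - U (z + h *\<^sub>R e') + U z"
  obtain s t where st: "0 < s" "s < h" "0 < t" "t < h" "?\<Delta> = h * h * ?f (z + s *\<^sub>R e + t *\<^sub>R e')"
    using second_difference[OF U e(1) h, of z e'] by blast
  obtain s' t' where st': "0 < s'" "s' < h" "0 < t'" "t' < h"
    "U (z + h *\<^sub>R e' + h *\<^sub>R e) - U (z + h *\<^sub>R e') - U (z + h *\<^sub>R e) + U z = h * h * ?g (z + s' *\<^sub>R e' + t' *\<^sub>R e)"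
    using second_difference[OF U e(2) h, of z e] by blast
  have eqs: "z + h *\<^sub>R e' + h *\<^sub>R e = z + h *\<^sub>R e + h *\<^sub>R e'" "z + s' *\<^sub>R e' + t' *\<^sub>R e = z + t' *\<^sub>R e + s' *\<^sub>R e'"
    by (simp_all add: algebra_simps)
  have "h * h * ?f (z + s *\<^sub>R e + t *\<^sub>R e') = h * h * ?g (z + t' *\<^sub>R e + s' *\<^sub>R e')"
    using st(5) st'(5)[unfolded eqs] by linarith
  then have "?f (z + s *\<^sub>R e + t *\<^sub>R e') = ?g (z + t' *\<^sub>R e + s' *\<^sub>R e')" using h by simp
  moreover have "dist (?f (z + s *\<^sub>R e + t *\<^sub>R e')) (?f z) < \<epsilon>" using near[OF st(1-4)] by (intro d1) auto
  moreover have "dist (?g (z + t' *\<^sub>R e + s' *\<^sub>R e')) (?g z) < \<epsilon>" using near[OF st'(3,4,1,2)] by (intro d2) auto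
  ultimately have "\<bar>?f z - ?g z\<bar> < 2 * \<epsilon>" unfolding dist_real_def by linarith
  then show False using \<epsilon> by (simp add: \<epsilon>_def)
qed

lemma comp_has_derivative:
  assumes "finite B" "csm B U" and p: "\<And>e. e \<in> B \<Longrightarrow> (p e has_derivative p' e) (at y)"
  shows "((\<lambda>y. U (\<Sum>e\<in>B. p e y *\<^sub>R e)) has_derivative
    (\<lambda>v. \<Sum>e\<in>B. p' e v * pd e U (\<Sum>e\<in>B. p e y *\<^sub>R e))) (at y)"
proof -
  let ?P = "\<lambda>y. \<Sum>e\<in>B. p e y *\<^sub>R e"
  define D where "D = (\<lambda>v. pd v U (?P y))"
  have lin: "linear D" unfolding D_def by (rule pd_linear[OF csm_differentiable[OF assms(2)]])
  have "(?P has_derivative (\<lambda>v. \<Sum>e\<in>B. p' e v *\<^sub>R e)) (at y)"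
    by (intro has_derivative_sum has_derivative_scaleR_left p)
  from has_derivative_compose[OF this pd_unfold[OF csm_differentiable[OF assms(2)]]]
  have "((\<lambda>y. U (?P y)) has_derivative (\<lambda>v. D (\<Sum>e\<in>B. p' e v *\<^sub>R e))) (at y)" unfolding D_def .
  also have "(\<lambda>v. D (\<Sum>e\<in>B. p' e v *\<^sub>R e)) = (\<lambda>v. \<Sum>e\<in>B. p' e v * D e)"
    by (simp add: linear_sum[OF lin] linear_scale[OF lin])
  finally show ?thesis by (simp only: D_def)
qed

lemma Ck_on_comp:
  assumes "open S" "finite B"
  shows "csm B U \<Longrightarrow> (\<And>e. e \<in> B \<Longrightarrow> Ck_on k S (p e)) \<Longrightarrow> Ck_on k S (\<lambda>y. U (\<Sum>e\<in>B. p e y *\<^sub>R e))"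
proof (induction k arbitrary: U)
  case 0
  have "continuous_on UNIV U"
    using csm_differentiable[OF 0(1)] by (auto intro!: continuous_at_imp_continuous_on differentiable_imp_continuous_within)
  moreover have "continuous_on S (\<lambda>y. \<Sum>e\<in>B. p e y *\<^sub>R e)" using 0(2) by (auto intro!: continuous_intros)
  ultimately show ?case by (auto intro: continuous_on_compose2)
next
  case (Suc k)
  show ?case
  proof (rule Ck_on_SucI[OF assms(1)])
    fix y assume y: "y \<in> S"
    show "((\<lambda>y. U (\<Sum>e\<in>B. p e y *\<^sub>R e)) has_derivative
      (\<lambda>v. \<Sum>e\<in>B. frechet_derivative (p e) (at y) v * pd e U (\<Sum>e\<in>B. p e y *\<^sub>R e))) (at y)"
      by (rule comp_has_derivative[OF assms(2) Suc.prems(1)]) (rule Ck_on_has_derivative[OF Suc.prems(2) y])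
  next
    fix v
    show "Ck_on k S (\<lambda>y. \<Sum>e\<in>B. frechet_derivative (p e) (at y) v * pd e U (\<Sum>e\<in>B. p e y *\<^sub>R e))"
    proof (rule Ck_on_sum[OF assms(1)], rule Ck_on_mult[OF assms(1)])
      fix e assume e: "e \<in> B"
      show "Ck_on k S (\<lambda>y. frechet_derivative (p e) (at y) v)" using Suc.prems(2)[OF e] by simp
      show "Ck_on k S (\<lambda>y. pd e U (\<Sum>e\<in>B. p e y *\<^sub>R e))"
        by (rule Suc.IH[OF csm_pd[OF Suc.prems(1) e]]) (rule Ck_on_SucD[OF Suc.prems(2)])
    qed
  qed
qed

context compact_manifold
begin

lemma smooth_fun_comp:
  assumes "finite B" "csm B U" "\<And>e. e \<in> B \<Longrightarrow> smooth_fun A (\<phi> e)"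
  shows "smooth_fun A (\<lambda>x. U (\<Sum>e\<in>B. \<phi> e x *\<^sub>R e))"
proof (rule smooth_funI)
  fix c assume c: "c \<in> A"
  show "smooth_on (chart_image c) (\<lambda>y. U (\<Sum>e\<in>B. \<phi> e (chart_inv c y) *\<^sub>R e))"
    unfolding smooth_on_def
    by (intro allI Ck_on_comp[OF chart_open(2)[OF c] assms(1,2), where p = "\<lambda>e y. \<phi> e (chart_inv c y)"]
        smooth_onD smooth_funD[OF assms(3) c])
qed

text \<open>By \<open>tangent_coordinates\<close> a derivation sees only the first partial
  derivatives of the chart expression, and to these the chain rule applies.\<close>

lemma tangent_comp:
  assumes B: "finite B" "csm B U" and \<phi>: "\<And>e. e \<in> B \<Longrightarrow> smooth_fun A (\<phi> e)" and v: "v \<in> tangent_space A x"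
  shows "v (\<lambda>x. U (\<Sum>e\<in>B. \<phi> e x *\<^sub>R e)) = (\<Sum>e\<in>B. pd e U (\<Sum>e\<in>B. \<phi> e x *\<^sub>R e) * v (\<phi> e))"
proof -
  obtain c where c: "c \<in> A" "x \<in> fst c" using chart_ex by blast
  obtain \<xi> where \<xi>_smooth: "\<And>i. smooth_fun A (\<xi> i)" and \<xi>: "\<And>v f. v \<in> tangent_space A x \<Longrightarrow> smooth_fun A f \<Longrightarrow>
       v f = (\<Sum>i\<in>Basis. frechet_derivative (\<lambda>y. f (chart_inv c y)) (at (snd c x)) i * v (\<xi> i))"
    by (rule tangent_coordinates[OF c], rule that)
  let ?F = "\<lambda>x. \<Sum>e\<in>B. \<phi> e x *\<^sub>R e"
  define y where "y = snd c x"
  have y: "y \<in> chart_image c" "chart_inv c y = x" using c chart_inv_chart by (auto simp: y_def)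
  let ?p = "\<lambda>e y. \<phi> e (chart_inv c y)"
  have "((\<lambda>y. U (\<Sum>e\<in>B. ?p e y *\<^sub>R e)) has_derivative
    (\<lambda>v. \<Sum>e\<in>B. frechet_derivative (?p e) (at y) v * pd e U (\<Sum>e\<in>B. ?p e y *\<^sub>R e))) (at y)"
    by (rule comp_has_derivative[OF B]) (rule smooth_on_has_derivative[OF smooth_funD[OF \<phi> c(1)] y(1)])
  then have fd: "frechet_derivative (\<lambda>y. U (?F (chart_inv c y))) (at y) =
     (\<lambda>v. \<Sum>e\<in>B. frechet_derivative (?p e) (at y) v * pd e U (?F x))"
    using y(2) by (simp add: frechet_derivative_at[symmetric])
  have "v (\<lambda>x. U (?F x)) = (\<Sum>i\<in>Basis. (\<Sum>e\<in>B. frechet_derivative (?p e) (at y) i * pd e U (?F x)) * v (\<xi> i))"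
    using \<xi>[OF v smooth_fun_comp[OF B \<phi>]] fd by (simp add: y_def)
  also have "\<dots> = (\<Sum>e\<in>B. \<Sum>i\<in>Basis. frechet_derivative (?p e) (at y) i * pd e U (?F x) * v (\<xi> i))"
    unfolding sum_distrib_right by (rule sum.swap)
  also have "\<dots> = (\<Sum>e\<in>B. pd e U (?F x) * v (\<phi> e))"
    by (intro sum.cong refl) (simp add: \<xi>[OF v \<phi>] y_def sum_distrib_left mult_ac)
  finally show ?thesis .
qed

end

section \<open>The second order operator on composite functions\<close>

locale manifold_operator = compact_manifold A
  for A :: "('a::{t2_space,second_countable_topology}, 'b::euclidean_space) atlas" +
  fixes L :: "('a \<Rightarrow> real) \<Rightarrow> ('a \<Rightarrow> real)"
  assumes L: "second_order_operator A L"
begin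

lemma L_local:
  assumes c: "c \<in> A" 
  obtains a b where "\<And>i j. i \<in> Basis \<Longrightarrow> j \<in> Basis \<Longrightarrow> smooth_on (chart_image c) (a i j)"
    "\<And>i. i \<in> Basis \<Longrightarrow> smooth_on (chart_image c) (b i)"
    "\<And>f y. smooth_fun A f \<Longrightarrow> y \<in> chart_image c \<Longrightarrow>
        L f (chart_inv c y) =
          (\<Sum>i\<in>Basis. \<Sum>j\<in>Basis. a i j y *
             frechet_derivative (\<lambda>z. frechet_derivative (\<lambda>y. f (chart_inv c y)) (at z) j) (at y) i)
          + (\<Sum>i\<in>Basis. b i y * frechet_derivative (\<lambda>y. f (chart_inv c y)) (at y) i)"
proof -
  have "\<exists>a b. (\<forall>i\<in>Basis. \<forall>j\<in>Basis. smooth_on (chart_image c) (a i j)) \<and>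
     (\<forall>i\<in>Basis. smooth_on (chart_image c) (b i)) \<and>
     (\<forall>f. smooth_fun A f \<longrightarrow> (\<forall>y\<in>chart_image c.
        L f (chart_inv c y) =
          (\<Sum>i\<in>Basis. \<Sum>j\<in>Basis. a i j y *
             frechet_derivative (\<lambda>z. frechet_derivative (\<lambda>y. f (chart_inv c y)) (at z) j) (at y) i)
          + (\<Sum>i\<in>Basis. b i y * frechet_derivative (\<lambda>y. f (chart_inv c y)) (at y) i)))"
    using L[unfolded second_order_operator_def comp_def, rule_format, OF c] .
  then obtain a b where "\<forall>i\<in>Basis. \<forall>j\<in>Basis. smooth_on (chart_image c) (a i j)"
    and "\<forall>i\<in>Basis. smooth_on (chart_image c) (b i)"
    and "\<forall>f. smooth_fun A f \<longrightarrow> (\<forall>y\<in>chart_image c.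
        L f (chart_inv c y) =
          (\<Sum>i\<in>Basis. \<Sum>j\<in>Basis. a i j y *
             frechet_derivative (\<lambda>z. frechet_derivative (\<lambda>y. f (chart_inv c y)) (at z) j) (at y) i)
          + (\<Sum>i\<in>Basis. b i y * frechet_derivative (\<lambda>y. f (chart_inv c y)) (at y) i))"
    by (elim exE conjE)
  from this[rule_format] show ?thesis by (rule that)
qed

lemma L_smooth:
  assumes f: "smooth_fun A f" shows "smooth_fun A (L f)"
proof (rule smooth_funI)
  fix c assume c: "c \<in> A"
  obtain a b where ab: "\<And>i j. i \<in> Basis \<Longrightarrow> j \<in> Basis \<Longrightarrow> smooth_on (chart_image c) (a i j)"
    "\<And>i. i \<in> Basis \<Longrightarrow> smooth_on (chart_image c) (b i)"
    "\<And>f y. smooth_fun A f \<Longrightarrow> y \<in> chart_image c \<Longrightarrow>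
        L f (chart_inv c y) =
          (\<Sum>i\<in>Basis. \<Sum>j\<in>Basis. a i j y *
             frechet_derivative (\<lambda>z. frechet_derivative (\<lambda>y. f (chart_inv c y)) (at z) j) (at y) i)
          + (\<Sum>i\<in>Basis. b i y * frechet_derivative (\<lambda>y. f (chart_inv c y)) (at y) i)"
    by (rule L_local[OF c], rule that)
  show "smooth_on (chart_image c) (\<lambda>y. L f (chart_inv c y))"
  proof (rule smooth_on_cong[OF chart_open(2)[OF c]])
    show "smooth_on (chart_image c) (\<lambda>y. (\<Sum>i\<in>Basis. \<Sum>j\<in>Basis. a i j y *
             frechet_derivative (\<lambda>z. frechet_derivative (\<lambda>y. f (chart_inv c y)) (at z) j) (at y) i)
          + (\<Sum>i\<in>Basis. b i y * frechet_derivative (\<lambda>y. f (chart_inv c y)) (at y) i))"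
      by (intro smooth_on_add smooth_on_sum smooth_on_mult chart_open(2)[OF c] ab(1,2)
          smooth_on_frechet_derivative smooth_funD[OF f c])
  qed (simp add: ab(3)[OF f])
qed

text \<open>The coefficients of order two of \<open>L\<close> in a chart need not be symmetric; only their symmetrization
  contributes, because second derivatives commute.\<close>
lemma L_comp:
  assumes B: "finite B" "csm B U" and \<phi>: "\<And>e. e \<in> B \<Longrightarrow> smooth_fun A (\<phi> e)"
  shows "L (\<lambda>x. U (\<Sum>e\<in>B. \<phi> e x *\<^sub>R e)) x =
    (\<Sum>e\<in>B. \<Sum>e'\<in>B. (L (\<lambda>x. \<phi> e x * \<phi> e' x) x - \<phi> e x * L (\<phi> e') x - \<phi> e' x * L (\<phi> e) x) / 2 *
        pd e' (pd e U) (\<Sum>e\<in>B. \<phi> e x *\<^sub>R e))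
    + (\<Sum>e\<in>B. L (\<phi> e) x * pd e U (\<Sum>e\<in>B. \<phi> e x *\<^sub>R e))"
proof -
  let ?F = "\<lambda>x. \<Sum>e\<in>B. \<phi> e x *\<^sub>R e"
  obtain c where c: "c \<in> A" "x \<in> fst c" using chart_ex by blast
  obtain a b where "\<And>i j. i \<in> Basis \<Longrightarrow> j \<in> Basis \<Longrightarrow> smooth_on (chart_image c) (a i j)"
    and "\<And>i. i \<in> Basis \<Longrightarrow> smooth_on (chart_image c) (b i)"
    and L_eq: "\<And>f y. smooth_fun A f \<Longrightarrow> y \<in> chart_image c \<Longrightarrow>
        L f (chart_inv c y) =
          (\<Sum>i\<in>Basis. \<Sum>j\<in>Basis. a i j y *
             frechet_derivative (\<lambda>z. frechet_derivative (\<lambda>y. f (chart_inv c y)) (at z) j) (at y) i)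
          + (\<Sum>i\<in>Basis. b i y * frechet_derivative (\<lambda>y. f (chart_inv c y)) (at y) i)"
    by (rule L_local[OF c(1)], rule that)
  define y where "y = snd c x"
  have y: "y \<in> chart_image c" "chart_inv c y = x" using c chart_inv_chart by (auto simp: y_def)
  have S: "open (chart_image c)" by (rule chart_open(2)[OF c(1)])
  define p where "p = (\<lambda>e y. \<phi> e (chart_inv c y))"
  have p: "smooth_on (chart_image c) (p e)" if "e \<in> B" for e
    unfolding p_def by (rule smooth_funD[OF \<phi>[OF that] c(1)])
  define d where "d = (\<lambda>e j z. frechet_derivative (p e) (at z) j)"
  have pd: "(p e has_derivative (\<lambda>j. d e j z)) (at z)" if "e \<in> B" "z \<in> chart_image c" for e z
    unfolding d_def by (rule smooth_on_has_derivative[OF p[OF that(1)] that(2)])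
  define d2 where "d2 = (\<lambda>e i j z. frechet_derivative (d e j) (at z) i)"
  have pd2: "(d e j has_derivative (\<lambda>i. d2 e i j z)) (at z)" if "e \<in> B" "z \<in> chart_image c" for e j z
    unfolding d2_def
    by (rule smooth_on_has_derivative[OF _ that(2)]) (unfold d_def, rule smooth_on_frechet_derivative[OF p[OF that(1)]])
  have L\<phi>: "L (\<phi> e) x = (\<Sum>i\<in>Basis. \<Sum>j\<in>Basis. a i j y * d2 e i j y) + (\<Sum>i\<in>Basis. b i y * d e i y)" if "e \<in> B" for e
    using L_eq[OF \<phi>[OF that] y(1)] unfolding y(2) d2_def d_def p_def .
  \<comment> \<open>The second order coefficients of the chart, evaluated on the differentials of
    \<open>\<phi> e\<close> and \<open>\<phi> e'\<close>; in general this is not symmetric in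
    \<open>e\<close> and \<open>e'\<close>.\<close>
  define M where "M = (\<lambda>e e'. \<Sum>i\<in>Basis. \<Sum>j\<in>Basis. a i j y * (d e i y * d e' j y))"
  define Q1 where "Q1 = (\<lambda>e. pd e U (?F x))"
  define Q2 where "Q2 = (\<lambda>e' e. pd e' (pd e U) (?F x))"
  have Px: "(\<Sum>e\<in>B. p e y *\<^sub>R e) = ?F x" by (simp add: p_def y(2))
  have "L (\<lambda>x. U (?F x)) x = (\<Sum>i\<in>Basis. \<Sum>j\<in>Basis. a i j y *
             (\<Sum>e\<in>B. d2 e i j y * Q1 e + d e j y * (\<Sum>e'\<in>B. d e' i y * Q2 e' e)))
          + (\<Sum>i\<in>Basis. b i y * (\<Sum>e\<in>B. d e i y * Q1 e))"
  proof -
    let ?f = "\<lambda>y. U (\<Sum>e\<in>B. p e y *\<^sub>R e)"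
    have D: "(?f has_derivative (\<lambda>v. \<Sum>e\<in>B. d e v z * pd e U (\<Sum>e\<in>B. p e z *\<^sub>R e))) (at z)" if "z \<in> chart_image c" for z
      by (rule comp_has_derivative[OF B]) (rule pd[OF _ that])
    have fd: "frechet_derivative ?f (at z) j = (\<Sum>e\<in>B. d e j z * pd e U (\<Sum>e\<in>B. p e z *\<^sub>R e))" if "z \<in> chart_image c" for z j
      using frechet_derivative_at[OF D[OF that]] by (simp add: fun_eq_iff)
    have D2: "((\<lambda>z. frechet_derivative ?f (at z) j) has_derivative
        (\<lambda>i. \<Sum>e\<in>B. d2 e i j y * Q1 e + d e j y * (\<Sum>e'\<in>B. d e' i y * Q2 e' e))) (at y)" for j
    proof (rule has_derivative_transform_within_open[OF _ S y(1)])
      have "((\<lambda>z. pd e U (\<Sum>e\<in>B. p e z *\<^sub>R e)) has_derivative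
          (\<lambda>v. \<Sum>e'\<in>B. d e' v y * pd e' (pd e U) (\<Sum>e\<in>B. p e y *\<^sub>R e))) (at y)" if "e \<in> B" for e
        by (rule comp_has_derivative[OF B(1) csm_pd[OF B(2) that]]) (rule pd[OF _ y(1)])
      then have "((\<lambda>z. d e j z * pd e U (\<Sum>e\<in>B. p e z *\<^sub>R e)) has_derivative
          (\<lambda>i. d2 e i j y * Q1 e + d e j y * (\<Sum>e'\<in>B. d e' i y * Q2 e' e))) (at y)" if "e \<in> B" for e
        using has_derivative_mult[OF pd2[OF that y(1), of j]] that unfolding Px Q1_def Q2_def
        by (fastforce simp: Px add.commute)
      then show "((\<lambda>z. \<Sum>e\<in>B. d e j z * pd e U (\<Sum>e\<in>B. p e z *\<^sub>R e)) has_derivative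
          (\<lambda>i. \<Sum>e\<in>B. d2 e i j y * Q1 e + d e j y * (\<Sum>e'\<in>B. d e' i y * Q2 e' e))) (at y)"
        by (rule has_derivative_sum)
    qed (simp add: fd)
    have fd2: "frechet_derivative (\<lambda>z. frechet_derivative ?f (at z) j) (at y) i =
        (\<Sum>e\<in>B. d2 e i j y * Q1 e + d e j y * (\<Sum>e'\<in>B. d e' i y * Q2 e' e))" for i j
      using frechet_derivative_at[OF D2[of j]] by (simp add: fun_eq_iff)
    have fd1: "frechet_derivative ?f (at y) i = (\<Sum>e\<in>B. d e i y * Q1 e)" for i
      using fd[OF y(1)] by (simp add: Q1_def Px)
    have "L (\<lambda>x. U (?F x)) (chart_inv c y) = (\<Sum>i\<in>Basis. \<Sum>j\<in>Basis. a i j y *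
             frechet_derivative (\<lambda>z. frechet_derivative ?f (at z) j) (at y) i)
          + (\<Sum>i\<in>Basis. b i y * frechet_derivative ?f (at y) i)"
      unfolding p_def by (rule L_eq[OF smooth_fun_comp[OF B \<phi>] y(1)])
    then show ?thesis by (simp only: fd1 fd2 y(2))
  qed
  also have "\<dots> = (\<Sum>e\<in>B. \<Sum>e'\<in>B. M e' e * Q2 e' e) + (\<Sum>e\<in>B. L (\<phi> e) x * Q1 e)"
  proof -
    have "(\<Sum>i\<in>Basis. \<Sum>j\<in>Basis. a i j y * (\<Sum>e\<in>B. d2 e i j y * Q1 e + d e j y * (\<Sum>e'\<in>B. d e' i y * Q2 e' e)))
       = (\<Sum>i\<in>Basis. \<Sum>j\<in>Basis. \<Sum>e\<in>B. a i j y * d2 e i j y * Q1 e) +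
         (\<Sum>i\<in>Basis. \<Sum>j\<in>Basis. \<Sum>e\<in>B. \<Sum>e'\<in>B. a i j y * (d e' i y * d e j y) * Q2 e' e)"
      by (simp add: sum.distrib sum_distrib_left distrib_left mult_ac)
    also have "(\<Sum>i\<in>Basis. \<Sum>j\<in>Basis. \<Sum>e\<in>B. a i j y * d2 e i j y * Q1 e) =
        (\<Sum>e\<in>B. (\<Sum>i\<in>Basis. \<Sum>j\<in>Basis. a i j y * d2 e i j y) * Q1 e)"
    proof -
      have "(\<Sum>i\<in>Basis. \<Sum>j\<in>Basis. \<Sum>e\<in>B. a i j y * d2 e i j y * Q1 e) =
        (\<Sum>i\<in>Basis. \<Sum>e\<in>B. \<Sum>j\<in>Basis. a i j y * d2 e i j y * Q1 e)" by (intro sum.cong refl sum.swap)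
      also have "\<dots> = (\<Sum>e\<in>B. \<Sum>i\<in>Basis. \<Sum>j\<in>Basis. a i j y * d2 e i j y * Q1 e)" by (rule sum.swap)
      finally show ?thesis by (simp only: sum_distrib_right)
    qed
    also have "(\<Sum>i\<in>Basis. \<Sum>j\<in>Basis. \<Sum>e\<in>B. \<Sum>e'\<in>B. a i j y * (d e' i y * d e j y) * Q2 e' e) =
        (\<Sum>e\<in>B. \<Sum>e'\<in>B. M e' e * Q2 e' e)"
    proof -
      have "(\<Sum>i\<in>Basis. \<Sum>j\<in>Basis. \<Sum>e\<in>B. \<Sum>e'\<in>B. a i j y * (d e' i y * d e j y) * Q2 e' e) =
        (\<Sum>i\<in>Basis. \<Sum>e\<in>B. \<Sum>j\<in>Basis. \<Sum>e'\<in>B. a i j y * (d e' i y * d e j y) * Q2 e' e)" by (intro sum.cong refl sum.swap)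
      also have "\<dots> = (\<Sum>e\<in>B. \<Sum>i\<in>Basis. \<Sum>j\<in>Basis. \<Sum>e'\<in>B. a i j y * (d e' i y * d e j y) * Q2 e' e)" by (rule sum.swap)
      also have "\<dots> = (\<Sum>e\<in>B. \<Sum>i\<in>Basis. \<Sum>e'\<in>B. \<Sum>j\<in>Basis. a i j y * (d e' i y * d e j y) * Q2 e' e)" by (intro sum.cong refl sum.swap)
      also have "\<dots> = (\<Sum>e\<in>B. \<Sum>e'\<in>B. \<Sum>i\<in>Basis. \<Sum>j\<in>Basis. a i j y * (d e' i y * d e j y) * Q2 e' e)" by (intro sum.cong refl sum.swap)
      finally show ?thesis unfolding M_def by (simp only: sum_distrib_right)
    qed
    finally have second: "(\<Sum>i\<in>Basis. \<Sum>j\<in>Basis. a i j y * (\<Sum>e\<in>B. d2 e i j y * Q1 e + d e j y * (\<Sum>e'\<in>B. d e' i y * Q2 e' e)))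
       = (\<Sum>e\<in>B. (\<Sum>i\<in>Basis. \<Sum>j\<in>Basis. a i j y * d2 e i j y) * Q1 e) + (\<Sum>e\<in>B. \<Sum>e'\<in>B. M e' e * Q2 e' e)" .
    have first: "(\<Sum>i\<in>Basis. b i y * (\<Sum>e\<in>B. d e i y * Q1 e)) = (\<Sum>e\<in>B. (\<Sum>i\<in>Basis. b i y * d e i y) * Q1 e)"
      unfolding sum_distrib_left sum_distrib_right by (subst sum.swap) (simp add: mult_ac)
    show ?thesis unfolding second first
      by (simp add: L\<phi> sum.distrib distrib_right)
  qed
  also have "(\<Sum>e\<in>B. \<Sum>e'\<in>B. M e' e * Q2 e' e) = (\<Sum>e\<in>B. \<Sum>e'\<in>B. (M e e' + M e' e) / 2 * Q2 e' e)"
  proof -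
    have "(\<Sum>e\<in>B. \<Sum>e'\<in>B. M e' e * Q2 e' e) = (\<Sum>e\<in>B. \<Sum>e'\<in>B. M e e' * Q2 e e')" by (rule sum.swap)
    also have "\<dots> = (\<Sum>e\<in>B. \<Sum>e'\<in>B. M e e' * Q2 e' e)"
      unfolding Q2_def by (intro sum.cong refl) (simp add: pd_commute[OF B(2)])
    finally have "(\<Sum>e\<in>B. \<Sum>e'\<in>B. M e' e * Q2 e' e) = (\<Sum>e\<in>B. \<Sum>e'\<in>B. M e e' * Q2 e' e)" .
    then show ?thesis
      by (simp add: add_divide_distrib distrib_right sum.distrib flip: sum_divide_distrib)
  qed
  \<comment> \<open>Computing \<open>L\<close> of the product of \<open>\<phi> e\<close> and
    \<open>\<phi> e'\<close> identifies the symmetrized coefficients with the carre du champ of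
    \<open>L\<close>, which no longer refers to the chart.\<close>
  also have "(\<Sum>e\<in>B. \<Sum>e'\<in>B. (M e e' + M e' e) / 2 * Q2 e' e) =
     (\<Sum>e\<in>B. \<Sum>e'\<in>B. (L (\<lambda>x. \<phi> e x * \<phi> e' x) x - \<phi> e x * L (\<phi> e') x - \<phi> e' x * L (\<phi> e) x) / 2 * Q2 e' e)"
  proof (intro sum.cong refl)
    fix e e' assume e: "e \<in> B" "e' \<in> B"
    let ?g = "\<lambda>y. p e y * p e' y"
    have D: "(?g has_derivative (\<lambda>v. p e z * d e' v z + d e v z * p e' z)) (at z)" if "z \<in> chart_image c" for z
      by (rule has_derivative_mult[OF pd[OF e(1) that] pd[OF e(2) that]])
    have fd: "frechet_derivative ?g (at z) j = p e z * d e' j z + d e j z * p e' z" if "z \<in> chart_image c" for z j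
      using frechet_derivative_at[OF D[OF that]] by (simp add: fun_eq_iff)
    have D2: "((\<lambda>z. frechet_derivative ?g (at z) j) has_derivative
        (\<lambda>i. (p e y * d2 e' i j y + d e i y * d e' j y) + (d e j y * d e' i y + d2 e i j y * p e' y))) (at y)" for j
    proof (rule has_derivative_transform_within_open[OF _ S y(1)])
      show "((\<lambda>z. p e z * d e' j z + d e j z * p e' z) has_derivative
        (\<lambda>i. (p e y * d2 e' i j y + d e i y * d e' j y) + (d e j y * d e' i y + d2 e i j y * p e' y))) (at y)"
        by (intro has_derivative_add has_derivative_mult pd pd2 e y(1))
    qed (simp add: fd)
    have fd2: "frechet_derivative (\<lambda>z. frechet_derivative ?g (at z) j) (at y) i =
        (p e y * d2 e' i j y + d e i y * d e' j y) + (d e j y * d e' i y + d2 e i j y * p e' y)" for i j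
      using frechet_derivative_at[OF D2[of j]] by (simp add: fun_eq_iff)
    have "L (\<lambda>x. \<phi> e x * \<phi> e' x) (chart_inv c y) = (\<Sum>i\<in>Basis. \<Sum>j\<in>Basis. a i j y *
             frechet_derivative (\<lambda>z. frechet_derivative ?g (at z) j) (at y) i)
          + (\<Sum>i\<in>Basis. b i y * frechet_derivative ?g (at y) i)"
      unfolding p_def by (rule L_eq[OF smooth_fun_mult[OF \<phi>[OF e(1)] \<phi>[OF e(2)]] y(1)])
    then have "L (\<lambda>x. \<phi> e x * \<phi> e' x) x = (\<Sum>i\<in>Basis. \<Sum>j\<in>Basis. a i j y *
        ((p e y * d2 e' i j y + d e i y * d e' j y) + (d e j y * d e' i y + d2 e i j y * p e' y)))
        + (\<Sum>i\<in>Basis. b i y * (p e y * d e' i y + d e i y * p e' y))"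
      by (simp only: fd2 fd[OF y(1)] y(2))
    also have "\<dots> = p e y * L (\<phi> e') x + p e' y * L (\<phi> e) x + (M e e' + M e' e)"
      unfolding L\<phi>[OF e(1)] L\<phi>[OF e(2)] M_def
      by (simp add: sum.distrib sum_distrib_left algebra_simps)
    finally show "(M e e' + M e' e) / 2 * Q2 e' e =
      (L (\<lambda>x. \<phi> e x * \<phi> e' x) x - \<phi> e x * L (\<phi> e') x - \<phi> e' x * L (\<phi> e) x) / 2 * Q2 e' e"
      by (simp add: p_def y(2))
  qed
  finally show ?thesis by (simp only: Q1_def Q2_def)
qed

end

section \<open>An embedding for which every smooth function extends\<close>

text \<open>Bounded sequences in \<open>'v\<close> serve as ambient vector space. They contain any
  finite number of copies of \<open>'v\<close>; the number of charts of a cover is a value and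
  cannot enter a type.\<close>

definition single :: "nat \<Rightarrow> 'v::real_normed_vector \<Rightarrow> nat \<Rightarrow>\<^sub>C 'v" where
  "single k v = Bcontfun (\<lambda>j. if j = k then v else 0)"

lemma apply_single [simp]: "apply_bcontfun (single k v) j = (if j = k then v else 0)"
proof -
  have "(\<lambda>j. if j = k then v else 0) \<in> bcontfun"
    unfolding bcontfun_def
    by (auto intro!: finite_imp_bounded finite_subset[of _ "{v, 0}"])
  then show ?thesis by (simp add: single_def Bcontfun_inverse)
qed

lemma bounded_linear_apply: "bounded_linear (\<lambda>z :: nat \<Rightarrow>\<^sub>C 'v::real_normed_vector. apply_bcontfun z k)"
  by (rule bounded_linear_intro[of _ 1]) (auto simp: norm_bounded)

text \<open>Each derivative is again a function of the component \<open>k\<close> alone and vanishes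
  outside the same compact \<open>K\<close>, so it is bounded.\<close>

lemma csm_cylinder:
  fixes W :: "'v::euclidean_space \<Rightarrow> real"
  assumes "smooth_on UNIV W" "compact K" "\<And>w. w \<notin> K \<Longrightarrow> W w = 0"
  shows "csm B (\<lambda>z :: nat \<Rightarrow>\<^sub>C 'v. W (apply_bcontfun z k))"
  unfolding csm_def
proof
  fix m
  have bnd: "bounded (range (\<lambda>z :: nat \<Rightarrow>\<^sub>C 'v. W (apply_bcontfun z k)))"
    if W: "smooth_on UNIV W" "\<And>w. w \<notin> K \<Longrightarrow> W w = 0" for W :: "'v \<Rightarrow> real"
  proof -
    have "continuous_on K W" using smooth_onD[OF W(1), of 0] continuous_on_subset by auto
    then have "bounded (W ` K)" using assms(2) compact_continuous_image compact_imp_bounded by blast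
    then have "bounded (insert 0 (W ` K))" by simp
    then show ?thesis by (rule bounded_subset) (use W(2) in blast)
  qed
  show "bsm B m (\<lambda>z :: nat \<Rightarrow>\<^sub>C 'v. W (apply_bcontfun z k))"
    using assms(1,3)
  proof (induction m arbitrary: W)
    case 0
    then show ?case using bnd by simp
  next
    case (Suc m)
    have D: "((\<lambda>z :: nat \<Rightarrow>\<^sub>C 'v. W (apply_bcontfun z k)) has_derivative
      (\<lambda>e. frechet_derivative W (at (apply_bcontfun z k)) (apply_bcontfun e k))) (at z)" for z
      by (rule has_derivative_compose[OF bounded_linear_imp_has_derivative[OF bounded_linear_apply]
            smooth_on_has_derivative[OF Suc.prems(1) UNIV_I]])
    have zero: "frechet_derivative W (at w) v = 0" if "w \<notin> K" for w v
    proof -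
      have "((\<lambda>w. 0) has_derivative (\<lambda>v. 0)) (at w)" by simp
      then have "(W has_derivative (\<lambda>v. 0)) (at w)"
        by (rule has_derivative_transform_within_open[of _ _ _ _ "- K"])
          (use assms(2) that Suc.prems(2) in \<open>auto intro: compact_imp_closed\<close>)
      then show ?thesis by (simp add: frechet_derivative_at[symmetric])
    qed
    have "bsm B m (pd e (\<lambda>z. W (apply_bcontfun z k)))" for e
    proof -
      have "pd e (\<lambda>z :: nat \<Rightarrow>\<^sub>C 'v. W (apply_bcontfun z k)) = (\<lambda>z. frechet_derivative W (at (apply_bcontfun z k)) (apply_bcontfun e k))"
        by (rule ext, rule pd_eqI[OF D])
      then show ?thesis
        using Suc.IH[OF smooth_on_frechet_derivative[OF Suc.prems(1), of "apply_bcontfun e k"] zero] by simp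
    qed
    then show ?case using bnd[OF Suc.prems] D by (auto intro: differentiableI)
  qed
qed

locale embedded_manifold = compact_manifold A
  for A :: "('a::{t2_space,second_countable_topology}, 'b::euclidean_space) atlas" +
  fixes n :: nat and ch :: "nat \<Rightarrow> ('a, 'b) chart" and \<eta> \<zeta> :: "nat \<Rightarrow> 'a \<Rightarrow> real" and Z :: "nat \<Rightarrow> 'a set"
  assumes ch: "\<And>k. k < n \<Longrightarrow> ch k \<in> A"
    and \<eta>: "\<And>k. k < n \<Longrightarrow> smooth_fun A (\<eta> k)" and \<zeta>: "\<And>k. k < n \<Longrightarrow> smooth_fun A (\<zeta> k)"
    and Z: "\<And>k. k < n \<Longrightarrow> closed (Z k)" "\<And>k. k < n \<Longrightarrow> Z k \<subseteq> fst (ch k)"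
      "\<And>k x. k < n \<Longrightarrow> x \<notin> Z k \<Longrightarrow> \<eta> k x = 0"
    and \<eta>1: "\<And>k x. k < n \<Longrightarrow> \<zeta> k x \<noteq> 0 \<Longrightarrow> \<eta> k x = 1"
    and \<zeta>_sum: "\<And>x. (\<Sum>k<n. \<zeta> k x) = 1"
begin

definition coord :: "nat \<Rightarrow> 'a \<Rightarrow> 'b" where
  "coord k x = (if x \<in> fst (ch k) then \<eta> k x *\<^sub>R snd (ch k) x else 0)"

definition basis :: "(nat \<Rightarrow>\<^sub>C ('b \<times> real)) set" where
  "basis = (\<lambda>(k, i). single k i) ` ({..<n} \<times> Basis)"

definition emb :: "'a \<Rightarrow> (nat \<Rightarrow>\<^sub>C ('b \<times> real)) \<Rightarrow> real" where
  "emb x e = (\<Sum>k<n. (coord k x, \<zeta> k x) \<bullet> apply_bcontfun e k)"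

text \<open>The map given by the cut-off charts together with the weights \<open>\<zeta> k\<close>;
  recording the weights is what makes the extension of functions explicit.\<close>

definition F :: "'a \<Rightarrow> nat \<Rightarrow>\<^sub>C ('b \<times> real)" where
  "F x = (\<Sum>e\<in>basis. emb x e *\<^sub>R e)"

lemma finite_basis: "finite basis" by (simp add: basis_def)

lemma apply_F:
  assumes "j < n" shows "apply_bcontfun (F x) j = (coord j x, \<zeta> j x)"
proof -
  have lin: "linear (\<lambda>z :: nat \<Rightarrow>\<^sub>C ('b \<times> real). apply_bcontfun z j)"
    using bounded_linear_apply bounded_linear.linear by blast
  have inj: "inj_on (\<lambda>(k, i). single k i) ({..<n} \<times> (Basis :: ('b \<times> real) set))"
  proof (rule inj_onI, clarify)
    fix k i k' i' assume i: "i \<in> (Basis :: ('b \<times> real) set)" "i' \<in> (Basis :: ('b \<times> real) set)" and eq: "single k i = single k' i'"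
    have "apply_bcontfun (single k i) k = apply_bcontfun (single k' i') k" using eq by simp
    then have "i = (if k = k' then i' else 0)" by simp
    then show "k = k' \<and> i = i'" using nonzero_Basis[OF i(1)] by (auto split: if_splits)
  qed
  have e: "emb x (single k i) = (coord k x, \<zeta> k x) \<bullet> i" if "k < n" for k i
  proof -
    have "emb x (single k i) = (\<Sum>k'<n. if k' = k then (coord k' x, \<zeta> k' x) \<bullet> i else 0)"
      unfolding emb_def by (intro sum.cong) auto
    then show ?thesis using that by simp
  qed
  have "F x = (\<Sum>(k, i)\<in>{..<n} \<times> Basis. emb x (single k i) *\<^sub>R single k i)"
    unfolding F_def basis_def by (subst sum.reindex[OF inj]) (simp add: case_prod_beta)
  also have "\<dots> = (\<Sum>k<n. \<Sum>i\<in>Basis. emb x (single k i) *\<^sub>R single k i)"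
    by (simp add: sum.cartesian_product)
  also have "apply_bcontfun \<dots> j = (\<Sum>k<n. \<Sum>i\<in>Basis. emb x (single k i) *\<^sub>R apply_bcontfun (single k i) j)"
    by (simp add: linear_sum[OF lin] linear_scale[OF lin] del: apply_single)
  also have "\<dots> = (\<Sum>k<n. if k = j then (\<Sum>i\<in>Basis. ((coord k x, \<zeta> k x) \<bullet> i) *\<^sub>R i) else 0)"
    by (intro sum.cong) (auto simp: e)
  also have "\<dots> = (\<Sum>i\<in>Basis. ((coord j x, \<zeta> j x) \<bullet> i) *\<^sub>R i)" using assms by simp
  also have "\<dots> = (coord j x, \<zeta> j x)" by (rule euclidean_representation)
  finally show ?thesis .
qed

lemma coord_smooth:
  assumes k: "k < n" shows "smooth_fun A (\<lambda>x. coord k x \<bullet> i)"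
proof -
  have cZ: "compact (Z k)" using compact_Int_closed[OF compact_UNIV Z(1)[OF k]] by simp
  have "compact (snd (ch k) ` Z k)"
    using cZ Z(2)[OF k] chart_continuous(1)[OF ch[OF k]] by (meson compact_continuous_image continuous_on_subset)
  moreover have "snd (ch k) ` Z k \<subseteq> chart_image (ch k)" using Z(2)[OF k] by blast
  moreover have "\<eta> k (chart_inv (ch k) y) * (y \<bullet> i) = 0" if "y \<in> chart_image (ch k)" "y \<notin> snd (ch k) ` Z k" for y
  proof -
    have "chart_inv (ch k) y \<notin> Z k" using that chart_chart_inv[OF ch[OF k]] by (metis imageI)
    then show ?thesis using Z(3)[OF k] by simp
  qed
  ultimately have "smooth_fun A (\<lambda>x. if x \<in> fst (ch k) then \<eta> k (chart_inv (ch k) (snd (ch k) x)) * (snd (ch k) x \<bullet> i) else 0)"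
    by (intro extend_by_zero[OF ch[OF k], where u = "\<lambda>y. \<eta> k (chart_inv (ch k) y) * (y \<bullet> i)"]
        smooth_on_mult chart_open(2)[OF ch[OF k]] smooth_funD[OF \<eta>[OF k] ch[OF k]] smooth_on_linear bounded_linear_inner_left)
  also have "(\<lambda>x. if x \<in> fst (ch k) then \<eta> k (chart_inv (ch k) (snd (ch k) x)) * (snd (ch k) x \<bullet> i) else 0) = (\<lambda>x. coord k x \<bullet> i)"
    using chart_inv_chart[OF ch[OF k]] by (auto simp: coord_def fun_eq_iff)
  finally show ?thesis .
qed

lemma emb_smooth: "smooth_fun A (\<lambda>x. emb x e)"
proof -
  have "smooth_fun A (\<lambda>x. \<Sum>k<n. coord k x \<bullet> fst (apply_bcontfun e k) + \<zeta> k x * snd (apply_bcontfun e k))"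
    by (intro smooth_fun_sum smooth_fun_add smooth_fun_mult smooth_fun_const coord_smooth \<zeta>) auto
  then show ?thesis by (simp add: emb_def inner_prod_def)
qed

text \<open>The \<zeta> k sum to 1, so a is the sum of the \<zeta> k a, and the k-th summand depends
  only on the k-th component of \<open>F x\<close>: where \<zeta> k is nonzero, the first entry of
  that component is the chart value of x and determines a x, and the second entry is the weight.
  Each summand thus extends to all sequences as a function of a single component.\<close>

lemma extension:
  assumes a: "smooth_fun A a"
  obtains G where "csm basis G" "\<And>x. G (F x) = a x"
proof -
  obtain \<theta> where \<theta>: "smooth_on UNIV \<theta>" "\<And>y::real. 0 \<le> \<theta> y" "\<And>y. \<theta> y \<le> (1::real)"
    "\<And>y. y \<in> ball 0 2 \<Longrightarrow> \<theta> y = 1" "\<And>y. y \<notin> cball 0 (2 * 2) \<Longrightarrow> \<theta> y = 0"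
    using bump_euclidean[of 2 0] by (metis zero_less_numeral)
  obtain Kz where Kz: "\<And>k x. k < n \<Longrightarrow> \<bar>\<zeta> k x\<bar> < Kz" "0 < Kz"
  proof -
    have "\<forall>k<n. \<exists>K. \<forall>x. \<bar>\<zeta> k x\<bar> \<le> K" using smooth_fun_bounded[OF \<zeta>] by blast
    then obtain K where K: "\<And>k x. k < n \<Longrightarrow> \<bar>\<zeta> k x\<bar> \<le> K k" by metis
    have "\<bar>\<zeta> k x\<bar> < (\<Sum>k<n. \<bar>K k\<bar>) + 1" if "k < n" for k x
    proof -
      have "\<bar>K k\<bar> \<le> (\<Sum>k<n. \<bar>K k\<bar>)" using that by (intro member_le_sum) auto
      then show ?thesis using K[OF that, of x] by linarith
    qed
    moreover have "0 < (\<Sum>k<n. \<bar>K k\<bar>) + 1" by (intro add_nonneg_pos sum_nonneg) auto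
    ultimately show ?thesis by (rule that)
  qed
  \<comment> \<open>A cutoff in the weight coordinate: it is 1 on the values of the \<zeta> k, which
    are bounded by \<open>Kz\<close>, and 0 beyond 4 Kz. This gives \<open>W k\<close> the compact
    support required by \<open>csm_cylinder\<close>.\<close>
  define \<theta>' where "\<theta>' = (\<lambda>t. \<theta> ((1 / Kz) * t))"
  have \<theta>': "smooth_on UNIV \<theta>'" unfolding \<theta>'_def
    by (rule smooth_on_compose[OF open_UNIV subset_UNIV \<theta>(1) smooth_on_linear[OF bounded_linear_mult_right open_UNIV]])
  define a' where "a' = (\<lambda>k y. if y \<in> chart_image (ch k) then \<eta> k (chart_inv (ch k) y) * a (chart_inv (ch k) y) else 0)"
  define K' where "K' = (\<lambda>k. snd (ch k) ` Z k)"
  have K': "compact (K' k)" "K' k \<subseteq> chart_image (ch k)" if k: "k < n" for k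
  proof -
    have cZ: "compact (Z k)" using compact_Int_closed[OF compact_UNIV Z(1)[OF k]] by simp
    show "compact (K' k)" unfolding K'_def
      using cZ Z(2)[OF k] chart_continuous(1)[OF ch[OF k]] by (meson compact_continuous_image continuous_on_subset)
    show "K' k \<subseteq> chart_image (ch k)" using Z(2)[OF k] by (auto simp: K'_def)
  qed
  have a'0: "a' k y = 0" if "k < n" "y \<notin> K' k" for k y
  proof (cases "y \<in> chart_image (ch k)")
    case True
    then have "chart_inv (ch k) y \<notin> Z k" using that chart_chart_inv[OF ch[OF that(1)]] unfolding K'_def by (metis imageI)
    then show ?thesis using Z(3)[OF that(1)] by (simp add: a'_def)
  qed (simp add: a'_def)
  have a'_smooth: "smooth_on UNIV (a' k)" if k: "k < n" for k
  proof (rule smooth_on_local)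
    fix y :: 'b
    show "\<exists>T. open T \<and> y \<in> T \<and> smooth_on T (a' k)"
    proof (cases "y \<in> K' k")
      case True
      have "smooth_on (chart_image (ch k)) (\<lambda>y. \<eta> k (chart_inv (ch k) y) * a (chart_inv (ch k) y))"
        by (intro smooth_on_mult chart_open(2)[OF ch[OF k]] smooth_funD[OF \<eta>[OF k] ch[OF k]] smooth_funD[OF a ch[OF k]])
      then have "smooth_on (chart_image (ch k)) (a' k)"
        by (rule smooth_on_cong[OF chart_open(2)[OF ch[OF k]]]) (simp add: a'_def)
      then show ?thesis using True K'(2)[OF k] chart_open(2)[OF ch[OF k]] by blast
    next
      case False
      have "open (- K' k)" using K'(1)[OF k] by (simp add: compact_imp_closed open_Compl)
      moreover from this have "smooth_on (- K' k) (a' k)"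
        by (rule smooth_on_cong[OF _ smooth_on_const[of _ 0]]) (simp add: a'0[OF k])
      ultimately show ?thesis using False by blast
    qed
  qed
  define W where "W = (\<lambda>k w. a' k (fst w) * (snd w * \<theta>' (snd w)))"
  have W_smooth: "smooth_on UNIV (W k)" if "k < n" for k
    unfolding W_def
    by (intro smooth_on_mult open_UNIV smooth_on_compose[OF open_UNIV _ a'_smooth[OF that]] smooth_on_compose[OF open_UNIV _ \<theta>']
        smooth_on_linear bounded_linear_fst bounded_linear_snd subset_UNIV)
  have csm_W: "csm basis (\<lambda>z. W k (apply_bcontfun z k))" if k: "k < n" for k
  proof (rule csm_cylinder[OF W_smooth[OF k]])
    show "compact (K' k \<times> cball (0::real) (4 * Kz))" by (intro compact_Times K'(1)[OF k] compact_cball)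
    fix w :: "'b \<times> real" assume w: "w \<notin> K' k \<times> cball 0 (4 * Kz)"
    show "W k w = 0"
    proof (cases "fst w \<in> K' k")
      case True
      then have "4 * Kz < \<bar>snd w\<bar>" using w by (cases w) auto
      then have "4 < \<bar>snd w\<bar> / Kz" using Kz(2) by (simp add: field_simps)
      then have "\<theta>' (snd w) = 0" unfolding \<theta>'_def using Kz(2) by (intro \<theta>(5)) (simp add: abs_mult)
      then show ?thesis by (simp add: W_def)
    qed (simp add: W_def a'0[OF k])
  qed
  define G where "G = (\<lambda>z. \<Sum>k<n. W k (apply_bcontfun z k))"
  have "csm basis G" unfolding G_def by (intro csm_sum csm_W) auto
  moreover have "G (F x) = a x" for x
  proof -
    have "W k (apply_bcontfun (F x) k) = \<zeta> k x * a x" if k: "k < n" for k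
    proof (cases "\<zeta> k x = 0")
      case True then show ?thesis by (simp add: W_def apply_F[OF k])
    next
      case False
      then have \<eta>x: "\<eta> k x = 1" by (rule \<eta>1[OF k])
      then have "x \<in> Z k" using Z(3)[OF k, of x] by auto
      then have x: "x \<in> fst (ch k)" using Z(2)[OF k] by blast
      have c: "coord k x = snd (ch k) x" using x \<eta>x by (simp add: coord_def)
      have "a' k (snd (ch k) x) = a x" using x \<eta>x chart_inv_chart[OF ch[OF k] x] by (simp add: a'_def)
      moreover have "\<theta>' (\<zeta> k x) = 1" unfolding \<theta>'_def
      proof (rule \<theta>(4))
        have "\<bar>\<zeta> k x\<bar> < 2 * Kz" using Kz(1)[OF k, of x] Kz(2) by simp
        then show "1 / Kz * \<zeta> k x \<in> ball 0 2" using Kz(2) by (simp add: abs_mult pos_divide_less_eq)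
      qed
      ultimately show ?thesis by (simp add: W_def apply_F[OF k] c)
    qed
    then have "G (F x) = (\<Sum>k<n. \<zeta> k x * a x)" by (simp add: G_def)
    also have "\<dots> = a x" using \<zeta>_sum[of x] by (simp flip: sum_distrib_right)
    finally show ?thesis .
  qed
  ultimately show ?thesis by (rule that)
qed

end

context compact_manifold
begin

text \<open>At every point two bumps are nested, \<zeta> being supported where \<eta> = 1. Dividing
  the \<zeta> of a finite subcover by their sum keeps this relation and makes them a partition of
  unity.\<close>

lemma embedding_exists: "\<exists>n ch \<eta> \<zeta> Z. embedded_manifold A n ch \<eta> \<zeta> Z"
proof -
  define Q where "Q = (\<lambda>x (t :: ('a, 'b) chart \<times> ('a \<Rightarrow> real) \<times> ('a \<Rightarrow> real) \<times> 'a set). case t of (c, \<eta>, \<zeta>, Z) \<Rightarrow>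
     c \<in> A \<and> smooth_fun A \<eta> \<and> smooth_fun A \<zeta> \<and> closed Z \<and> Z \<subseteq> fst c \<and> (\<forall>y. y \<notin> Z \<longrightarrow> \<eta> y = 0) \<and>
     (\<forall>y. \<zeta> y \<noteq> 0 \<longrightarrow> \<eta> y = 1) \<and> (\<forall>y. 0 \<le> \<zeta> y) \<and> (\<exists>V. open V \<and> x \<in> V \<and> (\<forall>y\<in>V. \<zeta> y = 1)))"
  have "\<exists>t. Q x t" for x
  proof -
    obtain c where c: "c \<in> A" "x \<in> fst c" using chart_ex by blast
    obtain \<eta> V Z where 1: "smooth_fun A \<eta>" "open V" "x \<in> V" "\<And>y. y \<in> V \<Longrightarrow> \<eta> y = (1::real)" "closed Z" "Z \<subseteq> fst c" "\<And>y. y \<notin> Z \<Longrightarrow> \<eta> y = 0"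
      using bump[OF chart_open(1)[OF c(1)] c(2)] by (metis (no_types, lifting))
    obtain \<zeta> V' Z' where 2: "smooth_fun A \<zeta>" "\<And>y. 0 \<le> \<zeta> y" "open V'" "x \<in> V'" "\<And>y. y \<in> V' \<Longrightarrow> \<zeta> y = (1::real)" "Z' \<subseteq> V" "\<And>y. y \<notin> Z' \<Longrightarrow> \<zeta> y = 0"
      using bump[OF 1(2,3)] by (metis (no_types, lifting))
    have "\<zeta> y \<noteq> 0 \<Longrightarrow> \<eta> y = 1" for y using 1(4) 2(6,7) by blast
    moreover have "\<exists>V. open V \<and> x \<in> V \<and> (\<forall>y\<in>V. \<zeta> y = 1)" using 2(3-5) by blast
    ultimately have "Q x (c, \<eta>, \<zeta>, Z)" using c(1) 1(1,5,6,7) 2(1,2) unfolding Q_def by simp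
    then show ?thesis by blast
  qed
  then obtain t where t: "\<And>x. Q x (t x)" by metis
  define c where "c = (\<lambda>x. fst (t x))"
  define \<eta> where "\<eta> = (\<lambda>x. fst (snd (t x)))"
  define \<zeta> where "\<zeta> = (\<lambda>x. fst (snd (snd (t x))))"
  define Z where "Z = (\<lambda>x. snd (snd (snd (t x))))"
  have P: "\<And>x. c x \<in> A" "\<And>x. smooth_fun A (\<eta> x)" "\<And>x. smooth_fun A (\<zeta> x)" "\<And>x. closed (Z x)" "\<And>x. Z x \<subseteq> fst (c x)"
    "\<And>x y. y \<notin> Z x \<Longrightarrow> \<eta> x y = 0" "\<And>x y. \<zeta> x y \<noteq> 0 \<Longrightarrow> \<eta> x y = 1" "\<And>x y. 0 \<le> \<zeta> x y"
    "\<And>x. \<exists>V. open V \<and> x \<in> V \<and> (\<forall>y\<in>V. \<zeta> x y = (1::real))"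
    using t unfolding Q_def c_def \<eta>_def \<zeta>_def Z_def by (simp_all add: case_prod_beta)
  obtain X where X: "finite X" "X \<noteq> {}" "\<And>y. \<exists>x\<in>X. \<zeta> x y = 1"
    by (rule finite_bump_cover[OF P(9)], rule that)
  define S where "S = (\<lambda>y. \<Sum>x\<in>X. \<zeta> x y)"
  have Spos: "0 < S y" for y
  proof -
    obtain x where x: "x \<in> X" "\<zeta> x y = 1" using X(3) by blast
    have "\<zeta> x y \<le> S y" unfolding S_def using x X(1) P(8) by (intro member_le_sum) auto
    then show ?thesis using x by simp
  qed
  have S: "smooth_fun A S" unfolding S_def by (intro smooth_fun_sum P(3))
  obtain xs where xs: "set xs = X" "distinct xs" using finite_distinct_list[OF X(1)] by blast
  have bij: "bij_betw (\<lambda>k. xs ! k) {..<length xs} X" using xs by (intro bij_betw_nth) auto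
  show ?thesis
  proof (intro exI)
    show "embedded_manifold A (length xs) (\<lambda>k. c (xs ! k)) (\<lambda>k. \<eta> (xs ! k)) (\<lambda>k y. \<zeta> (xs ! k) y * inverse (S y)) (\<lambda>k. Z (xs ! k))"
    proof (unfold_locales)
      show "(\<Sum>k<length xs. \<zeta> (xs ! k) y * inverse (S y)) = 1" for y
      proof -
        have "(\<Sum>k<length xs. \<zeta> (xs ! k) y * inverse (S y)) = (\<Sum>x\<in>X. \<zeta> x y * inverse (S y))"
          by (rule sum.reindex_bij_betw[OF bij])
        also have "\<dots> = S y * inverse (S y)" by (simp add: S_def sum_distrib_right)
        finally show ?thesis using Spos[of y] by simp
      qed
      show "smooth_fun A (\<lambda>y. \<zeta> (xs ! k) y * inverse (S y))" for k
        by (intro smooth_fun_mult P(3) smooth_fun_inverse[OF S]) (use Spos less_irrefl in metis)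
    qed (use P in auto)
  qed
qed

end

section \<open>Orthonormal frames\<close>

text \<open>Tangent vectors, covectors and functions on the manifold are all real-valued functions;
  this instance makes \<open>span\<close>, \<open>subspace\<close> and the abstract setting of
  \<open>cd_space\<close> applicable to them.\<close>

instantiation "fun" :: (type, real_vector) real_vector
begin

definition scaleR_fun :: "real \<Rightarrow> ('a \<Rightarrow> 'b) \<Rightarrow> 'a \<Rightarrow> 'b" where
  "scaleR_fun r f = (\<lambda>x. r *\<^sub>R f x)"

instance
  by standard (auto simp: scaleR_fun_def fun_eq_iff algebra_simps)

end

lemma scaleR_fun_apply [simp]: "(r *\<^sub>R f) x = r *\<^sub>R f x"
  by (simp add: scaleR_fun_def)

lemma sum_fun_apply: "(\<Sum>i\<in>I. f i) x = (\<Sum>i\<in>I. f i x :: 'b::ab_group_add)"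
  by (induction I rule: infinite_finite_induct) auto

lemma lin_span_eq_span: "lin_span S = span S"
proof -
  have eq: "(\<lambda>z. \<Sum>v\<in>F. c v * v z) = (\<Sum>v\<in>F. c v *\<^sub>R v)" for F c
    by (simp add: fun_eq_iff sum_fun_apply)
  show ?thesis unfolding lin_span_def span_explicit eq ..
qed

lemma span_image_lessThan:
  fixes f :: "nat \<Rightarrow> 'v::real_vector"
  shows "x \<in> span (f ` {..<k}) \<Longrightarrow> \<exists>c. x = (\<Sum>i<k. c i *\<^sub>R f i)"
proof (induction k arbitrary: x)
  case (Suc k)
  then obtain a where "x - a *\<^sub>R f k \<in> span (f ` {..<k})"
    by (auto simp: lessThan_Suc span_insert)
  then obtain c where c: "x - a *\<^sub>R f k = (\<Sum>i<k. c i *\<^sub>R f i)" using Suc.IH by blast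
  have "x = (\<Sum>i<Suc k. (c(k := a)) i *\<^sub>R f i)" using c by (simp add: algebra_simps)
  then show ?case by blast
qed simp

lemma span_insert_scale:
  fixes a :: "'v::real_vector"
  assumes "m \<noteq> 0" shows "span (insert (m *\<^sub>R a) S) = span (insert a S)"
proof -
  have "(\<exists>k. x - k *\<^sub>R m *\<^sub>R a \<in> span S) \<longleftrightarrow> (\<exists>k. x - k *\<^sub>R a \<in> span S)" for x
  proof
    assume "\<exists>k. x - k *\<^sub>R a \<in> span S"
    then obtain k where "x - k *\<^sub>R a \<in> span S" by blast
    then have "x - (k / m) *\<^sub>R m *\<^sub>R a \<in> span S" using assms by simp
    then show "\<exists>k. x - k *\<^sub>R m *\<^sub>R a \<in> span S" by blast
  qed auto
  then show ?thesis by (simp add: span_insert)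
qed

lemma lin_onD: "lin_on V p \<Longrightarrow> u \<in> V \<Longrightarrow> v \<in> V \<Longrightarrow> p (a *\<^sub>R u + b *\<^sub>R v) = a * p u + b * p v"
proof -
  assume "lin_on V p" "u \<in> V" "v \<in> V"
  then have "p (\<lambda>z. a * u z + b * v z) = a * p u + b * p v" unfolding lin_on_def by blast
  moreover have "(\<lambda>z. a * u z + b * v z) = a *\<^sub>R u + b *\<^sub>R v" by (simp add: fun_eq_iff)
  ultimately show ?thesis by simp
qed

lemma lin_on_sum:
  fixes f :: "'i \<Rightarrow> 'c \<Rightarrow> real" and c :: "'i \<Rightarrow> real" and V :: "('c \<Rightarrow> real) set"
  assumes "lin_on V p" "subspace V"
  shows "(\<And>i. i \<in> I \<Longrightarrow> f i \<in> V) \<Longrightarrow> p (\<Sum>i\<in>I. c i *\<^sub>R f i) = (\<Sum>i\<in>I. c i * p (f i))"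
proof (induction I rule: infinite_finite_induct)
  case (insert i I)
  have "(\<Sum>i\<in>I. c i *\<^sub>R f i) \<in> V" using insert.prems assms(2) by (intro subspace_sum subspace_scale) auto
  then have "p (c i *\<^sub>R f i + 1 *\<^sub>R (\<Sum>i\<in>I. c i *\<^sub>R f i)) = c i * p (f i) + 1 * p (\<Sum>i\<in>I. c i *\<^sub>R f i)"
    using insert.prems by (intro lin_onD[OF assms(1)]) auto
  moreover have "p (\<Sum>i\<in>I. c i *\<^sub>R f i) = (\<Sum>i\<in>I. c i * p (f i))" using insert by blast
  ultimately show ?case by (simp only: sum.insert[OF insert.hyps(1,2)] scaleR_one mult_1)
next
  case empty
  have "p 0 = 0" using lin_onD[OF assms(1) subspace_0[OF assms(2)] subspace_0[OF assms(2)], of 0 0]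
    by (simp only: scaleR_zero_left add_0 mult_zero_left)
  then show ?case unfolding sum.empty .
next
  case (infinite I)
  have "p 0 = 0" using lin_onD[OF assms(1) subspace_0[OF assms(2)] subspace_0[OF assms(2)], of 0 0]
    by (simp only: scaleR_zero_left add_0 mult_zero_left)
  then show ?case unfolding sum.infinite[OF infinite(1)] .
qed

context compact_manifold
begin

lemma tangent_subspace: "subspace (tangent_space A x)"
proof (rule subspaceI)
  show "0 \<in> tangent_space A x" by (auto simp: tangent_space_def lin_on_def)
next
  fix u v assume "u \<in> tangent_space A x" "v \<in> tangent_space A x"
  then show "u + v \<in> tangent_space A x" unfolding tangent_space_def lin_on_def
    by (auto simp: algebra_simps)
next
  fix c v assume "v \<in> tangent_space A x"
  then show "c *\<^sub>R v \<in> tangent_space A x" unfolding tangent_space_def lin_on_def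
    by (auto simp: algebra_simps)
qed

lemma vector_field_lincomb:
  assumes "smooth_vector_field A X" "smooth_vector_field A Y" "smooth_fun A f" "smooth_fun A g"
  shows "smooth_vector_field A (\<lambda>x. f x *\<^sub>R X x + g x *\<^sub>R Y x)"
  using assms unfolding smooth_vector_field_def
  by (auto intro!: smooth_fun_add smooth_fun_mult subspace_add[OF tangent_subspace] subspace_scale[OF tangent_subspace])

lemma vector_field_zero: "smooth_vector_field A (\<lambda>x. 0)"
  unfolding smooth_vector_field_def using smooth_fun_const by (auto intro: subspace_0[OF tangent_subspace])

lemma vector_field_scale:
  "smooth_vector_field A X \<Longrightarrow> smooth_fun A f \<Longrightarrow> smooth_vector_field A (\<lambda>x. f x *\<^sub>R X x)"
  using vector_field_lincomb[of X "\<lambda>x. 0" f "\<lambda>x. 0"] vector_field_zero smooth_fun_const by simp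

lemma vector_field_sum:
  "(\<And>i. i \<in> I \<Longrightarrow> smooth_vector_field A (X i)) \<Longrightarrow> smooth_vector_field A (\<lambda>x. \<Sum>i\<in>I. X i x)"
proof (induction I rule: infinite_finite_induct)
  case (insert i I)
  have "smooth_vector_field A (\<lambda>x. 1 *\<^sub>R X i x + 1 *\<^sub>R (\<Sum>i\<in>I. X i x))"
    by (rule vector_field_lincomb[OF _ _ smooth_fun_const smooth_fun_const]) (use insert in blast)+
  then show ?case unfolding sum.insert[OF insert.hyps(1,2)] scaleR_one .
next
  case empty
  show ?case unfolding sum.empty by (rule vector_field_zero)
next
  case (infinite I)
  show ?case unfolding sum.infinite[OF infinite(1)] by (rule vector_field_zero)
qed

lemma differential_cotangent: "differential A f x \<in> cotangent_space A x"
proof -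
  have "lin_on (tangent_space A x) (differential A f x)"
    unfolding lin_on_def
  proof (intro ballI allI)
    fix u v a b assume uv: "u \<in> tangent_space A x" "v \<in> tangent_space A x"
    have "a *\<^sub>R u + b *\<^sub>R v \<in> tangent_space A x" using uv tangent_subspace by (intro subspace_add subspace_scale)
    moreover have "(\<lambda>z. a * u z + b * v z) = a *\<^sub>R u + b *\<^sub>R v" by (simp add: fun_eq_iff)
    ultimately show "differential A f x (\<lambda>z. a * u z + b * v z) = a * differential A f x u + b * differential A f x v"
      using uv by (simp add: differential_def)
  qed
  then show ?thesis by (simp add: cotangent_space_def differential_def)
qed

end

section \<open>Horizontal sections and Gram-Schmidt orthonormalization\<close>

locale sub_riemannian = compact_manifold A
  for A :: "('a::{t2_space,second_countable_topology}, 'b::euclidean_space) atlas" +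
  fixes H :: "'a \<Rightarrow> 'a tangent set" and h :: "'a \<Rightarrow> 'a tangent \<Rightarrow> 'a tangent \<Rightarrow> real"
  assumes sub_bundle: "subbundle A H" and metric: "metric_tensor_on A H h"
begin

lemma H_span: "\<exists>S. H x = span S"
proof -
  obtain r :: nat where "\<forall>x. \<exists>W X. open W \<and> x \<in> W \<and> (\<forall>i<r. smooth_vector_field A (X i)) \<and>
     (\<forall>y\<in>W. H y = lin_span ((\<lambda>i. X i y) ` {..<r}) \<and> (\<forall>c. (\<forall>f. (\<Sum>i<r. c i * X i y f) = 0) \<longrightarrow> (\<forall>i<r. c i = 0)))"
    using sub_bundle unfolding subbundle_def by blast
  then obtain X where "H x = lin_span ((\<lambda>i. X i x) ` {..<r})" by meson
  then show ?thesis unfolding lin_span_eq_span by blast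
qed

lemma H_subspace: "subspace (H x)"
  using H_span[of x] by auto

lemma psd_h: "psd_form (H x) (h x)"
proof -
  have b: "sym_bilin_on (H x) (h x)" using metric unfolding metric_tensor_on_def by blast
  have s: "h x u v = h x v u" if "u \<in> H x" "v \<in> H x" for u v using b that unfolding sym_bilin_on_def by blast
  have l: "h x (a *\<^sub>R u + b *\<^sub>R v) w = a * h x u w + b * h x v w" if "u \<in> H x" "v \<in> H x" "w \<in> H x" for a b u v w
  proof -
    have "lin_on (H x) (h x w)" using b that unfolding sym_bilin_on_def by blast
    then have "h x w (a *\<^sub>R u + b *\<^sub>R v) = a * h x w u + b * h x w v" using that by (intro lin_onD)
    moreover have "a *\<^sub>R u + b *\<^sub>R v \<in> H x" using that H_subspace by (intro subspace_add subspace_scale)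
    ultimately show ?thesis using s that by simp
  qed
  show ?thesis
  proof
    show "h x (u + v) w = h x u w + h x v w" if "u \<in> H x" "v \<in> H x" "w \<in> H x" for u v w using l[OF that, of 1 1] by simp
    show "h x (a *\<^sub>R u) w = a * h x u w" if "u \<in> H x" "w \<in> H x" for a u w using l[OF that(1,1,2), of a 0] by simp
    show "h x u w = h x w u" if "u \<in> H x" "w \<in> H x" for u w by (rule s[OF that])
    show "0 \<le> h x u u" if "u \<in> H x" for u
    proof (cases "u = (\<lambda>f. 0)")
      case True
      have "h x (0 *\<^sub>R u) u = 0 * h x u u" using l[OF that that that, of 0 0] by simp
      moreover have "0 *\<^sub>R u = u" using True by (simp add: fun_eq_iff)
      ultimately show ?thesis by simp
    next
      case False then show ?thesis using metric that unfolding metric_tensor_on_def by force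
    qed
  qed (rule H_subspace)
qed

lemma h_pos: "u \<in> H x \<Longrightarrow> u \<noteq> 0 \<Longrightarrow> 0 < h x u u"
  using metric unfolding metric_tensor_on_def zero_fun_def by blast

lemma h_sum_left:
  assumes "w \<in> H x" "\<And>i. i \<in> I \<Longrightarrow> f i \<in> H x"
  shows "h x (\<Sum>i\<in>I. c i *\<^sub>R f i) w = (\<Sum>i\<in>I. c i * h x (f i) w)"
proof -
  interpret psd_form "H x" "h x" by (rule psd_h)
  have 0: "h x 0 w = 0" using scale_left[of 0 w 0] assms(1) subspace_0[OF H_subspace]
    by (metis mult_zero_left scaleR_zero_left)
  show ?thesis using assms(2)
  proof (induction I rule: infinite_finite_induct)
    case (insert i I)
    have in_H: "f i \<in> H x" "(\<Sum>i\<in>I. c i *\<^sub>R f i) \<in> H x"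
      using H_subspace insert.prems by (auto intro!: subspace_sum subspace_scale)
    have "h x (\<Sum>i\<in>insert i I. c i *\<^sub>R f i) w = h x (c i *\<^sub>R f i + (\<Sum>i\<in>I. c i *\<^sub>R f i)) w"
      unfolding sum.insert[OF insert.hyps(1,2)] ..
    also have "\<dots> = h x (c i *\<^sub>R f i) w + h x (\<Sum>i\<in>I. c i *\<^sub>R f i) w"
      by (rule add_left[OF subspace_scale[OF H_subspace in_H(1)] in_H(2) assms(1)])
    also have "h x (c i *\<^sub>R f i) w = c i * h x (f i) w" by (rule scale_left[OF in_H(1) assms(1)])
    also have "h x (\<Sum>i\<in>I. c i *\<^sub>R f i) w = (\<Sum>i\<in>I. c i * h x (f i) w)" by (rule insert.IH) (use insert.prems in blast)
    finally show ?case unfolding sum.insert[OF insert.hyps(1,2)] .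
  next
    case empty
    show ?case unfolding sum.empty by (rule 0)
  next
    case (infinite I)
    show ?case unfolding sum.infinite[OF infinite(1)] by (rule 0)
  qed
qed

lemma section_smooth_metric:
  "smooth_section A H X \<Longrightarrow> smooth_section A H Y \<Longrightarrow> smooth_fun A (\<lambda>x. h x (X x) (Y x))"
  using metric unfolding metric_tensor_on_def by blast

lemma section_in: "smooth_section A H X \<Longrightarrow> X x \<in> H x"
  unfolding smooth_section_def by blast

lemma section_scale: "smooth_section A H X \<Longrightarrow> smooth_fun A f \<Longrightarrow> smooth_section A H (\<lambda>x. f x *\<^sub>R X x)"
  unfolding smooth_section_def using H_subspace by (auto intro: vector_field_scale subspace_scale)

lemma section_sum: "(\<And>i. i \<in> I \<Longrightarrow> smooth_section A H (X i)) \<Longrightarrow> smooth_section A H (\<lambda>x. \<Sum>i\<in>I. X i x)"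
  unfolding smooth_section_def using H_subspace by (auto intro: vector_field_sum subspace_sum)

lemma section_diff: "smooth_section A H X \<Longrightarrow> smooth_section A H Y \<Longrightarrow> smooth_section A H (\<lambda>x. X x - Y x)"
  using vector_field_lincomb[of X Y "\<lambda>x. 1" "\<lambda>x. -1"] smooth_fun_const H_subspace
  unfolding smooth_section_def by (auto intro: subspace_diff)

text \<open>The metric is known to be smooth only on global sections, while the fields
  \<open>X i\<close> need to be horizontal only on \<open>W0\<close>. Hence each field is cut off
  before the projections are subtracted, and orthonormality is claimed on a neighbourhood that
  shrinks with every step.\<close>

lemma gram_schmidt:
  fixes r :: nat
  assumes W0: "open W0" "x0 \<in> W0" and X: "\<And>i. i < r \<Longrightarrow> smooth_vector_field A (X i)"
    and XH: "\<And>y i. y \<in> W0 \<Longrightarrow> i < r \<Longrightarrow> X i y \<in> H y"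
    and indep: "\<And>c. (\<And>f. (\<Sum>i<r. c i * X i x0 f) = 0) \<Longrightarrow> (\<forall>i<r. c i = 0)"
  shows "k \<le> r \<Longrightarrow> \<exists>W E. open W \<and> x0 \<in> W \<and> W \<subseteq> W0 \<and> (\<forall>i<k. smooth_section A H (E i)) \<and>
    (\<forall>y\<in>W. (\<forall>i<k. \<forall>j<k. h y (E i y) (E j y) = (if i = j then 1 else 0)) \<and>
      span ((\<lambda>i. E i y) ` {..<k}) = span ((\<lambda>i. X i y) ` {..<k}))"
proof (induction k)
  case 0
  then show ?case using W0 by (intro exI[of _ W0]) auto
next
  case (Suc k)
  then obtain W E where WE: "open W \<and> x0 \<in> W \<and> W \<subseteq> W0 \<and> (\<forall>i<k. smooth_section A H (E i)) \<and>
    (\<forall>y\<in>W. (\<forall>i<k. \<forall>j<k. h y (E i y) (E j y) = (if i = j then 1 else 0)) \<and>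
      span ((\<lambda>i. E i y) ` {..<k}) = span ((\<lambda>i. X i y) ` {..<k}))"
    using Suc_leD[OF Suc.prems] by blast
  have W: "open W" "x0 \<in> W" "W \<subseteq> W0" using WE by blast+
  have E: "smooth_section A H (E i)" if "i < k" for i using WE that by blast
  have orth: "h y (E i y) (E j y) = (if i = j then 1 else 0)" if "y \<in> W" "i < k" "j < k" for y i j
    using WE that by blast
  have spn: "span ((\<lambda>i. E i y) ` {..<k}) = span ((\<lambda>i. X i y) ` {..<k})" if "y \<in> W" for y
    using WE that by blast
  have k: "k < r" using Suc.prems by simp
  obtain \<psi> V K where \<psi>: "smooth_fun A \<psi>" "open V" "x0 \<in> V" "\<And>y. y \<in> V \<Longrightarrow> \<psi> y = (1::real)" "K \<subseteq> W0" "\<And>y. y \<notin> K \<Longrightarrow> \<psi> y = 0"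
    by (rule bump[OF W0], rule that)
  define Xk where "Xk = (\<lambda>y. \<psi> y *\<^sub>R X k y)"
  have Xk: "smooth_section A H Xk"
  proof -
    have "\<psi> y *\<^sub>R X k y \<in> H y" for y
    proof (cases "y \<in> K")
      case True then show ?thesis using XH[of y k] k \<psi>(5) H_subspace by (auto intro: subspace_scale)
    next
      case False then show ?thesis using \<psi>(6)[OF False] subspace_0[OF H_subspace] by simp
    qed
    then show ?thesis unfolding smooth_section_def Xk_def using vector_field_scale[OF X[OF k] \<psi>(1)] by blast
  qed
  define Y where "Y = (\<lambda>y. Xk y - (\<Sum>i<k. h y (Xk y) (E i y) *\<^sub>R E i y))"
  have Y: "smooth_section A H Y" unfolding Y_def
    by (intro section_diff Xk section_sum section_scale E section_smooth_metric) auto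
  have Yx0: "Y x0 \<noteq> 0"
  proof
    assume "Y x0 = 0"
    then have "X k x0 = (\<Sum>i<k. h x0 (Xk x0) (E i x0) *\<^sub>R E i x0)" using \<psi>(3,4) by (simp add: Y_def Xk_def)
    also have "\<dots> \<in> span ((\<lambda>i. E i x0) ` {..<k})" by (intro span_sum span_scale span_base) auto
    finally have "X k x0 \<in> span ((\<lambda>i. X i x0) ` {..<k})" using spn[OF W(2)] by simp
    then obtain c where c: "X k x0 = (\<Sum>i<k. c i *\<^sub>R X i x0)" using span_image_lessThan by blast
    define c' where "c' = (\<lambda>i. if i < k then - c i else if i = k then 1 else 0)"
    have "(\<Sum>i<r. c' i * X i x0 f) = 0" for f
    proof -
      have "(\<Sum>i<r. c' i * X i x0 f) = (\<Sum>i<Suc k. c' i * X i x0 f)"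
        using k by (intro sum.mono_neutral_right) (auto simp: c'_def)
      also have "\<dots> = X k x0 f - (\<Sum>i<k. c i * X i x0 f)" by (simp add: c'_def sum_negf)
      also have "\<dots> = 0" by (subst c) (simp add: sum_fun_apply)
      finally show ?thesis .
    qed
    then have "c' k = 0" using indep k by blast
    then show False by (simp add: c'_def)
  qed
  define N where "N = (\<lambda>y. h y (Y y) (Y y))"
  have N: "smooth_fun A N" unfolding N_def by (rule section_smooth_metric[OF Y Y])
  have N0: "0 < N x0" unfolding N_def by (rule h_pos[OF section_in[OF Y] Yx0])
  have openN: "open {y. 0 < N y}" using smooth_fun_continuous[OF N] by (intro open_Collect_less) auto
  obtain \<kappa> V' K' where \<kappa>: "smooth_fun A \<kappa>" "\<And>y. 0 \<le> \<kappa> y" "\<And>y. \<kappa> y \<le> (1::real)" "open V'" "x0 \<in> V'" "\<And>y. y \<in> V' \<Longrightarrow> \<kappa> y = 1"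
    "K' \<subseteq> {y. 0 < N y}" "\<And>y. y \<notin> K' \<Longrightarrow> \<kappa> y = 0"
    by (rule bump[OF openN, of x0]) (use N0 in simp, rule that)
  \<comment> \<open>Equal to \<open>N\<close> near \<open>x0\<close> and positive everywhere, so
    that its inverse square root is a globally smooth factor.\<close>
  define M where "M = (\<lambda>y. \<kappa> y * N y + (1 - \<kappa> y) * N x0)"
  have Mpos: "0 < M y" for y
  proof (cases "\<kappa> y = 0")
    case True then show ?thesis using N0 by (simp add: M_def)
  next
    case False
    then have "0 < \<kappa> y" "0 < N y" using \<kappa>(2)[of y] \<kappa>(7,8) by fastforce+
    then show ?thesis using \<kappa>(3)[of y] N0 by (auto simp: M_def intro!: add_pos_nonneg)
  qed
  define m where "m = (\<lambda>y. inverse (sqrt (M y)))"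
  have m: "smooth_fun A m" unfolding m_def
    by (rule smooth_fun_inverse_sqrt[OF _ Mpos]) (unfold M_def, intro smooth_fun_add smooth_fun_mult smooth_fun_diff smooth_fun_const N \<kappa>)
  define E' where "E' = (\<lambda>i. if i < k then E i else (\<lambda>y. m y *\<^sub>R Y y))"
  have E'_sec: "smooth_section A H (E' i)" if "i < Suc k" for i
    using that E section_scale[OF Y m] by (auto simp: E'_def)
  show ?case
  proof (intro exI[of _ "W \<inter> V \<inter> V'"] exI[of _ E'] conjI ballI allI impI)
    show "open (W \<inter> V \<inter> V')" "x0 \<in> W \<inter> V \<inter> V'" "W \<inter> V \<inter> V' \<subseteq> W0" using W \<psi> \<kappa> by auto
    show "smooth_section A H (E' i)" if "i < Suc k" for i by (rule E'_sec[OF that])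
  next
    fix y i j assume y: "y \<in> W \<inter> V \<inter> V'" and ij: "i < Suc k" "j < Suc k"
    interpret psd_form "H y" "h y" by (rule psd_h)
    have Ein: "E i y \<in> H y" if "i < k" for i using section_in[OF E[OF that]] .
    have Yin: "Y y \<in> H y" "Xk y \<in> H y" using section_in[OF Y] section_in[OF Xk] by auto
    have sumin: "(\<Sum>i<k. h y (Xk y) (E i y) *\<^sub>R E i y) \<in> H y" using Ein by (intro subspace_sum[OF sub] subspace_scale[OF sub]) auto
    have YE: "h y (Y y) (E j y) = 0" if j: "j < k" for j
    proof -
      have "h y (Y y) (E j y) = h y (Xk y) (E j y) - h y (\<Sum>i<k. h y (Xk y) (E i y) *\<^sub>R E i y) (E j y)"
        unfolding Y_def by (rule diff_left[OF Yin(2) sumin Ein[OF j]])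
      also have "h y (\<Sum>i<k. h y (Xk y) (E i y) *\<^sub>R E i y) (E j y) = (\<Sum>i<k. h y (Xk y) (E i y) * h y (E i y) (E j y))"
        by (rule h_sum_left[OF Ein[OF j]]) (use Ein in auto)
      also have "\<dots> = (\<Sum>i<k. if i = j then h y (Xk y) (E i y) else 0)"
        using y j orth by (intro sum.cong) auto
      also have "\<dots> = h y (Xk y) (E j y)" using j by simp
      finally show ?thesis by simp
    qed
    have Ny: "0 < N y" "m y * m y * N y = 1"
    proof -
      have "y \<in> K'" using \<kappa>(6,8) y by fastforce
      then show "0 < N y" using \<kappa>(7) by blast
      then show "m y * m y * N y = 1" using y \<kappa>(6) by (simp add: m_def M_def field_simps)
    qed
    show "h y (E' i y) (E' j y) = (if i = j then 1 else 0)"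
    proof (cases "i < k"; cases "j < k")
      assume "i < k" "j < k" then show ?thesis using orth y by (simp add: E'_def)
    next
      assume "i < k" "\<not> j < k"
      then show ?thesis using ij Ein Yin YE[of i] sym[of "E i y" "Y y"] by (simp add: E'_def scale_right)
    next
      assume "\<not> i < k" "j < k"
      then show ?thesis using ij Ein Yin YE[of j] by (simp add: E'_def scale_left)
    next
      assume "\<not> i < k" "\<not> j < k"
      then have "i = k" "j = k" using ij by auto
      then show ?thesis using Yin Ny(2) by (simp add: E'_def scale_left scale_right N_def mult.assoc)
    qed
  next
    fix y assume y: "y \<in> W \<inter> V \<inter> V'"
    let ?S = "(\<lambda>i. E i y) ` {..<k}" and ?T = "(\<lambda>i. X i y) ` {..<k}"
    have my: "m y \<noteq> 0" using Mpos[of y] by (simp add: m_def)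
    have "(\<lambda>i. E' i y) ` {..<Suc k} = insert (m y *\<^sub>R Y y) ?S"
      unfolding lessThan_Suc image_insert by (auto simp: E'_def)
    then have "span ((\<lambda>i. E' i y) ` {..<Suc k}) = span (insert (Y y) ?S)" using span_insert_scale[OF my] by simp
    also have "\<dots> = span (insert (X k y) ?S)"
    proof (rule eq_span_insert_eq)
      have "Y y - X k y = - (\<Sum>i<k. h y (Xk y) (E i y) *\<^sub>R E i y)" using y \<psi>(4) by (simp add: Y_def Xk_def)
      also have "\<dots> \<in> span ?S" by (intro span_neg span_sum span_scale span_base) auto
      finally show "Y y - X k y \<in> span ?S" .
    qed
    also have "\<dots> = span (insert (X k y) ?T)" using spn y by (simp add: span_insert)
    also have "insert (X k y) ?T = (\<lambda>i. X i y) ` {..<Suc k}" by (simp add: lessThan_Suc)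
    finally show "span ((\<lambda>i. E' i y) ` {..<Suc k}) = span ((\<lambda>i. X i y) ` {..<Suc k})" .
  qed
qed

lemma local_frame:
  obtains W r E where "open W" "x0 \<in> W" "\<And>i. i < r \<Longrightarrow> smooth_section A H (E i)"
    "\<And>y i j. y \<in> W \<Longrightarrow> i < r \<Longrightarrow> j < r \<Longrightarrow> h y (E i y) (E j y) = (if i = j then 1 else 0)"
    "\<And>y. y \<in> W \<Longrightarrow> H y = span ((\<lambda>i. E i y) ` {..<r::nat})"
proof -
  obtain r :: nat where r: "\<forall>x. \<exists>W X. open W \<and> x \<in> W \<and> (\<forall>i<r. smooth_vector_field A (X i)) \<and>
     (\<forall>y\<in>W. H y = lin_span ((\<lambda>i. X i y) ` {..<r}) \<and> (\<forall>c. (\<forall>f. (\<Sum>i<r. c i * X i y f) = 0) \<longrightarrow> (\<forall>i<r. c i = 0)))"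
    using sub_bundle unfolding subbundle_def by blast
  obtain W X where W0: "open W \<and> x0 \<in> W \<and> (\<forall>i<r. smooth_vector_field A (X i)) \<and>
     (\<forall>y\<in>W. H y = span ((\<lambda>i. X i y) ` {..<r}) \<and> (\<forall>c. (\<forall>f. (\<Sum>i<r. c i * X i y f) = 0) \<longrightarrow> (\<forall>i<r. c i = 0)))"
    using spec[OF r, of x0] unfolding lin_span_eq_span by (elim exE) (rule that)
  have WX: "open W" "x0 \<in> W" using W0 by simp_all
  have WX3: "smooth_vector_field A (X i)" if "i < r" for i using W0 that by simp
  have WX4: "H y = span ((\<lambda>i. X i y) ` {..<r})" if "y \<in> W" for y using W0 that by simp
  have WX5: "\<forall>i<r. c i = 0" if c: "\<And>f. (\<Sum>i<r. c i * X i x0 f) = 0" for c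
  proof -
    have "\<forall>c. (\<forall>f. (\<Sum>i<r. c i * X i x0 f) = 0) \<longrightarrow> (\<forall>i<r. c i = 0)" using W0 by blast
    from spec[OF this, of c] show ?thesis using c by (rule_tac mp) auto
  qed
  have XH: "X i y \<in> H y" if "y \<in> W" "i < r" for y i
    unfolding WX4[OF that(1)] using that(2) by (intro span_base) auto
  have "\<exists>W' E. open W' \<and> x0 \<in> W' \<and> W' \<subseteq> W \<and> (\<forall>i<r. smooth_section A H (E i)) \<and>
    (\<forall>y\<in>W'. (\<forall>i<r. \<forall>j<r. h y (E i y) (E j y) = (if i = j then 1 else 0)) \<and>
      span ((\<lambda>i. E i y) ` {..<r}) = span ((\<lambda>i. X i y) ` {..<r}))"
    by (rule gram_schmidt[OF WX WX3 XH WX5 order_refl])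
  then obtain W' E where E: "open W' \<and> x0 \<in> W' \<and> W' \<subseteq> W \<and> (\<forall>i<r. smooth_section A H (E i)) \<and>
    (\<forall>y\<in>W'. (\<forall>i<r. \<forall>j<r. h y (E i y) (E j y) = (if i = j then 1 else 0)) \<and>
      span ((\<lambda>i. E i y) ` {..<r}) = span ((\<lambda>i. X i y) ` {..<r}))"
    by (elim exE) (rule that)
  show ?thesis
  proof (rule that[of W' r E])
    show "open W'" "x0 \<in> W'" using E by simp_all
    show "smooth_section A H (E i)" if "i < r" for i using E that by simp
    show "h y (E i y) (E j y) = (if i = j then 1 else 0)" if "y \<in> W'" "i < r" "j < r" for y i j
      using E that by simp
    show "H y = span ((\<lambda>i. E i y) ` {..<r})" if "y \<in> W'" for y
      using E that WX4[of y] by auto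
  qed
qed

text \<open>In an orthonormal frame \<open>sharp\<close> of q is the sum of the q(E i) E i.
  Definiteness of the metric supplies the uniqueness on which the description operator in
  \<open>sharp\<close> depends.\<close>

lemma cometric_frame:
  fixes r :: nat
  assumes sec: "\<And>i. i < r \<Longrightarrow> smooth_section A H (E i)"
    and orth: "\<And>i j. i < r \<Longrightarrow> j < r \<Longrightarrow> h y (E i y) (E j y) = (if i = j then 1 else 0)"
    and spn: "H y = span ((\<lambda>i. E i y) ` {..<r})"
    and p: "p \<in> cotangent_space A y" and q: "q \<in> cotangent_space A y"
  shows "cometric H h y p q = (\<Sum>i<r. p (E i y) * q (E i y))"
proof -
  interpret psd_form "H y" "h y" by (rule psd_h)
  have Ein: "E i y \<in> H y" "E i y \<in> tangent_space A y" if "i < r" for i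
    using sec[OF that] unfolding smooth_section_def smooth_vector_field_def by blast+
  have lin: "lin_on (tangent_space A y) p" "lin_on (tangent_space A y) q" using p q by (auto simp: cotangent_space_def)
  define v where "v = (\<Sum>i<r. q (E i y) *\<^sub>R E i y)"
  have v: "v \<in> H y" unfolding v_def using Ein by (intro subspace_sum[OF sub] subspace_scale[OF sub]) auto
  have hv: "q w = h y w v" if w: "w \<in> H y" for w
  proof -
    obtain c where c: "w = (\<Sum>i<r. c i *\<^sub>R E i y)" using span_image_lessThan[OF w[unfolded spn]] by blast
    have "q w = (\<Sum>i<r. c i * q (E i y))" unfolding c using Ein by (intro lin_on_sum[OF lin(2) tangent_subspace]) auto
    moreover have "h y w v = (\<Sum>i<r. c i * q (E i y))"
    proof -
      have "h y w v = (\<Sum>i<r. c i * h y (E i y) v)" unfolding c by (rule h_sum_left[OF v]) (use Ein in auto)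
      also have "\<dots> = (\<Sum>i<r. c i * q (E i y))"
      proof (intro sum.cong refl arg_cong2[where f = "(*)"])
        fix i assume "i \<in> {..<r}"
        then have i: "i < r" by simp
        have "h y (E i y) v = h y v (E i y)" by (rule sym[OF Ein(1)[OF i] v])
        also have "\<dots> = (\<Sum>j<r. q (E j y) * h y (E j y) (E i y))"
          unfolding v_def by (rule h_sum_left[OF Ein(1)[OF i]]) (use Ein in auto)
        also have "\<dots> = (\<Sum>j<r. if j = i then q (E j y) else 0)" using orth i by (intro sum.cong) auto
        also have "\<dots> = q (E i y)" using i by simp
        finally show "h y (E i y) v = q (E i y)" .
      qed
      finally show ?thesis .
    qed
    ultimately show ?thesis by simp
  qed
  have "sharp H h y q = v"
    unfolding sharp_def
  proof (rule the_equality)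
    show "v \<in> H y \<and> (\<forall>w\<in>H y. q w = h y w v)" using v hv by blast
    fix u assume u: "u \<in> H y \<and> (\<forall>w\<in>H y. q w = h y w u)"
    have "u - v \<in> H y" using u v by simp
    then have "h y (u - v) u = h y (u - v) v" using u hv by metis
    then have "h y (u - v) (u - v) = 0" using u v by (simp add: diff_right)
    then have "u - v = 0" using h_pos[OF \<open>u - v \<in> H y\<close>] by force
    then show "u = v" by simp
  qed
  then have "cometric H h y p q = p v" by (simp add: cometric_def)
  also have "\<dots> = (\<Sum>i<r. q (E i y) * p (E i y))" unfolding v_def using Ein by (intro lin_on_sum[OF lin(1) tangent_subspace]) auto
  finally show ?thesis by (simp add: mult.commute)
qed

text \<open>The index set is kept nonempty by a zero field for every point of the finite cover.\<close>
lemma global_frame: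
  obtains I :: "('a \<times> nat) set" and D where "finite I" "I \<noteq> {}" "\<And>i. i \<in> I \<Longrightarrow> smooth_vector_field A (D i)"
    "\<And>y f g. cometric H h y (differential A f y) (differential A g y) = (\<Sum>i\<in>I. D i y f * D i y g)"
proof -
  define Q where "Q = (\<lambda>x (t :: nat \<times> (nat \<Rightarrow> 'a \<Rightarrow> 'a tangent) \<times> ('a \<Rightarrow> real)). case t of (r, E, \<psi>) \<Rightarrow>
    (\<forall>i<r. smooth_section A H (E i)) \<and> smooth_fun A \<psi> \<and> (\<exists>V. open V \<and> x \<in> V \<and> (\<forall>y\<in>V. \<psi> y = 1)) \<and>
    (\<forall>y. \<psi> y \<noteq> 0 \<longrightarrow> (\<forall>p\<in>cotangent_space A y. \<forall>q\<in>cotangent_space A y. cometric H h y p q = (\<Sum>i<r. p (E i y) * q (E i y)))))"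
  have "\<exists>t. Q x t" for x
  proof -
    obtain W r E where WE: "open W" "x \<in> W" "\<And>i. i < r \<Longrightarrow> smooth_section A H (E i)"
      "\<And>y i j. y \<in> W \<Longrightarrow> i < r \<Longrightarrow> j < r \<Longrightarrow> h y (E i y) (E j y) = (if i = j then 1 else 0)"
      "\<And>y. y \<in> W \<Longrightarrow> H y = span ((\<lambda>i. E i y) ` {..<r::nat})"
      by (rule local_frame[of x], rule that)
    obtain \<psi> V K where \<psi>: "smooth_fun A \<psi>" "\<And>y. 0 \<le> \<psi> y" "\<And>y. \<psi> y \<le> (1::real)" "open V" "x \<in> V" "\<And>y. y \<in> V \<Longrightarrow> \<psi> y = 1"
      "closed K" "K \<subseteq> W" "\<And>y. y \<notin> K \<Longrightarrow> \<psi> y = 0"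
      by (rule bump[OF WE(1,2)], rule that)
    have "cometric H h y p q = (\<Sum>i<r. p (E i y) * q (E i y))"
      if y: "\<psi> y \<noteq> 0" and pq: "p \<in> cotangent_space A y" "q \<in> cotangent_space A y" for y p q
    proof -
      have "y \<in> W" using y \<psi>(8,9) by blast
      then show ?thesis using WE(3,4,5) pq by (intro cometric_frame) auto
    qed
    moreover have "\<exists>V. open V \<and> x \<in> V \<and> (\<forall>y\<in>V. \<psi> y = 1)" using \<psi>(4-6) by blast
    ultimately have "Q x (r, E, \<psi>)" using WE(3) \<psi>(1) unfolding Q_def by simp
    then show ?thesis by blast
  qed
  then obtain t where t: "\<And>x. Q x (t x)" by metis
  define r where "r = (\<lambda>x. fst (t x))"
  define E where "E = (\<lambda>x. fst (snd (t x)))"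
  define \<psi> where "\<psi> = (\<lambda>x. snd (snd (t x)))"
  have P: "\<And>x i. i < r x \<Longrightarrow> smooth_section A H (E x i)" "\<And>x. smooth_fun A (\<psi> x)"
    "\<And>x. \<exists>V. open V \<and> x \<in> V \<and> (\<forall>y\<in>V. \<psi> x y = 1)"
    "\<And>x y p q. \<psi> x y \<noteq> 0 \<Longrightarrow> p \<in> cotangent_space A y \<Longrightarrow> q \<in> cotangent_space A y \<Longrightarrow>
      cometric H h y p q = (\<Sum>i<r x. p (E x i y) * q (E x i y))"
    using t unfolding Q_def r_def E_def \<psi>_def by (simp_all add: case_prod_beta)
  obtain X where X: "finite X" "X \<noteq> {}" "\<And>y. \<exists>x\<in>X. \<psi> x y = 1"
    by (rule finite_bump_cover[OF P(3)], rule that)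
  define S where "S = (\<lambda>y. \<Sum>x\<in>X. \<psi> x y * \<psi> x y)"
  have Spos: "0 < S y" for y
  proof -
    obtain x where x: "x \<in> X" "\<psi> x y = 1" using X(3) by blast
    have "\<psi> x y * \<psi> x y \<le> S y" unfolding S_def using x X(1) by (intro member_le_sum) auto
    then show ?thesis using x by simp
  qed
  have S: "smooth_fun A S" unfolding S_def by (intro smooth_fun_sum smooth_fun_mult P(2))
  \<comment> \<open>The squares of the \<open>m x\<close> form a partition of unity; squares,
    because each field occurs twice in the formula for the co-metric.\<close>
  define m where "m = (\<lambda>x y. \<psi> x y * inverse (sqrt (S y)))"
  have m: "smooth_fun A (m x)" for x unfolding m_def by (intro smooth_fun_mult P(2) smooth_fun_inverse_sqrt S Spos)
  define D where "D = (\<lambda>(x, i) y. if i < r x then m x y *\<^sub>R E x i y else 0)"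
  define I where "I = (SIGMA x:X. {..r x})"
  show ?thesis
  proof (rule that[of I D])
    show "finite I" "I \<noteq> {}" using X by (auto simp: I_def)
    show "smooth_vector_field A (D i)" if "i \<in> I" for i
    proof (cases i)
      case (Pair x j)
      show ?thesis
      proof (cases "j < r x")
        case True
        then have "smooth_vector_field A (\<lambda>y. m x y *\<^sub>R E x j y)" using P(1) m unfolding smooth_section_def by (intro vector_field_scale) auto
        then show ?thesis using True Pair by (simp add: D_def)
      next
        case False then show ?thesis using Pair vector_field_zero by (simp add: D_def)
      qed
    qed
    fix y f g
    let ?p = "differential A f y" and ?q = "differential A g y"
    have pq: "?p \<in> cotangent_space A y" "?q \<in> cotangent_space A y" by (rule differential_cotangent)+
    have ET: "E x j y \<in> tangent_space A y" if "j < r x" for x j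
      using P(1)[OF that] unfolding smooth_section_def smooth_vector_field_def by blast
    have "(\<Sum>i\<in>I. D i y f * D i y g) = (\<Sum>x\<in>X. \<Sum>j\<le>r x. D (x, j) y f * D (x, j) y g)"
      unfolding I_def using X(1) by (subst sum.Sigma) auto
    also have "\<dots> = (\<Sum>x\<in>X. (\<psi> x y * \<psi> x y) * inverse (S y) * cometric H h y ?p ?q)"
    proof (rule sum.cong[OF refl])
      fix x assume "x \<in> X"
      have "(\<Sum>j\<le>r x. D (x, j) y f * D (x, j) y g) = (\<Sum>j<r x. D (x, j) y f * D (x, j) y g)"
        by (intro sum.mono_neutral_right) (auto simp: D_def)
      also have "\<dots> = (\<Sum>j<r x. (m x y * m x y) * (?p (E x j y) * ?q (E x j y)))"
        using ET by (intro sum.cong) (auto simp: D_def differential_def)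
      also have "\<dots> = (m x y * m x y) * (\<Sum>j<r x. ?p (E x j y) * ?q (E x j y))" by (simp add: sum_distrib_left)
      also have "\<dots> = (m x y * m x y) * cometric H h y ?p ?q"
        using P(4)[OF _ pq, of x] by (cases "\<psi> x y = 0") (auto simp: m_def)
      also have "m x y * m x y = (\<psi> x y * \<psi> x y) * inverse (S y)"
        using Spos[of y] by (simp add: m_def field_simps)
      finally show "(\<Sum>j\<le>r x. D (x, j) y f * D (x, j) y g) = (\<psi> x y * \<psi> x y) * inverse (S y) * cometric H h y ?p ?q" .
    qed
    also have "\<dots> = S y * inverse (S y) * cometric H h y ?p ?q"
      unfolding S_def sum_distrib_right by simp
    finally show "cometric H h y ?p ?q = (\<Sum>i\<in>I. D i y f * D i y g)" using Spos[of y] by simp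
  qed
qed

end

section \<open>The operator on smooth functions\<close>

context compact_manifold
begin

lemma Gamma_smooth:
  "sym2_section A s \<Longrightarrow> smooth_fun A f \<Longrightarrow> smooth_fun A g \<Longrightarrow> smooth_fun A (Gamma A s f g)"
  unfolding sym2_section_def Gamma_def by blast

lemma Gamma_sym:
  assumes "sym2_section A s" shows "Gamma A s f g x = Gamma A s g f x"
  using assms differential_cotangent unfolding sym2_section_def sym_bilin_on_def Gamma_def by blast

lemma differential_lincomb:
  assumes "smooth_fun A f" "smooth_fun A g"
  shows "differential A (\<lambda>y. a * f y + b * g y) x = (\<lambda>v. a * differential A f x v + b * differential A g x v)"
  by (rule ext) (simp add: differential_def tangent_lincomb assms)

lemma Gamma_lincomb_right:
  assumes s: "sym2_section A s" and "smooth_fun A f" "smooth_fun A g"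
  shows "Gamma A s k (\<lambda>y. a * f y + b * g y) x = a * Gamma A s k f x + b * Gamma A s k g x"
proof -
  have "lin_on (cotangent_space A x) (s x (differential A k x))"
    using s differential_cotangent unfolding sym2_section_def sym_bilin_on_def by blast
  then show ?thesis
    unfolding Gamma_def differential_lincomb[OF assms(2,3)] lin_on_def using differential_cotangent by blast
qed

lemma Gamma_lincomb_left:
  assumes s: "sym2_section A s" and "smooth_fun A f" "smooth_fun A g"
  shows "Gamma A s (\<lambda>y. a * f y + b * g y) k x = a * Gamma A s f k x + b * Gamma A s g k x"
  using Gamma_lincomb_right[OF assms] Gamma_sym[OF s] by metis

lemma Gamma_sum_right:
  assumes s: "sym2_section A s"
  shows "(\<And>i. i \<in> I \<Longrightarrow> smooth_fun A (f i)) \<Longrightarrow>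
    Gamma A s k (\<lambda>y. \<Sum>i\<in>I. c i * f i y) x = (\<Sum>i\<in>I. c i * Gamma A s k (f i) x)"
proof (induction I rule: infinite_finite_induct)
  case (insert i I)
  have sm: "smooth_fun A (\<lambda>y. \<Sum>i\<in>I. c i * f i y)" using insert.prems by (intro smooth_fun_sum smooth_fun_cmult) auto
  have "Gamma A s k (\<lambda>y. c i * f i y + 1 * (\<Sum>i\<in>I. c i * f i y)) x
      = c i * Gamma A s k (f i) x + 1 * Gamma A s k (\<lambda>y. \<Sum>i\<in>I. c i * f i y) x"
    by (rule Gamma_lincomb_right[OF s _ sm]) (simp add: insert.prems)
  moreover have "Gamma A s k (\<lambda>y. \<Sum>i\<in>I. c i * f i y) x = (\<Sum>i\<in>I. c i * Gamma A s k (f i) x)"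
    by (rule insert.IH) (use insert.prems in blast)
  ultimately show ?case by (simp only: sum.insert[OF insert.hyps(1,2)] mult_1)
qed (use Gamma_lincomb_right[OF s smooth_fun_const smooth_fun_const, of k 0 0 0 0] in simp_all)

text \<open>At \<open>x\<close> the composite has the same differential as the linear combination of
  the \<open>\<phi> e\<close> whose coefficients are frozen at \<open>x\<close>, and
  \<open>Gamma\<close> depends on differentials only.\<close>

lemma Gamma_comp:
  assumes s: "sym2_section A s" and B: "finite B" "csm B U" and \<phi>: "\<And>e. e \<in> B \<Longrightarrow> smooth_fun A (\<phi> e)"
  shows "Gamma A s k (\<lambda>x. U (\<Sum>e\<in>B. \<phi> e x *\<^sub>R e)) x
    = (\<Sum>e\<in>B. pd e U (\<Sum>e\<in>B. \<phi> e x *\<^sub>R e) * Gamma A s k (\<phi> e) x)"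
proof -
  let ?c = "\<lambda>e. pd e U (\<Sum>e\<in>B. \<phi> e x *\<^sub>R e)"
  have "v (\<lambda>x. U (\<Sum>e\<in>B. \<phi> e x *\<^sub>R e)) = v (\<lambda>y. \<Sum>e\<in>B. ?c e * \<phi> e y)" if v: "v \<in> tangent_space A x" for v
  proof -
    have "v (\<lambda>y. \<Sum>e\<in>B. ?c e * \<phi> e y) = (\<Sum>e\<in>B. v (\<lambda>y. ?c e * \<phi> e y))"
      by (rule tangent_sum[OF v]) (intro smooth_fun_cmult \<phi>)
    also have "\<dots> = (\<Sum>e\<in>B. ?c e * v (\<phi> e))"
      using tangent_lincomb[OF v \<phi> smooth_fun_const, of _ _ 0] by (intro sum.cong) auto
    also have "\<dots> = v (\<lambda>x. U (\<Sum>e\<in>B. \<phi> e x *\<^sub>R e))" by (rule tangent_comp[OF B \<phi> v, symmetric])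
    finally show ?thesis ..
  qed
  then have "differential A (\<lambda>x. U (\<Sum>e\<in>B. \<phi> e x *\<^sub>R e)) x = differential A (\<lambda>y. \<Sum>e\<in>B. ?c e * \<phi> e y) x"
    unfolding differential_def by auto
  then have "Gamma A s k (\<lambda>x. U (\<Sum>e\<in>B. \<phi> e x *\<^sub>R e)) x = Gamma A s k (\<lambda>y. \<Sum>e\<in>B. ?c e * \<phi> e y) x"
    unfolding Gamma_def by simp
  then show ?thesis using Gamma_sum_right[OF s \<phi>] by simp
qed

end

context manifold_operator
begin

lemma L_lincomb:
  assumes f: "smooth_fun A f" and g: "smooth_fun A g"
  shows "L (\<lambda>y. a * f y + b * g y) x = a * L f x + b * L g x"
proof -
  obtain c where c: "c \<in> A" "x \<in> fst c" using chart_ex by blast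
  obtain \<alpha> \<beta> where "\<And>i j. i \<in> Basis \<Longrightarrow> j \<in> Basis \<Longrightarrow> smooth_on (chart_image c) (\<alpha> i j)"
    and "\<And>i. i \<in> Basis \<Longrightarrow> smooth_on (chart_image c) (\<beta> i)"
    and L_eq: "\<And>f y. smooth_fun A f \<Longrightarrow> y \<in> chart_image c \<Longrightarrow>
        L f (chart_inv c y) =
          (\<Sum>i\<in>Basis. \<Sum>j\<in>Basis. \<alpha> i j y *
             frechet_derivative (\<lambda>z. frechet_derivative (\<lambda>y. f (chart_inv c y)) (at z) j) (at y) i)
          + (\<Sum>i\<in>Basis. \<beta> i y * frechet_derivative (\<lambda>y. f (chart_inv c y)) (at y) i)"
    by (rule L_local[OF c(1)], rule that)
  define y where "y = snd c x"
  have y: "y \<in> chart_image c" "chart_inv c y = x" using c chart_inv_chart by (auto simp: y_def)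
  let ?S = "chart_image c"
  define d where "d = (\<lambda>(f :: 'a \<Rightarrow> real) z. frechet_derivative (\<lambda>y. f (chart_inv c y)) (at z))"
  have d: "((\<lambda>y. f (chart_inv c y)) has_derivative d f z) (at z)" if "smooth_fun A f" "z \<in> ?S" for f z
    unfolding d_def by (rule smooth_on_has_derivative[OF smooth_funD[OF that(1) c(1)] that(2)])
  have d2: "((\<lambda>z. d f z j) has_derivative (\<lambda>i. frechet_derivative (\<lambda>z. d f z j) (at y) i)) (at y)" if "smooth_fun A f" for f j
    by (rule smooth_on_has_derivative[OF _ y(1)]) (unfold d_def, rule smooth_on_frechet_derivative[OF smooth_funD[OF that c(1)]])
  let ?k = "\<lambda>y. a * f y + b * g y"
  have k: "smooth_fun A ?k" by (intro smooth_fun_add smooth_fun_cmult f g)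
  have dk: "d ?k z j = a * d f z j + b * d g z j" if "z \<in> ?S" for z j
  proof -
    have "((\<lambda>y. ?k (chart_inv c y)) has_derivative (\<lambda>j. a * d f z j + b * d g z j)) (at z)"
      by (intro derivative_intros d f g that)
    from fun_cong[OF has_derivative_unique[OF d[OF k that] this]] show ?thesis .
  qed
  have d2k: "frechet_derivative (\<lambda>z. d ?k z j) (at y) i =
      a * frechet_derivative (\<lambda>z. d f z j) (at y) i + b * frechet_derivative (\<lambda>z. d g z j) (at y) i" for i j
  proof -
    have "((\<lambda>z. a * d f z j + b * d g z j) has_derivative
        (\<lambda>i. a * frechet_derivative (\<lambda>z. d f z j) (at y) i + b * frechet_derivative (\<lambda>z. d g z j) (at y) i)) (at y)"
      by (intro derivative_intros d2 f g)
    then have "((\<lambda>z. d ?k z j) has_derivative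
        (\<lambda>i. a * frechet_derivative (\<lambda>z. d f z j) (at y) i + b * frechet_derivative (\<lambda>z. d g z j) (at y) i)) (at y)"
      by (rule has_derivative_transform_within_open[OF _ chart_open(2)[OF c(1)] y(1)]) (simp add: dk)
    from fun_cong[OF has_derivative_unique[OF d2[OF k] this]] show ?thesis .
  qed
  have L': "L f x = (\<Sum>i\<in>Basis. \<Sum>j\<in>Basis. \<alpha> i j y * frechet_derivative (\<lambda>z. d f z j) (at y) i) + (\<Sum>i\<in>Basis. \<beta> i y * d f y i)"
    if "smooth_fun A f" for f using L_eq[OF that y(1)] unfolding y(2) d_def .
  show ?thesis
    unfolding L'[OF k] L'[OF f] L'[OF g] d2k dk[OF y(1)]
    by (simp add: sum_distrib_left sum.distrib algebra_simps)
qed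

lemma L_const: "L (\<lambda>y. k) x = 0"
proof -
  obtain c where c: "c \<in> A" "x \<in> fst c" using chart_ex by blast
  obtain \<alpha> \<beta> where "\<And>i j. i \<in> Basis \<Longrightarrow> j \<in> Basis \<Longrightarrow> smooth_on (chart_image c) (\<alpha> i j)"
    and "\<And>i. i \<in> Basis \<Longrightarrow> smooth_on (chart_image c) (\<beta> i)"
    and L_eq: "\<And>f y. smooth_fun A f \<Longrightarrow> y \<in> chart_image c \<Longrightarrow>
        L f (chart_inv c y) =
          (\<Sum>i\<in>Basis. \<Sum>j\<in>Basis. \<alpha> i j y *
             frechet_derivative (\<lambda>z. frechet_derivative (\<lambda>y. f (chart_inv c y)) (at z) j) (at y) i)
          + (\<Sum>i\<in>Basis. \<beta> i y * frechet_derivative (\<lambda>y. f (chart_inv c y)) (at y) i)"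
    by (rule L_local[OF c(1)], rule that)
  define y where "y = snd c x"
  have y: "y \<in> chart_image c" "chart_inv c y = x" using c chart_inv_chart by (auto simp: y_def)
  have fd: "frechet_derivative (\<lambda>z. k' :: real) (at z) = (\<lambda>h. 0)" for k' and z :: 'b
    by (rule frechet_derivative_at[symmetric]) simp
  show ?thesis using L_eq[OF smooth_fun_const y(1), of k] by (simp add: y(2) fd)
qed

end

locale sub_laplacian = sub_riemannian A H h + manifold_operator A L
  for A :: "('a::{t2_space,second_countable_topology}, 'b::euclidean_space) atlas" and H h L +
  assumes symbol: "is_symbol A L (cometric H h)"
begin

lemma cometric_sym2: "sym2_section A (cometric H h)"
  using symbol unfolding is_symbol_def by blast

lemma carre_du_champ:
  "smooth_fun A f \<Longrightarrow> smooth_fun A g \<Longrightarrow>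
    Gamma A (cometric H h) f g x = (L (\<lambda>y. f y * g y) x - f x * L g x - g x * L f x) / 2"
  using symbol unfolding is_symbol_def Gamma_def by blast

lemma Gamma_cometric_nonneg: "0 \<le> Gamma A (cometric H h) f f x"
proof -
  obtain I :: "('a \<times> nat) set" and D where "finite I" "I \<noteq> {}" "\<And>i. i \<in> I \<Longrightarrow> smooth_vector_field A (D i)"
    and D: "\<And>y f g. cometric H h y (differential A f y) (differential A g y) = (\<Sum>i\<in>I. D i y f * D i y g)"
    by (rule global_frame, rule that)
  show ?thesis unfolding Gamma_def D by (intro sum_nonneg) simp
qed

text \<open>The equation is solved in the ambient space and the solution restricted along
  \<open>F\<close>. The walk may leave the image of the manifold; what counts is that its generator
  satisfies A U (F x) = L (U o F) x, and by \<open>L_comp\<close> this prescribes the coefficients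
  on the image only. Elsewhere they are given by \<open>extension\<close>. The residual is
  controlled with its derivatives along the basis, which bound \<open>Gamma A s\<close> by
  \<open>Gamma_comp\<close>.\<close>

theorem resolvent_dense:
  assumes s: "sym2_section A s"
  shows "\<exists>\<beta>0. \<forall>\<beta>\<ge>\<beta>0. \<forall>g. smooth_fun A g \<longrightarrow> (\<forall>\<epsilon>>0. \<exists>u. smooth_fun A u \<and>
    (\<forall>x. \<bar>\<beta> * u x - L u x - g x\<bar> \<le> \<epsilon>) \<and>
    (\<forall>x. Gamma A s (\<lambda>x. \<beta> * u x - L u x - g x) (\<lambda>x. \<beta> * u x - L u x - g x) x \<le> \<epsilon>))"
proof -
  obtain n ch \<eta> \<zeta> Z where "embedded_manifold A n ch \<eta> \<zeta> Z" using embedding_exists by blast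
  then interpret em: embedded_manifold A n ch \<eta> \<zeta> Z .
  obtain I :: "('a \<times> nat) set" and D where I: "finite I" "I \<noteq> {}" and D_smooth: "\<And>i. i \<in> I \<Longrightarrow> smooth_vector_field A (D i)"
    and D: "\<And>y f g. cometric H h y (differential A f y) (differential A g y) = (\<Sum>i\<in>I. D i y f * D i y g)"
    by (rule global_frame, rule that)
  let ?B = em.basis
  define \<phi> where "\<phi> = (\<lambda>e x. em.emb x e)"
  have \<phi>: "smooth_fun A (\<phi> e)" for e unfolding \<phi>_def by (rule em.emb_smooth)
  have F: "em.F x = (\<Sum>e\<in>?B. \<phi> e x *\<^sub>R e)" for x unfolding em.F_def \<phi>_def ..
  define N where "N = real (card I)"
  have N: "0 < N" using I by (simp add: N_def card_gt_0_iff)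
  define ext where "ext = (\<lambda>a. SOME G. csm ?B G \<and> (\<forall>x. G (em.F x) = a x))"
  have "csm ?B (ext a) \<and> (\<forall>x. ext a (em.F x) = a x)" if a: "smooth_fun A a" for a
  proof -
    have "\<exists>G. csm ?B G \<and> (\<forall>x. G (em.F x) = a x)"
      by (rule em.extension[OF a]) (intro exI conjI allI)
    then show ?thesis unfolding ext_def by (rule someI_ex)
  qed
  then have ext: "\<And>a. smooth_fun A a \<Longrightarrow> csm ?B (ext a)" "\<And>a x. smooth_fun A a \<Longrightarrow> ext a (em.F x) = a x"
    by simp_all
  \<comment> \<open>\<open>wk.gen\<close> contains a factor 1/2 and \<open>wk.A\<close> divides by
    the number N of fields; the root of 2 N makes up for both. The drift is the same for every index
    and so is unaffected by the average.\<close>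
  define \<sigma> where "\<sigma> = (\<lambda>i e. ext (\<lambda>x. sqrt (2 * N) * D i x (\<phi> e)))"
  define b where "b = (\<lambda>i::'a \<times> nat. \<lambda>e. ext (L (\<phi> e)))"
  have D\<phi>: "smooth_fun A (\<lambda>x. sqrt (2 * N) * D i x (\<phi> e))" if "i \<in> I" for i e
  proof (rule smooth_fun_cmult)
    have "\<forall>f. smooth_fun A f \<longrightarrow> smooth_fun A (\<lambda>x. D i x f)"
      using D_smooth[OF that] unfolding smooth_vector_field_def by (rule conjunct2)
    from this[rule_format, OF \<phi>] show "smooth_fun A (\<lambda>x. D i x (\<phi> e))" .
  qed
  interpret wk: walk ?B I \<sigma> b
  proof (rule walk.intro)
    show "finite I" "I \<noteq> {}" by (rule I)+
    show "walk_step ?B (\<sigma> i) (b i)" if "i \<in> I" for i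
    proof
      show "finite ?B" by (rule em.finite_basis)
      show "csm ?B (\<sigma> i e)" for e unfolding \<sigma>_def by (rule ext(1)[OF D\<phi>[OF that]])
      show "csm ?B (b i e)" for e unfolding b_def by (rule ext(1)[OF L_smooth[OF \<phi>]])
    qed
  qed
  have A_F: "wk.A U (em.F x) = L (\<lambda>x. U (em.F x)) x" if U: "csm ?B U" for U x
  proof -
    let ?P = "\<lambda>e e'. pd e' (pd e U) (em.F x)"
    have ws: "walk_step ?B (\<sigma> i) (b i)" if "i \<in> I" for i by (rule wk.ws[OF that])
    have "wk.gen i U (em.F x) = N * (\<Sum>e\<in>?B. \<Sum>e'\<in>?B. D i x (\<phi> e) * D i x (\<phi> e') * ?P e e')
        + (\<Sum>e\<in>?B. L (\<phi> e) x * pd e U (em.F x))" if i: "i \<in> I" for i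
    proof -
      have "(\<Sum>e\<in>?B. \<Sum>e'\<in>?B. \<sigma> i e (em.F x) * \<sigma> i e' (em.F x) * ?P e e')
        = (\<Sum>e\<in>?B. \<Sum>e'\<in>?B. 2 * N * (D i x (\<phi> e) * D i x (\<phi> e') * ?P e e'))"
      proof (intro sum.cong refl)
        fix e e'
        have "sqrt (2 * N) * sqrt (2 * N) = 2 * N" using N by simp
        then show "\<sigma> i e (em.F x) * \<sigma> i e' (em.F x) * ?P e e' = 2 * N * (D i x (\<phi> e) * D i x (\<phi> e') * ?P e e')"
          unfolding \<sigma>_def ext(2)[OF D\<phi>[OF i]] by (simp add: mult_ac)
      qed
      then show ?thesis
        unfolding walk_step.gen_def[OF ws[OF i]]
        unfolding b_def ext(2)[OF L_smooth[OF \<phi>]] by (simp only: sum_distrib_left[symmetric] mult.assoc)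
    qed
    then have "wk.A U (em.F x) = 1 / N * (\<Sum>i\<in>I. N * (\<Sum>e\<in>?B. \<Sum>e'\<in>?B. D i x (\<phi> e) * D i x (\<phi> e') * ?P e e')
        + (\<Sum>e\<in>?B. L (\<phi> e) x * pd e U (em.F x)))" unfolding wk.A_def N_def[symmetric] by simp
    also have "\<dots> = (\<Sum>i\<in>I. \<Sum>e\<in>?B. \<Sum>e'\<in>?B. D i x (\<phi> e) * D i x (\<phi> e') * ?P e e')
        + (\<Sum>e\<in>?B. L (\<phi> e) x * pd e U (em.F x))"
      using N by (simp add: sum.distrib sum_distrib_left[symmetric] N_def[symmetric] distrib_left)
    also have "(\<Sum>i\<in>I. \<Sum>e\<in>?B. \<Sum>e'\<in>?B. D i x (\<phi> e) * D i x (\<phi> e') * ?P e e')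
        = (\<Sum>e\<in>?B. \<Sum>i\<in>I. \<Sum>e'\<in>?B. D i x (\<phi> e) * D i x (\<phi> e') * ?P e e')" by (rule sum.swap)
    also have "\<dots> = (\<Sum>e\<in>?B. \<Sum>e'\<in>?B. \<Sum>i\<in>I. D i x (\<phi> e) * D i x (\<phi> e') * ?P e e')"
      by (intro sum.cong refl sum.swap)
    also have "\<dots> = (\<Sum>e\<in>?B. \<Sum>e'\<in>?B. Gamma A (cometric H h) (\<phi> e) (\<phi> e') x * ?P e e')"
      unfolding Gamma_def D by (simp add: sum_distrib_right)
    also have "\<dots> = (\<Sum>e\<in>?B. \<Sum>e'\<in>?B. (L (\<lambda>x. \<phi> e x * \<phi> e' x) x - \<phi> e x * L (\<phi> e') x - \<phi> e' x * L (\<phi> e) x) / 2 * ?P e e')"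
      unfolding carre_du_champ[OF \<phi> \<phi>] ..
    also have "\<dots> + (\<Sum>e\<in>?B. L (\<phi> e) x * pd e U (em.F x)) = L (\<lambda>x. U (em.F x)) x"
      unfolding F by (rule L_comp[OF em.finite_basis U \<phi>, symmetric])
    finally show ?thesis .
  qed
  obtain K where K: "\<And>x. (\<Sum>e\<in>?B. \<Sum>e'\<in>?B. \<bar>Gamma A s (\<phi> e) (\<phi> e') x\<bar>) \<le> K"
  proof -
    have "\<exists>K. \<forall>x. \<bar>Gamma A s (\<phi> e) (\<phi> e') x\<bar> \<le> K" for e e'
      by (rule smooth_fun_bounded[OF Gamma_smooth[OF s \<phi> \<phi>]])
    then obtain k where "\<And>e e' x. \<bar>Gamma A s (\<phi> e) (\<phi> e') x\<bar> \<le> k e e'" by metis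
    then have "(\<Sum>e\<in>?B. \<Sum>e'\<in>?B. \<bar>Gamma A s (\<phi> e) (\<phi> e') x\<bar>) \<le> (\<Sum>e\<in>?B. \<Sum>e'\<in>?B. k e e')" for x
      by (intro sum_mono)
    then show ?thesis by (rule that)
  qed
  have Gamma_F: "Gamma A s (\<lambda>x. R (em.F x)) (\<lambda>x. R (em.F x)) x \<le> \<delta>\<^sup>2 * K"
    if R: "csm ?B R" and \<delta>: "\<And>e z. e \<in> ?B \<Longrightarrow> \<bar>pd e R z\<bar> \<le> \<delta>" for R \<delta> x
  proof -
    let ?r = "\<lambda>x. R (em.F x)"
    have comp: "Gamma A s k ?r x = (\<Sum>e\<in>?B. pd e R (em.F x) * Gamma A s k (\<phi> e) x)" for k
      unfolding F by (rule Gamma_comp[OF s em.finite_basis R \<phi>])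
    have "Gamma A s ?r ?r x = (\<Sum>e\<in>?B. pd e R (em.F x) * Gamma A s (\<phi> e) ?r x)"
      unfolding comp[of ?r] using Gamma_sym[OF s] by metis
    also have "\<dots> = (\<Sum>e\<in>?B. \<Sum>e'\<in>?B. pd e R (em.F x) * (pd e' R (em.F x) * Gamma A s (\<phi> e) (\<phi> e') x))"
      unfolding comp sum_distrib_left ..
    also have "\<dots> \<le> (\<Sum>e\<in>?B. \<Sum>e'\<in>?B. \<delta>\<^sup>2 * \<bar>Gamma A s (\<phi> e) (\<phi> e') x\<bar>)"
    proof (intro sum_mono)
      fix e e' assume e: "e \<in> ?B" "e' \<in> ?B"
      have "pd e R (em.F x) * (pd e' R (em.F x) * Gamma A s (\<phi> e) (\<phi> e') x)
        \<le> \<bar>pd e R (em.F x)\<bar> * \<bar>pd e' R (em.F x)\<bar> * \<bar>Gamma A s (\<phi> e) (\<phi> e') x\<bar>"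
        unfolding abs_mult[symmetric] mult.assoc by (rule abs_ge_self)
      also have "\<dots> \<le> \<delta> * \<delta> * \<bar>Gamma A s (\<phi> e) (\<phi> e') x\<bar>"
        using \<delta>[OF e(1)] \<delta>[OF e(2)] order_trans[OF abs_ge_zero \<delta>[OF e(1)]]
        by (intro mult_right_mono mult_mono) auto
      finally show "pd e R (em.F x) * (pd e' R (em.F x) * Gamma A s (\<phi> e) (\<phi> e') x) \<le> \<delta>\<^sup>2 * \<bar>Gamma A s (\<phi> e) (\<phi> e') x\<bar>"
        by (simp add: power2_eq_square)
    qed
    also have "\<dots> = \<delta>\<^sup>2 * (\<Sum>e\<in>?B. \<Sum>e'\<in>?B. \<bar>Gamma A s (\<phi> e) (\<phi> e') x\<bar>)" by (simp add: sum_distrib_left)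
    also have "\<dots> \<le> \<delta>\<^sup>2 * K" by (intro mult_left_mono K) simp
    finally show ?thesis .
  qed
  obtain \<beta>0 where \<beta>0: "\<And>\<beta> G \<epsilon>. \<beta>0 \<le> \<beta> \<Longrightarrow> csm ?B G \<Longrightarrow> 0 < \<epsilon> \<Longrightarrow> \<exists>U. csm ?B U \<and>
     (\<forall>z. \<bar>\<beta> * U z - wk.A U z - G z\<bar> \<le> \<epsilon>) \<and> (\<forall>e\<in>?B. \<forall>z. \<bar>pd e (\<lambda>z. \<beta> * U z - wk.A U z - G z) z\<bar> \<le> \<epsilon>)"
    using wk.resolvent_approx by blast
  show ?thesis
  proof (intro exI[of _ \<beta>0] allI impI)
    fix \<beta> g \<epsilon> assume \<beta>: "\<beta>0 \<le> \<beta>" and g: "smooth_fun A g" and \<epsilon>: "0 < (\<epsilon>::real)"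
    have K0: "0 \<le> K" using K[of undefined] by (rule order_trans[rotated]) (intro sum_nonneg abs_ge_zero)
    \<comment> \<open>The second entry is for the carre du champ of the residual, which is quadratic
      and at most \<delta>^2 K.\<close>
    define \<delta> where "\<delta> = min \<epsilon> (sqrt (\<epsilon> / (K + 1)))"
    have \<delta>: "0 < \<delta>" "\<delta> \<le> \<epsilon>" using \<epsilon> K0 by (auto simp: \<delta>_def)
    have "\<delta>\<^sup>2 * K \<le> (sqrt (\<epsilon> / (K + 1)))\<^sup>2 * K"
      using \<delta>(1) by (intro mult_right_mono power_mono K0) (auto simp: \<delta>_def)
    also have "\<dots> \<le> \<epsilon>" using \<epsilon> K0 by (simp add: field_simps)
    finally have \<delta>K: "\<delta>\<^sup>2 * K \<le> \<epsilon>" .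
    obtain U where U: "csm ?B U" "\<And>z. \<bar>\<beta> * U z - wk.A U z - ext g z\<bar> \<le> \<delta>"
      "\<And>e z. e \<in> ?B \<Longrightarrow> \<bar>pd e (\<lambda>z. \<beta> * U z - wk.A U z - ext g z) z\<bar> \<le> \<delta>"
      using \<beta>0[OF \<beta> ext(1)[OF g] \<delta>(1)] by blast
    define R where "R = (\<lambda>z. \<beta> * U z - wk.A U z - ext g z)"
    define u where "u = (\<lambda>x. U (em.F x))"
    have r: "\<beta> * u x - L u x - g x = R (em.F x)" for x
      unfolding u_def R_def A_F[OF U(1)] ext(2)[OF g] ..
    have csm_R: "csm ?B R" unfolding R_def by (intro csm_diff csm_cmult wk.csm_A U(1) ext(1)[OF g])
    show "\<exists>u. smooth_fun A u \<and> (\<forall>x. \<bar>\<beta> * u x - L u x - g x\<bar> \<le> \<epsilon>) \<and>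
      (\<forall>x. Gamma A s (\<lambda>x. \<beta> * u x - L u x - g x) (\<lambda>x. \<beta> * u x - L u x - g x) x \<le> \<epsilon>)"
    proof (intro exI[of _ u] conjI allI)
      show "smooth_fun A u" unfolding u_def F by (rule smooth_fun_comp[OF em.finite_basis U(1) \<phi>])
      show "\<bar>\<beta> * u x - L u x - g x\<bar> \<le> \<epsilon>" for x
        unfolding r using U(2) \<delta>(2) unfolding R_def by (rule order_trans)
      show "Gamma A s (\<lambda>x. \<beta> * u x - L u x - g x) (\<lambda>x. \<beta> * u x - L u x - g x) x \<le> \<epsilon>" for x
        unfolding r by (rule order_trans[OF Gamma_F[OF csm_R] \<delta>K]) (unfold R_def, rule U(3))
    qed
  qed
qed

end

section \<open>Integration by parts\<close>

text \<open>The Borel sets over which \<open>e\<close> has integral 0 are closed under complements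
  and countable disjoint unions, and the open sets are stable under intersection; Dynkin's lemma
  does the rest.\<close>

lemma AE_zero_if_integral_open_zero:
  fixes e :: "'a::topological_space \<Rightarrow> real"
  assumes sets: "sets \<mu> = sets borel" and e: "integrable \<mu> e"
    and "\<And>U. open U \<Longrightarrow> (\<integral>x\<in>U. e x \<partial>\<mu>) = 0"
  shows "AE x in \<mu>. e x = 0"
proof (rule density_unique_real[OF e])
  show "integrable \<mu> (\<lambda>x. 0 :: real)" by simp
  have e_set: "set_integrable \<mu> B e" if "B \<in> sets \<mu>" for B
    using integrable_mult_indicator[OF that e] by (simp add: set_integrable_def)
  have sets': "sets \<mu> = sigma_sets UNIV (Collect open)" using sets sets_borel by simp
  have space: "space \<mu> = UNIV" using sets_eq_imp_space_eq[OF sets] by simp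
  fix B assume "B \<in> sets \<mu>"
  then have B: "B \<in> sigma_sets UNIV (Collect open)" unfolding sets' .
  have "(\<integral>x\<in>B. e x \<partial>\<mu>) = 0"
  proof (rule sigma_sets_induct_disjoint[OF _ _ B])
    show "Int_stable (Collect open :: 'a set set)" by (auto simp: Int_stable_def)
    show "(\<integral>x\<in>U. e x \<partial>\<mu>) = 0" if "U \<in> Collect open" for U using assms(3) that by simp
    show "(\<integral>x\<in>UNIV - C. e x \<partial>\<mu>) = 0" if C: "C \<in> sigma_sets UNIV (Collect open)" "(\<integral>x\<in>C. e x \<partial>\<mu>) = 0" for C
    proof -
      have C_sets: "C \<in> sets \<mu>" "UNIV - C \<in> sets \<mu>" using C(1) sets.compl_sets[of C \<mu>] unfolding sets'[symmetric] space by auto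
      have "(\<integral>x\<in>C \<union> (UNIV - C). e x \<partial>\<mu>) = (\<integral>x\<in>C. e x \<partial>\<mu>) + (\<integral>x\<in>UNIV - C. e x \<partial>\<mu>)"
        using C_sets by (intro set_integral_Un e_set) auto
      then show ?thesis using C(2) assms(3)[OF open_UNIV] by simp
    qed
    show "(\<integral>x\<in>(\<Union>i. C i). e x \<partial>\<mu>) = 0"
      if C: "disjoint_family C" "range C \<subseteq> sigma_sets UNIV (Collect open)" "\<And>i. (\<integral>x\<in>C i. e x \<partial>\<mu>) = 0" for C :: "nat \<Rightarrow> 'a set"
    proof -
      have "C i \<in> sets \<mu>" for i using C(2) unfolding sets' by blast
      then have "(\<integral>x\<in>(\<Union>i. C i). e x \<partial>\<mu>) = (\<Sum>i. \<integral>x\<in>C i. e x \<partial>\<mu>)"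
        using C(1) by (intro lebesgue_integral_countable_add e_set) (auto simp: disjoint_family_on_def)
      then show ?thesis using C(3) by simp
    qed
  qed (auto simp: set_lebesgue_integral_def)
  then show "(\<integral>x\<in>B. e x \<partial>\<mu>) = (\<integral>x\<in>B. 0 \<partial>\<mu>)" by (simp add: set_lebesgue_integral_def)
qed

section \<open>Smooth functions determine integrable functions\<close>

context compact_manifold
begin

lemma smooth_fun_prod: "(\<And>i. i < n \<Longrightarrow> smooth_fun A (f i)) \<Longrightarrow> smooth_fun A (\<lambda>x. \<Prod>i<n. f i x)" for n :: nat
  by (induction n) (auto intro!: smooth_fun_mult smooth_fun_const)

lemma smooth_compact_support: "smooth_fun A f \<Longrightarrow> smooth_compact_support A f"
  unfolding smooth_compact_support_def using compact_Int_closed[OF compact_UNIV, of "closure {x. f x \<noteq> 0}"] by simp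

text \<open>By Lindelof's theorem countably many bumps supported in \<open>U\<close> suffice for
  each point of \<open>U\<close> to have one with value 1. The function 1 - \<Prod> (1 - t i) over
  the first \<open>n\<close> bumps has value 1 as soon as one of them has.\<close>

lemma indicator_open_limit:
  assumes U: "open U"
  obtains f where "\<And>n::nat. smooth_fun A (f n)" "\<And>n x. \<bar>f n x\<bar> \<le> 1" "\<And>x. (\<lambda>n. f n x) \<longlonglongrightarrow> indicator U x"
proof -
  have "\<exists>\<xi> V. smooth_fun A \<xi> \<and> (\<forall>y. 0 \<le> \<xi> y \<and> \<xi> y \<le> 1) \<and> open V \<and> x \<in> V \<and> (\<forall>y\<in>V. \<xi> y = 1) \<and> (\<forall>y. y \<notin> U \<longrightarrow> \<xi> y = (0::real))"
    if x: "x \<in> U" for x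
  proof -
    obtain \<psi> V K where \<psi>: "smooth_fun A \<psi>" "\<And>y. 0 \<le> \<psi> y" "\<And>y. \<psi> y \<le> (1::real)" "open V" "x \<in> V"
      "\<And>y. y \<in> V \<Longrightarrow> \<psi> y = 1" "closed K" "K \<subseteq> U" "\<And>y. y \<notin> K \<Longrightarrow> \<psi> y = 0"
      by (rule bump[OF U x], rule that)
    have "\<psi> y = 0" if "y \<notin> U" for y using \<psi>(8,9) that by blast
    then show ?thesis using \<psi> by (intro exI[of _ \<psi>] exI[of _ V]) auto
  qed
  then have "\<forall>x\<in>U. \<exists>\<xi> V. smooth_fun A \<xi> \<and> (\<forall>y. 0 \<le> \<xi> y \<and> \<xi> y \<le> 1) \<and> open V \<and> x \<in> V \<and> (\<forall>y\<in>V. \<xi> y = 1) \<and> (\<forall>y. y \<notin> U \<longrightarrow> \<xi> y = (0::real))"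
    by (rule ballI)
  then obtain \<xi> V where \<xi>V: "\<forall>x\<in>U. smooth_fun A (\<xi> x) \<and> (\<forall>y. 0 \<le> \<xi> x y \<and> \<xi> x y \<le> 1) \<and> open (V x) \<and> x \<in> V x \<and>
      (\<forall>y\<in>V x. \<xi> x y = 1) \<and> (\<forall>y. y \<notin> U \<longrightarrow> \<xi> x y = (0::real))"
    unfolding bchoice_iff by (elim exE) (rule that)
  have \<xi>: "\<And>x. x \<in> U \<Longrightarrow> smooth_fun A (\<xi> x)" "\<And>x y. x \<in> U \<Longrightarrow> 0 \<le> \<xi> x y \<and> \<xi> x y \<le> 1"
    "\<And>x y. x \<in> U \<Longrightarrow> y \<notin> U \<Longrightarrow> \<xi> x y = 0"
    and V: "\<And>x. x \<in> U \<Longrightarrow> open (V x)" "\<And>x. x \<in> U \<Longrightarrow> x \<in> V x" "\<And>x y. x \<in> U \<Longrightarrow> y \<in> V x \<Longrightarrow> \<xi> x y = 1"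
    using \<xi>V by simp_all
  obtain F' where F': "F' \<subseteq> V ` U" "countable F'" "\<Union>F' = \<Union>(V ` U)"
    by (rule Lindelof[of "V ` U"]) (use V(1) in blast, rule that)
  obtain X where X: "countable X" "X \<subseteq> U" "F' = V ` X" using F'(1,2) countable_subset_image[of F' V U] by blast
  \<comment> \<open>The zero function keeps the enumerated set nonempty even if \<open>U\<close> is
    empty.\<close>
  define T where "T = insert (\<lambda>x. 0) (\<xi> ` X)"
  have T: "countable T" "T \<noteq> {}" using X by (auto simp: T_def)
  define t where "t = from_nat_into T"
  have t_in: "t i \<in> T" for i unfolding t_def by (rule from_nat_into[OF T(2)])
  have t: "smooth_fun A (t i)" "0 \<le> t i x" "t i x \<le> 1" "x \<notin> U \<Longrightarrow> t i x = 0" for i x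
    using t_in[of i] \<xi> X(2) smooth_fun_const[of 0] unfolding T_def by auto
  have t1: "\<exists>i. t i x = 1" if "x \<in> U" for x
  proof -
    have "x \<in> \<Union>F'" using F'(3) V(2) that by blast
    then obtain y where "y \<in> X" "x \<in> V y" using X(3) by blast
    then have "\<xi> y x = 1" "\<xi> y \<in> T" using V(3) X(2) by (auto simp: T_def)
    then show ?thesis unfolding t_def using from_nat_into_surj[OF T(1)] by metis
  qed
  define f where "f = (\<lambda>n x. 1 - (\<Prod>i<n. 1 - t i x))"
  have "0 \<le> (\<Prod>i<n. 1 - t i x)" "(\<Prod>i<n. 1 - t i x) \<le> 1" for n x
    using t by (auto intro!: prod_nonneg prod_le_1)
  then have "\<bar>f n x\<bar> \<le> 1" for n x unfolding f_def by (simp add: abs_le_iff)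
  moreover have "smooth_fun A (f n)" for n
    unfolding f_def by (intro smooth_fun_diff smooth_fun_const smooth_fun_prod t)
  moreover have "(\<lambda>n. f n x) \<longlonglongrightarrow> indicator U x" for x
  proof (cases "x \<in> U")
    case True
    then obtain i where i: "t i x = 1" using t1 by blast
    have "f n x = 1" if "i < n" for n
      unfolding f_def using i that by (simp add: prod_zero_iff) auto
    then have "\<forall>\<^sub>F n in sequentially. f n x = indicator U x" using True by (intro eventually_sequentiallyI[of "Suc i"]) auto
    then show ?thesis by (rule tendsto_eventually)
  next
    case False
    then show ?thesis by (simp add: f_def t(4))
  qed
  ultimately show ?thesis by (intro that[of f])
qed

lemma AE_zero_if_orthogonal_smooth:
  assumes sets: "sets \<mu> = sets borel" and e: "integrable \<mu> e"
    and orth: "\<And>f. smooth_fun A f \<Longrightarrow> (\<integral>x. e x * f x \<partial>\<mu>) = 0"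
  shows "AE x in \<mu>. e x = (0::real)"
proof (rule AE_zero_if_integral_open_zero[OF sets e])
  fix U :: "'a set" assume U: "open U"
  obtain f where f: "\<And>n::nat. smooth_fun A (f n)" "\<And>n x. \<bar>f n x\<bar> \<le> 1" "\<And>x. (\<lambda>n. f n x) \<longlonglongrightarrow> indicator U x"
    by (rule indicator_open_limit[OF U], rule that)
  have U_sets [measurable]: "U \<in> sets \<mu>" using U sets by simp
  have f_meas [measurable]: "f n \<in> borel_measurable \<mu>" for n
    using borel_measurable_continuous_onI[OF smooth_fun_continuous[OF f(1)]] measurable_cong_sets[OF sets refl] by blast
  have e_meas [measurable]: "e \<in> borel_measurable \<mu>" using e by auto
  have "(\<lambda>n. \<integral>x. e x * f n x \<partial>\<mu>) \<longlonglongrightarrow> (\<integral>x. e x * indicator U x \<partial>\<mu>)"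
  proof (rule integral_dominated_convergence[where w = "\<lambda>x. \<bar>e x\<bar>"])
    show "AE x in \<mu>. (\<lambda>n. e x * f n x) \<longlonglongrightarrow> e x * indicator U x" by (intro AE_I2 tendsto_mult tendsto_const f(3))
    show "AE x in \<mu>. norm (e x * f n x) \<le> \<bar>e x\<bar>" for n
      using f(2)[of n] by (intro AE_I2) (simp add: abs_mult mult_left_le)
  qed (use e in auto)
  then have "(\<integral>x. e x * indicator U x \<partial>\<mu>) = 0" unfolding orth[OF f(1)] by (simp add: LIMSEQ_const_iff)
  then show "(\<integral>x\<in>U. e x \<partial>\<mu>) = 0" by (simp add: set_lebesgue_integral_def mult.commute)
qed

end

locale symmetric_sub_laplacian = sub_laplacian A H h L
  for A :: "('a::{t2_space,second_countable_topology}, 'b::euclidean_space) atlas" and H h L +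
  fixes vol :: "'a measure" and Lbar :: "'a l2_graph"
  assumes sets_vol: "sets vol = sets borel" and sym_L: "symmetric_wrt A vol L"
    and Lbar: "self_adjoint_extension A vol L Lbar"
begin

lemma Lbar_adjoint: "Lbar = adjoint_graph vol Lbar"
  and Lbar_smooth: "smooth_fun A f \<Longrightarrow> (f, L f) \<in> Lbar"
  using Lbar smooth_compact_support unfolding self_adjoint_extension_def self_adjoint_def by blast+

text \<open>Finiteness is read off from the operator: (1, L 1) lies in \<open>Lbar\<close>, which
  equals its adjoint graph and hence consists of pairs from \<open>l2\<close>, so the constant 1 is
  square-integrable.\<close>

sublocale finite_measure vol
proof
  have "(\<lambda>x. 1) \<in> l2 vol"
    using Lbar_smooth[OF smooth_fun_const[of 1]] Lbar_adjoint unfolding adjoint_graph_def by blast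
  then have "integrable vol (\<lambda>x. 1 :: real)" by (simp add: l2_def)
  then show "emeasure vol (space vol) \<noteq> \<infinity>" by (auto simp: integrable_iff_bounded)
qed

lemma smooth_measurable: "smooth_fun A f \<Longrightarrow> f \<in> borel_measurable vol"
  using borel_measurable_continuous_onI[OF smooth_fun_continuous] measurable_cong_sets[OF sets_vol refl] by blast

lemma smooth_integrable: assumes "smooth_fun A f" shows "integrable vol f"
proof -
  obtain K where "\<And>x. \<bar>f x\<bar> \<le> K" using smooth_fun_bounded[OF assms] by blast
  then show ?thesis using smooth_measurable[OF assms] by (intro integrable_const_bound[of _ K]) auto
qed

lemma L_symmetric: "smooth_fun A f \<Longrightarrow> smooth_fun A g \<Longrightarrow> (\<integral>x. f x * L g x \<partial>vol) = (\<integral>x. g x * L f x \<partial>vol)"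
  using sym_L smooth_compact_support unfolding symmetric_wrt_def by blast

lemma integral_L: "smooth_fun A f \<Longrightarrow> (\<integral>x. L f x \<partial>vol) = 0"
  using L_symmetric[OF smooth_fun_const[of 1], of f] by (simp add: L_const)

lemma integral_Gamma:
  assumes f: "smooth_fun A f" and g: "smooth_fun A g"
  shows "(\<integral>x. Gamma A (cometric H h) f g x \<partial>vol) = - (\<integral>x. f x * L g x \<partial>vol)"
proof -
  have int: "integrable vol (L (\<lambda>y. f y * g y))" "integrable vol (\<lambda>x. f x * L g x)" "integrable vol (\<lambda>x. g x * L f x)"
    by (intro smooth_integrable L_smooth smooth_fun_mult f g)+
  have "(\<integral>x. Gamma A (cometric H h) f g x \<partial>vol) = (\<integral>x. (L (\<lambda>y. f y * g y) x - f x * L g x - g x * L f x) / 2 \<partial>vol)"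
    by (simp add: carre_du_champ[OF f g])
  also have "\<dots> = (0 - (\<integral>x. f x * L g x \<partial>vol) - (\<integral>x. g x * L f x \<partial>vol)) / 2"
    using int integral_L[OF smooth_fun_mult[OF f g]] by simp
  finally show ?thesis using L_symmetric[OF f g] by simp
qed

text \<open>The integral of \<open>L\<close> of a smooth function is 0, by symmetry against the
  constant 1; only the cross terms survive, and they are equal.\<close>

lemma integral_Gamma2:
  assumes s: "sym2_section A s" and f: "smooth_fun A f"
  shows "integrable vol (Gamma2 A L s f f)"
    and "(\<integral>x. Gamma2 A L s f f x \<partial>vol) = - (\<integral>x. Gamma A s f (L f) x \<partial>vol)"
proof -
  have eq: "Gamma2 A L s f f = (\<lambda>x. L (Gamma A s f f) x / 2 - Gamma A s f (L f) x)"
    unfolding Gamma2_def Gamma_sym[OF s, of "L f" f] by (auto simp: field_simps)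
  have int: "integrable vol (L (Gamma A s f f))" "integrable vol (Gamma A s f (L f))"
    by (intro smooth_integrable L_smooth Gamma_smooth s f)+
  show "integrable vol (Gamma2 A L s f f)" unfolding eq using int by simp
  show "(\<integral>x. Gamma2 A L s f f x \<partial>vol) = - (\<integral>x. Gamma A s f (L f) x \<partial>vol)"
    unfolding eq using int integral_L[OF Gamma_smooth[OF s f f]] by simp
qed

end

section \<open>The eigenvalue estimate\<close>

context symmetric_sub_laplacian
begin

lemma integral_psd_form:
  assumes s: "sym2_section A s" "pos_semidef A s"
  shows "psd_form (Collect (smooth_fun A)) (\<lambda>u w. \<integral>x. Gamma A s u w x \<partial>vol)"
proof
  show "subspace (Collect (smooth_fun A))"
    unfolding subspace_def plus_fun_def scaleR_fun_def zero_fun_def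
    by (auto intro: smooth_fun_add smooth_fun_cmult smooth_fun_const)
next
  fix u v w assume "u \<in> Collect (smooth_fun A)" "v \<in> Collect (smooth_fun A)" "w \<in> Collect (smooth_fun A)"
  then have uvw: "smooth_fun A u" "smooth_fun A v" "smooth_fun A w" by auto
  have "Gamma A s (u + v) w x = Gamma A s u w x + Gamma A s v w x" for x
    using Gamma_lincomb_left[OF s(1) uvw(1,2), of 1 1 w x] by (simp add: plus_fun_def)
  then show "(\<integral>x. Gamma A s (u + v) w x \<partial>vol) = (\<integral>x. Gamma A s u w x \<partial>vol) + (\<integral>x. Gamma A s v w x \<partial>vol)"
    using smooth_integrable[OF Gamma_smooth[OF s(1) uvw(1,3)]] smooth_integrable[OF Gamma_smooth[OF s(1) uvw(2,3)]] by simp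
next
  fix a :: real and u w assume "u \<in> Collect (smooth_fun A)" "w \<in> Collect (smooth_fun A)"
  then have uw: "smooth_fun A u" "smooth_fun A w" by auto
  have "Gamma A s (a *\<^sub>R u) w x = a * Gamma A s u w x" for x
    using Gamma_lincomb_left[OF s(1) uw(1,1), of a 0 w x] by (simp add: scaleR_fun_def)
  then show "(\<integral>x. Gamma A s (a *\<^sub>R u) w x \<partial>vol) = a * (\<integral>x. Gamma A s u w x \<partial>vol)" by simp
next
  show "(\<integral>x. Gamma A s u w x \<partial>vol) = (\<integral>x. Gamma A s w u x \<partial>vol)" for u w
    by (simp only: Gamma_sym[OF s(1), of u w])
  show "0 \<le> (\<integral>x. Gamma A s u u x \<partial>vol)" for u
    using s(2) differential_cotangent unfolding pos_semidef_def Gamma_def by (intro integral_nonneg_AE AE_I2) blast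
qed

lemma l2_psd_form: "psd_form (Collect (smooth_fun A)) (\<lambda>u w. \<integral>x. u x * w x \<partial>vol)"
proof
  show "subspace (Collect (smooth_fun A))"
    unfolding subspace_def plus_fun_def scaleR_fun_def zero_fun_def
    by (auto intro: smooth_fun_add smooth_fun_cmult smooth_fun_const)
next
  fix u v w assume "u \<in> Collect (smooth_fun A)" "v \<in> Collect (smooth_fun A)" "w \<in> Collect (smooth_fun A)"
  then have "integrable vol (\<lambda>x. u x * w x)" "integrable vol (\<lambda>x. v x * w x)"
    by (auto intro: smooth_integrable smooth_fun_mult)
  then show "(\<integral>x. (u + v) x * w x \<partial>vol) = (\<integral>x. u x * w x \<partial>vol) + (\<integral>x. v x * w x \<partial>vol)"
    by (simp add: plus_fun_def distrib_right)
next
  show "(\<integral>x. (a *\<^sub>R u) x * w x \<partial>vol) = a * (\<integral>x. u x * w x \<partial>vol)" for a u w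
    by (simp add: scaleR_fun_def mult.assoc)
qed (simp_all add: mult.commute)

text \<open>Pointwise |e u| \<le> (t e^2 + u^2 / t) / 2. With t the norm of u and a the integral of
  e^2, integration gives t (a + 1) / 2, whence the constant (a + 1) / 2. If the norm of u is 0, then
  u vanishes almost everywhere.\<close>

lemma l2_functional:
  assumes e: "e \<in> l2 vol"
  shows "integrable vol e" "smooth_fun A u \<Longrightarrow> integrable vol (\<lambda>x. e x * u x)"
    "\<exists>K. \<forall>u. smooth_fun A u \<longrightarrow> \<bar>\<integral>x. e x * u x \<partial>vol\<bar> \<le> K * sqrt (\<integral>x. u x * u x \<partial>vol)"
proof -
  have e': "e \<in> borel_measurable vol" "integrable vol (\<lambda>x. (e x)\<^sup>2)" using e by (auto simp: l2_def)
  show eu: "integrable vol (\<lambda>x. e x * u x)" if u: "smooth_fun A u" for u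
  proof (rule Bochner_Integration.integrable_bound)
    show "integrable vol (\<lambda>x. (e x)\<^sup>2 + u x * u x)" by (intro Bochner_Integration.integrable_add e' smooth_integrable smooth_fun_mult u)
    show "(\<lambda>x. e x * u x) \<in> borel_measurable vol" using e'(1) smooth_measurable[OF u] by simp
    have "\<bar>a * b\<bar> \<le> a\<^sup>2 + b * b" for a b :: real
    proof -
      have "2 * (\<bar>a\<bar> * \<bar>b\<bar>) \<le> a\<^sup>2 + b * b"
        using sum_squares_bound[of "\<bar>a\<bar>" "\<bar>b\<bar>"] by (simp add: power2_eq_square mult.assoc)
      moreover have "0 \<le> \<bar>a\<bar> * \<bar>b\<bar>" by simp
      ultimately show ?thesis unfolding abs_mult by linarith
    qed
    then show "AE x in vol. norm (e x * u x) \<le> norm ((e x)\<^sup>2 + u x * u x)"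
      by (intro AE_I2) (simp add: abs_of_nonneg)
  qed
  from eu[OF smooth_fun_const[of 1]] show "integrable vol e" by simp
  define a where "a = (\<integral>x. (e x)\<^sup>2 \<partial>vol)"
  have a: "0 \<le> a" unfolding a_def by simp
  have "\<bar>\<integral>x. e x * u x \<partial>vol\<bar> \<le> (a + 1) / 2 * sqrt (\<integral>x. u x * u x \<partial>vol)" if u: "smooth_fun A u" for u
  proof -
    define b where "b = (\<integral>x. u x * u x \<partial>vol)"
    have uu: "integrable vol (\<lambda>x. u x * u x)" by (intro smooth_integrable smooth_fun_mult u)
    have b: "0 \<le> b" unfolding b_def by (intro integral_nonneg_AE) simp
    show ?thesis
    proof (cases "b = 0")
      case True
      then have "AE x in vol. u x * u x = 0" using integral_nonneg_eq_0_iff_AE[OF uu] by (simp add: b_def)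
      then have "AE x in vol. e x * u x = 0" by eventually_elim simp
      then have "(\<integral>x. e x * u x \<partial>vol) = 0" by (rule integral_eq_zero_AE)
      then show ?thesis using a b by (simp add: b_def[symmetric])
    next
      case False
      define t where "t = sqrt b"
      have t: "0 < t" "b = t * t" using b False by (auto simp: t_def)
      have "\<bar>\<integral>x. e x * u x \<partial>vol\<bar> \<le> (\<integral>x. \<bar>e x * u x\<bar> \<partial>vol)" by (rule integral_abs_bound)
      also have "\<dots> \<le> (\<integral>x. (t * (e x)\<^sup>2 + u x * u x / t) / 2 \<partial>vol)"
      proof (rule integral_mono)
        show "integrable vol (\<lambda>x. \<bar>e x * u x\<bar>)" using eu[OF u] by simp
        show "integrable vol (\<lambda>x. (t * (e x)\<^sup>2 + u x * u x / t) / 2)" using e'(2) uu by simp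
        fix x
        have "2 * (t * \<bar>e x\<bar>) * \<bar>u x\<bar> \<le> (t * \<bar>e x\<bar>)\<^sup>2 + \<bar>u x\<bar>\<^sup>2" by (rule sum_squares_bound)
        then have "2 * t * \<bar>e x * u x\<bar> \<le> t * t * (e x)\<^sup>2 + u x * u x"
          by (simp add: abs_mult power_mult_distrib power2_eq_square mult_ac)
        then show "\<bar>e x * u x\<bar> \<le> (t * (e x)\<^sup>2 + u x * u x / t) / 2" using t(1) by (simp add: field_simps)
      qed
      also have "\<dots> = (t * a + b / t) / 2" using e'(2) uu by (simp add: a_def b_def)
      also have "\<dots> = (a + 1) / 2 * sqrt b" using t by (simp add: t_def[symmetric] field_simps)
      finally show ?thesis unfolding b_def .
    qed
  qed
  then show "\<exists>K. \<forall>u. smooth_fun A u \<longrightarrow> \<bar>\<integral>x. e x * u x \<partial>vol\<bar> \<le> K * sqrt (\<integral>x. u x * u x \<partial>vol)" by blast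
qed

text \<open>For the co-metric, integration by parts turns the integral of \<open>Gamma2\<close> into
  that of (L u)^2, which merges with the dimension term to the factor 1 - 1/n. For \<open>v\<close>
  the mixed term stays as it is.\<close>

lemma CD_integrated:
  assumes v: "sym2_section A v" and CD: "CD_star A L (cometric H h) v n \<rho>1 \<rho>20 \<rho>21" and u: "smooth_fun A u" and l: "0 < l"
  shows "(\<rho>1 - 1 / l) * (- (\<integral>x. u x * L u x \<partial>vol)) + (\<rho>20 + \<rho>21 * l) * (\<integral>x. Gamma A v u u x \<partial>vol)
    \<le> (1 - real_of_ereal (1 / n)) * (\<integral>x. L u x * L u x \<partial>vol) - l * (\<integral>x. Gamma A v u (L u) x \<partial>vol)"
proof -
  let ?h = "cometric H h" and ?c = "real_of_ereal (1 / n)"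
  note h = cometric_sym2
  have int: "integrable vol (\<lambda>x. L u x * L u x)" "integrable vol (Gamma A ?h u u)" "integrable vol (Gamma A v u u)"
    by (intro smooth_integrable Gamma_smooth smooth_fun_mult L_smooth h v u)+
  note int2 = integral_Gamma2(1)[OF h u] integral_Gamma2(1)[OF v u]
  have Lu: "(\<integral>x. Gamma A ?h u (L u) x \<partial>vol) = - (\<integral>x. L u x * L u x \<partial>vol)"
    unfolding integral_Gamma[OF u L_smooth[OF u]] L_symmetric[OF u L_smooth[OF u]] ..
  have "(\<integral>x. ?c * (L u x * L u x) + (\<rho>1 - 1 / l) * Gamma A ?h u u x + (\<rho>20 + \<rho>21 * l) * Gamma A v u u x \<partial>vol)
    \<le> (\<integral>x. Gamma2 A L ?h u u x + l * Gamma2 A L v u u x \<partial>vol)"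
  proof (rule integral_mono)
    show "integrable vol (\<lambda>x. ?c * (L u x * L u x) + (\<rho>1 - 1 / l) * Gamma A ?h u u x + (\<rho>20 + \<rho>21 * l) * Gamma A v u u x)"
      by (intro Bochner_Integration.integrable_add integrable_mult_right int)
    show "integrable vol (\<lambda>x. Gamma2 A L ?h u u x + l * Gamma2 A L v u u x)"
      by (intro Bochner_Integration.integrable_add integrable_mult_right int2)
    show "?c * (L u x * L u x) + (\<rho>1 - 1 / l) * Gamma A ?h u u x + (\<rho>20 + \<rho>21 * l) * Gamma A v u u x
      \<le> Gamma2 A L ?h u u x + l * Gamma2 A L v u u x" for x
      using CD u l unfolding CD_star_def power2_eq_square by blast
  qed
  also have "\<dots> = (\<integral>x. L u x * L u x \<partial>vol) - l * (\<integral>x. Gamma A v u (L u) x \<partial>vol)"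
    using int2 by (simp add: integral_Gamma2(2)[OF h u] integral_Gamma2(2)[OF v u] Lu)
  finally show ?thesis using int by (simp add: integral_Gamma[OF u u] left_diff_distrib)
qed

text \<open>The eigenfunction \<open>e\<close> enters only through its pairing with smooth
  functions. This functional is bounded since \<open>e\<close> is in \<open>l2\<close>, nonzero
  since smooth functions determine \<open>e\<close>, and an eigenfunctional since
  \<open>Lbar\<close> is its own adjoint and contains all pairs (f, L f) with smooth f.\<close>

theorem eigenvalue_estimate:
  assumes v: "sym2_section A v" "pos_semidef A v" and CD: "CD_star A L (cometric H h) v n \<rho>1 \<rho>20 \<rho>21"
    and \<rho>20: "0 < \<rho>20" and ev: "eigenvalue vol Lbar ev" "ev \<noteq> 0"
  shows "\<rho>1 - max 0 (- \<rho>21) / \<rho>20 \<le> (1 - real_of_ereal (1 / n) + 1 / \<rho>20) * (- ev)"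
proof -
  let ?V = "Collect (smooth_fun A)"
  let ?ip = "\<lambda>u w. \<integral>x. u x * w x \<partial>vol" and ?qv = "\<lambda>u w. \<integral>x. Gamma A v u w x \<partial>vol"
  obtain e where e: "(e, \<lambda>x. ev * e x) \<in> Lbar" "\<not> (AE x in vol. e x = 0)" using ev(1) unfolding eigenvalue_def by blast
  have e_l2: "e \<in> l2 vol" using e(1) Lbar_adjoint unfolding adjoint_graph_def by blast
  have e_L: "(\<integral>x. e x * L f x \<partial>vol) = ev * (\<integral>x. e x * f x \<partial>vol)" if f: "smooth_fun A f" for f
  proof -
    have "(e, \<lambda>x. ev * e x) \<in> adjoint_graph vol Lbar" using e(1) Lbar_adjoint by simp
    then have "(\<integral>x. e x * L f x \<partial>vol) = (\<integral>x. (ev * e x) * f x \<partial>vol)"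
      using Lbar_smooth[OF f] unfolding adjoint_graph_def by blast
    then show ?thesis by (simp add: mult.assoc)
  qed
  have n: "1 \<le> n" using CD unfolding CD_star_def by blast
  interpret ip: psd_form ?V ?ip by (rule l2_psd_form)
  interpret qv: psd_form ?V ?qv by (rule integral_psd_form[OF v])
  interpret cd_space ?V ?ip ?qv L "\<lambda>u. \<integral>x. e x * u x \<partial>vol" "real_of_ereal (1 / n)" \<rho>1 \<rho>20 \<rho>21 ev
  proof (rule cd_space.intro[OF l2_psd_form integral_psd_form[OF v]], rule cd_space_axioms.intro)
    show "L u \<in> ?V" if "u \<in> ?V" for u using that L_smooth by simp
    show "L (u + w) = L u + L w" if "u \<in> ?V" "w \<in> ?V" for u w
      using L_lincomb[of u w 1 1] that by (simp add: plus_fun_def fun_eq_iff)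
    show "L (a *\<^sub>R u) = a *\<^sub>R L u" if "u \<in> ?V" for a u
      using L_lincomb[of u u a 0] that by (simp add: scaleR_fun_def fun_eq_iff)
    show "?ip u (L w) = ?ip (L u) w" if "u \<in> ?V" "w \<in> ?V" for u w
      using L_symmetric[of u w] that by (simp add: mult.commute)
    show "?ip u (L u) \<le> 0" if "u \<in> ?V" for u
    proof -
      have "0 \<le> (\<integral>x. Gamma A (cometric H h) u u x \<partial>vol)"
        by (intro integral_nonneg_AE AE_I2 Gamma_cometric_nonneg)
      then show ?thesis using that by (simp add: integral_Gamma)
    qed
    show "(\<rho>1 - 1 / l) * (- ?ip u (L u)) + (\<rho>20 + \<rho>21 * l) * ?qv u u
        \<le> (1 - real_of_ereal (1 / n)) * ?ip (L u) (L u) - l * ?qv u (L u)" if "u \<in> ?V" "0 < l" for u l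
      using CD_integrated[OF v(1) CD] that by simp
    show "0 \<le> real_of_ereal (1 / n)" "real_of_ereal (1 / n) \<le> 1"
      using n by (cases n; simp add: one_ereal_def)+
    show "0 < \<rho>20" "ev \<noteq> 0" by fact+
    show "(\<integral>x. e x * (u + w) x \<partial>vol) = (\<integral>x. e x * u x \<partial>vol) + (\<integral>x. e x * w x \<partial>vol)" if "u \<in> ?V" "w \<in> ?V" for u w
      using l2_functional(2)[OF e_l2] that by (simp add: plus_fun_def distrib_left)
    show "(\<integral>x. e x * (a *\<^sub>R u) x \<partial>vol) = a * (\<integral>x. e x * u x \<partial>vol)" for a u
      by (simp add: scaleR_fun_def mult.left_commute)
    show "\<exists>K. \<forall>u\<in>?V. \<bar>\<integral>x. e x * u x \<partial>vol\<bar> \<le> K * ip.nrm u"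
      using l2_functional(3)[OF e_l2] unfolding ip.nrm_def by simp
    show "\<exists>u\<in>?V. (\<integral>x. e x * u x \<partial>vol) \<noteq> 0"
      using AE_zero_if_orthogonal_smooth[OF sets_vol l2_functional(1)[OF e_l2]] e(2) by blast
    show "(\<integral>x. e x * L u x \<partial>vol) = ev * (\<integral>x. e x * u x \<partial>vol)" if "u \<in> ?V" for u using e_L that by simp
    show "\<exists>\<beta>0. \<forall>\<beta>\<ge>\<beta>0. \<forall>g\<in>?V. \<forall>\<delta>>0. \<exists>u\<in>?V. ip.nrm (\<beta> *\<^sub>R u - L u - g) \<le> \<delta> \<and> qv.nrm (\<beta> *\<^sub>R u - L u - g) \<le> \<delta>"
    proof -
      obtain \<beta>0 where \<beta>0: "\<And>\<beta> g \<epsilon>. \<beta>0 \<le> \<beta> \<Longrightarrow> smooth_fun A g \<Longrightarrow> 0 < \<epsilon> \<Longrightarrow> \<exists>u. smooth_fun A u \<and>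
        (\<forall>x. \<bar>\<beta> * u x - L u x - g x\<bar> \<le> \<epsilon>) \<and>
        (\<forall>x. Gamma A v (\<lambda>x. \<beta> * u x - L u x - g x) (\<lambda>x. \<beta> * u x - L u x - g x) x \<le> \<epsilon>)"
        using resolvent_dense[OF v(1)] by blast
      have "\<exists>u\<in>?V. ip.nrm (\<beta> *\<^sub>R u - L u - g) \<le> \<delta> \<and> qv.nrm (\<beta> *\<^sub>R u - L u - g) \<le> \<delta>"
        if \<beta>: "\<beta>0 \<le> \<beta>" and g: "smooth_fun A g" and \<delta>: "0 < \<delta>" for \<beta> g \<delta>
      proof -
        let ?M = "measure vol (space vol)"
        \<comment> \<open>\<epsilon> \<le> 1 turns |r| \<le> \<epsilon> into r^2 \<le> \<epsilon>
          for the residual r. The other entry turns the pointwise bound \<epsilon> on r^2 and on its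
          carre du champ into the bound \<delta> for both seminorms.\<close>
        define \<epsilon> where "\<epsilon> = min 1 (\<delta>\<^sup>2 / (?M + 1))"
        have M: "0 \<le> ?M" by simp
        have \<epsilon>: "0 < \<epsilon>" "\<epsilon> \<le> 1" using \<delta> M by (auto simp: \<epsilon>_def add_nonneg_pos)
        have "\<epsilon> * ?M \<le> \<delta>\<^sup>2 / (?M + 1) * ?M" by (intro mult_right_mono M) (simp add: \<epsilon>_def)
        also have "\<dots> \<le> \<delta>\<^sup>2 / (?M + 1) * (?M + 1)" by (intro mult_left_mono) (use M in simp_all)
        also have "\<dots> = \<delta>\<^sup>2" using M by (simp add: add_nonneg_eq_0_iff)
        finally have \<epsilon>M: "\<epsilon> * ?M \<le> \<delta>\<^sup>2" .
        obtain u where u: "smooth_fun A u" "\<And>x. \<bar>\<beta> * u x - L u x - g x\<bar> \<le> \<epsilon>"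
          "\<And>x. Gamma A v (\<lambda>x. \<beta> * u x - L u x - g x) (\<lambda>x. \<beta> * u x - L u x - g x) x \<le> \<epsilon>"
          using \<beta>0[OF \<beta> g \<epsilon>(1)] by blast
        let ?r = "\<lambda>x. \<beta> * u x - L u x - g x"
        have r: "smooth_fun A ?r" by (intro smooth_fun_diff smooth_fun_cmult L_smooth u(1) g)
        have r_eq: "\<beta> *\<^sub>R u - L u - g = ?r" by (simp add: fun_eq_iff)
        have bound: "sqrt (\<integral>x. k x \<partial>vol) \<le> \<delta>" if k: "smooth_fun A k" "\<And>x. k x \<le> \<epsilon>" for k
        proof -
          have "(\<integral>x. k x \<partial>vol) \<le> (\<integral>x. \<epsilon> \<partial>vol)" by (intro integral_mono smooth_integrable k integrable_const)
          also have "\<dots> \<le> \<delta>\<^sup>2" using \<epsilon>M by (simp add: mult.commute)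
          finally show ?thesis using \<delta> by (intro real_le_lsqrt) auto
        qed
        have "?r x * ?r x \<le> \<epsilon>" for x
        proof -
          have "?r x * ?r x = \<bar>?r x\<bar> * \<bar>?r x\<bar>" by simp
          also have "\<dots> \<le> \<epsilon> * 1" using u(2)[of x] \<epsilon> by (intro mult_mono) auto
          finally show ?thesis by simp
        qed
        then have "ip.nrm ?r \<le> \<delta>" unfolding ip.nrm_def by (intro bound smooth_fun_mult r)
        moreover have "qv.nrm ?r \<le> \<delta>" unfolding qv.nrm_def by (intro bound Gamma_smooth v r u(3))
        ultimately show ?thesis using u(1) by (intro bexI[of _ u]) (simp_all only: r_eq mem_Collect_eq simp_thms)
      qed
      then show ?thesis by blast
    qed
  qed
  show ?thesis by (rule eigenvalue_bound)
qed

end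

theorem proposition4p1:
  fixes A :: "('a::{t2_space,second_countable_topology}, 'b::euclidean_space) atlas"
    and H :: "'a \<Rightarrow> 'a tangent set"
    and h :: "'a \<Rightarrow> 'a tangent \<Rightarrow> 'a tangent \<Rightarrow> real"
    and L :: "('a \<Rightarrow> real) \<Rightarrow> ('a \<Rightarrow> real)"
    and \<omega> :: "'a \<Rightarrow> ('b \<Rightarrow> 'a tangent) \<Rightarrow> real"
    and vol :: "'a measure"
    and Lbar :: "'a l2_graph"
    and v :: "'a \<Rightarrow> 'a cotangent \<Rightarrow> 'a cotangent \<Rightarrow> real"
    and n :: ereal
    and \<rho>1 \<rho>20 \<rho>21 ev :: real
  assumes "sub_riemannian_manifold A H h"
    and "compact (UNIV :: 'a set)"
    and "bracket_generating A H"
    and "second_order_operator A L"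
    and "is_symbol A L (cometric H h)"
    and "volume_form A \<omega>"
    and "volume_measure A \<omega> vol"
    and "symmetric_wrt A vol L"
    and "self_adjoint_extension A vol L Lbar"
    and "sym2_section A v"
    and "pos_semidef A v"
    and "CD_star A L (cometric H h) v n \<rho>1 \<rho>20 \<rho>21"
    and "\<rho>20 > 0"
    and "eigenvalue vol Lbar ev"
    and "ev \<noteq> 0"
  shows "(if n = \<infinity> then \<rho>20 / (1 + \<rho>20)
          else real_of_ereal n * \<rho>20 / (real_of_ereal n + \<rho>20 * (real_of_ereal n - 1)))
         * (\<rho>1 - max 0 (- \<rho>21) / \<rho>20) \<le> - ev"
proof -
  interpret symmetric_sub_laplacian A H h L vol Lbar
  proof
    show "smooth_atlas A" "subbundle A H" "metric_tensor_on A H h"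
      using assms(1) by (simp_all add: sub_riemannian_manifold_def)
    show "sets vol = sets borel" using assms(7) by (simp add: volume_measure_def)
  qed fact+
  have est: "\<rho>1 - max 0 (- \<rho>21) / \<rho>20 \<le> (1 - real_of_ereal (1 / n) + 1 / \<rho>20) * (- ev)"
    by (rule eigenvalue_estimate) fact+
  let ?k = "if n = \<infinity> then \<rho>20 / (1 + \<rho>20)
          else real_of_ereal n * \<rho>20 / (real_of_ereal n + \<rho>20 * (real_of_ereal n - 1))"
  have n: "1 \<le> n" using assms(12) unfolding CD_star_def by blast
  \<comment> \<open>The fraction of the claim is the reciprocal of 1 - 1/n + 1/\<rho>20 in both
    readings. Being nonnegative, it may multiply the estimate whatever the sign of its left-hand
    side.\<close>
  have "0 \<le> ?k \<and> ?k * (1 - real_of_ereal (1 / n) + 1 / \<rho>20) = 1"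
  proof (cases n)
    case PInf
    have "1 + 1 / \<rho>20 = (1 + \<rho>20) / \<rho>20" "1 + \<rho>20 \<noteq> 0" using \<open>\<rho>20 > 0\<close> by (simp_all add: field_simps)
    then show ?thesis using PInf \<open>\<rho>20 > 0\<close> by simp
  next
    case (real r)
    then have r: "1 \<le> r" using n by (simp add: one_ereal_def)
    then have "0 < r + \<rho>20 * (r - 1)" using \<open>\<rho>20 > 0\<close> by (intro add_pos_nonneg) auto
    moreover have "1 - 1 / r + 1 / \<rho>20 = (r + \<rho>20 * (r - 1)) / (r * \<rho>20)"
      using r \<open>\<rho>20 > 0\<close> by (simp add: field_simps)
    moreover have "real_of_ereal (1 / n) = 1 / r" using real by (simp add: one_ereal_def)
    ultimately show ?thesis using r real \<open>\<rho>20 > 0\<close> by simp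
  qed (use n in simp)
  then have k: "0 \<le> ?k" "?k * (1 - real_of_ereal (1 / n) + 1 / \<rho>20) = 1" by blast+
  have "?k * (\<rho>1 - max 0 (- \<rho>21) / \<rho>20) \<le> ?k * ((1 - real_of_ereal (1 / n) + 1 / \<rho>20) * (- ev))"
    by (rule mult_left_mono[OF est k(1)])
  also have "\<dots> = - ev" unfolding mult.assoc[symmetric] k(2) by simp
  finally show ?thesis .
qed

end
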